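(* Let $F$ be one of $\mathbb{R},\mathbb{C},\mathbb{H}$, and let $\{n_N\}_{N=1}^\infty$ be a sequence of positive integers with $n_N\le N$ for all $N$. Suppose that there exists a number $c\in(0,1)$ such that $$\sup_N\left(2\log n_N-\frac{c}{4}\sqrt{\frac{N}{n_N^3}}\right)<\infty .$$ Then the $(N,n_N)$-Stiefel manifold $V^F_{N,n_N}$ with distance multiplied by $\sqrt{N^F-1}$ converges weakly to the infinite-dimensional Gaussian space $\Gamma^\infty$ as $N\to\infty$; that is, the pyramids associated with the mm-spaces $\sqrt{N^F-1}\,V^F_{N,n_N}$ converge weakly to the pyramid $\mathcal{P}_{\Gamma^\infty}$.
   Context: **mm-spaces and pyramids.** An mm-space is a triple $(X,d_X,\mu_X)$ with $(X,d_X)$ a complete separable metric space and $\mu_X$ a Borel probability measure on $X$; one assumes $X=\operatorname{supp}\mu_X$. Two mm-spaces $X,Y$ are mm-isomorphic if there is an isometry $f:\operatorname{supp}\mu_X\to\operatorname{supp}\mu_Y$ with $f_\#\mu_X=\mu_Y$; $\mathcal{X}$ is the set of mm-isomorphism classes. Write $Y\prec X$ (Lipschitz order) if there is a $1$-Lipschitz map $f:X\to Y$ with $f_\#\mu_X=\mu_Y$. For $t>0$, $tX:=(X,t\,d_X,\mu_X)$. A parameter of $X$ is a Borel map $\varphi:I=[0,1)\to X$ with $\varphi_\#\mathcal{L}^1=\mu_X$ ($\mathcal{L}^1$ Lebesgue measure). The box distance $\square(X,Y)$ is the infimum of $\varepsilon\ge0$ for which there are parameters $\varphi:I\to X$, $\psi:I\to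 Y$ and a Borel set $I_0\subset I$ with $\mathcal{L}^1(I_0)\ge1-\varepsilon$ and $|d_X(\varphi(s),\varphi(t))-d_Y(\psi(s),\psi(t))|\le\varepsilon$ for all $s,t\in I_0$; it is a metric on $\mathcal{X}$. A pyramid is a nonempty $\square$-closed subset $\mathcal{P}\subset\mathcal{X}$ such that (i) $X\in\mathcal{P}$, $Y\prec X$ imply $Y\in\mathcal{P}$; (ii) for $X,X'\in\mathcal{P}$ there is $Y\in\mathcal{P}$ with $X\prec Y$, $X'\prec Y$. The pyramid associated with $X$ is $\mathcal{P}_X:=\{X'\in\mathcal{X}: X'\prec X\}$. Pyramids $\mathcal{P}_n$ converge weakly to a pyramid $\mathcal{P}$ if $\lim_n\square(X,\mathcal{P}_n)=0$ for every $X\in\mathcal{P}$ and $\liminf_n\square(X,\mathcal{P}_n)>0$ for every $X\in\mathcal{X}\setminus\mathcal{P}$, where $\square(X,\mathcal{P}_n)=\inf_{Y\in\mathcal{P}_n}\square(X,Y)$. **Gaussian space.** $\Gamma^m:=(\mathbb{R}^m,\|\cdot\|,\gamma^m)$, with Euclidean norm and standard Gaussian measure $\gamma^m$. The infinite-dimensional Gaussian space $\Gamma^\infty$ is understood as the pyramid $\mathcal{P}_{\Gamma^\infty}$, the $\square$-closure of $\bigcup_{m\ge1}\mathcal{P}_{\Gamma^m}$. **Stiefel manifolds.** $\mathbb{H}$ denotes the quaternions; $N^F:=N\cdot\dim_{\mathbb{R}}F$. $M^F_{N,n}$ is the set of $N\times n$ matrices over $F$ with Frobenius norm $\|Z\|=\sqrt{\operatorname{tr}(Z^*Z)}$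 ($Z^*$ the conjugate transpose). $V^F_{N,n}=\{Z\in M^F_{N,n}: Z^*Z=I_n\}$ ($n\le N$) is an mm-space with the distance $\|Z-W\|$ and the Haar probability measure, i.e. the unique Borel probability measure invariant under left multiplication by the unitary group $U^F(N)=\{U\in M^F_{N,N}:U^*U=UU^*=I_N\}$. *)

theory Defs
  imports
    "HOL-Probability.Probability"
    "Jordan_Normal_Form.Matrix"
begin

section \<open>mm-spaces\<close>

record 'a mms =
  pts :: "'a set"
  dst :: "'a \<Rightarrow> 'a \<Rightarrow> real"
  msr :: "'a measure"

abbreviation mms_top :: "'a mms \<Rightarrow> 'a topology" where
  "mms_top X \<equiv> Metric_space.mtopology (pts X) (dst X)"

definition borel_measure_of :: "'a topology \<Rightarrow> 'a measure" where
  "borel_measure_of T = sigma (topspace T) {U. openin T U}"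

definition mms_supp :: "'a mms \<Rightarrow> 'a set" where
  "mms_supp X = {x \<in> pts X. \<forall>U. openin (mms_top X) U \<and> x \<in> U \<longrightarrow> emeasure (msr X) U > 0}"

definition mm_space :: "'a mms \<Rightarrow> bool" where
  "mm_space X \<longleftrightarrow>
     Metric_space (pts X) (dst X) \<and>
     Metric_space.mcomplete (pts X) (dst X) \<and>
     separable_space (mms_top X) \<and>
     sets (msr X) = sets (borel_measure_of (mms_top X)) \<and>
     prob_space (msr X) \<and>
     mms_supp X = pts X"

definition mm_iso :: "'a mms \<Rightarrow> 'b mms \<Rightarrow> bool" where
  "mm_iso X Y \<longleftrightarrow>
     (\<exists>f. bij_betw f (pts X) (pts Y) \<and>
          (\<forall>x\<in>pts X. \<forall>y\<in>pts X. dst Y (f x) (f y) = dst X x y) \<and>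
          f \<in> msr X \<rightarrow>\<^sub>M msr Y \<and> distr (msr X) (msr Y) f = msr Y)"

text \<open>\<open>lip_le Y X\<close> is the Lipschitz order \<open>Y \<prec> X\<close>.\<close>

definition lip_le :: "'b mms \<Rightarrow> 'a mms \<Rightarrow> bool" where
  "lip_le Y X \<longleftrightarrow>
     (\<exists>f. f ` pts X \<subseteq> pts Y \<and>
          (\<forall>x\<in>pts X. \<forall>y\<in>pts X. dst Y (f x) (f y) \<le> dst X x y) \<and>
          f \<in> msr X \<rightarrow>\<^sub>M msr Y \<and> distr (msr X) (msr Y) f = msr Y)"

text \<open>Meaningful for \<open>t > 0\<close> only.\<close>

definition mms_scale :: "real \<Rightarrow> 'a mms \<Rightarrow> 'a mms" where
  "mms_scale t X = X\<lparr>dst := \<lambda>x y. t * dst X x y\<rparr>"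

definition is_parameter :: "(real \<Rightarrow> 'a) \<Rightarrow> 'a mms \<Rightarrow> bool" where
  "is_parameter \<phi> X \<longleftrightarrow>
     \<phi> \<in> restrict_space lborel {0..<1} \<rightarrow>\<^sub>M msr X \<and>
     distr (restrict_space lborel {0..<1}) (msr X) \<phi> = msr X"

definition box_dist :: "'a mms \<Rightarrow> 'b mms \<Rightarrow> real" where
  "box_dist X Y = Inf {\<epsilon>. 0 \<le> \<epsilon> \<and>
     (\<exists>\<phi> \<psi> I0. is_parameter \<phi> X \<and> is_parameter \<psi> Y \<and>
        I0 \<in> sets borel \<and> I0 \<subseteq> {0..<1} \<and> measure lborel I0 \<ge> 1 - \<epsilon> \<and>
        (\<forall>s\<in>I0. \<forall>t\<in>I0. \<bar>dst X (\<phi> s) (\<phi> t) - dst Y (\<psi> s) (\<psi> t)\<bar> \<le> \<epsilon>))}"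


section \<open>Pyramids\<close>

text \<open>
  The set of mm-isomorphism classes is represented by all mm-spaces whose points lie in the
  type \<open>nat \<Rightarrow> real\<close>; a set of classes is represented by the set of all representatives of its
  members.  By \<open>mm_iso_representative\<close> below no isomorphism class is lost.  All notions used
  are invariant under \<open>mm_iso\<close>; see \<open>is_pyramid_mm_iso\<close> for pyramids.
\<close>

type_synonym mms_rep = "(nat \<Rightarrow> real) mms"

definition all_mms :: "mms_rep set" where
  "all_mms = {X. mm_space X}"

lemma mm_iso_representative:
  fixes X :: "'a mms"
  assumes "mm_space X"
  shows "\<exists>Y \<in> all_mms. mm_iso X Y"
proof -
  define M where "M = pts X"
  define d where "d = dst X"
  define \<mu> where "\<mu> = msr X"
  interpret X: Metric_space M d
    using assms by (simp add: mm_space_def M_def d_def)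
  interpret P: prob_space \<mu>
    using assms by (simp add: mm_space_def \<mu>_def)
  have top: "mms_top X = X.mtopology"
    by (simp add: M_def d_def)
  have compl: "X.mcomplete" and sep: "separable_space X.mtopology"
    and sets: "sets \<mu> = sets (borel_measure_of X.mtopology)" and supp: "mms_supp X = M"
    using assms by (simp_all add: mm_space_def M_def d_def \<mu>_def)
  have space: "space \<mu> = M"
    using sets_eq_imp_space_eq[OF sets] by (simp add: borel_measure_of_def space_measure_of_conv)
  obtain C where C: "countable C" "C \<subseteq> M" "X.mtopology closure_of C = M"
    using sep by (auto simp: separable_space_def)
  have "M \<noteq> {}"
    using P.not_empty by (simp add: space)
  with C(3) have "C \<noteq> {}"
    by auto
  define c where "c = from_nat_into C"
  have c: "range c = C"
    using range_from_nat_into[OF \<open>C \<noteq> {}\<close> C(1)] by (simp add: c_def)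
  have cM: "c i \<in> M" for i
    using c C(2) by auto
  define e where "e x = (\<lambda>i. d x (c i))" for x
  have inj: "inj_on e M"
  proof (rule inj_onI, rule ccontr)
    fix x y assume xy: "x \<in> M" "y \<in> M" "e x = e y" "x \<noteq> y"
    then have half: "d x y / 2 > 0"
      using X.mdist_pos_less by (metis half_gt_zero)
    have "x \<in> X.mtopology closure_of C"
      using C(3) xy(1) by simp
    then have "\<forall>r>0. \<exists>z\<in>C. z \<in> X.mball x r"
      unfolding X.metric_closure_of mem_Collect_eq by (rule conjunct2)
    from this[rule_format, OF half] have "\<exists>z\<in>C. z \<in> X.mball x (d x y / 2)" .
    then obtain z where z: "z \<in> C" "z \<in> X.mball x (d x y / 2)"
      by blast
    then obtain i where "z = c i"
      using c by auto
    then have "d x (c i) < d x y / 2"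
      using z by simp
    moreover have "d y (c i) = d x (c i)"
      using xy(3) unfolding e_def by metis
    moreover have "d x y \<le> d x (c i) + d (c i) y"
      using X.triangle xy cM by blast
    ultimately show False
      by (simp add: X.commute[of "c i" y])
  qed
  define g where "g = inv_into M e"
  have ge: "g (e x) = x" if "x \<in> M" for x
    using inj that by (simp add: g_def)
  have gM: "g a \<in> M" and eg: "e (g a) = a" if "a \<in> e ` M" for a
    using that ge by auto
  define d' where "d' a b = d (g a) (g b)" for a b
  interpret Y: Metric_space "e ` M" d'
  proof
    fix a b c' assume "a \<in> e ` M" "b \<in> e ` M"
    then show "d' a b = 0 \<longleftrightarrow> a = b"
      using ge by (auto simp: d'_def)
    assume "c' \<in> e ` M"
    then show "d' a c' \<le> d' a b + d' b c'"
      using gM \<open>a \<in> e ` M\<close> \<open>b \<in> e ` M\<close> by (simp add: d'_def X.triangle)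
  qed (simp_all add: d'_def X.commute)
  have ball: "Y.mball (e x) r = e ` X.mball x r" if "x \<in> M" for x r
    using that ge by (auto simp: d'_def)
  have open_im: "openin Y.mtopology (e ` U)" if "openin X.mtopology U" for U
  proof -
    have "\<exists>r>0. Y.mball (e x) r \<subseteq> e ` U" if "x \<in> U" for x
      using that \<open>openin X.mtopology U\<close> ball by (metis X.openin_mtopology image_mono subsetD)
    then show ?thesis
      using that by (auto simp: X.openin_mtopology Y.openin_mtopology)
  qed
  have open_vim: "openin X.mtopology {x \<in> M. e x \<in> V}" if "openin Y.mtopology V" for V
  proof -
    have "\<exists>r>0. X.mball x r \<subseteq> {x \<in> M. e x \<in> V}" if x: "x \<in> M" "e x \<in> V" for x
    proof -
      obtain r where r: "r > 0" "Y.mball (e x) r \<subseteq> V"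
        using \<open>openin Y.mtopology V\<close> x by (auto simp: Y.openin_mtopology)
      then have "X.mball x r \<subseteq> {x \<in> M. e x \<in> V}"
        using ball[OF x(1), of r] by auto
      with r(1) show ?thesis
        by blast
    qed
    then show ?thesis
      by (auto simp: X.openin_mtopology)
  qed
  have cont: "continuous_map X.mtopology Y.mtopology e"
    using open_vim by (auto simp: continuous_map_def)
  define \<nu> where "\<nu> = distr \<mu> (borel_measure_of Y.mtopology) e"
  define Y where "Y = \<lparr>pts = e ` M, dst = d', msr = \<nu>\<rparr>"
  have meas: "e \<in> \<mu> \<rightarrow>\<^sub>M borel_measure_of Y.mtopology"
    unfolding borel_measure_of_def
  proof (rule measurable_measure_of)
    fix V assume "V \<in> {U. openin Y.mtopology U}"
    then have "openin X.mtopology {x \<in> M. e x \<in> V}"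
      using open_vim by simp
    moreover have "e -` V \<inter> space \<mu> = {x \<in> M. e x \<in> V}"
      by (auto simp: space)
    ultimately show "e -` V \<inter> space \<mu> \<in> sets \<mu>"
      using openin_subset[of X.mtopology]
      by (auto simp: sets borel_measure_of_def sets_measure_of_conv intro!: sigma_sets.Basic)
  qed (use openin_subset[of Y.mtopology] in \<open>auto simp: space\<close>)
  have "homeomorphic_map X.mtopology Y.mtopology e"
    by (rule bijective_open_imp_homeomorphic_map) (use cont open_im inj in \<open>auto simp: open_map_def\<close>)
  then have "separable_space Y.mtopology"
    using sep homeomorphic_separable_space homeomorphic_map_imp_homeomorphic_space by blast
  moreover have "Y.mcomplete"
    unfolding Y.mcomplete_def
  proof (intro allI impI)
    fix \<sigma> assume \<sigma>: "Y.MCauchy \<sigma>"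
    then have r: "\<sigma> i \<in> e ` M" for i
      by (auto simp: Y.MCauchy_def)
    have ran: "range (g \<circ> \<sigma>) \<subseteq> M"
      unfolding image_subset_iff comp_apply using gM[OF r] by simp
    have "\<forall>\<epsilon>>0. \<exists>N. \<forall>n n'. N \<le> n \<longrightarrow> N \<le> n' \<longrightarrow> d' (\<sigma> n) (\<sigma> n') < \<epsilon>"
      using \<sigma> unfolding Y.MCauchy_def by (rule conjunct2)
    then have "X.MCauchy (g \<circ> \<sigma>)"
      unfolding X.MCauchy_def d'_def comp_apply using ran[unfolded comp_def] by (intro conjI)
    then have "\<exists>x. limitin X.mtopology (g \<circ> \<sigma>) x sequentially"
      by (rule compl[unfolded X.mcomplete_def, rule_format])
    then obtain x where "limitin X.mtopology (g \<circ> \<sigma>) x sequentially"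
      by (elim exE)
    then have "limitin Y.mtopology (e \<circ> (g \<circ> \<sigma>)) (e x) sequentially"
      by (rule continuous_map_limit[OF cont])
    moreover have "e \<circ> (g \<circ> \<sigma>) = \<sigma>"
      unfolding comp_def by (rule ext) (rule eg[OF r])
    ultimately show "\<exists>x. limitin Y.mtopology \<sigma> x sequentially"
      by auto
  qed
  moreover have "mms_supp Y = e ` M"
  proof -
    have "emeasure \<nu> V > 0" if "x \<in> M" "openin Y.mtopology V" "e x \<in> V" for x V
    proof -
      have "V \<in> sets (borel_measure_of Y.mtopology)"
        using that openin_subset[of Y.mtopology]
        by (auto simp: borel_measure_of_def sets_measure_of_conv intro!: sigma_sets.Basic)
      then have "emeasure \<nu> V = emeasure \<mu> (e -` V \<inter> space \<mu>)"
        using meas by (simp add: \<nu>_def emeasure_distr)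
      also have "e -` V \<inter> space \<mu> = {x \<in> M. e x \<in> V}"
        by (auto simp: space)
      also have "emeasure \<mu> {x \<in> M. e x \<in> V} > 0"
      proof -
        have "x \<in> mms_supp X"
          using supp that(1) by simp
        then have "\<forall>U. openin X.mtopology U \<and> x \<in> U \<longrightarrow> emeasure \<mu> U > 0"
          unfolding mms_supp_def mem_Collect_eq top \<mu>_def by (rule conjunct2)
        moreover have "x \<in> {x \<in> M. e x \<in> V}"
          using that by simp
        ultimately show ?thesis
          using open_vim[OF that(2)] by blast
      qed
      finally show ?thesis .
    qed
    then show ?thesis
      by (auto simp: mms_supp_def Y_def)
  qed
  moreover have "prob_space \<nu>"
    unfolding \<nu>_def using meas by (rule P.prob_space_distr)
  ultimately have "mm_space Y"
    using Y.Metric_space_axioms by (simp add: mm_space_def Y_def \<nu>_def)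
  moreover have "mm_iso X Y"
    unfolding mm_iso_def
  proof (intro exI[of _ e] conjI)
    show "e \<in> msr X \<rightarrow>\<^sub>M msr Y"
      using meas by (simp add: Y_def \<nu>_def \<mu>_def[symmetric])
    have "distr \<mu> \<nu> e = \<nu>"
      unfolding \<nu>_def by (rule distr_cong) simp_all
    then show "distr (msr X) (msr Y) e = msr Y"
      by (simp add: Y_def \<mu>_def[symmetric])
  qed (use inj ge in \<open>auto simp: bij_betw_def Y_def M_def[symmetric] d_def[symmetric] d'_def\<close>)
  ultimately show ?thesis
    by (auto simp: all_mms_def)
qed

definition box_closure :: "mms_rep set \<Rightarrow> mms_rep set" where
  "box_closure A = {X \<in> all_mms. \<forall>\<epsilon>>0. \<exists>Y\<in>A. box_dist X Y < \<epsilon>}"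

definition is_pyramid :: "mms_rep set \<Rightarrow> bool" where
  "is_pyramid P \<longleftrightarrow>
     P \<noteq> {} \<and> P \<subseteq> all_mms \<and> box_closure P = P \<and>
     (\<forall>X\<in>P. \<forall>Y\<in>all_mms. lip_le Y X \<longrightarrow> Y \<in> P) \<and>
     (\<forall>X\<in>P. \<forall>X'\<in>P. \<exists>Y\<in>P. lip_le X Y \<and> lip_le X' Y)"

lemma is_pyramid_mm_iso:
  assumes "is_pyramid P" "X \<in> P" "Y \<in> all_mms" "mm_iso X Y"
  shows "Y \<in> P"
proof -
  have "lip_le Y X"
    using assms(4) unfolding mm_iso_def lip_le_def bij_betw_def by fastforce
  with assms show ?thesis
    by (auto simp: is_pyramid_def)
qed

definition pyramid_of :: "'a mms \<Rightarrow> mms_rep set" where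
  "pyramid_of X = {X' \<in> all_mms. lip_le X' X}"

definition box_to_set :: "mms_rep \<Rightarrow> mms_rep set \<Rightarrow> real" where
  "box_to_set X P = (INF Y\<in>P. box_dist X Y)"

text \<open>
  Weak convergence is a property of pyramids.  As usual for a limit notion, the definition is
  total: being a pyramid is not part of it.
\<close>

definition weakly_converges :: "(nat \<Rightarrow> mms_rep set) \<Rightarrow> mms_rep set \<Rightarrow> bool" where
  "weakly_converges P Q \<longleftrightarrow>
     (\<forall>X\<in>Q. (\<lambda>n. box_to_set X (P n)) \<longlonglongrightarrow> 0) \<and>
     (\<forall>X\<in>all_mms - Q. liminf (\<lambda>n. ereal (box_to_set X (P n))) > 0)"


section \<open>Gaussian spaces\<close>

text \<open>\<open>\<real>\<^sup>m\<close> is \<open>{..<m} \<rightarrow>\<^sub>E UNIV\<close>, the space of the product measure.\<close>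

definition gaussian_space :: "nat \<Rightarrow> mms_rep" where
  "gaussian_space m =
     \<lparr>pts = {..<m} \<rightarrow>\<^sub>E UNIV,
      dst = (\<lambda>x y. sqrt (\<Sum>i<m. (x i - y i)\<^sup>2)),
      msr = (\<Pi>\<^sub>M i\<in>{..<m}. density lborel (\<lambda>t. ennreal (std_normal_density t)))\<rparr>"

definition gaussian_pyramid :: "mms_rep set" where
  "gaussian_pyramid = box_closure (\<Union>m\<in>{1..}. pyramid_of (gaussian_space m))"


section \<open>The scalars\<close>

class star_div_algebra = real_normed_div_algebra + euclidean_space +
  fixes star :: "'a \<Rightarrow> 'a"
  assumes star_add: "star (x + y) = star x + star y"
    and star_scaleR: "star (r *\<^sub>R x) = r *\<^sub>R star x"
    and star_mult: "star (x * y) = star y * star x"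
    and star_star: "star (star x) = x"
    and star_mult_self: "star x * x = (norm x)\<^sup>2 *\<^sub>R 1"

instantiation real :: star_div_algebra
begin
definition star_real :: "real \<Rightarrow> real" where "star_real x = x"
instance
  by standard (simp_all add: star_real_def power2_eq_square)
end

instantiation complex :: star_div_algebra
begin
definition star_complex :: "complex \<Rightarrow> complex" where "star_complex = cnj"
instance
proof
  fix x :: complex
  show "star x * x = (norm x)\<^sup>2 *\<^sub>R 1"
    unfolding scaleR_conv_of_real complex_norm_square star_complex_def by (simp add: mult.commute)
qed (simp_all add: star_complex_def complex_eq_iff)
end

datatype quat = Quat (q1: real) (qi: real) (qj: real) (qk: real)

lemma quat_eq_iff: "x = y \<longleftrightarrow> q1 x = q1 y \<and> qi x = qi y \<and> qj x = qj y \<and> qk x = qk y"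
  by (cases x; cases y) simp

instantiation quat :: ab_group_add
begin
definition "0 = Quat 0 0 0 0"
definition "x + y = Quat (q1 x + q1 y) (qi x + qi y) (qj x + qj y) (qk x + qk y)" for x y :: quat
definition "- x = Quat (- q1 x) (- qi x) (- qj x) (- qk x)" for x :: quat
definition "x - y = Quat (q1 x - q1 y) (qi x - qi y) (qj x - qj y) (qk x - qk y)" for x y :: quat
instance
  by standard (simp_all add: quat_eq_iff zero_quat_def plus_quat_def uminus_quat_def minus_quat_def)
end

instantiation quat :: real_vector
begin
definition "r *\<^sub>R x = Quat (r * q1 x) (r * qi x) (r * qj x) (r * qk x)" for x :: quat
instance
  by standard (simp_all add: quat_eq_iff scaleR_quat_def plus_quat_def algebra_simps)
end

instantiation quat :: real_inner
begin
definition "inner x y = q1 x * q1 y + qi x * qi y + qj x * qj y + qk x * qk y" for x y :: quat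
definition "norm x = sqrt ((q1 x)\<^sup>2 + (qi x)\<^sup>2 + (qj x)\<^sup>2 + (qk x)\<^sup>2)" for x :: quat
definition "sgn x = x /\<^sub>R norm x" for x :: quat
definition "dist x y = norm (x - y)" for x y :: quat
definition "(uniformity :: (quat \<times> quat) filter) = (INF e\<in>{0 <..}. principal {(x, y). dist x y < e})"
definition "open (U :: quat set) \<longleftrightarrow> (\<forall>x\<in>U. eventually (\<lambda>(x', y). x' = x \<longrightarrow> y \<in> U) uniformity)"
instance
proof
  fix x y z :: quat and a b r :: real and U :: "quat set"
  show "inner x x = 0 \<longleftrightarrow> x = 0"
    by (simp add: inner_quat_def quat_eq_iff zero_quat_def add_nonneg_eq_0_iff)
  show "norm x = sqrt (inner x x)"
    by (simp add: inner_quat_def norm_quat_def power2_eq_square)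
  show "inner x y = inner y x"
    by (simp add: inner_quat_def mult.commute)
  show "inner (x + y) z = inner x z + inner y z"
    by (simp add: inner_quat_def plus_quat_def algebra_simps)
  show "inner (r *\<^sub>R x) y = r * inner x y"
    by (simp add: inner_quat_def scaleR_quat_def algebra_simps)
  show "0 \<le> inner x x"
    by (simp add: inner_quat_def)
qed (rule sgn_quat_def dist_quat_def uniformity_quat_def open_quat_def)+
end

instantiation quat :: real_normed_div_algebra
begin
definition "1 = Quat 1 0 0 0"
definition "x * y = Quat
  (q1 x * q1 y - qi x * qi y - qj x * qj y - qk x * qk y)
  (q1 x * qi y + qi x * q1 y + qj x * qk y - qk x * qj y)
  (q1 x * qj y - qi x * qk y + qj x * q1 y + qk x * qi y)
  (q1 x * qk y + qi x * qj y - qj x * qi y + qk x * q1 y)" for x y :: quat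
definition "inverse x = Quat (q1 x / (norm x)\<^sup>2) (- qi x / (norm x)\<^sup>2)
  (- qj x / (norm x)\<^sup>2) (- qk x / (norm x)\<^sup>2)" for x :: quat
definition "x div y = x * inverse y" for x y :: quat
instance
proof
  fix x y z :: quat and r :: real
  have nx: "(norm x)\<^sup>2 = q1 x * q1 x + qi x * qi x + qj x * qj x + qk x * qk x"
    unfolding norm_quat_def by (subst real_sqrt_pow2) (simp_all add: power2_eq_square)
  show "norm (x * y) = norm x * norm y"
    unfolding norm_quat_def times_quat_def real_sqrt_mult[symmetric] quat.sel
    by (rule arg_cong[where f = sqrt]) Groebner_Basis.algebra
  show "x * y * z = x * (y * z)"
    unfolding times_quat_def quat.sel quat.inject by (intro conjI; Groebner_Basis.algebra)
  show "(x + y) * z = x * z + y * z"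
    unfolding times_quat_def plus_quat_def quat.sel quat.inject
    by (intro conjI; Groebner_Basis.algebra)
  show "x * (y + z) = x * y + x * z"
    unfolding times_quat_def plus_quat_def quat.sel quat.inject
    by (intro conjI; Groebner_Basis.algebra)
  show "r *\<^sub>R x * y = r *\<^sub>R (x * y)"
    unfolding times_quat_def scaleR_quat_def quat.sel quat.inject
    by (intro conjI; Groebner_Basis.algebra)
  show "x * r *\<^sub>R y = r *\<^sub>R (x * y)"
    unfolding times_quat_def scaleR_quat_def quat.sel quat.inject
    by (intro conjI; Groebner_Basis.algebra)
  show "1 * x = x" "x * 1 = x" "(0::quat) \<noteq> 1"
    by (simp_all add: times_quat_def one_quat_def zero_quat_def)
  show "inverse (0::quat) = 0"
    by (simp add: inverse_quat_def zero_quat_def)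
  show "x div y = x * inverse y"
    by (rule divide_quat_def)
  assume "x \<noteq> 0"
  define c where "c = 1 / (norm x)\<^sup>2"
  have c: "c * (q1 x * q1 x + qi x * qi x + qj x * qj x + qk x * qk x) = 1"
    unfolding nx[symmetric] c_def using \<open>x \<noteq> 0\<close> by simp
  have i: "inverse x = Quat (c * q1 x) (c * - qi x) (c * - qj x) (c * - qk x)"
    by (simp add: inverse_quat_def c_def)
  show "inverse x * x = 1"
    unfolding i times_quat_def one_quat_def quat.sel quat.inject
    unfolding c[symmetric] by (intro conjI; Groebner_Basis.algebra)
  show "x * inverse x = 1"
    unfolding i times_quat_def one_quat_def quat.sel quat.inject
    unfolding c[symmetric] by (intro conjI; Groebner_Basis.algebra)
qed
end

instantiation quat :: star_div_algebra
begin
definition "Basis = {Quat 1 0 0 0, Quat 0 1 0 0, Quat 0 0 1 0, Quat 0 0 0 1}"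
definition "star x = Quat (q1 x) (- qi x) (- qj x) (- qk x)" for x :: quat
instance
proof
  fix x y :: quat and r :: real
  show "(\<forall>u\<in>Basis. inner x u = 0) \<longleftrightarrow> x = 0"
    unfolding Basis_quat_def quat_eq_iff[of x] by (simp add: inner_quat_def zero_quat_def)
  show "u \<in> Basis \<Longrightarrow> v \<in> Basis \<Longrightarrow> inner u v = (if u = v then 1 else 0)" for u v :: quat
    unfolding Basis_quat_def insert_iff empty_iff simp_thms
    by (elim disjE) (simp_all add: inner_quat_def)
  show "star x * x = (norm x)\<^sup>2 *\<^sub>R 1"
    unfolding norm_quat_def by (subst real_sqrt_pow2)
      (simp_all add: star_quat_def times_quat_def one_quat_def scaleR_quat_def power2_eq_square)
  show "star (x * y) = star y * star x"
    unfolding star_quat_def times_quat_def quat.sel quat.inject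
    by (intro conjI; Groebner_Basis.algebra)
  show "star (x + y) = star x + star y"
    by (simp add: star_quat_def plus_quat_def)
  show "star (r *\<^sub>R x) = r *\<^sub>R star x"
    by (simp add: star_quat_def scaleR_quat_def)
  show "star (star x) = x"
    by (simp add: star_quat_def)
  show "Basis \<noteq> ({} :: quat set)" "finite (Basis :: quat set)"
    unfolding Basis_quat_def by simp_all
qed
end

lemma DIM_quat [simp]: "DIM(quat) = 4"
  by (simp add: Basis_quat_def)


section \<open>Stiefel manifolds\<close>

definition conj_transpose :: "'f::star_div_algebra mat \<Rightarrow> 'f mat" where
  "conj_transpose Z = map_mat star (transpose_mat Z)"

definition mat_trace :: "'f::comm_monoid_add mat \<Rightarrow> 'f" where
  "mat_trace A = (\<Sum>i<dim_row A. A $$ (i, i))"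

text \<open>\<open>tr (Z\<^sup>* Z)\<close> is a real multiple of \<open>1\<close>; the inner product with \<open>1\<close> reads off the real number.\<close>

definition frob_norm :: "'f::star_div_algebra mat \<Rightarrow> real" where
  "frob_norm Z = sqrt (inner (mat_trace (conj_transpose Z * Z)) 1)"

lemma frob_norm_eq:
  assumes "Z \<in> carrier_mat N n"
  shows "frob_norm Z = sqrt (\<Sum>i<N. \<Sum>j<n. (norm (Z $$ (i, j)))\<^sup>2)"
proof -
  have "(conj_transpose Z * Z) $$ (j, j) = (\<Sum>i<N. (norm (Z $$ (i, j)))\<^sup>2 *\<^sub>R 1)" if "j < n" for j
    using assms that
    by (simp add: conj_transpose_def scalar_prod_def star_mult_self[symmetric] atLeast0LessThan)
  then have "mat_trace (conj_transpose Z * Z) = (\<Sum>j<n. \<Sum>i<N. (norm (Z $$ (i, j)))\<^sup>2 *\<^sub>R 1)"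
    using assms by (simp add: mat_trace_def conj_transpose_def)
  then show ?thesis
    using sum.swap[of "\<lambda>j i. (norm (Z $$ (i, j)))\<^sup>2" "{..<N}" "{..<n}"]
    by (simp add: frob_norm_def inner_sum_left dot_square_norm)
qed

definition unitary_group :: "nat \<Rightarrow> 'f::star_div_algebra mat set" where
  "unitary_group N = {U \<in> carrier_mat N N.
     conj_transpose U * U = 1\<^sub>m N \<and> U * conj_transpose U = 1\<^sub>m N}"

definition stiefel_set :: "nat \<Rightarrow> nat \<Rightarrow> 'f::star_div_algebra mat set" where
  "stiefel_set N n = {Z \<in> carrier_mat N n. conj_transpose Z * Z = 1\<^sub>m n}"

text \<open>The case distinction is there because \<open>Metric_space\<close> requires symmetry and nonnegativity
  off the carrier as well.\<close>

definition stiefel_dist :: "nat \<Rightarrow> nat \<Rightarrow> 'f::star_div_algebra mat \<Rightarrow> 'f mat \<Rightarrow> real" where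
  "stiefel_dist N n Z W =
     (if Z \<in> stiefel_set N n \<and> W \<in> stiefel_set N n then frob_norm (Z - W) else 0)"

definition stiefel_haar :: "nat \<Rightarrow> nat \<Rightarrow> 'f::star_div_algebra mat measure" where
  "stiefel_haar N n = (THE \<mu>.
     sets \<mu> = sets (borel_measure_of
       (Metric_space.mtopology (stiefel_set N n) (stiefel_dist N n))) \<and>
     prob_space \<mu> \<and>
     (\<forall>U\<in>unitary_group N. distr \<mu> \<mu> (\<lambda>Z. U * Z) = \<mu>))"

definition stiefel :: "nat \<Rightarrow> nat \<Rightarrow> 'f::star_div_algebra mat mms" where
  "stiefel N n =
     \<lparr>pts = stiefel_set N n, dst = stiefel_dist N n, msr = stiefel_haar N n\<rparr>"

end

theory Submission
  imports Defs
begin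

text \<open>The hypothesis forces \<open>n\<^sup>2 / N \<longlonglongrightarrow> 0\<close>. Let \<open>G\<close> be an \<open>N \<times> n\<close> matrix over \<open>F\<close> with independent standard
  Gaussian coordinates and \<open>d = dim F\<close>. The expected squared distance of \<open>G\<^sup>* G / (N d)\<close> to the
  identity is of order \<open>n\<^sup>2 / N\<close>, so \<open>G / sqrt (N d)\<close> is nearly orthonormal with high probability.
  There the polar factor of \<open>G\<close>, the limit of the Newton--Schulz iteration, is a unitarily
  equivariant function of \<open>G\<close> which is \<open>exp \<delta>\<close>-Lipschitz after scaling by \<open>sqrt (N d - 1)\<close>. Completed
  by an independent Haar frame where \<open>G\<close> is not nearly orthonormal, it is Haar distributed, because
  the invariant measure is unique. Hence a space dominated by the scaled Stiefel manifold is, up to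
  a small box distance, dominated by a Gaussian space.

  Conversely, the first column of a Haar frame is distributed as a normalized Gaussian vector. The
  projection to its first \<open>m\<close> real coordinates is 1-Lipschitz, and after scaling by
  \<open>sqrt (N d - 1)\<close> its law is close to the Gaussian measure on \<open>\<real>\<^sup>m\<close>, so every space dominated by
  \<open>\<Gamma>\<^sup>m\<close> is approximated by spaces dominated by the scaled Stiefel manifolds.\<close>

section \<open>Parametrizing probability measures by the unit interval\<close>

text \<open>The box distance is defined by parameters on the unit interval, so every comparison has
  to be realized on one probability space: the Gaussian matrix and the independent frame are put on
  a product, which must be shown to be an image of Lebesgue measure. The main obstacle is that the
  polar factor is Lipschitz only on an event, and a Lipschitz map on a subset need not extend when
  its target is an arbitrary metric space. A space dominated by the Stiefel manifold is therefore
  first mapped by finitely many distance functions into \<open>R^k\<close> with the maximum norm,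
  where extension works coordinate by coordinate with the same constant. Domination asks for
  constant 1, so \<open>exp \<delta>\<close> is divided out; the resulting multiplicative error is
  small only on bounded sets, whence the localization to balls. Newton--Schulz steps are polynomials
  in \<open>A\<close> and \<open>adj A\<close>: they make sense over the quaternions, visibly
  commute with unitaries, and their Lipschitz constants in the Frobenius norm multiply to at most
  \<open>exp \<delta>\<close>. Haar measure is itself built from the Gaussian, by conditioning on an
  invariant event.\<close>

definition cantor_real :: "(nat \<Rightarrow> bool) \<Rightarrow> real" where
  "cantor_real b = (\<Sum>k. (if b k then 2 else 0) * (1/3) ^ Suc k)"

lemma cantor_real_summable: "summable (\<lambda>k. (if b k then 2 else 0) * (1/3::real) ^ Suc k)"
proof (rule summable_comparison_test')
  show "summable (\<lambda>k. 2 * (1/3::real) ^ Suc k)"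
    by (intro summable_mult) (simp add: summable_geometric)
  show "norm ((if b k then 2 else 0) * (1/3::real) ^ Suc k) \<le> 2 * (1/3) ^ Suc k" if "k \<ge> 0" for k
    by auto
qed

lemma cantor_real_Suc: "cantor_real b = ((if b 0 then 2 else 0) + cantor_real (\<lambda>k. b (Suc k))) / 3"
proof -
  have "cantor_real b = (if b 0 then 2 else 0) * (1/3) +
      (\<Sum>k. (if b (Suc k) then 2 else 0) * (1/3) ^ Suc (Suc k))"
    using suminf_split_head[OF cantor_real_summable[of b]] unfolding cantor_real_def by simp
  also have "(\<Sum>k. (if b (Suc k) then 2 else 0) * (1/3::real) ^ Suc (Suc k)) =
      (\<Sum>k. (1/3) * ((if b (Suc k) then 2 else 0) * (1/3) ^ Suc k))"
    by (intro suminf_cong) simp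
  also have "\<dots> = (1/3) * cantor_real (\<lambda>k. b (Suc k))"
    unfolding cantor_real_def by (intro suminf_mult cantor_real_summable)
  finally show ?thesis
    by (simp add: add_divide_distrib)
qed

lemma cantor_real_bounds: "0 \<le> cantor_real b" "cantor_real b \<le> 1"
proof -
  show "0 \<le> cantor_real b"
    unfolding cantor_real_def by (intro suminf_nonneg cantor_real_summable) auto
  have "cantor_real b \<le> (\<Sum>k. 2 * (1/3::real) ^ Suc k)"
    unfolding cantor_real_def
    by (intro suminf_le cantor_real_summable summable_mult) (auto simp: summable_geometric)
  also have "\<dots> = (\<Sum>k. (2/3) * (1/3::real) ^ k)"
    by (intro suminf_cong) simp
  also have "\<dots> = (2/3) * (\<Sum>k. (1/3::real) ^ k)"
    by (intro suminf_mult) (simp add: summable_geometric)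
  also have "\<dots> = 1"
    by (subst suminf_geometric) auto
  finally show "cantor_real b \<le> 1" .
qed

text \<open>With ternary digits 0 and 2 the value lies in [0, 1/3] or in [2/3, 1] according to the
  first bit. This gap, absent from binary expansions, lets a Borel threshold test decode the
  bit.\<close>

lemma cantor_real_gt_half: "cantor_real b > 1/2 \<longleftrightarrow> b 0"
  using cantor_real_bounds[of "\<lambda>k. b (Suc k)"] cantor_real_Suc[of b] by (auto split: if_splits)

text \<open>Deletes the leading ternary digit of a point of the Cantor set, so that bit
  \<open>k\<close> of a code is a threshold test on iterate \<open>k\<close>.\<close>

definition cantor_shift :: "real \<Rightarrow> real" where
  "cantor_shift y = 3 * y - (if y > 1/2 then 2 else 0)"

lemma cantor_shift_cantor_real: "(cantor_shift ^^ k) (cantor_real b) = cantor_real (\<lambda>i. b (i + k))"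
proof (induction k)
  case (Suc k)
  then have "(cantor_shift ^^ Suc k) (cantor_real b) = cantor_shift (cantor_real (\<lambda>i. b (i + k)))"
    by simp
  also have "\<dots> = cantor_real (\<lambda>i. b (Suc i + k))"
    using cantor_real_gt_half[of "\<lambda>i. b (i + k)"] cantor_real_Suc[of "\<lambda>i. b (i + k)"]
    unfolding cantor_shift_def by auto
  finally show ?case
    by simp
qed simp

lemma measurable_cantor_shift_pow: "(cantor_shift ^^ k) \<in> borel_measurable borel"
proof (induction k)
  case (Suc k)
  have "cantor_shift \<in> borel_measurable borel"
    unfolding cantor_shift_def by measurable
  from measurable_compose[OF Suc this] show ?case
    by (simp add: comp_def)
qed (simp add: id_def)

text \<open>The real sequence \<open>x\<close> is coded by the bits \<open>x i < q\<close> with \<open>q\<close> rational.\<close>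

definition seq_to_real :: "(nat \<Rightarrow> real) \<Rightarrow> real" where
  "seq_to_real x = cantor_real (\<lambda>k. x (fst (prod_decode k)) <
     real_of_rat (nat_to_rat_surj (snd (prod_decode k))))"

text \<open>Coordinate \<open>i\<close> is recovered as the infimum of the rationals above it. The
  infimum is taken in the extended reals to make the map total; numbers that code no sequence get a
  meaningless but Borel value.\<close>

definition real_to_seq :: "real \<Rightarrow> nat \<Rightarrow> real" where
  "real_to_seq y i = real_of_ereal (INF j. if (cantor_shift ^^ prod_encode (i, j)) y > 1/2
     then ereal (real_of_rat (nat_to_rat_surj j)) else \<infinity>)"

lemma measurable_seq_to_real: "seq_to_real \<in> borel_measurable borel"
proof -
  have [measurable]: "(\<lambda>x :: nat \<Rightarrow> real. x i) \<in> borel_measurable borel" for i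
    by (rule measurable_product_coordinates)
  show ?thesis
    unfolding seq_to_real_def cantor_real_def by measurable
qed

lemma measurable_real_to_seq: "real_to_seq \<in> borel_measurable borel"
proof (rule measurable_coordinatewise_then_product)
  fix i
  note measurable_cantor_shift_pow[measurable]
  show "(\<lambda>y. real_to_seq y i) \<in> borel_measurable borel"
    unfolding real_to_seq_def by measurable
qed

lemma real_to_seq_seq_to_real: "real_to_seq (seq_to_real x) = x"
proof
  fix i
  let ?q = "\<lambda>j. real_of_rat (nat_to_rat_surj j)"
  have bit: "(cantor_shift ^^ prod_encode (i, j)) (seq_to_real x) > 1/2 \<longleftrightarrow> x i < ?q j" for j
    unfolding seq_to_real_def cantor_shift_cantor_real cantor_real_gt_half by simp
  have "(INF j. if x i < ?q j then ereal (?q j) else \<infinity>) = ereal (x i)"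
  proof (rule antisym)
    show "ereal (x i) \<le> (INF j. if x i < ?q j then ereal (?q j) else \<infinity>)"
      by (rule INF_greatest) auto
    show "(INF j. if x i < ?q j then ereal (?q j) else \<infinity>) \<le> ereal (x i)"
    proof (rule ccontr)
      let ?I = "INF j. if x i < ?q j then ereal (?q j) else \<infinity>"
      assume "\<not> ?I \<le> ereal (x i)"
      then have "ereal (x i) < ?I"
        by simp
      then obtain r where r: "ereal (x i) < ereal (real_of_rat r)" "ereal (real_of_rat r) < ?I"
        using ereal_dense3 by blast
      obtain j where j: "nat_to_rat_surj j = r"
        using surj_nat_to_rat_surj unfolding surj_def by metis
      have "?I \<le> (if x i < ?q j then ereal (?q j) else \<infinity>)"
        by (rule INF_lower) (rule UNIV_I)
      with r j show False
        by simp
    qed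
  qed
  then show "real_to_seq (seq_to_real x) i = x i"
    unfolding real_to_seq_def bit by (simp only: real_of_ereal.simps)
qed

section \<open>Images of Lebesgue measure on [0,1)\<close>

abbreviation unit_interval :: "real measure" where
  "unit_interval \<equiv> restrict_space lborel {0..<1}"

lemma prob_space_unit_interval: "prob_space unit_interval"
  by (rule prob_spaceI) (simp add: emeasure_restrict_space space_restrict_space)

text \<open>The measures that admit a parameter. The infimum in \<open>box_dist\<close> ranges over
  a nonempty set exactly when both measures are of this kind, and by composition a coupling may be
  built on any parametrizable probability space in place of the interval.\<close>

definition parametrizable :: "'a measure \<Rightarrow> bool" where
  "parametrizable M \<longleftrightarrow> (\<exists>g \<in> unit_interval \<rightarrow>\<^sub>M M. distr unit_interval M g = M)"

lemma parametrizable_prob_space: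
  assumes "parametrizable M"
  shows "prob_space M"
proof -
  obtain g where g: "g \<in> unit_interval \<rightarrow>\<^sub>M M" "distr unit_interval M g = M"
    using assms unfolding parametrizable_def by blast
  show ?thesis
    using prob_space.prob_space_distr[OF prob_space_unit_interval g(1)] g(2) by simp
qed

lemma parametrizable_distr:
  assumes "parametrizable M" "f \<in> M \<rightarrow>\<^sub>M N"
  shows "parametrizable (distr M N f)"
proof -
  obtain g where g: "g \<in> unit_interval \<rightarrow>\<^sub>M M" "distr unit_interval M g = M"
    using assms unfolding parametrizable_def by blast
  have "distr unit_interval (distr M N f) (f \<circ> g) = distr unit_interval N (f \<circ> g)"
    by (rule distr_cong) simp_all
  also have "\<dots> = distr M N f"
    using distr_distr[OF assms(2) g(1)] g(2) by simp
  finally have "distr unit_interval (distr M N f) (f \<circ> g) = distr M N f" .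
  moreover have "f \<circ> g \<in> unit_interval \<rightarrow>\<^sub>M distr M N f"
    using measurable_comp[OF g(1) assms(2)] by simp
  ultimately show ?thesis
    unfolding parametrizable_def by blast
qed

lemma parametrizable_distr_eq:
  assumes "parametrizable M" "f \<in> M \<rightarrow>\<^sub>M N" "distr M N f = N'"
  shows "parametrizable N'"
  using parametrizable_distr[OF assms(1,2)] assms(3) by simp

text \<open>Quantile transform: \<open>I\<close> is the generalized inverse of the distribution
  function. It is used on the open interval, and the null point 0 receives a default value.\<close>

lemma parametrizable_real:
  assumes "real_distribution M"
  shows "parametrizable M"
proof -
  interpret real_distribution M by fact
  interpret cdf_distribution M by standard
  define g where "g s = (if s \<in> {0<..<1} then I s else 0)" for s
  have "g \<in> borel_measurable borel"
  proof -
    have "{x \<in> space borel. x \<in> {0<..<1::real}} = {0<..<1}"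
      by auto
    then show ?thesis
      unfolding g_def using measurable_CI
      by (subst measurable_If_restrict_space_iff) (auto simp del: greaterThanLessThan_iff)
  qed
  then have meas: "g \<in> unit_interval \<rightarrow>\<^sub>M borel"
    by (intro measurable_restrict_space1) simp
  have "distr unit_interval borel g = distr (restrict_space lborel {0<..<1}) borel I"
  proof (rule measure_eqI)
    fix A assume "A \<in> sets (distr unit_interval borel g)"
    then have A: "A \<in> sets borel" by simp
    have mI: "I \<in> borel_measurable (restrict_space lborel {0<..<1})"
      using measurable_CI by (simp cong: measurable_cong_sets add: sets_restrict_space)
    have sI: "I -` A \<inter> {0<..<1} \<in> sets lborel"
      using measurable_sets[OF mI A] by (simp add: sets_restrict_space_iff space_restrict_space Int_commute)
    have sg: "g -` A \<inter> {0..<1} \<in> sets lborel"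
      using measurable_sets[OF \<open>g \<in> borel_measurable borel\<close> A] by auto
    have "emeasure (distr unit_interval borel g) A = emeasure lborel (g -` A \<inter> {0..<1})"
      using A meas sg by (simp add: emeasure_distr space_restrict_space emeasure_restrict_space)
    also have "\<dots> = emeasure lborel (I -` A \<inter> {0<..<1})"
    proof (rule emeasure_eq_AE)
      show "AE x in lborel. x \<in> g -` A \<inter> {0..<1} \<longleftrightarrow> x \<in> I -` A \<inter> {0<..<1}"
        using AE_lborel_singleton[of 0] by eventually_elim (auto simp: g_def)
    qed (use sI sg in auto)
    also have "\<dots> = emeasure (distr (restrict_space lborel {0<..<1}) borel I) A"
      using A mI sI by (simp add: emeasure_distr space_restrict_space emeasure_restrict_space)
    finally show "emeasure (distr unit_interval borel g) A = \<dots>" .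
  qed simp
  also have "\<dots> = M"
    by (rule distr_I_eq_M)
  finally have "distr unit_interval borel g = M" .
  moreover have "distr unit_interval M g = distr unit_interval borel g"
    by (rule distr_cong) simp_all
  moreover have "g \<in> unit_interval \<rightarrow>\<^sub>M M"
    using meas by simp
  ultimately show ?thesis
    unfolding parametrizable_def by auto
qed

text \<open>The point is coded by a sequence of reals and then by a single real, whose law has a
  quantile function; decoding transports that parameter back.\<close>

lemma parametrizable_embed:
  fixes e :: "'a \<Rightarrow> nat \<Rightarrow> real"
  assumes "prob_space M" "e \<in> borel_measurable M" "h \<in> borel \<rightarrow>\<^sub>M M"
    and "\<And>x. x \<in> space M \<Longrightarrow> h (e x) = x"
  shows "parametrizable M"
proof -
  have m: "seq_to_real \<circ> e \<in> borel_measurable M" "h \<circ> real_to_seq \<in> borel \<rightarrow>\<^sub>M M"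
    using assms measurable_seq_to_real measurable_real_to_seq by auto
  have "real_distribution (distr M borel (seq_to_real \<circ> e))"
    using prob_space.real_distribution_distr[OF assms(1) m(1)] .
  then have "parametrizable (distr M borel (seq_to_real \<circ> e))"
    by (rule parametrizable_real)
  moreover have "distr (distr M borel (seq_to_real \<circ> e)) M (h \<circ> real_to_seq) = M"
  proof -
    have "distr (distr M borel (seq_to_real \<circ> e)) M (h \<circ> real_to_seq) =
        distr M M (h \<circ> real_to_seq \<circ> (seq_to_real \<circ> e))"
      by (rule distr_distr[OF m(2,1)])
    also have "\<dots> = distr M M (\<lambda>x. x)"
      by (rule distr_cong) (simp_all add: assms(4) real_to_seq_seq_to_real)
    finally show ?thesis
      by (simp add: distr_id2)
  qed
  ultimately show ?thesis
    using m(2) by (intro parametrizable_distr_eq[where f = "h \<circ> real_to_seq"]) auto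
qed

text \<open>Stated for arbitrary laws on the square because the couplings produced by gluing are not
  product measures.\<close>

lemma parametrizable_real2:
  assumes "prob_space M" "sets M = sets (unit_interval \<Otimes>\<^sub>M unit_interval)"
  shows "parametrizable M"
proof (rule parametrizable_embed)
  define e :: "real \<times> real \<Rightarrow> nat \<Rightarrow> real" where "e p i = (if i = 0 then fst p else snd p)" for p i
  define h :: "(nat \<Rightarrow> real) \<Rightarrow> real \<times> real" where
    "h a = (if a 0 \<in> {0..<1} \<and> a 1 \<in> {0..<1} then (a 0, a 1) else (0, 0))" for a
  have sp: "space M = {0..<1} \<times> {0..<1}"
    using sets_eq_imp_space_eq[OF assms(2)] by (simp add: space_pair_measure space_restrict_space)
  have [measurable]: "(\<lambda>x :: nat \<Rightarrow> real. x i) \<in> borel_measurable borel" for i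
    by (rule measurable_product_coordinates)
  have id: "(\<lambda>x. x) \<in> unit_interval \<rightarrow>\<^sub>M borel"
    by (rule measurable_restrict_space1) simp
  have "fst \<in> borel_measurable (unit_interval \<Otimes>\<^sub>M unit_interval)"
    using measurable_compose[OF measurable_fst id] .
  moreover have "snd \<in> borel_measurable (unit_interval \<Otimes>\<^sub>M unit_interval)"
    using measurable_compose[OF measurable_snd id] .
  ultimately have "(\<lambda>p. e p i) \<in> borel_measurable (unit_interval \<Otimes>\<^sub>M unit_interval)" for i
    by (cases "i = 0") (simp_all add: e_def)
  then show "e \<in> borel_measurable M"
    unfolding measurable_cong_sets[OF assms(2) refl]
    by (intro measurable_coordinatewise_then_product) simp
  have c: "(\<lambda>a. if a 0 \<in> {0..<1} \<and> a 1 \<in> {0..<1} then a i else 0) \<in> borel \<rightarrow>\<^sub>M unit_interval"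
    if "i < 2" for i :: nat
  proof (rule measurable_restrict_space2)
    show "(\<lambda>a. if a 0 \<in> {0..<1} \<and> a 1 \<in> {0..<1} then a i else 0) \<in> borel \<rightarrow>\<^sub>M (lborel :: real measure)"
      by measurable
    have "i = 0 \<or> i = 1" using that by auto
    then show "(\<lambda>a. if a 0 \<in> {0..<1} \<and> a 1 \<in> {0..<1} then a i else 0) \<in> space borel \<rightarrow> {0..<1::real}"
      by auto
  qed
  have "h = (\<lambda>a. (if a 0 \<in> {0..<1} \<and> a 1 \<in> {0..<1} then a 0 else 0,
      if a 0 \<in> {0..<1} \<and> a 1 \<in> {0..<1} then a 1 else 0))"
    by (auto simp: h_def fun_eq_iff)
  also have "\<dots> \<in> borel \<rightarrow>\<^sub>M unit_interval \<Otimes>\<^sub>M unit_interval"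
    by (rule measurable_Pair[OF c c]) auto
  finally show "h \<in> borel \<rightarrow>\<^sub>M M"
    unfolding measurable_cong_sets[OF refl assms(2)] .
  show "h (e p) = p" if "p \<in> space M" for p
    using that by (auto simp: sp h_def e_def)
qed (rule assms(1))

lemma parametrizable_pair:
  assumes "parametrizable A" "parametrizable B"
  shows "parametrizable (A \<Otimes>\<^sub>M B)"
proof -
  obtain f where f: "f \<in> unit_interval \<rightarrow>\<^sub>M A" "distr unit_interval A f = A"
    using assms(1) unfolding parametrizable_def by blast
  obtain g where g: "g \<in> unit_interval \<rightarrow>\<^sub>M B" "distr unit_interval B g = B"
    using assms(2) unfolding parametrizable_def by blast
  interpret U: prob_space unit_interval by (rule prob_space_unit_interval)
  interpret UU: pair_prob_space unit_interval unit_interval ..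
  interpret B: prob_space B using parametrizable_prob_space[OF assms(2)] .
  have eq: "A \<Otimes>\<^sub>M B = distr (unit_interval \<Otimes>\<^sub>M unit_interval) (A \<Otimes>\<^sub>M B) (\<lambda>(x, y). (f x, g y))"
    using pair_measure_distr[OF f(1) g(1)] f(2) g(2) B.sigma_finite_measure_axioms by simp
  have pm: "parametrizable (unit_interval \<Otimes>\<^sub>M unit_interval)"
    by (rule parametrizable_real2) (auto intro: UU.prob_space_axioms)
  have meas: "(\<lambda>(x, y). (f x, g y)) \<in> unit_interval \<Otimes>\<^sub>M unit_interval \<rightarrow>\<^sub>M A \<Otimes>\<^sub>M B"
    using f(1) g(1) by measurable
  show ?thesis
    by (rule parametrizable_distr_eq[OF pm meas eq[symmetric]])
qed

section \<open>Separable metric spaces and their Borel sets\<close>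

lemma space_borel_measure_of [simp]: "space (borel_measure_of T) = topspace T"
  by (simp add: borel_measure_of_def space_measure_of_conv)

lemma openin_sets_borel_measure_of: "openin T U \<Longrightarrow> U \<in> sets (borel_measure_of T)"
  using openin_subset[of T]
  by (auto simp: borel_measure_of_def sets_measure_of_conv intro!: sigma_sets.Basic)

lemma measurable_borel_measure_of:
  assumes "f \<in> space N \<rightarrow> topspace T"
    and "\<And>U. openin T U \<Longrightarrow> f -` U \<inter> space N \<in> sets N"
  shows "f \<in> N \<rightarrow>\<^sub>M borel_measure_of T"
  unfolding borel_measure_of_def
  by (rule measurable_measure_of) (use assms openin_subset[of T] in auto)

lemma lipschitz_preimage_openin:
  assumes "Metric_space M d" "Metric_space M' d'" "f \<in> M \<rightarrow> M'"
    and lip: "\<And>x y. x \<in> M \<Longrightarrow> y \<in> M \<Longrightarrow> d' (f x) (f y) \<le> K * d x y"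
    and U: "openin (Metric_space.mtopology M' d') U"
  shows "openin (Metric_space.mtopology M d) (f -` U \<inter> M)"
proof -
  interpret X: Metric_space M d by fact
  interpret Y: Metric_space M' d' by fact
  show ?thesis
    unfolding X.openin_mtopology
  proof (intro conjI allI impI)
    fix x assume x: "x \<in> f -` U \<inter> M"
    then obtain r where r: "r > 0" "Y.mball (f x) r \<subseteq> U"
      using U unfolding Y.openin_mtopology by blast
    \<comment> \<open>\<open>\<bar>K\<bar> + 1\<close> is positive and dominates \<open>K\<close>,
      whatever the sign of \<open>K\<close>.\<close>
    define s where "s = r / (\<bar>K\<bar> + 1)"
    have "s > 0"
      using r(1) by (simp add: s_def add_nonneg_pos)
    moreover have "X.mball x s \<subseteq> f -` U \<inter> M"
    proof
      fix y assume y: "y \<in> X.mball x s"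
      have "d' (f x) (f y) \<le> K * d x y"
        using y lip by simp
      also have "\<dots> \<le> (\<bar>K\<bar> + 1) * d x y"
        by (intro mult_right_mono) auto
      also have "\<dots> < (\<bar>K\<bar> + 1) * s"
        using y by (intro mult_strict_left_mono) auto
      also have "\<dots> = r"
        by (simp add: s_def add_nonneg_eq_0_iff)
      finally have "f y \<in> Y.mball (f x) r"
        using y x assms(3) by auto
      with r(2) y show "y \<in> f -` U \<inter> M"
        by auto
    qed
    ultimately show "\<exists>r>0. X.mball x r \<subseteq> f -` U \<inter> M"
      by blast
  qed simp
qed

lemma lipschitz_measurable:
  assumes "Metric_space M d" "Metric_space M' d'" "f \<in> M \<rightarrow> M'"
    and "\<And>x y. x \<in> M \<Longrightarrow> y \<in> M \<Longrightarrow> d' (f x) (f y) \<le> K * d x y"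
  shows "f \<in> borel_measure_of (Metric_space.mtopology M d) \<rightarrow>\<^sub>M
    borel_measure_of (Metric_space.mtopology M' d')"
proof -
  interpret X: Metric_space M d by fact
  interpret Y: Metric_space M' d' by fact
  show ?thesis
  proof (rule measurable_borel_measure_of)
    fix U assume "openin Y.mtopology U"
    with assms have "openin X.mtopology (f -` U \<inter> M)"
      by (rule lipschitz_preimage_openin)
    then show "f -` U \<inter> space (borel_measure_of X.mtopology) \<in> sets (borel_measure_of X.mtopology)"
      by (simp add: openin_sets_borel_measure_of)
  qed (use assms(3) in simp)
qed

lemma borel_measure_of_euclidean: "borel_measure_of (euclidean :: real topology) = borel"
  by (simp add: borel_measure_of_def borel_def)

lemma lipschitz_measurable_real:
  assumes "Metric_space M d"
    and "\<And>x y. x \<in> M \<Longrightarrow> y \<in> M \<Longrightarrow> \<bar>f x - f y\<bar> \<le> K * d x y"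
  shows "f \<in> borel_measurable (borel_measure_of (Metric_space.mtopology M d))"
  using lipschitz_measurable[OF assms(1) Met_TC.Metric_space_axioms, of f K] assms(2)
  by (simp add: dist_real_def borel_measure_of_euclidean)

section \<open>Metric spaces with a fixed dense sequence\<close>

locale sep_metric = Metric_space M d
  for M :: "'a set" and d :: "'a \<Rightarrow> 'a \<Rightarrow> real" +
  fixes c :: "nat \<Rightarrow> 'a"
  assumes c_in: "c i \<in> M"
    and c_dense: "x \<in> M \<Longrightarrow> r > 0 \<Longrightarrow> \<exists>i. d x (c i) < r"
begin

abbreviation "B \<equiv> borel_measure_of mtopology"

lemma measurable_dist_left: "a \<in> M \<Longrightarrow> (\<lambda>x. d x a) \<in> borel_measurable B"
proof (rule lipschitz_measurable_real[where K = 1])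
  fix x y assume "a \<in> M" "x \<in> M" "y \<in> M"
  then show "\<bar>d x a - d y a\<bar> \<le> 1 * d x y"
    using triangle[of x y a] triangle[of y x a] commute[of x y] by auto
qed (rule Metric_space_axioms)

text \<open>Second countability: an open set is the union of the countably many balls around the
  points \<open>c i\<close> with radii \<open>1 / (1 + j)\<close> that it contains, so measurability
  has to be tested only on distances to the dense sequence.\<close>

lemma measurable_into:
  assumes h: "h \<in> space N \<rightarrow> M" and meas: "\<And>i. (\<lambda>w. d (h w) (c i)) \<in> borel_measurable N"
  shows "h \<in> N \<rightarrow>\<^sub>M B"
proof (rule measurable_borel_measure_of)
  fix U assume U: "openin mtopology U"
  define J where "J = {(i, j). mball (c i) (1 / (1 + real j)) \<subseteq> U}"
  have *: "h -` U \<inter> space N = (\<Union>(i, j)\<in>J. {w \<in> space N. d (h w) (c i) < 1 / (1 + real j)})"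
  proof (intro equalityI subsetI)
    fix w assume w: "w \<in> h -` U \<inter> space N"
    then obtain r where r: "r > 0" "mball (h w) r \<subseteq> U"
      using U unfolding openin_mtopology by blast
    obtain j where j: "1 / (1 + real j) < r / 2"
      using reals_Archimedean[of "r/2"] r(1) by (auto simp: inverse_eq_divide)
    have hw: "h w \<in> M"
      using h w by auto
    obtain i where i: "d (h w) (c i) < 1 / (1 + real j)"
      using c_dense[OF hw, of "1 / (1 + real j)"] by (auto simp: add_pos_nonneg)
    have "mball (c i) (1 / (1 + real j)) \<subseteq> mball (h w) r"
      using i j hw c_in commute[of "h w" "c i"] by (intro mball_subset) auto
    with r i w show "w \<in> (\<Union>(i, j)\<in>J. {w \<in> space N. d (h w) (c i) < 1 / (1 + real j)})"
      by (auto simp: J_def intro!: bexI[of _ "(i, j)"])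
  next
    fix w assume "w \<in> (\<Union>(i, j)\<in>J. {w \<in> space N. d (h w) (c i) < 1 / (1 + real j)})"
    then obtain i j where ij: "mball (c i) (1 / (1 + real j)) \<subseteq> U" "w \<in> space N"
      "d (h w) (c i) < 1 / (1 + real j)"
      by (auto simp: J_def)
    moreover have "h w \<in> M"
      using h ij by auto
    ultimately have "h w \<in> mball (c i) (1 / (1 + real j))"
      using c_in commute[of "h w" "c i"] by simp
    with ij show "w \<in> h -` U \<inter> space N"
      by auto
  qed
  have [measurable]: "(\<lambda>w. d (h w) (c i)) \<in> borel_measurable N" for i
    by (rule meas)
  have "countable J"
    by (rule countableI_type)
  then show "h -` U \<inter> space N \<in> sets N"
    unfolding * by (rule sets.countable_UN') auto
qed (use h in simp)

text \<open>Measurable for the product of the Borel algebras because \<open>d x y < a\<close> holds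
  iff \<open>d x (c i) < q\<close> and \<open>d y (c i) < a - q\<close> for some \<open>i\<close>
  and some rational \<open>q\<close>: a countable union of rectangles.\<close>

lemma measurable_dist_pair: "(\<lambda>p. d (fst p) (snd p)) \<in> borel_measurable (B \<Otimes>\<^sub>M B)"
proof (rule borel_measurableI_less)
  fix a :: real
  have *: "{p \<in> space (B \<Otimes>\<^sub>M B). d (fst p) (snd p) < a} =
    (\<Union>(i, q)\<in>UNIV. {p \<in> space (B \<Otimes>\<^sub>M B). d (fst p) (c i) < real_of_rat q \<and>
       d (snd p) (c i) < a - real_of_rat q})"
  proof (intro equalityI subsetI)
    fix p assume p: "p \<in> {p \<in> space (B \<Otimes>\<^sub>M B). d (fst p) (snd p) < a}"
    then have in_M: "fst p \<in> M" "snd p \<in> M"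
      by (auto simp: space_pair_measure)
    define e where "e = a - d (fst p) (snd p)"
    have e: "e > 0"
      using p by (simp add: e_def)
    obtain i where i: "d (fst p) (c i) < e / 4"
      using c_dense[OF in_M(1), of "e/4"] e by auto
    obtain q where q: "d (fst p) (c i) < real_of_rat q" "real_of_rat q < e / 4"
      using of_rat_dense[OF i] by blast
    have "d (snd p) (c i) \<le> d (snd p) (fst p) + d (fst p) (c i)"
      using in_M c_in by (intro triangle) auto
    also have "\<dots> < a - real_of_rat q"
      using q e commute[of "snd p" "fst p"] by (simp add: e_def)
    finally show "p \<in> (\<Union>(i, q)\<in>UNIV. {p \<in> space (B \<Otimes>\<^sub>M B). d (fst p) (c i) < real_of_rat q \<and>
       d (snd p) (c i) < a - real_of_rat q})"
      using p q by auto
  next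
    fix p assume "p \<in> (\<Union>(i, q)\<in>UNIV. {p \<in> space (B \<Otimes>\<^sub>M B). d (fst p) (c i) < real_of_rat q \<and>
       d (snd p) (c i) < a - real_of_rat q})"
    then obtain i q where p: "p \<in> space (B \<Otimes>\<^sub>M B)" "d (fst p) (c i) < real_of_rat q"
       "d (snd p) (c i) < a - real_of_rat q"
      by auto
    have "d (fst p) (snd p) \<le> d (fst p) (c i) + d (c i) (snd p)"
      using p c_in by (intro triangle) (auto simp: space_pair_measure)
    with p show "p \<in> {p \<in> space (B \<Otimes>\<^sub>M B). d (fst p) (snd p) < a}"
      using commute[of "snd p" "c i"] by simp
  qed
  note measurable_dist_left[OF c_in, measurable]
  have "{p \<in> space (B \<Otimes>\<^sub>M B). d (fst p) (c i) < real_of_rat q \<and>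
       d (snd p) (c i) < a - real_of_rat q} \<in> sets (B \<Otimes>\<^sub>M B)" for i q
    by measurable
  then show "{p \<in> space (B \<Otimes>\<^sub>M B). d (fst p) (snd p) < a} \<in> sets (B \<Otimes>\<^sub>M B)"
    unfolding * by (intro sets.countable_UN') auto
qed

text \<open>The fibres form a countable Borel partition in which points of the same cell are less
  than \<open>2 * r\<close> apart; couplings are glued on this discretization.\<close>

definition cell :: "real \<Rightarrow> 'a \<Rightarrow> nat" where
  "cell r x = (LEAST i. d x (c i) < r)"

lemma measurable_cell: "cell r \<in> B \<rightarrow>\<^sub>M count_space UNIV"
proof -
  note measurable_dist_left[OF c_in, measurable]
  show ?thesis
    unfolding cell_def by measurable
qed

lemma dist_cell: "x \<in> M \<Longrightarrow> r > 0 \<Longrightarrow> d x (c (cell r x)) < r"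
  unfolding cell_def using c_dense by (rule LeastI_ex)

lemma cell_eq_dist:
  assumes "x \<in> M" "y \<in> M" "r > 0" "cell r x = cell r y"
  shows "d x y < 2 * r"
proof -
  have "d x y \<le> d x (c (cell r x)) + d (c (cell r x)) y"
    using assms c_in by (intro triangle) auto
  with assms dist_cell[of x r] dist_cell[of y r] show ?thesis
    using commute[of y "c (cell r x)"] by auto
qed

lemma separable_space_mtopology: "separable_space mtopology"
  unfolding separable_space_def
proof (intro exI conjI)
  show "mtopology closure_of (range c) = topspace mtopology"
    unfolding metric_closure_of topspace_mtopology using c_dense c_in by fastforce
qed (use c_in in auto)

text \<open>Separability is hereditary in metric spaces: for each \<open>c i\<close> and each scale
  \<open>1 / (1 + j)\<close> choose a point of \<open>S\<close> within that distance if there is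
  one, and an arbitrary point of \<open>S\<close> otherwise.\<close>

lemma sep_metric_subspace:
  assumes "S \<subseteq> M" "S \<noteq> {}"
  shows "\<exists>c'. sep_metric S d c'"
proof -
  define near where "near i j = {x \<in> S. d x (c i) < 1 / (1 + real j)}" for i j
  define c' where "c' k = (let (i, j) = prod_decode k in
    if near i j \<noteq> {} then SOME x. x \<in> near i j else SOME x. x \<in> S)" for k
  have c'_in: "c' k \<in> S" for k
  proof (cases "prod_decode k")
    case (Pair i j)
    show ?thesis
    proof (cases "near i j = {}")
      case False
      then have "(SOME x. x \<in> near i j) \<in> near i j"
        by (simp add: some_in_eq)
      with False Pair show ?thesis
        by (simp add: c'_def near_def)
    next
      case True
      with Pair assms(2) show ?thesis
        by (simp add: c'_def some_in_eq)
    qed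
  qed
  have "\<exists>k. d x (c' k) < r" if x: "x \<in> S" "r > 0" for x r
  proof -
    obtain j where j: "1 / (1 + real j) < r / 2"
      using reals_Archimedean[of "r/2"] x(2) by (auto simp: inverse_eq_divide)
    obtain i where i: "d x (c i) < 1 / (1 + real j)"
      using c_dense[of x "1 / (1 + real j)"] x assms(1) by (auto simp: add_pos_nonneg)
    then have "near i j \<noteq> {}"
      using x by (auto simp: near_def)
    then have "(SOME x. x \<in> near i j) \<in> near i j"
      by (simp add: some_in_eq)
    with \<open>near i j \<noteq> {}\<close> have y: "c' (prod_encode (i, j)) \<in> near i j"
      by (simp add: c'_def)
    have "d x (c' (prod_encode (i, j))) \<le> d x (c i) + d (c i) (c' (prod_encode (i, j)))"
      using x c'_in assms(1) c_in by (intro triangle) auto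
    also have "\<dots> < r"
      using i j y commute[of "c i"] by (simp add: near_def)
    finally show ?thesis
      by blast
  qed
  with c'_in have "sep_metric S d c'"
    using subspace[OF assms(1)] by (simp add: sep_metric_def sep_metric_axioms_def)
  then show ?thesis
    by blast
qed

end

text \<open>A point \<open>x\<close> of a complete separable space is recovered measurably from its distances
  \<open>a i = d x (c i)\<close> to a dense sequence: it is the limit of the first \<open>c i\<close> with
  \<open>a i < 1 / 2 ^ k\<close>, as \<open>k\<close> tends to infinity.\<close>

lemma (in sep_metric) dist_seq_left_inverse:
  assumes "mcomplete"
  shows "\<exists>h \<in> (borel :: (nat \<Rightarrow> real) measure) \<rightarrow>\<^sub>M B. \<forall>x\<in>M. h (\<lambda>i. d x (c i)) = x"
proof -
  define idx where "idx k a = (LEAST i. a i < (1/2) ^ k)" for k and a :: "nat \<Rightarrow> real"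
  \<comment> \<open>A Borel condition that makes \<open>c (idx k a)\<close> a Cauchy sequence. Every
    sequence of distances from a point satisfies it, and elsewhere \<open>h\<close> is the constant
    \<open>c 0\<close>.\<close>
  define good where "good a \<longleftrightarrow> (\<forall>j k. d (c (idx j a)) (c (idx k a)) \<le> (1/2) ^ j + (1/2) ^ k)" for a
  define h where "h a = (if good a then SOME x. limitin mtopology (\<lambda>k. c (idx k a)) x sequentially else c 0)" for a
  have lim: "limitin mtopology (\<lambda>k. c (idx k a)) (h a) sequentially" if "good a" for a
  proof -
    have "MCauchy (\<lambda>k. c (idx k a))"
      unfolding MCauchy_def
    proof (intro conjI allI impI)
      fix e :: real assume "e > 0"
      then obtain N where N: "(1/2 :: real) ^ N < e / 2"
        using real_arch_pow_inv[of "e/2" "1/2"] by auto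
      have "d (c (idx m a)) (c (idx n a)) < e" if "N \<le> m" "N \<le> n" for m n
      proof -
        have "(1/2 :: real) ^ m \<le> (1/2) ^ N" "(1/2 :: real) ^ n \<le> (1/2) ^ N"
          using that by (auto intro!: power_decreasing)
        moreover have "d (c (idx m a)) (c (idx n a)) \<le> (1/2) ^ m + (1/2) ^ n"
          using \<open>good a\<close> unfolding good_def by blast
        ultimately show ?thesis
          using N by linarith
      qed
      then show "\<exists>N. \<forall>n n'. N \<le> n \<longrightarrow> N \<le> n' \<longrightarrow> d (c (idx n a)) (c (idx n' a)) < e"
        by blast
    qed (use c_in in auto)
    then show ?thesis
      using assms that unfolding mcomplete_def h_def by (auto intro: someI_ex)
  qed
  then have h_in: "h a \<in> M" for a
    by (cases "good a") (auto simp: h_def c_in intro: limitin_mspace)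
  have [measurable]: "(\<lambda>x :: nat \<Rightarrow> real. x i) \<in> borel_measurable borel" for i
    by (rule measurable_product_coordinates)
  have idx [measurable]: "idx k \<in> borel \<rightarrow>\<^sub>M count_space UNIV" for k
    unfolding idx_def by measurable
  have good [measurable]: "Measurable.pred borel good"
    unfolding good_def by measurable
  have "h \<in> borel \<rightarrow>\<^sub>M B"
  proof (rule measurable_into)
    fix i
    have conv: "(\<lambda>k. d (c (idx k a)) (c i)) \<longlonglongrightarrow> d (h a) (c i)" if "good a" for a
    proof (rule tendsto_sandwich[of "\<lambda>k. d (h a) (c i) - d (c (idx k a)) (h a)" _ _
          "\<lambda>k. d (h a) (c i) + d (c (idx k a)) (h a)"])
      have "(\<lambda>k. d (c (idx k a)) (h a)) \<longlonglongrightarrow> 0"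
        using lim[OF that] unfolding limitin_metric_dist_null by blast
      from tendsto_diff[OF tendsto_const this] tendsto_add[OF tendsto_const this]
      show "(\<lambda>k. d (h a) (c i) - d (c (idx k a)) (h a)) \<longlonglongrightarrow> d (h a) (c i)"
        "(\<lambda>k. d (h a) (c i) + d (c (idx k a)) (h a)) \<longlonglongrightarrow> d (h a) (c i)"
        by auto
      have "d (h a) (c i) \<le> d (h a) (c (idx k a)) + d (c (idx k a)) (c i)"
        "d (c (idx k a)) (c i) \<le> d (c (idx k a)) (h a) + d (h a) (c i)" for k
        using h_in c_in by (auto intro: triangle)
      then show "\<forall>\<^sub>F k in sequentially. d (h a) (c i) - d (c (idx k a)) (h a) \<le> d (c (idx k a)) (c i)"
        "\<forall>\<^sub>F k in sequentially. d (c (idx k a)) (c i) \<le> d (h a) (c i) + d (c (idx k a)) (h a)"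
        by (auto simp: commute[of "h a"] algebra_simps)
    qed
    show "(\<lambda>a. d (h a) (c i)) \<in> borel_measurable borel"
    proof (rule borel_measurable_LIMSEQ_real)
      show "(\<lambda>k. if good a then d (c (idx k a)) (c i) else d (c 0) (c i)) \<longlonglongrightarrow> d (h a) (c i)" for a
        using conv[of a] by (cases "good a") (auto simp: h_def)
      show "(\<lambda>a. if good a then d (c (idx k a)) (c i) else d (c 0) (c i)) \<in> borel_measurable borel" for k
        by measurable
    qed
  qed (use h_in in auto)
  moreover have "h (\<lambda>i. d x (c i)) = x" if x: "x \<in> M" for x
  proof -
    define a where "a = (\<lambda>i. d x (c i))"
    have le: "d x (c (idx k a)) < (1/2) ^ k" for k
      using LeastI_ex[OF c_dense[OF x, of "(1/2) ^ k"]] by (simp add: idx_def a_def)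
    have "good a"
      unfolding good_def
    proof (intro allI)
      fix j k
      have "d (c (idx j a)) (c (idx k a)) \<le> d (c (idx j a)) x + d x (c (idx k a))"
        using x c_in by (intro triangle) auto
      with le[of j] le[of k] show "d (c (idx j a)) (c (idx k a)) \<le> (1/2) ^ j + (1/2) ^ k"
        using commute[of "c (idx j a)" x] by simp
    qed
    moreover have "limitin mtopology (\<lambda>k. c (idx k a)) x sequentially"
      unfolding limitin_metric_dist_null
    proof (intro conjI)
      show "(\<lambda>k. d (c (idx k a)) x) \<longlonglongrightarrow> 0"
      proof (rule tendsto_sandwich[of "\<lambda>_. 0" _ _ "\<lambda>k. (1/2) ^ k"])
        show "\<forall>\<^sub>F k in sequentially. d (c (idx k a)) x \<le> (1/2) ^ k"
          using le commute[of _ x] by (auto intro!: always_eventually less_imp_le)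
      qed (auto intro!: LIMSEQ_realpow_zero)
    qed (use x c_in in auto)
    ultimately have "h a = x"
      by (intro limitin_metric_unique[OF lim]) auto
    then show ?thesis
      by (simp add: a_def)
  qed
  ultimately show ?thesis
    by blast
qed

section \<open>Mm-spaces: dense sequences and parameters\<close>

lemma mm_space_sep_metric:
  assumes "mm_space X"
  shows "\<exists>c. sep_metric (pts X) (dst X) c"
proof -
  interpret Metric_space "pts X" "dst X"
    using assms by (simp add: mm_space_def)
  interpret prob_space "msr X"
    using assms by (simp add: mm_space_def)
  have "sets (msr X) = sets (borel_measure_of mtopology)"
    using assms by (simp add: mm_space_def)
  from sets_eq_imp_space_eq[OF this] have "pts X \<noteq> {}"
    using not_empty by simp
  obtain C where C: "countable C" "C \<subseteq> pts X" "mtopology closure_of C = pts X"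
    using assms by (auto simp: mm_space_def separable_space_def)
  have "C \<noteq> {}"
    using C(3) \<open>pts X \<noteq> {}\<close> by auto
  have ran: "range (from_nat_into C) = C"
    using range_from_nat_into[OF \<open>C \<noteq> {}\<close> C(1)] .
  have "\<exists>i. dst X x (from_nat_into C i) < r" if xr: "x \<in> pts X" "r > 0" for x r
  proof -
    have "x \<in> mtopology closure_of C"
      using C(3) xr by simp
    then obtain y where "y \<in> C" "dst X x y < r"
      unfolding metric_closure_of using xr(2) by auto
    moreover obtain i where "y = from_nat_into C i"
      using \<open>y \<in> C\<close> ran by (metis rangeE)
    ultimately show ?thesis
      by blast
  qed
  moreover have "from_nat_into C i \<in> pts X" for i
    using ran C(2) by auto
  ultimately show ?thesis
    by (auto simp: sep_metric_def sep_metric_axioms_def Metric_space_axioms)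
qed

lemma mm_space_sets:
  assumes "mm_space X"
  shows "sets (msr X) = sets (borel_measure_of (mms_top X))"
  using assms by (simp add: mm_space_def)

lemma mm_space_space:
  assumes "mm_space X"
  shows "space (msr X) = pts X"
proof -
  interpret Metric_space "pts X" "dst X"
    using assms by (simp add: mm_space_def)
  show ?thesis
    using sets_eq_imp_space_eq[OF mm_space_sets[OF assms]] by simp
qed

text \<open>The distances to a dense sequence embed the space into the sequences of reals;
  completeness supplies the measurable left inverse.\<close>

lemma mm_space_parametrizable:
  assumes "mm_space X"
  shows "parametrizable (msr X)"
proof -
  obtain c where "sep_metric (pts X) (dst X) c"
    using mm_space_sep_metric[OF assms] by blast
  then interpret sep_metric "pts X" "dst X" c .
  note S = mm_space_sets[OF assms]
  have "mcomplete"
    using assms by (simp add: mm_space_def)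
  from dist_seq_left_inverse[OF this]
  obtain h where h: "h \<in> borel \<rightarrow>\<^sub>M B" "\<forall>x\<in>pts X. h (\<lambda>i. dst X x (c i)) = x"
    by blast
  show ?thesis
  proof (rule parametrizable_embed)
    show "prob_space (msr X)"
      using assms by (simp add: mm_space_def)
    show "(\<lambda>x i. dst X x (c i)) \<in> borel_measurable (msr X)"
      unfolding measurable_cong_sets[OF S refl]
      by (intro measurable_coordinatewise_then_product measurable_dist_left c_in)
    show "h \<in> borel \<rightarrow>\<^sub>M msr X"
      using h(1) unfolding measurable_cong_sets[OF refl S] .
    show "\<And>x. x \<in> space (msr X) \<Longrightarrow> h (\<lambda>i. dst X x (c i)) = x"
      using h(2) by (simp add: mm_space_space[OF assms])
  qed
qed

section \<open>The box distance\<close>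

lemma (in prob_space) prob_Int_ge:
  assumes "A \<in> events" "B \<in> events"
  shows "prob (A \<inter> B) \<ge> prob A + prob B - 1"
proof -
  have "prob (space M - (A \<inter> B)) = prob ((space M - A) \<union> (space M - B))"
    by (rule arg_cong[of _ _ prob]) auto
  also have "\<dots> \<le> prob (space M - A) + prob (space M - B)"
    using assms by (intro measure_Un_le) auto
  finally show ?thesis
    using assms by (simp add: prob_compl)
qed

text \<open>A parameter of \<open>P\<close> turns \<open>\<phi>\<close> and \<open>\<psi>\<close>
  into parameters of the two spaces and pulls \<open>A\<close> back to the set \<open>I0\<close>.
  Upper bounds on the box distance can thus be read off from couplings on product spaces.\<close>

lemma box_dist_le:
  assumes P: "parametrizable P"
    and \<phi>: "\<phi> \<in> P \<rightarrow>\<^sub>M msr X" "distr P (msr X) \<phi> = msr X"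
    and \<psi>: "\<psi> \<in> P \<rightarrow>\<^sub>M msr Y" "distr P (msr Y) \<psi> = msr Y"
    and A: "A \<in> sets P" "measure P A \<ge> 1 - \<epsilon>" "0 \<le> \<epsilon>"
    and close: "\<And>s t. s \<in> A \<Longrightarrow> t \<in> A \<Longrightarrow> \<bar>dst X (\<phi> s) (\<phi> t) - dst Y (\<psi> s) (\<psi> t)\<bar> \<le> \<epsilon>"
  shows "box_dist X Y \<le> \<epsilon>"
proof -
  obtain g where g: "g \<in> unit_interval \<rightarrow>\<^sub>M P" "distr unit_interval P g = P"
    using P unfolding parametrizable_def by blast
  have par: "is_parameter (f \<circ> g) Z" if "f \<in> P \<rightarrow>\<^sub>M msr Z" "distr P (msr Z) f = msr Z" for f Z
    using that distr_distr[OF that(1) g(1)] measurable_comp[OF g(1) that(1)] g(2)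
    by (simp add: is_parameter_def)
  define I0 where "I0 = g -` A \<inter> {0..<1}"
  have I0: "I0 \<in> sets unit_interval"
    using measurable_sets[OF g(1) A(1)] by (simp add: I0_def space_restrict_space)
  have "measure P A = measure (distr unit_interval P g) A"
    using g(2) by simp
  also have "\<dots> = measure unit_interval I0"
    using g(1) A(1) by (simp add: measure_distr I0_def space_restrict_space)
  also have "\<dots> = measure lborel I0"
    by (rule measure_restrict_space) (auto simp: I0_def)
  finally have "measure lborel I0 \<ge> 1 - \<epsilon>"
    using A(2) by simp
  moreover have "I0 \<in> sets borel"
    using I0 by (simp add: sets_restrict_space_iff)
  moreover have "I0 \<subseteq> {0..<1}"
    by (auto simp: I0_def)
  moreover have "\<forall>s\<in>I0. \<forall>t\<in>I0. \<bar>dst X ((\<phi> \<circ> g) s) ((\<phi> \<circ> g) t) - dst Y ((\<psi> \<circ> g) s) ((\<psi> \<circ> g) t)\<bar> \<le> \<epsilon>"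
    using close by (auto simp: I0_def)
  ultimately show ?thesis
    unfolding box_dist_def using par[OF \<phi>] par[OF \<psi>] A(3)
    by (intro cInf_lower bdd_belowI[of _ 0]) blast+
qed

text \<open>At \<open>\<epsilon> = 1\<close> the set \<open>I0\<close> may be empty. The infimum is
  thus over a nonempty set, which its order properties presuppose.\<close>

lemma box_dist_witness:
  assumes "parametrizable (msr X)" "parametrizable (msr Y)"
  shows "1 \<in> {\<epsilon>. 0 \<le> \<epsilon> \<and>
     (\<exists>\<phi> \<psi> I0. is_parameter \<phi> X \<and> is_parameter \<psi> Y \<and>
        I0 \<in> sets borel \<and> I0 \<subseteq> {0..<1} \<and> measure lborel I0 \<ge> 1 - \<epsilon> \<and>
        (\<forall>s\<in>I0. \<forall>t\<in>I0. \<bar>dst X (\<phi> s) (\<phi> t) - dst Y (\<psi> s) (\<psi> t)\<bar> \<le> \<epsilon>))}"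
proof -
  obtain \<phi> where "is_parameter \<phi> X"
    using assms(1) unfolding parametrizable_def is_parameter_def by blast
  moreover obtain \<psi> where "is_parameter \<psi> Y"
    using assms(2) unfolding parametrizable_def is_parameter_def by blast
  moreover have "({} :: real set) \<in> sets borel \<and> {} \<subseteq> {0..<1::real} \<and> measure lborel ({} :: real set) \<ge> 1 - 1"
    by simp
  ultimately show ?thesis
    by (intro CollectI conjI exI[of _ \<phi>] exI[of _ \<psi>] exI[of _ "{}"]) auto
qed

lemma box_dist_nonneg:
  assumes "parametrizable (msr X)" "parametrizable (msr Y)"
  shows "0 \<le> box_dist X Y"
  unfolding box_dist_def using box_dist_witness[OF assms] by (intro cInf_greatest) blast+

lemma box_dist_lessE:
  assumes "box_dist X Y < \<epsilon>" "parametrizable (msr X)" "parametrizable (msr Y)"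
  obtains \<phi> \<psi> A where "\<phi> \<in> unit_interval \<rightarrow>\<^sub>M msr X" "distr unit_interval (msr X) \<phi> = msr X"
    "\<psi> \<in> unit_interval \<rightarrow>\<^sub>M msr Y" "distr unit_interval (msr Y) \<psi> = msr Y"
    "A \<in> sets unit_interval" "measure unit_interval A \<ge> 1 - \<epsilon>"
    "\<And>s t. s \<in> A \<Longrightarrow> t \<in> A \<Longrightarrow> \<bar>dst X (\<phi> s) (\<phi> t) - dst Y (\<psi> s) (\<psi> t)\<bar> \<le> \<epsilon>"
proof -
  have "\<exists>e<\<epsilon>. (\<exists>\<phi> \<psi> I0. is_parameter \<phi> X \<and> is_parameter \<psi> Y \<and>
        I0 \<in> sets borel \<and> I0 \<subseteq> {0..<1} \<and> measure lborel I0 \<ge> 1 - e \<and>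
        (\<forall>s\<in>I0. \<forall>t\<in>I0. \<bar>dst X (\<phi> s) (\<phi> t) - dst Y (\<psi> s) (\<psi> t)\<bar> \<le> e))"
    using cInf_lessD[OF _ assms(1)[unfolded box_dist_def]] box_dist_witness[OF assms(2,3)] by blast
  then obtain e \<phi> \<psi> I0 where *: "e < \<epsilon>" "is_parameter \<phi> X" "is_parameter \<psi> Y" "I0 \<in> sets borel"
    "I0 \<subseteq> {0..<1}" "measure lborel I0 \<ge> 1 - e"
    "\<forall>s\<in>I0. \<forall>t\<in>I0. \<bar>dst X (\<phi> s) (\<phi> t) - dst Y (\<psi> s) (\<psi> t)\<bar> \<le> e"
    by blast
  have "measure unit_interval I0 = measure lborel I0"
    using *(4,5) by (intro measure_restrict_space) auto
  show thesis
  proof (rule that[of \<phi> \<psi> I0])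
    show "I0 \<in> sets unit_interval"
      using *(4,5) by (auto simp: sets_restrict_space_iff)
    show "measure unit_interval I0 \<ge> 1 - \<epsilon>"
      using \<open>measure unit_interval I0 = _\<close> *(1,6) by simp
    show "\<bar>dst X (\<phi> s) (\<phi> t) - dst Y (\<psi> s) (\<psi> t)\<bar> \<le> \<epsilon>" if "s \<in> I0" "t \<in> I0" for s t
      using *(1,7) that by force
  qed (use *(2,3) in \<open>simp_all add: is_parameter_def\<close>)
qed

section \<open>Gluing of couplings and the triangle inequality\<close>

lemma pred_nat_eq:
  fixes f g :: "'a \<Rightarrow> nat"
  assumes [measurable]: "f \<in> M \<rightarrow>\<^sub>M count_space UNIV" "g \<in> M \<rightarrow>\<^sub>M count_space UNIV"
  shows "Measurable.pred M (\<lambda>x. f x = g x)"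
proof -
  have "Measurable.pred M (\<lambda>x. \<exists>j. f x = j \<and> g x = j)"
    by measurable
  also have "(\<lambda>x. \<exists>j. f x = j \<and> g x = j) = (\<lambda>x. f x = g x)"
    by auto
  finally show ?thesis .
qed

text \<open>Two probability measures are coupled by making the parts \<open>k = j\<close> and \<open>l = j\<close> independent
  for each \<open>j\<close>.\<close>

lemma discrete_gluing:
  fixes k :: "'a \<Rightarrow> nat" and l :: "'b \<Rightarrow> nat"
  assumes "prob_space M" "prob_space N"
    and k [measurable]: "k \<in> M \<rightarrow>\<^sub>M count_space UNIV" and l [measurable]: "l \<in> N \<rightarrow>\<^sub>M count_space UNIV"
    and eq: "\<And>j. emeasure M {x \<in> space M. k x = j} = emeasure N {y \<in> space N. l y = j}"
  shows "\<exists>P. sets P = sets (M \<Otimes>\<^sub>M N) \<and> prob_space P \<and> distr P M fst = M \<and> distr P N snd = N \<and>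
    (AE p in P. k (fst p) = l (snd p))"
proof -
  interpret M: prob_space M by fact
  interpret N: prob_space N by fact
  interpret MN: pair_prob_space M N ..
  define q where "q j = emeasure M {x \<in> space M. k x = j}" for j
  \<comment> \<open>The block where both labels are \<open>j\<close> has product mass
    \<open>q j * q j\<close>; the factor \<open>1 / q j\<close> corrects this to \<open>q j\<close>.
    Where \<open>q j = 0\<close> the factor is infinite, but such labels occur only on null
    sets.\<close>
  define f where "f p = (if k (fst p) = l (snd p) then inverse (q (k (fst p))) else 0)" for p
  have [measurable]: "(\<lambda>p. inverse (q (k (fst p)))) \<in> borel_measurable (M \<Otimes>\<^sub>M N)"
    by (rule measurable_compose[of "\<lambda>p. k (fst p)" _ "count_space UNIV"]) auto
  have f [measurable]: "f \<in> borel_measurable (M \<Otimes>\<^sub>M N)"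
    unfolding f_def
    by (intro measurable_If pred_nat_eq[unfolded pred_def]) measurable
  have q_top: "q j \<noteq> \<infinity>" for j
    using M.emeasure_finite by (simp add: q_def)
  have AE_M: "AE x in M. q (k x) \<noteq> 0"
  proof -
    have "AE x in M. \<forall>j. q j = 0 \<longrightarrow> k x \<noteq> j"
      unfolding AE_all_countable
    proof
      fix j
      have "AE x in M. \<not> (k x = j)" if "q j = 0"
        using that by (intro AE_I'[of "{x \<in> space M. k x = j}"]) (auto simp: q_def null_sets_def)
      then show "AE x in M. q j = 0 \<longrightarrow> k x \<noteq> j"
        by (cases "q j = 0") auto
    qed
    then show ?thesis
      by eventually_elim auto
  qed
  have AE_N: "AE y in N. q (l y) \<noteq> 0"
  proof -
    have "AE y in N. \<forall>j. q j = 0 \<longrightarrow> l y \<noteq> j"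
      unfolding AE_all_countable
    proof
      fix j
      have "AE y in N. \<not> (l y = j)" if "q j = 0"
        using that by (intro AE_I'[of "{y \<in> space N. l y = j}"]) (auto simp: q_def null_sets_def eq)
      then show "AE y in N. q j = 0 \<longrightarrow> l y \<noteq> j"
        by (cases "q j = 0") auto
    qed
    then show ?thesis
      by eventually_elim auto
  qed
  have inv: "inverse (q j) * q j = 1" if "q j \<noteq> 0" for j
    using that q_top[of j] ennreal_inverse_mult[of "q j"]
    by (metis ennreal_divide_self divide_ennreal_def infinity_ennreal_def mult.commute top.not_eq_extremum)
  define P where "P = density (M \<Otimes>\<^sub>M N) f"
  have emP: "emeasure P A = (\<integral>\<^sup>+ p. f p * indicator A p \<partial>(M \<Otimes>\<^sub>M N))" if "A \<in> sets (M \<Otimes>\<^sub>M N)" for A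
    unfolding P_def using that by (simp add: emeasure_density)
  have fst_P: "emeasure P (fst -` A \<inter> space (M \<Otimes>\<^sub>M N)) = emeasure M A" if A [measurable]: "A \<in> sets M" for A
  proof -
    have "emeasure P (fst -` A \<inter> space (M \<Otimes>\<^sub>M N)) =
        (\<integral>\<^sup>+ p. f p * indicator (fst -` A \<inter> space (M \<Otimes>\<^sub>M N)) p \<partial>(M \<Otimes>\<^sub>M N))"
      by (rule emP) measurable
    also have "\<dots> = (\<integral>\<^sup>+ p. f p * indicator A (fst p) \<partial>(M \<Otimes>\<^sub>M N))"
      by (intro nn_integral_cong) (auto split: split_indicator)
    also have "\<dots> = (\<integral>\<^sup>+ x. (\<integral>\<^sup>+ y. f (x, y) * indicator A x \<partial>N) \<partial>M)"
      by (subst N.nn_integral_fst[symmetric]) auto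
    also have "\<dots> = (\<integral>\<^sup>+ x. indicator A x \<partial>M)"
    proof (rule nn_integral_cong_AE, use AE_M in eventually_elim)
      fix x assume "q (k x) \<noteq> 0"
      have "(\<integral>\<^sup>+ y. f (x, y) * indicator A x \<partial>N) =
          (\<integral>\<^sup>+ y. (inverse (q (k x)) * indicator A x) * indicator {y \<in> space N. l y = k x} y \<partial>N)"
        by (intro nn_integral_cong) (auto simp: f_def split: split_indicator)
      also have "\<dots> = (inverse (q (k x)) * indicator A x) * q (k x)"
        by (subst nn_integral_cmult_indicator) (auto simp: q_def eq)
      also have "\<dots> = indicator A x"
        using inv[OF \<open>q (k x) \<noteq> 0\<close>] by (simp add: ac_simps)
      finally show "(\<integral>\<^sup>+ y. f (x, y) * indicator A x \<partial>N) = indicator A x" .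
    qed
    finally show ?thesis
      by simp
  qed
  have snd_P: "emeasure P (snd -` A \<inter> space (M \<Otimes>\<^sub>M N)) = emeasure N A" if A [measurable]: "A \<in> sets N" for A
  proof -
    have "emeasure P (snd -` A \<inter> space (M \<Otimes>\<^sub>M N)) =
        (\<integral>\<^sup>+ p. f p * indicator (snd -` A \<inter> space (M \<Otimes>\<^sub>M N)) p \<partial>(M \<Otimes>\<^sub>M N))"
      by (rule emP) measurable
    also have "\<dots> = (\<integral>\<^sup>+ p. f p * indicator A (snd p) \<partial>(M \<Otimes>\<^sub>M N))"
      by (intro nn_integral_cong) (auto split: split_indicator)
    also have "\<dots> = (\<integral>\<^sup>+ y. (\<integral>\<^sup>+ x. f (x, y) * indicator A y \<partial>M) \<partial>N)"
      by (subst MN.nn_integral_snd[symmetric]) auto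
    also have "\<dots> = (\<integral>\<^sup>+ y. indicator A y \<partial>N)"
    proof (rule nn_integral_cong_AE, use AE_N in eventually_elim)
      fix y assume "q (l y) \<noteq> 0"
      have "(\<integral>\<^sup>+ x. f (x, y) * indicator A y \<partial>M) =
          (\<integral>\<^sup>+ x. (inverse (q (l y)) * indicator A y) * indicator {x \<in> space M. k x = l y} x \<partial>M)"
        by (intro nn_integral_cong) (auto simp: f_def split: split_indicator)
      also have "\<dots> = (inverse (q (l y)) * indicator A y) * q (l y)"
        by (subst nn_integral_cmult_indicator) (auto simp: q_def)
      also have "\<dots> = indicator A y"
        using inv[OF \<open>q (l y) \<noteq> 0\<close>] by (simp add: ac_simps)
      finally show "(\<integral>\<^sup>+ x. f (x, y) * indicator A y \<partial>M) = indicator A y" .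
    qed
    finally show ?thesis
      by simp
  qed
  have sets_P: "sets P = sets (M \<Otimes>\<^sub>M N)"
    by (simp add: P_def)
  have space_P: "space P = space (M \<Otimes>\<^sub>M N)"
    by (simp add: P_def)
  have "prob_space P"
  proof (rule prob_spaceI)
    have "space P = fst -` space M \<inter> space (M \<Otimes>\<^sub>M N)"
      by (auto simp: space_P space_pair_measure)
    then show "emeasure P (space P) = 1"
      using fst_P[of "space M"] by (simp add: M.emeasure_space_1)
  qed
  moreover have "distr P M fst = M"
  proof (rule measure_eqI)
    fix A assume "A \<in> sets (distr P M fst)"
    then have A: "A \<in> sets M" by simp
    have "fst \<in> P \<rightarrow>\<^sub>M M"
      unfolding measurable_cong_sets[OF sets_P refl] by simp
    with A show "emeasure (distr P M fst) A = emeasure M A"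
      by (subst emeasure_distr) (simp_all add: space_P fst_P)
  qed simp
  moreover have "distr P N snd = N"
  proof (rule measure_eqI)
    fix A assume "A \<in> sets (distr P N snd)"
    then have A: "A \<in> sets N" by simp
    have "snd \<in> P \<rightarrow>\<^sub>M N"
      unfolding measurable_cong_sets[OF sets_P refl] by simp
    with A show "emeasure (distr P N snd) A = emeasure N A"
      by (subst emeasure_distr) (simp_all add: space_P snd_P)
  qed simp
  moreover have "AE p in P. k (fst p) = l (snd p)"
    unfolding P_def by (subst AE_density) (auto simp: f_def)
  ultimately show ?thesis
    using sets_P by blast
qed

text \<open>The two parameters of \<open>Y\<close> need not agree, so a coupling is chosen under
  which they lie in the same cell of \<open>Y\<close>. They are then within \<open>2 * r\<close> of
  each other, which costs \<open>4 * r\<close> in the comparison of two distances and nothing in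
  measure.\<close>

lemma box_dist_triangle:
  assumes X: "mm_space X" and Y: "mm_space Y" and Z: "mm_space Z"
  shows "box_dist X Z \<le> box_dist X Y + box_dist Y Z"
proof (rule field_le_epsilon)
  fix e :: real assume e: "e > 0"
  define a where "a = box_dist X Y + e / 6"
  define b where "b = box_dist Y Z + e / 6"
  note pX = mm_space_parametrizable[OF X] and pY = mm_space_parametrizable[OF Y]
    and pZ = mm_space_parametrizable[OF Z]
  obtain \<phi> \<psi> A where 1: "\<phi> \<in> unit_interval \<rightarrow>\<^sub>M msr X" "distr unit_interval (msr X) \<phi> = msr X"
    "\<psi> \<in> unit_interval \<rightarrow>\<^sub>M msr Y" "distr unit_interval (msr Y) \<psi> = msr Y"
    "A \<in> sets unit_interval" "measure unit_interval A \<ge> 1 - a"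
    "\<And>s t. s \<in> A \<Longrightarrow> t \<in> A \<Longrightarrow> \<bar>dst X (\<phi> s) (\<phi> t) - dst Y (\<psi> s) (\<psi> t)\<bar> \<le> a"
    using box_dist_lessE[of X Y a] pX pY e unfolding a_def by (metis less_add_same_cancel1 zero_less_divide_iff zero_less_numeral)
  obtain \<psi>' \<zeta> A' where 2: "\<psi>' \<in> unit_interval \<rightarrow>\<^sub>M msr Y" "distr unit_interval (msr Y) \<psi>' = msr Y"
    "\<zeta> \<in> unit_interval \<rightarrow>\<^sub>M msr Z" "distr unit_interval (msr Z) \<zeta> = msr Z"
    "A' \<in> sets unit_interval" "measure unit_interval A' \<ge> 1 - b"
    "\<And>s t. s \<in> A' \<Longrightarrow> t \<in> A' \<Longrightarrow> \<bar>dst Y (\<psi>' s) (\<psi>' t) - dst Z (\<zeta> s) (\<zeta> t)\<bar> \<le> b"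
    using box_dist_lessE[of Y Z b] pY pZ e unfolding b_def by (metis less_add_same_cancel1 zero_less_divide_iff zero_less_numeral)
  obtain c where "sep_metric (pts Y) (dst Y) c"
    using mm_space_sep_metric[OF Y] by blast
  then interpret Y: sep_metric "pts Y" "dst Y" c .
  interpret U: prob_space unit_interval by (rule prob_space_unit_interval)
  have cell [measurable]: "Y.cell r \<in> msr Y \<rightarrow>\<^sub>M count_space UNIV" for r
    using Y.measurable_cell unfolding measurable_cong_sets[OF mm_space_sets[OF Y] refl] .
  \<comment> \<open>Budget: \<open>a\<close> and \<open>b\<close> exceed the two box distances by
    \<open>e / 6\<close> each, and \<open>4 * r\<close> takes the rest of \<open>e\<close>.\<close>
  define r where "r = e / 6"
  define k where "k s = Y.cell r (\<psi> s)" for s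
  define l where "l s = Y.cell r (\<psi>' s)" for s
  have k: "k \<in> unit_interval \<rightarrow>\<^sub>M count_space UNIV"
    unfolding k_def using 1(3) by (rule measurable_compose) (rule cell)
  have l: "l \<in> unit_interval \<rightarrow>\<^sub>M count_space UNIV"
    unfolding l_def using 2(1) by (rule measurable_compose) (rule cell)
  have law: "emeasure unit_interval {s \<in> space unit_interval. Y.cell r (f s) = j} =
      emeasure (msr Y) {y \<in> space (msr Y). Y.cell r y = j}"
    if f: "f \<in> unit_interval \<rightarrow>\<^sub>M msr Y" "distr unit_interval (msr Y) f = msr Y" for f j
  proof -
    have "emeasure (msr Y) {y \<in> space (msr Y). Y.cell r y = j} =
      emeasure (distr unit_interval (msr Y) f) {y \<in> space (msr Y). Y.cell r y = j}"
      by (simp add: f(2))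
    also have "\<dots> = emeasure unit_interval {s \<in> space unit_interval. Y.cell r (f s) = j}"
      using f(1) measurable_space[OF f(1)]
      by (subst emeasure_distr) (auto intro!: arg_cong[of _ _ "emeasure unit_interval"])
    finally show ?thesis ..
  qed
  have "emeasure unit_interval {x \<in> space unit_interval. k x = j} =
      emeasure unit_interval {x \<in> space unit_interval. l x = j}" for j
    unfolding k_def l_def law[OF 1(3,4)] law[OF 2(1,2)] ..
  from discrete_gluing[OF U.prob_space_axioms U.prob_space_axioms k l this]
  obtain P where P: "sets P = sets (unit_interval \<Otimes>\<^sub>M unit_interval)" "prob_space P"
    "distr P unit_interval fst = unit_interval" "distr P unit_interval snd = unit_interval"
    "AE p in P. k (fst p) = l (snd p)"
    by blast
  interpret P: prob_space P by fact
  have fst_P: "fst \<in> P \<rightarrow>\<^sub>M unit_interval" and snd_P: "snd \<in> P \<rightarrow>\<^sub>M unit_interval"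
    unfolding measurable_cong_sets[OF P(1) refl] by simp_all
  define G where "G = (fst -` A \<inter> space P) \<inter> (snd -` A' \<inter> space P) \<inter> {p \<in> space P. k (fst p) = l (snd p)}"
  have kl: "{p \<in> space P. k (fst p) = l (snd p)} \<in> sets P"
    using pred_nat_eq[OF measurable_compose[OF fst_P k] measurable_compose[OF snd_P l]]
    by (simp add: pred_def)
  have G: "G \<in> sets P"
    unfolding G_def using measurable_sets[OF fst_P 1(5)] measurable_sets[OF snd_P 2(5)] kl by blast
  have "P.prob (fst -` A \<inter> space P) = measure (distr P unit_interval fst) A"
    using fst_P 1(5) by (simp add: measure_distr)
  then have mA: "P.prob (fst -` A \<inter> space P) \<ge> 1 - a"
    using P(3) 1(6) by simp
  have "P.prob (snd -` A' \<inter> space P) = measure (distr P unit_interval snd) A'"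
    using snd_P 2(5) by (simp add: measure_distr)
  then have mA': "P.prob (snd -` A' \<inter> space P) \<ge> 1 - b"
    using P(4) 2(6) by simp
  have mkl: "P.prob {p \<in> space P. k (fst p) = l (snd p)} = 1"
    using P(5) kl by (simp add: P.prob_Collect_eq_1)
  have "P.prob G \<ge> 1 - (a + b + 4 * r)"
    using P.prob_Int_ge[of "fst -` A \<inter> space P" "snd -` A' \<inter> space P"]
      P.prob_Int_ge[of "(fst -` A \<inter> space P) \<inter> (snd -` A' \<inter> space P)" "{p \<in> space P. k (fst p) = l (snd p)}"]
      mA mA' mkl kl measurable_sets[OF fst_P 1(5)] measurable_sets[OF snd_P 2(5)] e
    unfolding G_def r_def by auto
  moreover have "parametrizable P"
    by (rule parametrizable_real2) (use P in auto)
  moreover have "\<phi> \<circ> fst \<in> P \<rightarrow>\<^sub>M msr X" "distr P (msr X) (\<phi> \<circ> fst) = msr X"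
    using distr_distr[OF 1(1) fst_P] measurable_comp[OF fst_P 1(1)] P(3) 1(2) by auto
  moreover have "\<zeta> \<circ> snd \<in> P \<rightarrow>\<^sub>M msr Z" "distr P (msr Z) (\<zeta> \<circ> snd) = msr Z"
    using distr_distr[OF 2(3) snd_P] measurable_comp[OF snd_P 2(3)] P(4) 2(4) by auto
  moreover have "0 \<le> a + b + 4 * r"
    using box_dist_nonneg[OF pX pY] box_dist_nonneg[OF pY pZ] e by (simp add: a_def b_def r_def)
  moreover have "\<bar>dst X ((\<phi> \<circ> fst) s) ((\<phi> \<circ> fst) t) - dst Z ((\<zeta> \<circ> snd) s) ((\<zeta> \<circ> snd) t)\<bar> \<le> a + b + 4 * r"
    if st: "s \<in> G" "t \<in> G" for s t
  proof -
    have near: "dst Y (\<psi> (fst s)) (\<psi>' (snd s)) < 2 * r" if "s \<in> G" for s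
    proof (rule Y.cell_eq_dist)
      have "s \<in> space P"
        using that by (simp add: G_def)
      then show "\<psi> (fst s) \<in> pts Y" "\<psi>' (snd s) \<in> pts Y"
        using measurable_space[OF fst_P] measurable_space[OF snd_P] measurable_space[OF 1(3)]
          measurable_space[OF 2(1)] by (auto simp: mm_space_space[OF Y])
      show "Y.cell r (\<psi> (fst s)) = Y.cell r (\<psi>' (snd s))"
        using that by (simp add: G_def k_def l_def)
    qed (use e in \<open>simp add: r_def\<close>)
    have in_Y: "\<psi> (fst s) \<in> pts Y" "\<psi>' (snd s) \<in> pts Y" if "s \<in> G" for s
      using that measurable_space[OF fst_P] measurable_space[OF snd_P] measurable_space[OF 1(3)]
          measurable_space[OF 2(1)] by (auto simp: mm_space_space[OF Y] G_def)
    have "\<bar>dst Y (\<psi> (fst s)) (\<psi> (fst t)) - dst Y (\<psi>' (snd s)) (\<psi>' (snd t))\<bar> \<le> 4 * r"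
      using Y.triangle[OF in_Y(1)[OF st(1)] in_Y(2)[OF st(1)] in_Y(1)[OF st(2)]]
        Y.triangle[OF in_Y(2)[OF st(1)] in_Y(2)[OF st(2)] in_Y(1)[OF st(2)]]
        Y.triangle[OF in_Y(2)[OF st(1)] in_Y(1)[OF st(1)] in_Y(2)[OF st(2)]]
        Y.triangle[OF in_Y(1)[OF st(1)] in_Y(1)[OF st(2)] in_Y(2)[OF st(2)]]
        near[OF st(1)] near[OF st(2)]
        Y.commute[of "\<psi> (fst s)" "\<psi>' (snd s)"] Y.commute[of "\<psi> (fst t)" "\<psi>' (snd t)"]
      by linarith
    moreover have "\<bar>dst X (\<phi> (fst s)) (\<phi> (fst t)) - dst Y (\<psi> (fst s)) (\<psi> (fst t))\<bar> \<le> a"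
      using st by (intro 1(7)) (auto simp: G_def)
    moreover have "\<bar>dst Y (\<psi>' (snd s)) (\<psi>' (snd t)) - dst Z (\<zeta> (snd s)) (\<zeta> (snd t))\<bar> \<le> b"
      using st by (intro 2(7)) (auto simp: G_def)
    ultimately show ?thesis
      by (auto simp: abs_if split: if_splits)
  qed
  ultimately have "box_dist X Z \<le> a + b + 4 * r"
    using G by (intro box_dist_le[where P = P and A = G]) auto
  then show "box_dist X Z \<le> box_dist X Y + box_dist Y Z + e"
    using e by (simp add: a_def b_def r_def)
qed

section \<open>Closures of Lipschitz images\<close>

text \<open>A possible source of a dominated mm-space: completeness and separability are not needed.\<close>

definition full_support_space :: "'a mms \<Rightarrow> bool" where
  "full_support_space X \<longleftrightarrow> Metric_space (pts X) (dst X) \<and>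
     sets (msr X) = sets (borel_measure_of (mms_top X)) \<and> prob_space (msr X) \<and> mms_supp X = pts X"

text \<open>The image itself may be incomplete. Its closure is complete when the target is, and
  every nonempty relatively open subset of the closure meets the image, which gives full
  support.\<close>

definition image_mms :: "'a mms \<Rightarrow> 'b set \<Rightarrow> ('b \<Rightarrow> 'b \<Rightarrow> real) \<Rightarrow> ('a \<Rightarrow> 'b) \<Rightarrow> 'b mms" where
  "image_mms X M d g = (let S = Metric_space.mtopology M d closure_of (g ` pts X) in
     \<lparr>pts = S, dst = d, msr = distr (msr X) (borel_measure_of (Metric_space.mtopology S d)) g\<rparr>)"

lemma image_mms:
  assumes X: "full_support_space X" and sep: "sep_metric M d c" and compl: "Metric_space.mcomplete M d"
    and g: "g \<in> pts X \<rightarrow> M" and lip: "\<And>x y. x \<in> pts X \<Longrightarrow> y \<in> pts X \<Longrightarrow> d (g x) (g y) \<le> dst X x y"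
  shows "mm_space (image_mms X M d g)" "lip_le (image_mms X M d g) X"
    "pts (image_mms X M d g) \<subseteq> M" "g \<in> pts X \<rightarrow> pts (image_mms X M d g)"
    "g \<in> msr X \<rightarrow>\<^sub>M msr (image_mms X M d g)"
    "distr (msr X) (msr (image_mms X M d g)) g = msr (image_mms X M d g)"
    "dst (image_mms X M d g) = d"
proof -
  interpret M: sep_metric M d c by fact
  interpret X: Metric_space "pts X" "dst X"
    using X by (simp add: full_support_space_def)
  interpret P: prob_space "msr X"
    using X by (simp add: full_support_space_def)
  have sets_X: "sets (msr X) = sets (borel_measure_of X.mtopology)"
    using X by (simp add: full_support_space_def)
  from sets_eq_imp_space_eq[OF this] have space_X: "space (msr X) = pts X"
    by simp
  then have ne: "pts X \<noteq> {}"
    using P.not_empty by simp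
  define S where "S = M.mtopology closure_of (g ` pts X)"
  have S_M: "S \<subseteq> M"
    using closure_of_subset_topspace[of M.mtopology] by (simp add: S_def)
  interpret S: Submetric M d S
    by unfold_locales (rule S_M)
  have gS: "g \<in> pts X \<rightarrow> S"
    using closure_of_subset[of "g ` pts X" M.mtopology] g by (auto simp: S_def)
  define Y where "Y = image_mms X M d g"
  have Y: "pts Y = S" "dst Y = d" "msr Y = distr (msr X) (borel_measure_of S.sub.mtopology) g"
    by (simp_all add: Y_def image_mms_def S_def Let_def)
  have "S \<noteq> {}"
    using gS ne by auto
  then obtain c' where "sep_metric S d c'"
    using M.sep_metric_subspace[OF S_M] by blast
  then have "separable_space S.sub.mtopology"
    by (rule sep_metric.separable_space_mtopology)
  have g_meas: "g \<in> msr X \<rightarrow>\<^sub>M borel_measure_of S.sub.mtopology"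
    unfolding measurable_cong_sets[OF sets_X refl]
    by (rule lipschitz_measurable[where K = 1])
      (use gS lip X.Metric_space_axioms S.sub.Metric_space_axioms in auto)
  have "S.sub.mcomplete"
    by (rule S.closedin_mcomplete_imp_mcomplete) (simp_all add: compl S_def)
  have pos: "emeasure (msr Y) U > 0" if U: "openin S.sub.mtopology U" "y \<in> U" for U y
  proof -
    obtain V where V: "openin M.mtopology V" "U = V \<inter> S"
      using U(1) unfolding S.mtopology_submetric openin_subtopology by auto
    have "y \<in> M.mtopology closure_of (g ` pts X)"
      using U(2) V(2) by (simp add: S_def)
    then obtain x where x: "x \<in> pts X" "g x \<in> V"
      using V U(2) unfolding in_closure_of by auto
    have "openin X.mtopology (g -` U \<inter> pts X)"
      by (rule lipschitz_preimage_openin[where K = 1, OF X.Metric_space_axioms S.sub.Metric_space_axioms gS _ U(1)])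
        (use lip in auto)
    moreover have "x \<in> g -` U \<inter> pts X"
      using x gS V by auto
    moreover have "x \<in> mms_supp X"
      using X x(1) by (simp add: full_support_space_def)
    ultimately have "emeasure (msr X) (g -` U \<inter> pts X) > 0"
      unfolding mms_supp_def by blast
    moreover have "emeasure (msr Y) U = emeasure (msr X) (g -` U \<inter> pts X)"
      unfolding Y using g_meas openin_sets_borel_measure_of[OF U(1)]
      by (simp add: emeasure_distr space_X)
    ultimately show ?thesis
      by simp
  qed
  have "mms_supp Y = S"
    unfolding mms_supp_def Y(1,2) using pos by auto
  moreover have "prob_space (msr Y)"
    unfolding Y by (rule P.prob_space_distr) (rule g_meas)
  ultimately show "mm_space Y"
    unfolding mm_space_def Y(1,2)
    using S.sub.Metric_space_axioms \<open>S.sub.mcomplete\<close> \<open>separable_space S.sub.mtopology\<close>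
    by (simp add: Y(3))
  show "g \<in> msr X \<rightarrow>\<^sub>M msr Y"
    using g_meas unfolding Y by simp
  have "distr (msr X) (msr Y) g = distr (msr X) (borel_measure_of S.sub.mtopology) g"
    by (rule distr_cong) (simp_all add: Y)
  then show d: "distr (msr X) (msr Y) g = msr Y"
    by (simp add: Y)
  show "pts Y \<subseteq> M" "g \<in> pts X \<rightarrow> pts Y" "dst Y = d"
    using S_M gS by (simp_all add: Y)
  show "lip_le Y X"
    unfolding lip_le_def
    by (intro exI[of _ g] conjI) (use gS lip d \<open>g \<in> msr X \<rightarrow>\<^sub>M msr Y\<close> in \<open>auto simp: Y(1,2)\<close>)
qed

section \<open>The standard Gaussian measure\<close>

abbreviation gauss1 :: "real measure" where
  "gauss1 \<equiv> density lborel (\<lambda>t. ennreal (std_normal_density t))"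

definition gauss :: "nat \<Rightarrow> (nat \<Rightarrow> real) measure" where
  "gauss m = (\<Pi>\<^sub>M i\<in>{..<m}. gauss1)"

abbreviation lebesgue_PiM :: "nat \<Rightarrow> (nat \<Rightarrow> real) measure" where
  "lebesgue_PiM m \<equiv> (\<Pi>\<^sub>M i\<in>{..<m}. lborel)"

abbreviation coord_space :: "nat \<Rightarrow> (nat \<Rightarrow> real) set" where
  "coord_space m \<equiv> {..<m} \<rightarrow>\<^sub>E UNIV"

lemma prob_space_gauss1: "prob_space gauss1"
  by (rule prob_space_normal_density) simp

interpretation gauss1: product_sigma_finite "\<lambda>_ :: nat. gauss1"
  by (simp add: product_sigma_finite_def prob_space_gauss1 prob_space_imp_sigma_finite)

interpretation leb1: product_sigma_finite "\<lambda>_ :: nat. lborel :: real measure"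
  by (simp add: product_sigma_finite_def sigma_finite_lborel)

lemma sets_gauss: "sets (gauss m) = sets (lebesgue_PiM m)"
  unfolding gauss_def by (intro sets_PiM_cong) simp_all

lemma space_gauss: "space (gauss m) = coord_space m"
  by (simp add: gauss_def space_PiM)

lemma prob_space_gauss: "prob_space (gauss m)"
  unfolding gauss_def by (rule prob_space_PiM) (rule prob_space_gauss1)

lemma measurable_gauss_coord [measurable]: "i < m \<Longrightarrow> (\<lambda>x. x i) \<in> borel_measurable (gauss m)"
  unfolding measurable_cong_sets[OF sets_gauss refl]
  using measurable_component_singleton[of i "{..<m}" "\<lambda>_. lborel :: real measure"] by simp

lemma measurable_lebesgue_coord [measurable]: "i < m \<Longrightarrow> (\<lambda>x. x i) \<in> borel_measurable (lebesgue_PiM m)"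
  using measurable_component_singleton[of i "{..<m}" "\<lambda>_. lborel :: real measure"] by simp

lemma measurable_into_gauss:
  assumes "f \<in> space N \<rightarrow> coord_space m" "\<And>i. i < m \<Longrightarrow> (\<lambda>w. f w i) \<in> borel_measurable N"
  shows "f \<in> N \<rightarrow>\<^sub>M gauss m"
  unfolding measurable_cong_sets[OF refl sets_gauss]
proof (rule measurable_PiM_single')
  show "(\<lambda>w. f w i) \<in> N \<rightarrow>\<^sub>M lborel" if "i \<in> {..<m}" for i
    using assms(2)[of i] that by simp
qed (use assms(1) in auto)

definition gauss_density :: "nat \<Rightarrow> (nat \<Rightarrow> real) \<Rightarrow> ennreal" where
  "gauss_density m x = ennreal ((1 / sqrt (2 * pi)) ^ m * exp (- (\<Sum>i<m. (x i)\<^sup>2) / 2))"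

lemma gauss_density_prod: "gauss_density m x = (\<Prod>i<m. ennreal (std_normal_density (x i)))"
proof -
  have "(\<Prod>i<m. ennreal (std_normal_density (x i))) = ennreal (\<Prod>i<m. std_normal_density (x i))"
    by (rule prod_ennreal) simp
  also have "(\<Prod>i<m. std_normal_density (x i)) =
      (1 / sqrt (2 * pi)) ^ m * exp (\<Sum>i<m. - (x i)\<^sup>2 / 2)"
    unfolding std_normal_density_def prod.distrib by (simp add: exp_sum)
  also have "(\<Sum>i<m. - (x i)\<^sup>2 / 2) = - (\<Sum>i<m. (x i)\<^sup>2) / 2"
    by (simp add: sum_divide_distrib sum_negf)
  finally show ?thesis
    by (simp add: gauss_density_def)
qed

lemma measurable_gauss_density [measurable]: "gauss_density m \<in> borel_measurable (lebesgue_PiM m)"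
proof -
  have [measurable]: "(\<lambda>x. \<Sum>i<m. (x i)\<^sup>2) \<in> borel_measurable (lebesgue_PiM m)"
    by (intro borel_measurable_sum borel_measurable_power measurable_lebesgue_coord) simp
  show ?thesis
    unfolding gauss_density_def by measurable
qed

text \<open>Displays the Gaussian as Lebesgue measure with a density that depends on the Euclidean
  norm only, on which invariance under linear isometries rests.\<close>

lemma gauss_eq_density: "gauss m = density (lebesgue_PiM m) (gauss_density m)"
  unfolding gauss_def
proof (rule gauss1.PiM_eqI[symmetric])
  show "sets (density (lebesgue_PiM m) (gauss_density m)) = sets (\<Pi>\<^sub>M i\<in>{..<m}. gauss1)"
    using sets_gauss[of m] by (simp add: gauss_def)
  fix A :: "nat \<Rightarrow> real set" assume "\<And>i. i \<in> {..<m} \<Longrightarrow> A i \<in> sets gauss1"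
  then have A: "\<And>i. i < m \<Longrightarrow> A i \<in> sets lborel" by simp
  have "Pi\<^sub>E {..<m} A \<in> sets (lebesgue_PiM m)"
    by (rule sets_PiM_I_finite) (use A in auto)
  then have "emeasure (density (lebesgue_PiM m) (gauss_density m)) (Pi\<^sub>E {..<m} A) =
      (\<integral>\<^sup>+ x. gauss_density m x * indicator (Pi\<^sub>E {..<m} A) x \<partial>lebesgue_PiM m)"
    by (simp add: emeasure_density)
  also have "\<dots> = (\<integral>\<^sup>+ x. (\<Prod>i<m. ennreal (std_normal_density (x i)) * indicator (A i) (x i)) \<partial>lebesgue_PiM m)"
  proof (rule nn_integral_cong)
    fix x assume "x \<in> space (lebesgue_PiM m)"
    then have x: "x \<in> coord_space m" by (simp add: space_PiM)
    have "indicator (Pi\<^sub>E {..<m} A) x = (\<Prod>i<m. indicator (A i) (x i) :: ennreal)"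
      using x by (auto simp: indicator_def PiE_iff prod_eq_1_iff intro!: prod.neutral[symmetric])
    then show "gauss_density m x * indicator (Pi\<^sub>E {..<m} A) x =
        (\<Prod>i<m. ennreal (std_normal_density (x i)) * indicator (A i) (x i))"
      by (simp add: gauss_density_prod prod.distrib)
  qed
  also have "\<dots> = (\<Prod>i<m. \<integral>\<^sup>+ t. ennreal (std_normal_density t) * indicator (A i) t \<partial>lborel)"
    by (rule leb1.product_nn_integral_prod) (use A in auto)
  also have "\<dots> = (\<Prod>i<m. emeasure gauss1 (A i))"
    by (intro prod.cong refl) (use A in \<open>simp add: emeasure_density\<close>)
  finally show "emeasure (density (lebesgue_PiM m) (gauss_density m)) (Pi\<^sub>E {..<m} A) =
      (\<Prod>i<m. emeasure gauss1 (A i))" .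
qed simp

section \<open>Invariance under linear isometries\<close>

definition vplus :: "nat \<Rightarrow> (nat \<Rightarrow> real) \<Rightarrow> (nat \<Rightarrow> real) \<Rightarrow> nat \<Rightarrow> real" where
  "vplus m x y = (\<lambda>i\<in>{..<m}. x i + y i)"

definition vminus :: "nat \<Rightarrow> (nat \<Rightarrow> real) \<Rightarrow> (nat \<Rightarrow> real) \<Rightarrow> nat \<Rightarrow> real" where
  "vminus m x y = (\<lambda>i\<in>{..<m}. x i - y i)"

lemma vplus_in [simp]: "vplus m x y \<in> coord_space m"
  by (simp add: vplus_def)

lemma vminus_in [simp]: "vminus m x y \<in> coord_space m"
  by (simp add: vminus_def)

lemma coord_space_eqI: "x \<in> coord_space m \<Longrightarrow> y \<in> coord_space m \<Longrightarrow> (\<And>i. i < m \<Longrightarrow> x i = y i) \<Longrightarrow> x = y"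
  by (rule PiE_ext) auto

lemma vminus_vplus: "x \<in> coord_space m \<Longrightarrow> vplus m (vminus m x y) y = x"
  by (rule coord_space_eqI[where m = m]) (auto simp: vplus_def vminus_def)

lemma vplus_vminus: "x \<in> coord_space m \<Longrightarrow> vminus m (vplus m x y) y = x"
  by (rule coord_space_eqI[where m = m]) (auto simp: vplus_def vminus_def)

lemma measurable_into_lebesgue_PiM:
  assumes "f \<in> space N \<rightarrow> coord_space m" "\<And>i. i < m \<Longrightarrow> (\<lambda>w. f w i) \<in> borel_measurable N"
  shows "f \<in> N \<rightarrow>\<^sub>M lebesgue_PiM m"
  using measurable_into_gauss[OF assms] unfolding measurable_cong_sets[OF refl sets_gauss] .

lemma measurable_vplus [measurable]:
  assumes [measurable]: "f \<in> N \<rightarrow>\<^sub>M lebesgue_PiM m" "g \<in> N \<rightarrow>\<^sub>M lebesgue_PiM m"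
  shows "(\<lambda>w. vplus m (f w) (g w)) \<in> N \<rightarrow>\<^sub>M lebesgue_PiM m"
proof (rule measurable_into_lebesgue_PiM)
  fix i assume i: "i < m"
  have [measurable]: "(\<lambda>w. f w i) \<in> borel_measurable N" "(\<lambda>w. g w i) \<in> borel_measurable N"
    using measurable_compose[OF assms(1) measurable_lebesgue_coord[OF i]]
      measurable_compose[OF assms(2) measurable_lebesgue_coord[OF i]] by auto
  show "(\<lambda>w. vplus m (f w) (g w) i) \<in> borel_measurable N"
    using i by (simp add: vplus_def)
qed simp

lemma measurable_vminus [measurable]:
  assumes [measurable]: "f \<in> N \<rightarrow>\<^sub>M lebesgue_PiM m" "g \<in> N \<rightarrow>\<^sub>M lebesgue_PiM m"
  shows "(\<lambda>w. vminus m (f w) (g w)) \<in> N \<rightarrow>\<^sub>M lebesgue_PiM m"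
proof (rule measurable_into_lebesgue_PiM)
  fix i assume i: "i < m"
  have [measurable]: "(\<lambda>w. f w i) \<in> borel_measurable N" "(\<lambda>w. g w i) \<in> borel_measurable N"
    using measurable_compose[OF assms(1) measurable_lebesgue_coord[OF i]]
      measurable_compose[OF assms(2) measurable_lebesgue_coord[OF i]] by auto
  show "(\<lambda>w. vminus m (f w) (g w) i) \<in> borel_measurable N"
    using i by (simp add: vminus_def)
qed simp

lemma lebesgue_PiM_translate:
  assumes a: "a \<in> coord_space m"
  shows "distr (lebesgue_PiM m) (lebesgue_PiM m) (\<lambda>x. vplus m x a) = lebesgue_PiM m"
proof (rule leb1.PiM_eqI)
  have am: "a \<in> space (lebesgue_PiM m)"
    using a by (simp add: space_PiM)
  fix A :: "nat \<Rightarrow> real set" assume "\<And>i. i \<in> {..<m} \<Longrightarrow> A i \<in> sets lborel"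
  then have A: "\<And>i. i < m \<Longrightarrow> A i \<in> sets borel" by simp
  have box: "Pi\<^sub>E {..<m} A \<in> sets (lebesgue_PiM m)"
    by (rule sets_PiM_I_finite) (use A in auto)
  have meas: "(\<lambda>x. vplus m x a) \<in> lebesgue_PiM m \<rightarrow>\<^sub>M lebesgue_PiM m"
    using am by measurable
  have pre: "(+) (a i) -` A i \<in> sets borel" if "i < m" for i
    using measurable_sets[of "(+) (a i)" borel borel "A i"] A[OF that] by simp
  have "(\<lambda>x. vplus m x a) -` Pi\<^sub>E {..<m} A \<inter> space (lebesgue_PiM m) =
      Pi\<^sub>E {..<m} (\<lambda>i. (+) (a i) -` A i)"
    by (auto simp: space_PiM PiE_iff vplus_def add.commute extensional_def)
  then have "emeasure (distr (lebesgue_PiM m) (lebesgue_PiM m) (\<lambda>x. vplus m x a)) (Pi\<^sub>E {..<m} A) =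
      emeasure (lebesgue_PiM m) (Pi\<^sub>E {..<m} (\<lambda>i. (+) (a i) -` A i))"
    using meas box by (simp add: emeasure_distr)
  also have "\<dots> = (\<Prod>i<m. emeasure lborel ((+) (a i) -` A i))"
    by (rule leb1.emeasure_PiM) (use pre in auto)
  also have "\<dots> = (\<Prod>i<m. emeasure lborel (A i))"
  proof (rule prod.cong[OF refl])
    fix i assume "i \<in> {..<m}"
    then have "emeasure lborel (A i) = emeasure (distr lborel borel ((+) (a i))) (A i)"
      by (simp add: lborel_distr_plus)
    also have "\<dots> = emeasure lborel ((+) (a i) -` A i)"
      using A \<open>i \<in> {..<m}\<close> by (simp add: emeasure_distr)
    finally show "emeasure lborel ((+) (a i) -` A i) = emeasure lborel (A i)" ..
  qed
  finally show "emeasure (distr (lebesgue_PiM m) (lebesgue_PiM m) (\<lambda>x. vplus m x a)) (Pi\<^sub>E {..<m} A) =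
      (\<Prod>i<m. emeasure lborel (A i))" .
qed simp_all

lemma nn_integral_translate:
  assumes a: "a \<in> coord_space m" and f: "f \<in> borel_measurable (lebesgue_PiM m)"
  shows "(\<integral>\<^sup>+ x. f (vplus m x a) \<partial>lebesgue_PiM m) = (\<integral>\<^sup>+ x. f x \<partial>lebesgue_PiM m)"
proof -
  have am: "a \<in> space (lebesgue_PiM m)"
    using a by (simp add: space_PiM)
  have "(\<integral>\<^sup>+ x. f x \<partial>lebesgue_PiM m) =
      (\<integral>\<^sup>+ x. f x \<partial>distr (lebesgue_PiM m) (lebesgue_PiM m) (\<lambda>x. vplus m x a))"
    by (simp add: lebesgue_PiM_translate[OF a])
  also have "\<dots> = (\<integral>\<^sup>+ x. f (vplus m x a) \<partial>lebesgue_PiM m)"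
  proof (rule nn_integral_distr)
    show "(\<lambda>x. vplus m x a) \<in> lebesgue_PiM m \<rightarrow>\<^sub>M lebesgue_PiM m"
      using am by measurable
  qed (use f in simp)
  finally show ?thesis ..
qed

text \<open>Uniqueness of translation invariant measures, by exchanging the order of integration in
  \<open>\<integral>\<integral> f (L x) * g (y + L x)\<close>, where \<open>g\<close> is the Gaussian density.\<close>

lemma nn_integral_isometry_reflect:
  assumes L [measurable]: "L \<in> lebesgue_PiM m \<rightarrow>\<^sub>M lebesgue_PiM m"
    and add: "\<And>x y. x \<in> coord_space m \<Longrightarrow> y \<in> coord_space m \<Longrightarrow> L (vplus m x y) = vplus m (L x) (L y)"
    and surj: "\<And>y. y \<in> coord_space m \<Longrightarrow> \<exists>x\<in>coord_space m. L x = y"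
    and iso: "\<And>x. x \<in> coord_space m \<Longrightarrow> (\<Sum>i<m. (L x i)\<^sup>2) = (\<Sum>i<m. (x i)\<^sup>2)"
    and f [measurable]: "f \<in> borel_measurable (lebesgue_PiM m)"
  shows "(\<integral>\<^sup>+ x. f (L x) \<partial>lebesgue_PiM m) =
    (\<integral>\<^sup>+ x. f (vminus m (\<lambda>i\<in>{..<m}. 0) x) \<partial>lebesgue_PiM m)"
proof -
  let ?V = "lebesgue_PiM m" and ?g = "gauss_density m" and ?z = "\<lambda>i\<in>{..<m}. 0 :: real"
  interpret V: sigma_finite_measure ?V
    by (rule leb1.sigma_finite) simp
  interpret VV: pair_sigma_finite ?V ?V ..
  have L_in: "L x \<in> coord_space m" if "x \<in> coord_space m" for x
    using measurable_space[OF L] that by (simp add: space_PiM)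
  have z: "?z \<in> space ?V"
    by (simp add: space_PiM)
  have g1: "(\<integral>\<^sup>+ x. ?g x \<partial>?V) = 1"
  proof -
    have "(\<integral>\<^sup>+ x. ?g x \<partial>?V) = emeasure (gauss m) (space (gauss m))"
      unfolding gauss_eq_density by (simp add: emeasure_density cong: nn_integral_cong)
    then show ?thesis
      using prob_space.emeasure_space_1[OF prob_space_gauss] by simp
  qed
  have gL: "?g (L x) = ?g x" if "x \<in> coord_space m" for x
    using iso[OF that] by (simp add: gauss_density_def)
  have L_minus: "L (vminus m x y) = vminus m (L x) (L y)" if "x \<in> coord_space m" "y \<in> coord_space m" for x y
  proof -
    have "L x = vplus m (L (vminus m x y)) (L y)"
      using add[of "vminus m x y" y] vminus_vplus[OF that(1)] that by simp
    then have "vminus m (L x) (L y) = vminus m (vplus m (L (vminus m x y)) (L y)) (L y)"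
      by simp
    also have "\<dots> = L (vminus m x y)"
      by (rule vplus_vminus) (rule L_in, simp)
    finally show ?thesis ..
  qed
  have "(\<integral>\<^sup>+ x. f (L x) \<partial>?V) = (\<integral>\<^sup>+ x. f (L x) * (\<integral>\<^sup>+ y. ?g (vplus m y (L x)) \<partial>?V) \<partial>?V)"
  proof (rule nn_integral_cong)
    fix x assume "x \<in> space ?V"
    then have "L x \<in> coord_space m"
      using L_in by (simp add: space_PiM)
    from nn_integral_translate[OF this measurable_gauss_density] show
      "f (L x) = f (L x) * (\<integral>\<^sup>+ y. ?g (vplus m y (L x)) \<partial>?V)"
      by (simp add: g1)
  qed
  also have "\<dots> = (\<integral>\<^sup>+ x. (\<integral>\<^sup>+ y. f (L x) * ?g (vplus m y (L x)) \<partial>?V) \<partial>?V)"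
    by (intro nn_integral_cong nn_integral_cmult[symmetric]) measurable
  also have "\<dots> = (\<integral>\<^sup>+ y. (\<integral>\<^sup>+ x. f (L x) * ?g (vplus m y (L x)) \<partial>?V) \<partial>?V)"
    by (rule VV.Fubini'[symmetric]) measurable
  \<comment> \<open>For \<open>y = L y'\<close> the substitution of \<open>x + y'\<close> for
    \<open>x\<close> moves \<open>y\<close> from the density into \<open>f\<close>, since
    \<open>?g\<close> takes equal values at \<open>x + y'\<close> and at
    \<open>L (x + y') = y + L x\<close>.\<close>
  also have "\<dots> = (\<integral>\<^sup>+ y. (\<integral>\<^sup>+ x. f (vminus m (L x) y) * ?g x \<partial>?V) \<partial>?V)"
  proof (rule nn_integral_cong)
    fix y assume "y \<in> space ?V"
    then obtain y' where y': "y' \<in> coord_space m" "L y' = y"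
      using surj by (auto simp: space_PiM)
    then have [measurable]: "y \<in> space ?V" "y' \<in> space ?V"
      using \<open>y \<in> space ?V\<close> by (simp_all add: space_PiM)
    have "(\<integral>\<^sup>+ x. f (vminus m (L x) y) * ?g x \<partial>?V) =
        (\<integral>\<^sup>+ x. f (vminus m (L (vplus m x y')) y) * ?g (vplus m x y') \<partial>?V)"
      by (rule nn_integral_translate[OF y'(1), symmetric]) measurable
    also have "\<dots> = (\<integral>\<^sup>+ x. f (L x) * ?g (vplus m y (L x)) \<partial>?V)"
    proof (rule nn_integral_cong)
      fix x assume "x \<in> space ?V"
      then have x: "x \<in> coord_space m"
        by (simp add: space_PiM)
      have "vminus m (L (vplus m x y')) y = L x"
        using add[OF x y'(1)] vplus_vminus[OF L_in[OF x]] y'(2) by simp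
      moreover have "?g (vplus m x y') = ?g (vplus m y (L x))"
      proof -
        have "?g (vplus m x y') = ?g (L (vplus m x y'))"
          by (rule gL[symmetric]) simp
        also have "L (vplus m x y') = vplus m y (L x)"
          using add[OF x y'(1)] y'(2) by (simp add: vplus_def add.commute cong: restrict_cong)
        finally show ?thesis .
      qed
      ultimately show "f (vminus m (L (vplus m x y')) y) * ?g (vplus m x y') =
          f (L x) * ?g (vplus m y (L x))"
        by simp
    qed
    finally show "(\<integral>\<^sup>+ x. f (L x) * ?g (vplus m y (L x)) \<partial>?V) =
        (\<integral>\<^sup>+ x. f (vminus m (L x) y) * ?g x \<partial>?V)" ..
  qed
  also have "\<dots> = (\<integral>\<^sup>+ x. (\<integral>\<^sup>+ y. f (vminus m (L x) y) * ?g x \<partial>?V) \<partial>?V)"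
    by (rule VV.Fubini') measurable
  \<comment> \<open>Shifting \<open>y\<close> by \<open>L x\<close> removes \<open>L\<close> from
    the inner integral; what remains is the same reflected integral for every
    \<open>L\<close>.\<close>
  also have "\<dots> = (\<integral>\<^sup>+ x. (\<integral>\<^sup>+ y. f (vminus m ?z y) \<partial>?V) * ?g x \<partial>?V)"
  proof (rule nn_integral_cong)
    fix x assume x: "x \<in> space ?V"
    then have Lx: "L x \<in> coord_space m"
      using L_in by (simp add: space_PiM)
    then have Lx' [measurable]: "L x \<in> space ?V"
      by (simp add: space_PiM)
    note z[measurable]
    have "(\<integral>\<^sup>+ y. f (vminus m (L x) y) * ?g x \<partial>?V) = (\<integral>\<^sup>+ y. f (vminus m (L x) y) \<partial>?V) * ?g x"
      by (rule nn_integral_multc) measurable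
    also have "(\<integral>\<^sup>+ y. f (vminus m (L x) y) \<partial>?V) = (\<integral>\<^sup>+ y. f (vminus m (L x) (vplus m y (L x))) \<partial>?V)"
      by (rule nn_integral_translate[OF Lx, symmetric]) measurable
    also have "\<dots> = (\<integral>\<^sup>+ y. f (vminus m ?z y) \<partial>?V)"
      by (intro nn_integral_cong arg_cong[of _ _ f] coord_space_eqI[where m = m])
        (auto simp: vminus_def vplus_def)
    finally show "(\<integral>\<^sup>+ y. f (vminus m (L x) y) * ?g x \<partial>?V) = (\<integral>\<^sup>+ y. f (vminus m ?z y) \<partial>?V) * ?g x" .
  qed
  also have "\<dots> = (\<integral>\<^sup>+ y. f (vminus m ?z y) \<partial>?V) * (\<integral>\<^sup>+ x. ?g x \<partial>?V)"
    by (rule nn_integral_cmult) measurable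
  also have "\<dots> = (\<integral>\<^sup>+ y. f (vminus m ?z y) \<partial>?V)"
    by (simp add: g1)
  finally show ?thesis .
qed

text \<open>\<open>L\<close> and the identity lead to the same reflected integral, so
  \<open>L\<close> preserves Lebesgue measure; the density is preserved because it is a function of
  the norm.\<close>

lemma gauss_isometry:
  assumes L: "L \<in> gauss m \<rightarrow>\<^sub>M gauss m"
    and add: "\<And>x y. x \<in> coord_space m \<Longrightarrow> y \<in> coord_space m \<Longrightarrow> L (vplus m x y) = vplus m (L x) (L y)"
    and surj: "\<And>y. y \<in> coord_space m \<Longrightarrow> \<exists>x\<in>coord_space m. L x = y"
    and iso: "\<And>x. x \<in> coord_space m \<Longrightarrow> (\<Sum>i<m. (L x i)\<^sup>2) = (\<Sum>i<m. (x i)\<^sup>2)"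
  shows "distr (gauss m) (gauss m) L = gauss m"
proof (rule measure_eqI)
  fix A assume "A \<in> sets (distr (gauss m) (gauss m) L)"
  then have A: "A \<in> sets (gauss m)" by simp
  then have [measurable]: "A \<in> sets (lebesgue_PiM m)"
    by (simp add: sets_gauss)
  let ?V = "lebesgue_PiM m" and ?g = "gauss_density m"
  have L' [measurable]: "L \<in> ?V \<rightarrow>\<^sub>M ?V"
    using L unfolding measurable_cong_sets[OF sets_gauss sets_gauss] .
  have id: "(\<integral>\<^sup>+ x. f x \<partial>?V) = (\<integral>\<^sup>+ x. f (vminus m (\<lambda>i\<in>{..<m}. 0) x) \<partial>?V)"
    if "f \<in> borel_measurable ?V" for f :: "(nat \<Rightarrow> real) \<Rightarrow> ennreal"
    by (rule nn_integral_isometry_reflect[where L = "\<lambda>x. x"]) (use that in auto)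
  have "L -` A \<inter> space (gauss m) \<in> sets (gauss m)"
    using measurable_sets[OF L A] .
  then have meas [measurable]: "L -` A \<inter> coord_space m \<in> sets ?V"
    by (simp add: sets_gauss space_gauss)
  have "emeasure (distr (gauss m) (gauss m) L) A = emeasure (gauss m) (L -` A \<inter> coord_space m)"
    using L A by (simp add: emeasure_distr space_gauss)
  also have "\<dots> = (\<integral>\<^sup>+ x. ?g x * indicator (L -` A \<inter> coord_space m) x \<partial>?V)"
    unfolding gauss_eq_density using meas by (rule emeasure_density[rotated]) measurable
  also have "\<dots> = (\<integral>\<^sup>+ x. ?g (L x) * indicator A (L x) \<partial>?V)"
    using iso by (intro nn_integral_cong) (auto simp: space_PiM gauss_density_def split: split_indicator)
  also have "\<dots> = (\<integral>\<^sup>+ x. ?g x * indicator A x \<partial>?V)"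
    using nn_integral_isometry_reflect[OF L' add surj iso, of "\<lambda>x. ?g x * indicator A x"]
      id[of "\<lambda>x. ?g x * indicator A x"] by simp
  also have "\<dots> = emeasure (gauss m) A"
    unfolding gauss_eq_density by (rule emeasure_density[symmetric]) measurable
  finally show "emeasure (distr (gauss m) (gauss m) L) A = emeasure (gauss m) A" .
qed simp

subsection \<open>Moments\<close>

lemma gauss1_moment:
  "integrable gauss1 (\<lambda>x. x ^ k)" "integral\<^sup>L gauss1 (\<lambda>x. x ^ k) = (\<integral>x. std_normal_density x * x ^ k \<partial>lborel)"
  by (subst integrable_density integral_density; simp add: integrable_std_normal_moment)+

lemma gauss1_moments:
  "integral\<^sup>L gauss1 (\<lambda>x. x ^ 0) = 1" "integral\<^sup>L gauss1 (\<lambda>x. x ^ 1) = 0"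
  "integral\<^sup>L gauss1 (\<lambda>x. x ^ 2) = 1" "integral\<^sup>L gauss1 (\<lambda>x. x ^ 3) = 0"
  "integral\<^sup>L gauss1 (\<lambda>x. x ^ 4) = 3"
  unfolding gauss1_moment(2)
  using integral_std_normal_moment_even[of 0] integral_std_normal_moment_odd[of 0]
    integral_std_normal_moment_even[of 1] integral_std_normal_moment_odd[of 1]
    integral_std_normal_moment_even[of 2]
  by (simp_all add: fact_numeral numeral_3_eq_3)

lemma gauss_monomial:
  "integrable (gauss m) (\<lambda>x. \<Prod>i<m. x i ^ a i)"
  "integral\<^sup>L (gauss m) (\<lambda>x. \<Prod>i<m. x i ^ a i) = (\<Prod>i<m. integral\<^sup>L gauss1 (\<lambda>x. x ^ a i))"
  unfolding gauss_def
  by (intro gauss1.product_integrable_prod gauss1.product_integral_prod gauss1_moment(1); simp)+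

text \<open>The exponent of variable \<open>i\<close> in \<open>x p * x q * x r * x s\<close>;
  independence then factors the expectation over \<open>i\<close>.\<close>

definition count4 :: "nat \<Rightarrow> nat \<Rightarrow> nat \<Rightarrow> nat \<Rightarrow> nat \<Rightarrow> nat" where
  "count4 p q r s i = of_bool (i = p) + of_bool (i = q) + of_bool (i = r) + of_bool (i = s)"

lemma monomial4:
  assumes "p < m" "q < m" "r < m" "s < m"
  shows "x p * x q * x r * x s = (\<Prod>i<m. (x i :: real) ^ count4 p q r s i)"
proof -
  have *: "(\<Prod>i<m. x i ^ of_bool (i = p)) = x p" if "p < m" for p
  proof -
    have "(\<Prod>i<m. x i ^ of_bool (i = p)) = (\<Prod>i<m. if i = p then x i else 1)"
      by (intro prod.cong) auto
    with that show ?thesis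
      by (simp add: prod.delta)
  qed
  show ?thesis
    unfolding count4_def power_add prod.distrib using assms by (simp add: *)
qed

text \<open>Wick's formula in degree four. A variable of multiplicity one or three makes the product
  of moments vanish; otherwise the indices form two different pairs, with value 1, or all coincide,
  where the fourth moment 3 counts the three pairings.\<close>

lemma gauss_moment4:
  assumes m: "p < m" "q < m" "r < m" "s < m"
  shows "integrable (gauss m) (\<lambda>x. x p * x q * x r * x s)"
    "integral\<^sup>L (gauss m) (\<lambda>x. x p * x q * x r * x s) =
      of_bool (p = q \<and> r = s) + of_bool (p = r \<and> q = s) + of_bool (p = s \<and> q = r)"
proof -
  let ?M = "\<lambda>p q r s. \<Prod>i<m. integral\<^sup>L gauss1 (\<lambda>x. x ^ count4 p q r s i)"
  show "integrable (gauss m) (\<lambda>x. x p * x q * x r * x s)"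
    unfolding monomial4[OF m] by (rule gauss_monomial)
  have eq: "integral\<^sup>L (gauss m) (\<lambda>x. x p * x q * x r * x s) = ?M p q r s"
    unfolding monomial4[OF m] by (rule gauss_monomial)
  have zero: "?M p q r s = 0" if "i < m" "count4 p q r s i = 1 \<or> count4 p q r s i = 3" for i p q r s
    using that gauss1_moments by (intro prod_zero bexI[of _ i]) auto
  have pair: "?M p q r s = 1" if "\<And>i. count4 p q r s i \<in> {0, 2}" for p q r s
  proof (rule prod.neutral, rule ballI)
    fix i
    have "count4 p q r s i = 0 \<or> count4 p q r s i = 2"
      using that[of i] by auto
    then show "integral\<^sup>L gauss1 (\<lambda>x. x ^ count4 p q r s i) = 1"
      using gauss1_moments by auto
  qed
  have all: "?M p p p p = 3" if "p < m" for p
  proof -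
    have "?M p p p p = (\<Prod>i<m. if i = p then 3 else 1)"
    proof (intro prod.cong refl)
      fix i
      have "count4 p p p p i = (if i = p then 4 else 0)"
        by (simp add: count4_def)
      then show "integral\<^sup>L gauss1 (\<lambda>x. x ^ count4 p p p p i) = (if i = p then 3 else 1)"
        using gauss1_moments(1,5) by (cases "i = p") (simp_all only: if_True if_False simp_thms)
    qed
    with that show ?thesis
      by (simp add: prod.delta)
  qed
  show "integral\<^sup>L (gauss m) (\<lambda>x. x p * x q * x r * x s) =
      of_bool (p = q \<and> r = s) + of_bool (p = r \<and> q = s) + of_bool (p = s \<and> q = r)"
  proof (cases "p = q \<and> r = s \<and> p \<noteq> r \<or> p = r \<and> q = s \<and> p \<noteq> q \<or> p = s \<and> q = r \<and> p \<noteq> q")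
    case True
    then have mid: "?M p q r s = 1"
      by (intro pair) (auto simp: count4_def)
    have rhs: "of_bool (p = q \<and> r = s) + of_bool (p = r \<and> q = s) + of_bool (p = s \<and> q = r) = (1 :: real)"
      using True by (elim disjE conjE) simp_all
    show ?thesis
      by (simp only: eq mid rhs)
  next
    case False
    show ?thesis
    proof (cases "p = q \<and> q = r \<and> r = s")
      case True
      then have mid: "?M p q r s = 3"
        using all[OF m(1)] by metis
      have rhs: "of_bool (p = q \<and> r = s) + of_bool (p = r \<and> q = s) + of_bool (p = s \<and> q = r) = (3 :: real)"
        using True by simp
      show ?thesis
        by (simp only: eq mid rhs)
    next
      case False': False
      have "\<exists>i<m. count4 p q r s i = 1 \<or> count4 p q r s i = 3"
      proof -
        consider "p \<noteq> q" "p \<noteq> r" "p \<noteq> s" | "p = q" "p = r" "p \<noteq> s" | "p = q" "p \<noteq> r" "r \<noteq> s"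
          | "p \<noteq> q" "p = r" "p = s" | "p \<noteq> q" "p = r" "p \<noteq> s" "q \<noteq> s" | "p \<noteq> q" "p \<noteq> r" "p = s" "q \<noteq> r"
          using False False' by blast
        then show ?thesis
        proof cases
          case 1 then show ?thesis using m by (intro exI[of _ p]) (simp add: count4_def)
        next
          case 2 then show ?thesis using m by (intro exI[of _ p]) (simp add: count4_def)
        next
          case 3 then show ?thesis using m by (intro exI[of _ r]) (auto simp: count4_def)
        next
          case 4 then show ?thesis using m by (intro exI[of _ p]) (simp add: count4_def)
        next
          case 5 then show ?thesis using m by (intro exI[of _ q]) (auto simp: count4_def)
        next
          case 6 then show ?thesis using m by (intro exI[of _ q]) (auto simp: count4_def)
        qed
      qed
      then have mid: "?M p q r s = 0"
        using zero by blast
      have n: "(p = q \<and> r = s) = False" "(p = r \<and> q = s) = False" "(p = s \<and> q = r) = False"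
        using False False' by blast+
      have rhs: "of_bool (p = q \<and> r = s) + of_bool (p = r \<and> q = s) + of_bool (p = s \<and> q = r) = (0 :: real)"
        by (simp only: n of_bool_eq add_0_left)
      show ?thesis
        by (simp only: eq mid rhs)
    qed
  qed
qed

lemma gauss_moment2:
  assumes m: "p < m" "q < m"
  shows "integrable (gauss m) (\<lambda>x. x p * x q)"
    "integral\<^sup>L (gauss m) (\<lambda>x. x p * x q) = of_bool (p = q)"
proof -
  define a where "a i = of_bool (i = p) + (of_bool (i = q) :: nat)" for i
  have *: "(\<Prod>i<m. (x i :: real) ^ of_bool (i = p)) = x p" if "p < m" for p x
  proof -
    have "(\<Prod>i<m. (x i :: real) ^ of_bool (i = p)) = (\<Prod>i<m. if i = p then x i else 1)"
      by (intro prod.cong) auto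
    with that show ?thesis
      by (simp add: prod.delta)
  qed
  have mono: "x p * x q = (\<Prod>i<m. (x i :: real) ^ a i)" for x
    unfolding a_def power_add prod.distrib using m by (simp add: *)
  show "integrable (gauss m) (\<lambda>x. x p * x q)"
    unfolding mono by (rule gauss_monomial)
  have eq: "integral\<^sup>L (gauss m) (\<lambda>x. x p * x q) = (\<Prod>i<m. integral\<^sup>L gauss1 (\<lambda>x. x ^ a i))"
    unfolding mono by (rule gauss_monomial)
  show "integral\<^sup>L (gauss m) (\<lambda>x. x p * x q) = of_bool (p = q)"
  proof (cases "p = q")
    case True
    have "integral\<^sup>L gauss1 (\<lambda>x. x ^ a i) = 1" for i
      using gauss1_moments True by (cases "i = p") (auto simp: a_def numeral_2_eq_2)
    with eq True show ?thesis
      by simp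
  next
    case False
    then have "integral\<^sup>L gauss1 (\<lambda>x. x ^ a p) = 0"
      using gauss1_moments by (simp add: a_def)
    with m(1) have "(\<Prod>i<m. integral\<^sup>L gauss1 (\<lambda>x. x ^ a i)) = 0"
      by (intro prod_zero) auto
    with eq False show ?thesis
      by simp
  qed
qed

text \<open>By Wick's formula the centred products for \<open>t\<close> and \<open>t'\<close> have
  covariance 1 for each of the two ways in which their index pairs can match, straight or crossed.
  Injectivity leaves at most one \<open>t'\<close> for each way, and the crossed terms are bounded
  by \<open>2ab \<le> a^2 + b^2\<close>; hence the factor 2.\<close>

lemma gauss_quadratic_variance:
  fixes c :: "'t \<Rightarrow> real" and p q :: "'t \<Rightarrow> nat"
  assumes T: "finite T" and pq: "\<And>t. t \<in> T \<Longrightarrow> p t < m \<and> q t < m"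
    and inj: "inj_on (\<lambda>t. (p t, q t)) T"
  shows "integrable (gauss m) (\<lambda>x. (\<Sum>t\<in>T. c t * (x (p t) * x (q t) - of_bool (p t = q t)))\<^sup>2)"
    "integral\<^sup>L (gauss m) (\<lambda>x. (\<Sum>t\<in>T. c t * (x (p t) * x (q t) - of_bool (p t = q t)))\<^sup>2) \<le> 2 * (\<Sum>t\<in>T. (c t)\<^sup>2)"
proof -
  interpret prob_space "gauss m" by (rule prob_space_gauss)
  define F where "F t t' x = (x (p t) * x (q t) - of_bool (p t = q t)) *
      (x (p t') * x (q t') - of_bool (p t' = q t'))" for t t' and x :: "nat \<Rightarrow> real"
  have F_eq: "F t t' = (\<lambda>x. x (p t) * x (q t) * x (p t') * x (q t') - of_bool (p t = q t) * (x (p t') * x (q t'))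
      - of_bool (p t' = q t') * (x (p t) * x (q t)) + of_bool (p t = q t) * of_bool (p t' = q t'))" for t t'
    by (auto simp: F_def algebra_simps fun_eq_iff)
  have F: "integrable (gauss m) (F t t')"
    "integral\<^sup>L (gauss m) (F t t') = of_bool (p t = p t' \<and> q t = q t') + of_bool (p t = q t' \<and> q t = p t')"
    if "t \<in> T" "t' \<in> T" for t t'
    using pq[OF that(1)] pq[OF that(2)] unfolding F_eq
    by (auto simp: gauss_moment4 gauss_moment2 prob_space)
  have sq: "(\<Sum>t\<in>T. c t * (x (p t) * x (q t) - of_bool (p t = q t)))\<^sup>2 =
      (\<Sum>t\<in>T. \<Sum>t'\<in>T. c t * c t' * F t t' x)" for x
    unfolding power2_eq_square sum_product F_def by (simp add: algebra_simps)
  show "integrable (gauss m) (\<lambda>x. (\<Sum>t\<in>T. c t * (x (p t) * x (q t) - of_bool (p t = q t)))\<^sup>2)"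
    unfolding sq by (intro Bochner_Integration.integrable_sum integrable_mult_right F)
  have "integral\<^sup>L (gauss m) (\<lambda>x. (\<Sum>t\<in>T. c t * (x (p t) * x (q t) - of_bool (p t = q t)))\<^sup>2) =
      (\<Sum>t\<in>T. \<Sum>t'\<in>T. c t * c t' * integral\<^sup>L (gauss m) (F t t'))"
    unfolding sq
    by (subst Bochner_Integration.integral_sum, (intro Bochner_Integration.integrable_sum integrable_mult_right F; assumption),
        intro sum.cong refl, subst Bochner_Integration.integral_sum,
        (intro integrable_mult_right F; assumption)) simp
  also have "\<dots> = (\<Sum>t\<in>T. \<Sum>t'\<in>T. c t * c t' * of_bool (p t = p t' \<and> q t = q t')) +
      (\<Sum>t\<in>T. \<Sum>t'\<in>T. c t * c t' * of_bool (p t = q t' \<and> q t = p t'))"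
    unfolding sum.distrib[symmetric] by (intro sum.cong refl) (simp add: F algebra_simps)
  also have "(\<Sum>t\<in>T. \<Sum>t'\<in>T. c t * c t' * of_bool (p t = p t' \<and> q t = q t')) = (\<Sum>t\<in>T. (c t)\<^sup>2)"
  proof (rule sum.cong[OF refl])
    fix t assume t: "t \<in> T"
    have "(\<Sum>t'\<in>T. c t * c t' * of_bool (p t = p t' \<and> q t = q t')) = (\<Sum>t'\<in>T. if t' = t then c t * c t else 0)"
      using inj t by (intro sum.cong refl) (auto simp: inj_on_def)
    also have "\<dots> = (c t)\<^sup>2"
      using t T by (simp add: power2_eq_square)
    finally show "(\<Sum>t'\<in>T. c t * c t' * of_bool (p t = p t' \<and> q t = q t')) = (c t)\<^sup>2" .
  qed
  also have "(\<Sum>t\<in>T. \<Sum>t'\<in>T. c t * c t' * of_bool (p t = q t' \<and> q t = p t')) \<le>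
      (\<Sum>t\<in>T. \<Sum>t'\<in>T. ((c t)\<^sup>2 / 2 + (c t')\<^sup>2 / 2) * of_bool (p t = q t' \<and> q t = p t'))"
  proof (intro sum_mono mult_right_mono)
    fix t t'
    show "c t * c t' \<le> (c t)\<^sup>2 / 2 + (c t')\<^sup>2 / 2"
      using sum_squares_bound[of "c t" "c t'"] by simp
  qed simp
  also have "\<dots> = (\<Sum>t\<in>T. \<Sum>t'\<in>T. (c t)\<^sup>2 / 2 * of_bool (p t = q t' \<and> q t = p t')) +
      (\<Sum>t\<in>T. \<Sum>t'\<in>T. (c t')\<^sup>2 / 2 * of_bool (p t = q t' \<and> q t = p t'))"
    unfolding sum.distrib[symmetric] by (intro sum.cong refl) (simp add: distrib_right)
  also have "(\<Sum>t\<in>T. \<Sum>t'\<in>T. (c t')\<^sup>2 / 2 * of_bool (p t = q t' \<and> q t = p t')) =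
      (\<Sum>t\<in>T. \<Sum>t'\<in>T. (c t)\<^sup>2 / 2 * of_bool (p t = q t' \<and> q t = p t'))"
    by (subst sum.swap) (intro sum.cong refl, auto)
  also have "(\<Sum>t\<in>T. \<Sum>t'\<in>T. (c t)\<^sup>2 / 2 * of_bool (p t = q t' \<and> q t = p t')) \<le> (\<Sum>t\<in>T. (c t)\<^sup>2 / 2)"
  proof (rule sum_mono)
    fix t assume t: "t \<in> T"
    have "(\<Sum>t'\<in>T. of_bool (p t = q t' \<and> q t = p t') :: real) = real (card {t'\<in>T. p t = q t' \<and> q t = p t'})"
      using T by (simp add: of_bool_def sum.If_cases Int_def)
    also have "\<dots> \<le> 1"
    proof -
      have "card {t'\<in>T. p t = q t' \<and> q t = p t'} \<le> Suc 0"
        using T inj by (subst card_le_Suc0_iff_eq) (auto simp: inj_on_def)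
      then show ?thesis
        by simp
    qed
    finally have "(c t)\<^sup>2 / 2 * (\<Sum>t'\<in>T. of_bool (p t = q t' \<and> q t = p t')) \<le> (c t)\<^sup>2 / 2 * 1"
      by (intro mult_left_mono) auto
    then show "(\<Sum>t'\<in>T. (c t)\<^sup>2 / 2 * of_bool (p t = q t' \<and> q t = p t')) \<le> (c t)\<^sup>2 / 2"
      by (simp add: sum_distrib_left)
  qed
  finally show "integral\<^sup>L (gauss m) (\<lambda>x. (\<Sum>t\<in>T. c t * (x (p t) * x (q t) - of_bool (p t = q t)))\<^sup>2)
      \<le> 2 * (\<Sum>t\<in>T. (c t)\<^sup>2)"
    by (simp add: sum_divide_distrib[symmetric])
qed

subsection \<open>Gaussian spaces as mm-spaces\<close>

text \<open>Rational vectors are dense among the coordinate vectors but need not come from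
  \<open>M\<close>; for every rational vector and every scale a point of \<open>M\<close> close to
  it is chosen instead.\<close>

lemma sep_metric_coords:
  fixes e :: "'a \<Rightarrow> nat \<Rightarrow> real"
  assumes "Metric_space M d" "M \<noteq> {}"
    and bound: "\<And>x y. x \<in> M \<Longrightarrow> y \<in> M \<Longrightarrow> d x y \<le> (\<Sum>i<m. \<bar>e x i - e y i\<bar>)"
  shows "\<exists>c. sep_metric M d c"
proof -
  interpret Metric_space M d by fact
  define near where "near qs j = {x \<in> M. \<forall>i<m. \<bar>e x i - real_of_rat (qs ! i)\<bar> < 1 / (1 + real j)}"
    for qs :: "rat list" and j :: nat
  define c where "c k = (let (qs, j) = from_nat k in
    if near qs j \<noteq> {} then SOME x. x \<in> near qs j else SOME x. x \<in> M)" for k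
  have c_in: "c k \<in> M" for k
  proof (cases "from_nat k :: rat list \<times> nat")
    case (Pair qs j)
    show ?thesis
    proof (cases "near qs j = {}")
      case False
      then have "(SOME x. x \<in> near qs j) \<in> near qs j"
        by (simp add: some_in_eq)
      with False Pair show ?thesis
        by (simp add: c_def near_def)
    next
      case True
      with Pair assms(2) show ?thesis
        by (simp add: c_def some_in_eq)
    qed
  qed
  have "\<exists>k. d x (c k) < r" if x: "x \<in> M" "r > 0" for x r
  proof -
    have "r / (2 * (real m + 1)) > 0"
      using x by simp
    then obtain j where j: "1 / (1 + real j) < r / (2 * (real m + 1))"
      using reals_Archimedean by (auto simp: inverse_eq_divide)
    have "\<exists>q. \<bar>e x i - real_of_rat q\<bar> < 1 / (1 + real j)" for i
    proof -
      have "e x i < e x i + 1 / (1 + real j)"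
        by (simp add: add_pos_nonneg)
      from of_rat_dense[OF this] obtain q where "e x i < real_of_rat q" "real_of_rat q < e x i + 1 / (1 + real j)"
        by blast
      then have "\<bar>e x i - real_of_rat q\<bar> < 1 / (1 + real j)"
        by linarith
      then show ?thesis
        by blast
    qed
    then obtain q where q: "\<And>i. \<bar>e x i - real_of_rat (q i)\<bar> < 1 / (1 + real j)"
      by metis
    define qs where "qs = map q [0..<m]"
    have x_near: "x \<in> near qs j"
      using q x(1) by (simp add: near_def qs_def)
    then have "(SOME x. x \<in> near qs j) \<in> near qs j"
      by (intro someI)
    with x_near have y: "c (to_nat (qs, j)) \<in> near qs j"
      by (auto simp: c_def)
    define y where "y = c (to_nat (qs, j))"
    have "d x y \<le> (\<Sum>i<m. \<bar>e x i - e y i\<bar>)"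
      using x(1) c_in by (intro bound) (auto simp: y_def)
    also have "\<dots> \<le> (\<Sum>i<m. 2 / (1 + real j))"
    proof (rule sum_mono)
      fix i assume "i \<in> {..<m}"
      then have "\<bar>e x i - real_of_rat (qs ! i)\<bar> < 1 / (1 + real j)"
          "\<bar>e y i - real_of_rat (qs ! i)\<bar> < 1 / (1 + real j)"
        using x_near y by (simp_all add: near_def y_def)
      then show "\<bar>e x i - e y i\<bar> \<le> 2 / (1 + real j)"
        by linarith
    qed
    also have "\<dots> = 2 * real m * (1 / (1 + real j))"
      by simp
    also have "\<dots> \<le> 2 * real m * (r / (2 * (real m + 1)))"
      using j by (intro mult_left_mono) auto
    also have "\<dots> < r"
      using x(2) by (simp add: field_simps)
    finally show ?thesis
      by (auto simp: y_def)
  qed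
  with c_in have "sep_metric M d c"
    by (simp add: sep_metric_def sep_metric_axioms_def Metric_space_axioms)
  then show ?thesis
    by blast
qed

definition vdist :: "nat \<Rightarrow> (nat \<Rightarrow> real) \<Rightarrow> (nat \<Rightarrow> real) \<Rightarrow> real" where
  "vdist m x y = L2_set (\<lambda>i. x i - y i) {..<m}"

lemma vdist_sqrt: "vdist m x y = sqrt (\<Sum>i<m. (x i - y i)\<^sup>2)"
  by (simp add: vdist_def L2_set_def)

lemma abs_coord_le_vdist: "i < m \<Longrightarrow> \<bar>x i - y i\<bar> \<le> vdist m x y"
  unfolding vdist_sqrt by (intro real_le_rsqrt) (auto intro: member_le_sum[of i "{..<m}" "\<lambda>i. (x i - y i)\<^sup>2"])

lemma vdist_le_sum: "vdist m x y \<le> (\<Sum>i<m. \<bar>x i - y i\<bar>)"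
  unfolding vdist_def by (rule L2_set_le_sum_abs)

lemma Metric_space_vdist: "Metric_space (coord_space m) (vdist m)"
proof
  show "0 \<le> vdist m x y" for x y
    by (simp add: vdist_def)
  show "vdist m x y = vdist m y x" for x y
    by (simp add: vdist_sqrt power2_commute)
  show "vdist m x y = 0 \<longleftrightarrow> x = y" if "x \<in> coord_space m" "y \<in> coord_space m" for x y
  proof
    assume "vdist m x y = 0"
    then have "x i = y i" if "i < m" for i
      using abs_coord_le_vdist[OF that, of x y] by simp
    with that show "x = y"
      by (rule coord_space_eqI)
  qed (simp add: vdist_def L2_set_def)
  show "vdist m x z \<le> vdist m x y + vdist m y z" for x y z
    using L2_set_triangle_ineq[of "\<lambda>i. x i - y i" "\<lambda>i. y i - z i" "{..<m}"] by (simp add: vdist_def)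
qed

lemma gaussian_space_sel [simp]:
  "pts (gaussian_space m) = coord_space m" "dst (gaussian_space m) = vdist m"
  "msr (gaussian_space m) = gauss m"
  by (simp_all add: gaussian_space_def gauss_def vdist_sqrt fun_eq_iff)

lemma sets_eq_if_measurable_id:
  assumes "(\<lambda>x. x) \<in> M \<rightarrow>\<^sub>M N" "(\<lambda>x. x) \<in> N \<rightarrow>\<^sub>M M" "space M = space N"
  shows "sets M = sets N"
proof
  show "sets M \<subseteq> sets N"
    using measurable_sets[OF assms(2)] sets.sets_into_space[of _ M] assms(3)
    by (fastforce simp: Int_absorb2)
  show "sets N \<subseteq> sets M"
    using measurable_sets[OF assms(1)] sets.sets_into_space[of _ N] assms(3)
    by (fastforce simp: Int_absorb2)
qed

lemma coord_space_not_empty: "coord_space m \<noteq> {}"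
  by (simp add: PiE_eq_empty_iff)

lemma sep_metric_vdist: "\<exists>c. sep_metric (coord_space m) (vdist m) c"
  by (rule sep_metric_coords[OF Metric_space_vdist coord_space_not_empty vdist_le_sum])

text \<open>The Gaussian measure is a product measure, while an mm-space asks for the Borel algebra
  of its metric; the identity is measurable in both directions.\<close>

lemma sets_gauss_borel:
  "sets (gauss m) = sets (borel_measure_of (Metric_space.mtopology (coord_space m) (vdist m)))"
proof -
  obtain c where "sep_metric (coord_space m) (vdist m) c"
    using sep_metric_vdist by blast
  then interpret sep_metric "coord_space m" "vdist m" c .
  show ?thesis
  proof (rule sets_eq_if_measurable_id)
    show "(\<lambda>x. x) \<in> gauss m \<rightarrow>\<^sub>M B"
    proof (rule measurable_into)
      fix i
      have "(\<lambda>w. \<Sum>j<m. (w j - c i j)\<^sup>2) \<in> borel_measurable (gauss m)"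
        by (intro borel_measurable_sum borel_measurable_power borel_measurable_diff measurable_gauss_coord) auto
      then show "(\<lambda>w. vdist m w (c i)) \<in> borel_measurable (gauss m)"
        unfolding vdist_sqrt by measurable
    qed (simp add: space_gauss)
    show "(\<lambda>x. x) \<in> B \<rightarrow>\<^sub>M gauss m"
    proof (rule measurable_into_gauss)
      show "(\<lambda>w. w i) \<in> borel_measurable B" if "i < m" for i
        by (rule lipschitz_measurable_real[where K = 1])
          (use abs_coord_le_vdist[OF that] Metric_space_axioms in auto)
    qed simp
  qed (simp add: space_gauss)
qed

lemma emeasure_gauss1_pos:
  assumes "a < b"
  shows "emeasure gauss1 {a<..<b} > 0"
proof -
  have "emeasure gauss1 {a<..<b} \<noteq> 0"
  proof
    assume "emeasure gauss1 {a<..<b} = 0"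
    then have "(\<integral>\<^sup>+ t. ennreal (std_normal_density t) * indicator {a<..<b} t \<partial>lborel) = 0"
      by (simp add: emeasure_density)
    then have "AE t in lborel. ennreal (std_normal_density t) * indicator {a<..<b} t = 0"
      by (subst (asm) nn_integral_0_iff_AE) auto
    then have "AE t in lborel. t \<notin> {a<..<b}"
      by eventually_elim (auto simp: std_normal_density_def split: split_indicator_asm)
    then have "emeasure lborel {a<..<b} = 0"
      by (subst (asm) AE_iff_measurable[where N = "{a<..<b}"]) auto
    with assms show False
      by simp
  qed
  then show ?thesis
    by (simp add: zero_less_iff_neq_zero)
qed

lemma full_support_gaussian_space: "full_support_space (gaussian_space m)"
proof -
  interpret Metric_space "coord_space m" "vdist m"
    by (rule Metric_space_vdist)
  have "emeasure (gauss m) U > 0" if U: "openin mtopology U" "x \<in> U" for U x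
  proof -
    obtain r where r: "r > 0" "mball x r \<subseteq> U" and x: "x \<in> coord_space m"
      using U unfolding openin_mtopology by blast
    \<comment> \<open>The cube of half side \<open>s\<close> around \<open>x\<close> lies in the
      ball: the sum of the \<open>m\<close> coordinate distances is at most
      \<open>m * s < r\<close>, also for \<open>m = 0\<close>.\<close>
    define s where "s = r / (real m + 1)"
    have s: "s > 0"
      using r by (simp add: s_def)
    define Q where "Q = Pi\<^sub>E {..<m} (\<lambda>i. {x i - s<..<x i + s})"
    have Q: "Q \<in> sets (gauss m)"
      unfolding Q_def gauss_def by (rule sets_PiM_I_finite) auto
    have "emeasure (gauss m) Q = (\<Prod>i<m. emeasure gauss1 {x i - s<..<x i + s})"
      unfolding Q_def gauss_def by (rule gauss1.emeasure_PiM) auto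
    also have "\<dots> \<noteq> 0"
      using emeasure_gauss1_pos s by (auto simp: zero_less_iff_neq_zero)
    finally have "emeasure (gauss m) Q > 0"
      by (simp add: zero_less_iff_neq_zero)
    also have "Q \<subseteq> U"
    proof
      fix y assume y: "y \<in> Q"
      then have "y \<in> coord_space m"
        by (auto simp: Q_def PiE_iff)
      moreover have "vdist m x y < r"
      proof -
        have "vdist m x y \<le> (\<Sum>i<m. \<bar>x i - y i\<bar>)"
          by (rule vdist_le_sum)
        also have "\<dots> \<le> (\<Sum>i<m. s)"
          using y by (intro sum_mono) (force simp: Q_def PiE_iff abs_le_iff)
        also have "\<dots> < r"
          using r by (simp add: s_def field_simps)
        finally show ?thesis .
      qed
      ultimately have "y \<in> mball x r"
        using x by simp
      with r show "y \<in> U"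
        by blast
    qed
    then have "emeasure (gauss m) Q \<le> emeasure (gauss m) U"
      using openin_sets_borel_measure_of[OF U(1)] by (intro emeasure_mono) (simp_all add: sets_gauss_borel)
    finally show ?thesis .
  qed
  then have "mms_supp (gaussian_space m) = coord_space m"
    by (auto simp: mms_supp_def)
  then show ?thesis
    by (simp add: full_support_space_def Metric_space_axioms sets_gauss_borel prob_space_gauss)
qed

lemma parametrizable_gauss: "parametrizable (gauss m)"
proof (rule parametrizable_embed)
  show "(\<lambda>x i. if i < m then x i else 0) \<in> borel_measurable (gauss m)"
  proof (rule measurable_coordinatewise_then_product)
    show "(\<lambda>x. if i < m then x i else 0) \<in> borel_measurable (gauss m)" for i
      by (cases "i < m") auto
  qed
  show "(\<lambda>a. restrict a {..<m}) \<in> borel \<rightarrow>\<^sub>M gauss m"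
    by (rule measurable_into_gauss) (auto intro: measurable_product_coordinates)
  show "restrict (\<lambda>i. if i < m then x i else 0) {..<m} = x" if "x \<in> space (gauss m)" for x
    using that by (intro coord_space_eqI[of _ m]) (auto simp: space_gauss)
qed (rule prob_space_gauss)

lemma gauss_restrict:
  assumes "m \<le> m'"
  shows "(\<lambda>x. restrict x {..<m}) \<in> gauss m' \<rightarrow>\<^sub>M gauss m"
    "distr (gauss m') (gauss m) (\<lambda>x. restrict x {..<m}) = gauss m"
proof -
  show "(\<lambda>x. restrict x {..<m}) \<in> gauss m' \<rightarrow>\<^sub>M gauss m"
    using assms by (intro measurable_into_gauss) auto
  interpret product_prob_space "\<lambda>_ :: nat. gauss1" "{..<m'}"
    by (simp add: product_prob_space_def product_prob_space_axioms_def product_sigma_finite_def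
      prob_space_gauss1 prob_space_imp_sigma_finite)
  show "distr (gauss m') (gauss m) (\<lambda>x. restrict x {..<m}) = gauss m"
    unfolding gauss_def by (rule distr_PiM_restrict_finite) (use assms in auto)
qed

section \<open>The maximum metric\<close>

text \<open>For this metric a map is 1-Lipschitz as soon as its coordinates are, so real-valued
  extensions combine without loss. The inserted 0 takes care of \<open>k = 0\<close>.\<close>

definition mdist :: "nat \<Rightarrow> (nat \<Rightarrow> real) \<Rightarrow> (nat \<Rightarrow> real) \<Rightarrow> real" where
  "mdist k x y = Max (insert 0 ((\<lambda>i. \<bar>x i - y i\<bar>) ` {..<k}))"

lemma mdist_le_iff: "mdist k x y \<le> r \<longleftrightarrow> 0 \<le> r \<and> (\<forall>i<k. \<bar>x i - y i\<bar> \<le> r)"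
  unfolding mdist_def by (subst Max_le_iff) auto

lemma abs_coord_le_mdist: "i < k \<Longrightarrow> \<bar>x i - y i\<bar> \<le> mdist k x y"
  using mdist_le_iff[of k x y "mdist k x y"] by simp

lemma mdist_nonneg: "0 \<le> mdist k x y"
  using mdist_le_iff[of k x y "mdist k x y"] by simp

lemma Metric_space_mdist: "Metric_space (coord_space k) (mdist k)"
proof
  show "0 \<le> mdist k x y" for x y
    by (rule mdist_nonneg)
  show "mdist k x y = mdist k y x" for x y
    by (simp add: mdist_def abs_minus_commute)
  show "mdist k x y = 0 \<longleftrightarrow> x = y" if "x \<in> coord_space k" "y \<in> coord_space k" for x y
  proof
    assume "mdist k x y = 0"
    then have "x i = y i" if "i < k" for i
      using abs_coord_le_mdist[OF that, of x y] by simp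
    with that show "x = y"
      by (rule coord_space_eqI)
  next
    assume "x = y"
    then show "mdist k x y = 0"
      using mdist_nonneg[of k x y] by (intro antisym) (simp_all add: mdist_le_iff)
  qed
  show "mdist k x z \<le> mdist k x y + mdist k y z" for x y z
    unfolding mdist_le_iff[of k x z]
  proof (intro conjI allI impI)
    fix i assume "i < k"
    from abs_coord_le_mdist[OF this, of x y] abs_coord_le_mdist[OF this, of y z]
    show "\<bar>x i - z i\<bar> \<le> mdist k x y + mdist k y z"
      by linarith
  qed (simp add: mdist_nonneg)
qed

lemma sep_metric_mdist: "\<exists>c. sep_metric (coord_space k) (mdist k) c"
proof (rule sep_metric_coords[OF Metric_space_mdist coord_space_not_empty])
  show "mdist k x y \<le> (\<Sum>i<k. \<bar>x i - y i\<bar>)" for x y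
    unfolding mdist_le_iff by (auto intro: sum_nonneg member_le_sum[of _ "{..<k}" "\<lambda>i. \<bar>x i - y i\<bar>"])
qed

lemma mcomplete_mdist: "Metric_space.mcomplete (coord_space k) (mdist k)"
proof -
  interpret Metric_space "coord_space k" "mdist k"
    by (rule Metric_space_mdist)
  show ?thesis
    unfolding mcomplete_def
  proof (intro allI impI)
    fix \<sigma> assume \<sigma>: "MCauchy \<sigma>"
    then have in_V: "\<sigma> n \<in> coord_space k" for n
      by (auto simp: MCauchy_def)
    have "Cauchy (\<lambda>n. \<sigma> n i)" if "i < k" for i
      unfolding Cauchy_def
    proof (intro allI impI)
      fix e :: real assume "e > 0"
      then obtain N where "\<forall>n n'. N \<le> n \<longrightarrow> N \<le> n' \<longrightarrow> mdist k (\<sigma> n) (\<sigma> n') < e"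
        using \<sigma> unfolding MCauchy_def by blast
      then show "\<exists>N. \<forall>n\<ge>N. \<forall>n'\<ge>N. dist (\<sigma> n i) (\<sigma> n' i) < e"
        using abs_coord_le_mdist[OF that] unfolding dist_real_def by (meson le_less_trans)
    qed
    then have "\<exists>l. (\<lambda>n. \<sigma> n i) \<longlonglongrightarrow> l" if "i < k" for i
      using that real_Cauchy_convergent convergent_def by blast
    then obtain l where l: "\<And>i. i < k \<Longrightarrow> (\<lambda>n. \<sigma> n i) \<longlonglongrightarrow> l i"
      by metis
    define x where "x = restrict l {..<k}"
    have "(\<lambda>n. mdist k (\<sigma> n) x) \<longlonglongrightarrow> 0"
    proof (rule tendsto_sandwich[of "\<lambda>_. 0" _ _ "\<lambda>n. \<Sum>i<k. \<bar>\<sigma> n i - x i\<bar>"])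
      have "(\<lambda>n. \<Sum>i<k. \<bar>\<sigma> n i - x i\<bar>) \<longlonglongrightarrow> (\<Sum>i<k. \<bar>x i - x i\<bar>)"
        using l by (intro tendsto_sum tendsto_rabs tendsto_diff) (auto simp: x_def)
      then show "(\<lambda>n. \<Sum>i<k. \<bar>\<sigma> n i - x i\<bar>) \<longlonglongrightarrow> 0"
        by simp
      have "mdist k (\<sigma> n) x \<le> (\<Sum>i<k. \<bar>\<sigma> n i - x i\<bar>)" for n
        unfolding mdist_le_iff
        by (auto intro: sum_nonneg member_le_sum[of _ "{..<k}" "\<lambda>i. \<bar>\<sigma> n i - x i\<bar>"])
      then show "\<forall>\<^sub>F n in sequentially. mdist k (\<sigma> n) x \<le> (\<Sum>i<k. \<bar>\<sigma> n i - x i\<bar>)"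
        by simp
    qed (auto simp: mdist_nonneg)
    then show "\<exists>x. limitin mtopology \<sigma> x sequentially"
      using in_V by (intro exI[of _ x]) (auto simp: limitin_metric_dist_null x_def)
  qed
qed

section \<open>Finitely supported infinite matrices\<close>

lemma star_one [simp]: "star (1 :: 'f :: star_div_algebra) = 1"
  using star_mult_self[of "1 :: 'f"] by simp

lemma star_zero [simp]: "star (0 :: 'f :: star_div_algebra) = 0"
  using star_scaleR[of 0 "0 :: 'f"] by simp

lemma star_minus: "star (x - y) = star x - star (y :: 'f :: star_div_algebra)"
  using star_add[of "x - y" y] by (simp add: algebra_simps)

lemma star_sum: "star (sum f S) = (\<Sum>x\<in>S. star (f x :: 'f :: star_div_algebra))"
  by (induction S rule: infinite_finite_induct) (simp_all add: star_add)

lemma norm_star [simp]: "norm (star x) = norm (x :: 'f :: star_div_algebra)"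
proof (cases "x = 0")
  case False
  have "norm (star x * x) = (norm x)\<^sup>2"
    unfolding star_mult_self by simp
  with False show ?thesis
    by (simp add: norm_mult power2_eq_square)
qed simp

lemma inner_star [simp]: "inner (star x) (star y) = inner x (y :: 'f :: star_div_algebra)"
  unfolding dot_norm by (simp add: star_add[symmetric])

lemma star_polarization: "star x * y + star y * x = (2 * inner x y) *\<^sub>R (1 :: 'f :: star_div_algebra)"
proof -
  have "star (x + y) * (x + y) = star x * x + star y * y + (star x * y + star y * x)"
    by (simp add: star_add algebra_simps)
  then have "star x * y + star y * x = ((norm (x + y))\<^sup>2 - (norm x)\<^sup>2 - (norm y)\<^sup>2) *\<^sub>R (1 :: 'f)"
    unfolding star_mult_self by (simp add: algebra_simps)
  then show ?thesis
    by (simp add: dot_norm)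
qed

text \<open>Polarization expresses \<open>2 * inner x y\<close> by
  \<open>star x * y + star y * x\<close>, and both sides lead to the same expression because
  \<open>star\<close> reverses products.\<close>

lemma inner_mult_star_left: "inner (a * x) y = inner x (star a * (y :: 'f :: star_div_algebra))"
proof -
  have "(2 * inner (a * x) y) *\<^sub>R (1 :: 'f) = (2 * inner x (star a * y)) *\<^sub>R 1"
    unfolding star_polarization[symmetric] by (simp add: star_mult star_star mult.assoc)
  then show ?thesis
    by simp
qed

text \<open>Matrices of all sizes live in one type, a normed algebra without unit that carries the
  Frobenius inner product. Limits, norm inequalities and ring normalization apply to it directly,
  and sizes enter only through \<open>dims\<close>.\<close>

typedef (overloaded) 'f fmat = "{A :: nat \<Rightarrow> nat \<Rightarrow> 'f :: zero. \<exists>m. \<forall>i j. m \<le> i \<or> m \<le> j \<longrightarrow> A i j = 0}"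
  morphisms entry Abs_fmat
  by (rule exI[of _ "\<lambda>_ _. 0"]) simp

definition dims :: "nat \<Rightarrow> nat \<Rightarrow> 'f :: zero fmat \<Rightarrow> bool" where
  "dims N n A \<longleftrightarrow> (\<forall>i j. N \<le> i \<or> n \<le> j \<longrightarrow> entry A i j = 0)"

lemma fmat_eqI: "(\<And>i j. entry A i j = entry B i j) \<Longrightarrow> A = B"
  by (simp add: entry_inject[symmetric] fun_eq_iff)

lemma dims_ex: "\<exists>m. dims m m A"
  using entry[of A] by (auto simp: dims_def)

lemma dims_mono: "dims N n A \<Longrightarrow> N \<le> N' \<Longrightarrow> n \<le> n' \<Longrightarrow> dims N' n' A"
  unfolding dims_def by (meson le_trans)

lemma dims_ex2: "\<exists>m. dims m m A \<and> dims m m B"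
proof -
  obtain k l where "dims k k A" "dims l l B"
    using dims_ex by metis
  then have "dims (max k l) (max k l) A" "dims (max k l) (max k l) B"
    by (auto elim: dims_mono)
  then show ?thesis
    by blast
qed

lemma entry_Abs_fmat:
  assumes "\<And>i j. N \<le> i \<or> n \<le> j \<Longrightarrow> f i j = 0"
  shows "entry (Abs_fmat f) = f"
proof (rule Abs_fmat_inverse)
  have "\<forall>i j. max N n \<le> i \<or> max N n \<le> j \<longrightarrow> f i j = 0"
    using assms by auto
  then show "f \<in> {A. \<exists>m. \<forall>i j. m \<le> i \<or> m \<le> j \<longrightarrow> A i j = 0}"
    by blast
qed

instantiation fmat :: (ab_group_add) ab_group_add
begin
definition "0 = Abs_fmat (\<lambda>i j. 0)"
definition "A + B = Abs_fmat (\<lambda>i j. entry A i j + entry B i j)"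
definition "- A = Abs_fmat (\<lambda>i j. - entry A i j)"
definition "A - B = Abs_fmat (\<lambda>i j. entry A i j - entry B i j)"

lemma entry_zero [simp]: "entry 0 i j = 0"
  unfolding zero_fmat_def by (subst entry_Abs_fmat[of 0 0]) auto

lemma entry_plus [simp]: "entry (A + B) i j = entry A i j + entry B i j"
proof -
  obtain m where m: "dims m m A" "dims m m B"
    using dims_ex2 by blast
  then show ?thesis
    unfolding plus_fmat_def by (subst entry_Abs_fmat[of m m]) (auto simp: dims_def)
qed

lemma entry_minus [simp]: "entry (A - B) i j = entry A i j - entry B i j"
proof -
  obtain m where m: "dims m m A" "dims m m B"
    using dims_ex2 by blast
  then show ?thesis
    unfolding minus_fmat_def by (subst entry_Abs_fmat[of m m]) (auto simp: dims_def)
qed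

lemma entry_uminus [simp]: "entry (- A) i j = - entry A i j"
proof -
  obtain m where m: "dims m m A"
    using dims_ex by blast
  then show ?thesis
    unfolding uminus_fmat_def by (subst entry_Abs_fmat[of m m]) (auto simp: dims_def)
qed

instance
  by standard (auto intro!: fmat_eqI)
end

instantiation fmat :: (real_vector) real_vector
begin
definition "r *\<^sub>R A = Abs_fmat (\<lambda>i j. r *\<^sub>R entry A i j)"

lemma entry_scaleR [simp]: "entry (r *\<^sub>R A) i j = r *\<^sub>R entry A i j"
proof -
  obtain m where m: "dims m m A"
    using dims_ex by blast
  then show ?thesis
    unfolding scaleR_fmat_def by (subst entry_Abs_fmat[of m m]) (auto simp: dims_def)
qed

instance
  by standard (auto intro!: fmat_eqI simp: algebra_simps)
end

lemma dims_closed [simp, intro]: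
  "dims N n 0"
  "dims N n A \<Longrightarrow> dims N n B \<Longrightarrow> dims N n (A + B)"
  "dims N n A \<Longrightarrow> dims N n B \<Longrightarrow> dims N n (A - B)"
  "dims N n A' \<Longrightarrow> dims N n (r *\<^sub>R A')"
  for A B :: "'f :: ab_group_add fmat" and A' :: "'g :: real_vector fmat"
  by (simp_all add: dims_def)

instantiation fmat :: (real_inner) real_inner
begin
text \<open>The Frobenius inner product. The support of \<open>A\<close> is finite, so no size has
  to be named.\<close>

definition "inner A B = (\<Sum>p | entry A (fst p) (snd p) \<noteq> 0. inner (entry A (fst p) (snd p)) (entry B (fst p) (snd p)))"
  for A B :: "'a fmat"
definition "norm A = sqrt (inner A A)" for A :: "'a fmat"
definition "sgn A = A /\<^sub>R norm A" for A :: "'a fmat"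
definition "dist A B = norm (A - B)" for A B :: "'a fmat"
definition "(uniformity :: ('a fmat \<times> 'a fmat) filter) = (INF e\<in>{0 <..}. principal {(x, y). dist x y < e})"
definition "open (U :: 'a fmat set) \<longleftrightarrow> (\<forall>x\<in>U. eventually (\<lambda>(x', y). x' = x \<longrightarrow> y \<in> U) uniformity)"

lemma inner_fmat_sum:
  assumes "dims N n A"
  shows "inner A B = (\<Sum>i<N. \<Sum>j<n. inner (entry A i j) (entry B i j))"
proof -
  have "inner A B = (\<Sum>p\<in>{..<N} \<times> {..<n}. inner (entry A (fst p) (snd p)) (entry B (fst p) (snd p)))"
    unfolding inner_fmat_def
    by (rule sum.mono_neutral_left) (use assms in \<open>auto simp: dims_def not_le[symmetric]\<close>)
  then show ?thesis
    by (simp add: sum.cartesian_product case_prod_beta)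
qed

instance
proof
  fix A B C :: "'a fmat" and r :: real and U :: "'a fmat set"
  obtain m where m: "dims m m A" "dims m m B"
    using dims_ex2 by blast
  then have mp: "dims m m (A + B)" "dims m m (r *\<^sub>R A)"
    by auto
  show "inner A B = inner B A"
    by (simp add: inner_fmat_sum[OF m(1)] inner_fmat_sum[OF m(2)] inner_commute)
  show "inner (A + B) C = inner A C + inner B C"
    by (simp add: inner_fmat_sum[OF m(1)] inner_fmat_sum[OF m(2)] inner_fmat_sum[OF mp(1)]
        inner_add_left sum.distrib)
  show "inner (r *\<^sub>R A) B = r * inner A B"
    by (simp add: inner_fmat_sum[OF m(1)] inner_fmat_sum[OF mp(2)] sum_distrib_left)
  show "0 \<le> inner A A"
    by (simp add: inner_fmat_sum[OF m(1)] sum_nonneg)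
  show "inner A A = 0 \<longleftrightarrow> A = 0"
  proof
    assume "inner A A = 0"
    then have "entry A i j = 0" if "i < m" "j < m" for i j
      using that unfolding inner_fmat_sum[OF m(1)]
      by (subst (asm) sum_nonneg_eq_0_iff, simp, simp add: sum_nonneg)
        (subst (asm) sum_nonneg_eq_0_iff, auto)
    with m(1) show "A = 0"
      by (intro fmat_eqI) (auto simp: dims_def not_le[symmetric])
  qed (simp add: inner_fmat_def)
qed (simp_all add: norm_fmat_def sgn_fmat_def dist_fmat_def uniformity_fmat_def open_fmat_def)
end

lemma norm_fmat_sum:
  assumes "dims N n A"
  shows "(norm A)\<^sup>2 = (\<Sum>i<N. \<Sum>j<n. (norm (entry A i j))\<^sup>2)"
  using inner_fmat_sum[OF assms, of A] by (simp add: dot_square_norm)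

lemma norm_entry_le: "norm (entry A i j) \<le> norm (A :: 'f :: real_inner fmat)"
proof -
  obtain m where m: "dims m m A"
    using dims_ex by blast
  define k where "k = Suc (max m (max i j))"
  have k: "dims k k A" "i < k" "j < k"
    using m by (auto simp: k_def elim: dims_mono)
  have "(norm (entry A i j))\<^sup>2 \<le> (\<Sum>j<k. (norm (entry A i j))\<^sup>2)"
    using k by (intro member_le_sum) auto
  also have "\<dots> \<le> (\<Sum>i<k. \<Sum>j<k. (norm (entry A i j))\<^sup>2)"
    using k by (intro member_le_sum[of i "{..<k}" "\<lambda>i. \<Sum>j<k. (norm (entry A i j))\<^sup>2"]) (auto intro: sum_nonneg)
  also have "\<dots> = (norm A)\<^sup>2"
    by (rule norm_fmat_sum[OF k(1), symmetric])
  finally show ?thesis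
    by (rule power2_le_imp_le) simp
qed

instantiation fmat :: (star_div_algebra) real_normed_algebra
begin
definition "A * B = Abs_fmat (\<lambda>i j. \<Sum>k | entry A i k \<noteq> 0. entry A i k * entry B k j)"

lemma entry_mult_row:
  assumes "\<And>k. k \<ge> m \<Longrightarrow> entry A i k = 0"
  shows "entry (A * B) i j = (\<Sum>k<m. entry A i k * entry B k j)"
proof -
  have "entry (A * B) = (\<lambda>i j. \<Sum>k | entry A i k \<noteq> 0. entry A i k * entry B k j)"
  proof -
    obtain l where l: "dims l l A" "dims l l B"
      using dims_ex2 by blast
    show ?thesis
      unfolding times_fmat_def
    proof (rule entry_Abs_fmat[of l l])
      fix i j assume "l \<le> i \<or> l \<le> j"
      then show "(\<Sum>k | entry A i k \<noteq> 0. entry A i k * entry B k j) = 0"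
        using l by (intro sum.neutral) (auto simp: dims_def)
    qed
  qed
  then have "entry (A * B) i j = (\<Sum>k | entry A i k \<noteq> 0. entry A i k * entry B k j)"
    by simp
  also have "\<dots> = (\<Sum>k<m. entry A i k * entry B k j)"
    by (rule sum.mono_neutral_left) (use assms in \<open>auto simp: not_le[symmetric]\<close>)
  finally show ?thesis .
qed

lemma entry_mult: "dims N m A \<Longrightarrow> entry (A * B) i j = (\<Sum>k<m. entry A i k * entry B k j)"
  by (rule entry_mult_row) (simp add: dims_def)

lemma dims_mult: "dims N m A \<Longrightarrow> dims m' n B \<Longrightarrow> dims N n (A * B)"
  unfolding dims_def[of N n]
  using entry_mult[of N m A B] by (auto simp: dims_def intro!: sum.neutral)

instance
proof
  fix A B C :: "'a fmat" and r :: real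
  obtain m1 where m1: "dims m1 m1 A" "dims m1 m1 B"
    using dims_ex2 by blast
  obtain m2 where m2: "dims m2 m2 C"
    using dims_ex by blast
  define m where "m = max m1 m2"
  have m: "dims m m A" "dims m m B" "dims m m C"
    using m1 m2 by (auto simp: m_def elim: dims_mono)
  have mm: "dims m m (A + B)" "dims m m (A * B)" "dims m m (r *\<^sub>R A)"
    using m by (auto intro: dims_mult)
  show "A * B * C = A * (B * C)"
  proof (rule fmat_eqI)
    fix i j
    have "entry (A * B * C) i j = (\<Sum>k<m. \<Sum>l<m. entry A i l * entry B l k * entry C k j)"
      by (simp add: entry_mult[OF mm(2)] entry_mult[OF m(1)] sum_distrib_right)
    also have "\<dots> = (\<Sum>l<m. \<Sum>k<m. entry A i l * entry B l k * entry C k j)"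
      by (rule sum.swap)
    also have "\<dots> = entry (A * (B * C)) i j"
      by (simp add: entry_mult[OF m(1)] entry_mult[OF m(2)] sum_distrib_left mult.assoc)
    finally show "entry (A * B * C) i j = entry (A * (B * C)) i j" .
  qed
  show "(A + B) * C = A * C + B * C"
    by (rule fmat_eqI) (simp add: entry_mult[OF mm(1)] entry_mult[OF m(1)] entry_mult[OF m(2)]
        distrib_right sum.distrib)
  show "A * (B + C) = A * B + A * C"
    by (rule fmat_eqI) (simp add: entry_mult[OF m(1)] distrib_left sum.distrib)
  show "r *\<^sub>R A * B = r *\<^sub>R (A * B)"
    by (rule fmat_eqI) (simp add: entry_mult[OF m(1)] entry_mult[OF mm(3)] scaleR_sum_right)
  show "A * r *\<^sub>R B = r *\<^sub>R (A * B)"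
    by (rule fmat_eqI) (simp add: entry_mult[OF m(1)] scaleR_sum_right)
  \<comment> \<open>Submultiplicativity of the Frobenius norm is Cauchy-Schwarz for each entry of
    the product.\<close>
  have "(norm (A * B))\<^sup>2 = (\<Sum>i<m. \<Sum>j<m. (norm (\<Sum>k<m. entry A i k * entry B k j))\<^sup>2)"
    by (simp add: norm_fmat_sum[OF mm(2)] entry_mult[OF m(1)])
  also have "\<dots> \<le> (\<Sum>i<m. \<Sum>j<m. (\<Sum>k<m. (norm (entry A i k))\<^sup>2) * (\<Sum>k<m. (norm (entry B k j))\<^sup>2))"
  proof (intro sum_mono)
    fix i j
    have "norm (\<Sum>k<m. entry A i k * entry B k j) \<le> (\<Sum>k<m. \<bar>norm (entry A i k)\<bar> * \<bar>norm (entry B k j)\<bar>)"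
      by (rule order_trans[OF norm_sum]) (simp add: norm_mult)
    also have "\<dots> \<le> L2_set (\<lambda>k. norm (entry A i k)) {..<m} * L2_set (\<lambda>k. norm (entry B k j)) {..<m}"
      by (rule L2_set_mult_ineq)
    finally have "(norm (\<Sum>k<m. entry A i k * entry B k j))\<^sup>2 \<le>
        (L2_set (\<lambda>k. norm (entry A i k)) {..<m} * L2_set (\<lambda>k. norm (entry B k j)) {..<m})\<^sup>2"
      by (rule power_mono) simp
    then show "(norm (\<Sum>k<m. entry A i k * entry B k j))\<^sup>2 \<le>
        (\<Sum>k<m. (norm (entry A i k))\<^sup>2) * (\<Sum>k<m. (norm (entry B k j))\<^sup>2)"
      by (simp add: power_mult_distrib L2_set_def sum_nonneg)
  qed
  also have "\<dots> = (\<Sum>i<m. \<Sum>k<m. (norm (entry A i k))\<^sup>2) * (\<Sum>j<m. \<Sum>k<m. (norm (entry B k j))\<^sup>2)"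
    by (rule sum_product[symmetric])
  also have "(\<Sum>j<m. \<Sum>k<m. (norm (entry B k j))\<^sup>2) = (\<Sum>k<m. \<Sum>j<m. (norm (entry B k j))\<^sup>2)"
    by (rule sum.swap)
  also have "(\<Sum>i<m. \<Sum>k<m. (norm (entry A i k))\<^sup>2) * \<dots> = (norm A * norm B)\<^sup>2"
    by (simp add: norm_fmat_sum[OF m(1)] norm_fmat_sum[OF m(2)] power_mult_distrib)
  finally show "norm (A * B) \<le> norm A * norm B"
    by (rule power2_le_imp_le) simp
qed
end

definition adj :: "'f :: star_div_algebra fmat \<Rightarrow> 'f fmat" where
  "adj A = Abs_fmat (\<lambda>i j. star (entry A j i))"

lemma entry_adj [simp]: "entry (adj A) i j = star (entry A j i)"
proof -
  obtain m where m: "dims m m A"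
    using dims_ex by blast
  then show ?thesis
    unfolding adj_def by (subst entry_Abs_fmat[of m m]) (auto simp: dims_def)
qed

lemma dims_adj: "dims N n A \<Longrightarrow> dims n N (adj A)"
  by (auto simp: dims_def)

lemma adj_simps:
  "adj (adj A) = A" "adj (A + B) = adj A + adj B" "adj (A - B) = adj A - adj B"
  "adj (r *\<^sub>R A) = r *\<^sub>R adj A"
  by (auto intro!: fmat_eqI simp: star_star star_add star_minus star_scaleR)

lemma adj_mult: "adj (A * B) = adj B * adj A"
proof (rule fmat_eqI)
  fix i j
  obtain m where m: "dims m m A" "dims m m B"
    using dims_ex2 by blast
  show "entry (adj (A * B)) i j = entry (adj B * adj A) i j"
    by (simp add: entry_mult[OF m(1)] entry_mult[OF dims_adj[OF m(2)]] star_sum star_mult)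
qed

lemma inner_adj: "inner (adj A) (adj B) = inner A B"
proof -
  obtain m where m: "dims m m A"
    using dims_ex by blast
  show ?thesis
    unfolding inner_fmat_sum[OF m] inner_fmat_sum[OF dims_adj[OF m]]
    by (subst sum.swap) simp
qed

lemma norm_adj: "norm (adj A) = norm A"
  by (simp add: norm_eq_sqrt_inner inner_adj)

text \<open>Lets a left factor be moved across the inner product; the norm estimates for the polar
  factor use this in the place of singular values.\<close>

lemma inner_mult_adj: "inner (A * B) C = inner B (adj A * C)"
proof -
  obtain m where m: "dims m m A" "dims m m B"
    using dims_ex2 by blast
  have "inner (A * B) C = (\<Sum>i<m. \<Sum>j<m. \<Sum>k<m. inner (entry A i k * entry B k j) (entry C i j))"
    by (simp add: inner_fmat_sum[OF dims_mult[OF m]] entry_mult[OF m(1)] inner_sum_left)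
  also have "\<dots> = (\<Sum>i<m. \<Sum>k<m. \<Sum>j<m. inner (entry B k j) (star (entry A i k) * entry C i j))"
    by (rule sum.cong[OF refl], subst sum.swap) (simp add: inner_mult_star_left)
  also have "\<dots> = (\<Sum>k<m. \<Sum>i<m. \<Sum>j<m. inner (entry B k j) (star (entry A i k) * entry C i j))"
    by (rule sum.swap)
  also have "\<dots> = (\<Sum>k<m. \<Sum>j<m. \<Sum>i<m. inner (entry B k j) (star (entry A i k) * entry C i j))"
    by (intro sum.cong refl sum.swap)
  also have "\<dots> = inner B (adj A * C)"
    by (simp add: inner_fmat_sum[OF m(2)] entry_mult[OF dims_adj[OF m(1)]] inner_sum_right)
  finally show ?thesis .
qed

definition idm :: "nat \<Rightarrow> 'f :: star_div_algebra fmat" where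
  "idm n = Abs_fmat (\<lambda>i j. if i = j \<and> i < n then 1 else 0)"

lemma entry_idm [simp]: "entry (idm n) i j = (if i = j \<and> i < n then 1 else 0)"
  unfolding idm_def by (subst entry_Abs_fmat[of n n]) auto

lemma dims_idm: "dims n n (idm n)"
  by (auto simp: dims_def)

lemma adj_idm: "adj (idm n) = idm n"
  by (rule fmat_eqI) auto

lemma mult_idm: 
  assumes "dims N n A"
  shows "A * idm n = A"
proof (rule fmat_eqI)
  fix i j
  have "entry (A * idm n) i j = (\<Sum>k<n. if k = j then entry A i k else 0)"
    unfolding entry_mult[OF assms] by (intro sum.cong) auto
  then show "entry (A * idm n) i j = entry A i j"
    using assms by (auto simp: dims_def)
qed

lemma idm_mult: 
  assumes "dims n N A"
  shows "idm n * A = A"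
proof (rule fmat_eqI)
  fix i j
  have "entry (idm n * A) i j = (\<Sum>k<n. if k = i then entry A k j else 0)"
    unfolding entry_mult[OF dims_idm] by (intro sum.cong) auto
  then show "entry (idm n * A) i j = entry A i j"
    using assms by (auto simp: dims_def)
qed

lemma fmat_tendsto:
  fixes X :: "nat \<Rightarrow> 'f :: star_div_algebra fmat"
  assumes X: "\<And>k. dims N n (X k)" and L: "dims N n L"
    and lim: "\<And>i j. i < N \<Longrightarrow> j < n \<Longrightarrow> (\<lambda>k. entry (X k) i j) \<longlonglongrightarrow> entry L i j"
  shows "X \<longlonglongrightarrow> L"
proof -
  have "(\<lambda>k. (norm (X k - L))\<^sup>2) \<longlonglongrightarrow> (\<Sum>i<N. \<Sum>j<n. (norm (entry L i j - entry L i j))\<^sup>2)"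
    unfolding norm_fmat_sum[OF dims_closed(3)[OF X L]] entry_minus
    using lim by (intro tendsto_intros) auto
  then have "(\<lambda>k. sqrt ((norm (X k - L))\<^sup>2)) \<longlonglongrightarrow> sqrt 0"
    by (intro tendsto_real_sqrt) simp
  then have "(\<lambda>k. norm (X k - L)) \<longlonglongrightarrow> 0"
    by simp
  then show ?thesis
    by (simp add: tendsto_norm_zero_iff LIM_zero_iff)
qed

lemma tendsto_adj:
  assumes "X \<longlonglongrightarrow> L"
  shows "(\<lambda>k. adj (X k :: 'f :: star_div_algebra fmat)) \<longlonglongrightarrow> adj L"
proof -
  have "(\<lambda>k. norm (adj (X k) - adj L)) \<longlonglongrightarrow> 0"
    using assms unfolding adj_simps(3)[symmetric] norm_adj
    by (simp add: tendsto_norm_zero_iff LIM_zero_iff)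
  then show ?thesis
    by (simp add: tendsto_norm_zero_iff LIM_zero_iff)
qed

section \<open>The polar factor of a nearly orthonormal matrix\<close>

text \<open>Gram matrix minus identity, the defect of the columns from being orthonormal.\<close>

definition gram :: "nat \<Rightarrow> 'f :: star_div_algebra fmat \<Rightarrow> 'f fmat" where
  "gram n A = adj A * A - idm n"

text \<open>One Newton--Schulz step towards \<open>A (A\<^sup>* A)\<^bsup>-1/2\<^esup>\<close>.\<close>

definition polar_step :: "nat \<Rightarrow> 'f :: star_div_algebra fmat \<Rightarrow> 'f fmat" where
  "polar_step n A = A - (1/2) *\<^sub>R (A * gram n A)"

lemma dims_gram: "dims N n A \<Longrightarrow> dims n n (gram n A)"
  unfolding gram_def by (intro dims_closed dims_mult[of n N _ N n] dims_idm dims_adj)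

lemma dims_polar_step: "dims N n A \<Longrightarrow> dims N n (polar_step n A)"
  unfolding polar_step_def by (intro dims_closed dims_mult[of N n _ n n] dims_gram)

lemma adj_gram: "adj (gram n A) = gram n A"
  by (simp add: gram_def adj_simps adj_mult adj_idm)

text \<open>\<open>adj A * A = 1 + V\<close> commutes with \<open>V\<close>, so the new defect is
  the polynomial \<open>(1 - V/2)^2 (1 + V) - 1 = - 3/4 V^2 + 1/4 V^3\<close>. The linear term
  cancels, which is the quadratic convergence of Newton's method.\<close>

lemma gram_polar_step:
  assumes A: "dims N n A" and W: "norm (gram n A) \<le> \<delta>" "\<delta> \<le> 1"
  shows "norm (gram n (polar_step n A)) \<le> \<delta>\<^sup>2"
proof -
  define V where "V = gram n A"
  have AA: "adj A * A = idm n + V"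
    by (simp add: V_def gram_def)
  have V: "dims n n V" "adj V = V"
    by (simp_all add: V_def dims_gram[OF A] adj_gram)
  have iV: "idm n * V = V" "V * idm n = V"
    using V(1) by (simp_all add: idm_mult mult_idm)
  have VAA: "V * (adj A * A) = V + V * V" "(adj A * A) * V = V + V * V"
    unfolding AA by (simp_all add: iV algebra_simps)
  have VAAV: "V * (adj A * (A * V)) = V * V + V * (V * V)"
    using VAA by (simp add: mult.assoc[symmetric]) (simp add: algebra_simps)
  have "gram n (polar_step n A) = adj A * A - (1/2) *\<^sub>R (adj A * A * V) - (1/2) *\<^sub>R (V * (adj A * A))
      + (1/4) *\<^sub>R (V * (adj A * (A * V))) - idm n"
    unfolding gram_def[of n "polar_step n A"]
    unfolding polar_step_def V_def[symmetric] adj_simps adj_mult V(2)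
    by (simp add: algebra_simps)
  also have "\<dots> = - (3/4) *\<^sub>R (V * V) + (1/4) *\<^sub>R (V * (V * V))"
    unfolding VAA VAAV unfolding AA by (simp add: algebra_simps flip: scaleR_add_left)
  finally have "norm (gram n (polar_step n A)) = norm (- (3/4) *\<^sub>R (V * V) + (1/4) *\<^sub>R (V * (V * V)))"
    by simp
  also have "\<dots> \<le> norm (- (3/4) *\<^sub>R (V * V)) + norm ((1/4) *\<^sub>R (V * (V * V)))"
    by (rule norm_triangle_ineq)
  also have "\<dots> \<le> 3/4 * (norm V * norm V) + 1/4 * (norm V * (norm V * norm V))"
    using norm_mult_ineq[of V V] norm_mult_ineq[of V "V * V"]
      mult_left_mono[OF norm_mult_ineq[of V V] norm_ge_zero[of V]] by simp
  also have "\<dots> \<le> 3/4 * (\<delta> * \<delta>) + 1/4 * (1 * (\<delta> * \<delta>))"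
  proof -
    have "norm V \<le> \<delta>" "norm V \<le> 1"
      using W by (simp_all add: V_def)
    moreover from this have "0 \<le> \<delta>"
      using norm_ge_zero order_trans by blast
    ultimately have "norm V * norm V \<le> \<delta> * \<delta>" "norm V * (norm V * norm V) \<le> 1 * (\<delta> * \<delta>)"
      by (intro mult_mono; simp)+
    then show ?thesis
      by (intro add_mono mult_left_mono) auto
  qed
  finally show ?thesis
    by (simp add: power2_eq_square)
qed

text \<open>The Lipschitz constant must tend to 1 with \<open>\<delta>\<close>, so bounding all
  terms separately is too crude. In the identity \<open>eq\<close> the term
  \<open>D * (V + W)\<close> is of order \<open>\<delta>\<close>. The term \<open>P * S\<close> is
  not, but subtracting a quarter of it from \<open>D\<close> does not increase the norm: its inner
  product with \<open>D\<close> is exactly \<open>inner S S\<close>, which compensates its own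
  square.\<close>

lemma polar_step_lipschitz:
  assumes A: "dims N n A" "norm (gram n A) \<le> \<delta>" and B: "dims N n B" "norm (gram n B) \<le> \<delta>"
    and \<delta>: "\<delta> \<le> 1"
  shows "norm (polar_step n A - polar_step n B) \<le> (1 + \<delta> / 2) * norm (A - B)"
proof -
  define P where "P = A + B"
  define D where "D = A - B"
  define V where "V = gram n A"
  define W where "W = gram n B"
  define S where "S = V - W"
  have wV: "dims n n V" and wW: "dims n n W"
    by (simp_all add: V_def W_def dims_gram[OF A(1)] dims_gram[OF B(1)])
  then have wS: "dims n n S"
    by (auto simp: S_def)
  have AA: "adj A * A = idm n + V" and BB: "adj B * B = idm n + W"
    by (simp_all add: V_def W_def gram_def)
  have eq: "polar_step n A - polar_step n B = (D - (1/4) *\<^sub>R (P * S)) - (1/4) *\<^sub>R (D * (V + W))"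
  proof -
    have "P * S + D * (V + W) = 2 *\<^sub>R (A * V) - 2 *\<^sub>R (B * W)"
      by (simp add: P_def S_def D_def algebra_simps scaleR_2)
    then have "(1/4) *\<^sub>R (P * S) + (1/4) *\<^sub>R (D * (V + W)) = (1/2) *\<^sub>R (A * V) - (1/2) *\<^sub>R (B * W)"
      by (simp flip: scaleR_add_right) (simp add: scaleR_diff_right)
    then show ?thesis
      by (simp add: polar_step_def D_def V_def[symmetric] W_def[symmetric] algebra_simps)
  qed
  have n1: "norm (D - (1/4) *\<^sub>R (P * S)) \<le> norm D"
  proof -
    have aS: "adj S = S"
      by (simp add: S_def V_def W_def adj_simps adj_gram)
    have PD: "adj P * D + adj D * P = 2 *\<^sub>R S"
    proof -
      have "adj P * D + adj D * P = 2 *\<^sub>R (adj A * A) - 2 *\<^sub>R (adj B * B)"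
        by (simp add: P_def D_def adj_simps algebra_simps scaleR_2)
      then show ?thesis
        unfolding AA BB by (simp add: S_def algebra_simps)
    qed
    have "inner (adj P * D) S = inner (adj (adj P * D)) (adj S)"
      by (rule inner_adj[symmetric])
    then have "inner (adj P * D) S = inner (adj D * P) S"
      by (simp add: adj_mult adj_simps aS)
    then have "2 * inner (adj P * D) S = inner (adj P * D + adj D * P) S"
      by (simp add: inner_add_left)
    then have 1: "inner D (P * S) = inner S S"
      unfolding PD using inner_mult_adj[of P S D] by (simp add: inner_commute)
    \<comment> \<open>Parallelogram identity. As \<open>norm (V + W) \<le> 2\<close>, it gives
      \<open>inner (P * S) (P * S) \<le> (4 + 2 * 2) * inner S S\<close>, and the resulting
      \<open>8 / 16\<close> is just balanced by the mixed term with coefficient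
      \<open>1 / 2\<close>.\<close>
    have "adj P * P = 4 *\<^sub>R idm n + 2 *\<^sub>R (V + W) - adj D * D"
    proof -
      have "adj P * P + adj D * D = 2 *\<^sub>R (adj A * A) + 2 *\<^sub>R (adj B * B)"
        by (simp add: P_def D_def adj_simps algebra_simps scaleR_2)
      also have "\<dots> = 4 *\<^sub>R idm n + 2 *\<^sub>R (V + W)"
        unfolding AA BB by (simp add: algebra_simps flip: scaleR_add_left)
      finally show ?thesis
        by (simp add: algebra_simps)
    qed
    then have PPS: "adj P * (P * S) = 4 *\<^sub>R S + 2 *\<^sub>R ((V + W) * S) - adj D * (D * S)"
      by (simp add: mult.assoc[symmetric]) (simp add: algebra_simps idm_mult[OF wS])
    have "inner (P * S) (P * S) = 4 * inner S S + 2 * inner S ((V + W) * S) - inner (D * S) (D * S)"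
      unfolding inner_mult_adj[of P] PPS inner_mult_adj[of D]
      by (simp add: inner_add_right inner_diff_right)
    also have "\<dots> \<le> 4 * inner S S + 2 * inner S ((V + W) * S)"
      by simp
    also have "inner S ((V + W) * S) \<le> norm S * norm ((V + W) * S)"
      by (rule norm_cauchy_schwarz)
    also have "norm ((V + W) * S) \<le> norm (V + W) * norm S"
      by (rule norm_mult_ineq)
    also have "norm (V + W) \<le> 2"
      using norm_triangle_ineq[of V W] A(2) B(2) \<delta> by (simp add: V_def W_def)
    finally have "inner (P * S) (P * S) \<le> 4 * inner S S + 2 * (norm S * (2 * norm S))"
      by (simp add: mult_left_mono mult_right_mono)
    then have 2: "inner (P * S) (P * S) \<le> 8 * inner S S"
      by (simp add: dot_square_norm power2_eq_square)
    have "inner (D - (1/4) *\<^sub>R (P * S)) (D - (1/4) *\<^sub>R (P * S)) =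
        inner D D - 1/2 * inner D (P * S) + 1/16 * inner (P * S) (P * S)"
      by (simp add: inner_diff_left inner_diff_right inner_commute algebra_simps)
    also have "\<dots> \<le> inner D D"
      using 2 unfolding 1 by simp
    finally show ?thesis
      by (simp add: norm_le)
  qed
  have n2: "norm ((1/4) *\<^sub>R (D * (V + W))) \<le> \<delta> / 2 * norm D"
  proof -
    have "norm (D * (V + W)) \<le> norm D * (2 * \<delta>)"
    proof (rule order_trans[OF norm_mult_ineq mult_left_mono])
      show "norm (V + W) \<le> 2 * \<delta>"
        using norm_triangle_ineq[of V W] A(2) B(2) by (simp add: V_def W_def)
    qed simp
    then show ?thesis
      by (simp add: mult.commute mult.left_commute)
  qed
  have "norm (polar_step n A - polar_step n B) \<le> norm D + \<delta> / 2 * norm D"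
    unfolding eq by (rule order_trans[OF norm_triangle_ineq4 add_mono[OF n1 n2]])
  then show ?thesis
    by (simp add: D_def algebra_simps)
qed

lemma polar_step_equivariant:
  assumes U: "dims N N U" "adj U * U = idm N" and A: "dims N n A"
  shows "gram n (U * A) = gram n A" "polar_step n (U * A) = U * polar_step n A"
proof -
  have "adj (U * A) * (U * A) = adj A * ((adj U * U) * A)"
    by (simp add: adj_mult mult.assoc)
  also have "\<dots> = adj A * A"
    using A U by (simp add: idm_mult)
  finally show g: "gram n (U * A) = gram n A"
    by (simp add: gram_def)
  show "polar_step n (U * A) = U * polar_step n A"
    unfolding polar_step_def g by (simp add: algebra_simps)
qed

section \<open>The iteration and its limit\<close>

abbreviation polar_iter :: "nat \<Rightarrow> nat \<Rightarrow> 'f :: star_div_algebra fmat \<Rightarrow> 'f fmat" where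
  "polar_iter n k A \<equiv> (polar_step n ^^ k) A"

lemma dims_polar_iter: "dims N n A \<Longrightarrow> dims N n (polar_iter n k A)"
  by (induction k) (simp_all add: dims_polar_step)

text \<open>Squaring a defect that is at most 1/4 divides it by at least 4; this geometric rate is
  what the later sums use.\<close>

lemma gram_polar_iter:
  assumes A: "dims N n A" "norm (gram n A) \<le> \<delta>" "\<delta> \<le> 1/4"
  shows "norm (gram n (polar_iter n k A)) \<le> \<delta> * (1/4) ^ k"
proof (induction k)
  case (Suc k)
  have \<delta>: "0 \<le> \<delta>"
    using A(2) norm_ge_zero order_trans by blast
  have p: "(1/4 :: real) ^ k \<le> 1" "0 \<le> (1/4 :: real) ^ k"
    by (auto intro: power_le_one)
  have "\<delta> * (1/4) ^ k \<le> 1/4 * 1"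
    using A(3) p \<delta> by (intro mult_mono) auto
  then have "norm (gram n (polar_iter n (Suc k) A)) \<le> (\<delta> * (1/4) ^ k)\<^sup>2"
    using gram_polar_step[OF dims_polar_iter[OF A(1)] Suc] by simp
  also have "\<dots> = (\<delta> * (1/4) ^ k) * (\<delta> * (1/4) ^ k)"
    by (simp add: power2_eq_square)
  also have "\<dots> \<le> (\<delta> * (1/4) ^ k) * (1/4)"
    using \<open>\<delta> * (1/4) ^ k \<le> 1/4 * 1\<close> \<delta> p by (intro mult_left_mono) auto
  finally show ?case
    by simp
qed (use A in simp)

text \<open>The factor \<open>1 + e / 2\<close> of step \<open>k\<close>, with
  \<open>e = \<delta> / 4^k\<close>, is bounded by \<open>exp (3/4 * e)\<close>; the exponent is
  generous so that the geometric sum telescopes to \<open>\<delta> * (1 - 1 / 4^k)\<close>.\<close>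

lemma polar_iter_lipschitz:
  assumes A: "dims N n A" "norm (gram n A) \<le> \<delta>" and B: "dims N n B" "norm (gram n B) \<le> \<delta>"
    and \<delta>: "\<delta> \<le> 1/4"
  shows "norm (polar_iter n k A - polar_iter n k B) \<le> exp (\<delta> * (1 - (1/4) ^ k)) * norm (A - B)"
proof (induction k)
  case (Suc k)
  have \<delta>0: "0 \<le> \<delta>"
    using A(2) norm_ge_zero order_trans by blast
  define e where "e = \<delta> * (1/4) ^ k"
  have p: "(1/4 :: real) ^ k \<le> 1" "0 \<le> (1/4 :: real) ^ k"
    by (auto intro: power_le_one)
  have e: "e \<le> 1" "0 \<le> e"
    using \<delta> \<delta>0 p mult_mono[of \<delta> "1/4" "(1/4) ^ k" 1] by (auto simp: e_def)
  have "norm (polar_iter n (Suc k) A - polar_iter n (Suc k) B) \<le>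
      (1 + e / 2) * norm (polar_iter n k A - polar_iter n k B)"
    using polar_step_lipschitz[OF dims_polar_iter[OF A(1)] gram_polar_iter[OF A \<delta>]
        dims_polar_iter[OF B(1)] gram_polar_iter[OF B \<delta>]] e(1) by (simp add: e_def)
  also have "\<dots> \<le> exp (3/4 * e) * (exp (\<delta> * (1 - (1/4) ^ k)) * norm (A - B))"
  proof (rule mult_mono)
    have "1 + e / 2 \<le> exp (e / 2)"
      by (rule exp_ge_add_one_self)
    also have "\<dots> \<le> exp (3/4 * e)"
      using e by simp
    finally show "1 + e / 2 \<le> exp (3/4 * e)" .
  qed (use Suc in auto)
  also have "\<dots> = exp (3/4 * e + \<delta> * (1 - (1/4) ^ k)) * norm (A - B)"
    by (simp add: exp_add)
  also have "3/4 * e + \<delta> * (1 - (1/4) ^ k) = \<delta> * (1 - (1/4) ^ Suc k)"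
    by (simp add: e_def algebra_simps)
  finally show ?case .
qed simp

text \<open>The limit is taken entry by entry within a fixed size, since the space of all finitely
  supported matrices is not complete.\<close>

definition polar :: "nat \<Rightarrow> nat \<Rightarrow> 'f :: star_div_algebra fmat \<Rightarrow> 'f fmat" where
  "polar N n A = Abs_fmat (\<lambda>i j. if i < N \<and> j < n then lim (\<lambda>k. entry (polar_iter n k A) i j) else 0)"

lemma entry_polar: "entry (polar N n A) i j = (if i < N \<and> j < n then lim (\<lambda>k. entry (polar_iter n k A) i j) else 0)"
  unfolding polar_def by (subst entry_Abs_fmat[of N n]) auto

lemma dims_polar: "dims N n (polar N n A)"
  by (auto simp: dims_def entry_polar)

text \<open>Bounds the iterates uniformly, so that their increments, which are products with the
  geometrically decaying defect, are summable. The square of the norm is the inner product of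
  \<open>idm n\<close> with \<open>adj A * A\<close>.\<close>

lemma norm_dims_le:
  fixes A :: "'f :: star_div_algebra fmat"
  assumes A: "dims N n A" "norm (gram n A) \<le> 1"
  shows "norm A \<le> norm (idm n :: 'f fmat) + 1"
proof -
  let ?c = "norm (idm n :: 'f fmat)"
  have "(norm A)\<^sup>2 = inner (A * idm n) A"
    by (simp add: mult_idm[OF A(1)] dot_square_norm)
  also have "\<dots> = inner (idm n) (idm n + gram n A)"
    by (simp add: inner_mult_adj gram_def)
  also have "\<dots> \<le> ?c * norm (idm n + gram n A)"
    by (rule norm_cauchy_schwarz)
  also have "\<dots> \<le> ?c * (?c + 1)"
    using norm_triangle_ineq[of "idm n" "gram n A"] A(2) by (intro mult_left_mono) auto
  also have "\<dots> \<le> (?c + 1)\<^sup>2"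
    by (simp add: power2_eq_square algebra_simps)
  finally show ?thesis
    by (rule power2_le_imp_le) simp
qed

lemma polar_tendsto:
  fixes A :: "'f :: star_div_algebra fmat"
  assumes A: "dims N n A" "norm (gram n A) \<le> 1/4"
  shows "(\<lambda>k. polar_iter n k A) \<longlonglongrightarrow> polar N n A"
proof (rule fmat_tendsto[where N = N and n = n])
  fix i j assume ij: "i < N" "j < n"
  define f where "f k = entry (polar_iter n k A) i j" for k
  define C where "C = norm (idm n :: 'f fmat) + 1"
  have "norm (f (Suc k) - f k) \<le> C * (1/4) ^ k" for k
  proof -
    let ?X = "polar_iter n k A"
    have g: "norm (gram n ?X) \<le> 1/4 * (1/4) ^ k"
      by (rule gram_polar_iter[OF A]) simp
    moreover have "(1/4 :: real) ^ k \<le> 1"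
      by (simp add: power_le_one)
    ultimately have X: "norm ?X \<le> C"
      unfolding C_def by (intro norm_dims_le[OF dims_polar_iter[OF A(1)]]) auto
    have "norm (f (Suc k) - f k) = norm (entry (polar_iter n (Suc k) A - ?X) i j)"
      by (simp add: f_def)
    also have "\<dots> \<le> norm (polar_iter n (Suc k) A - ?X)"
      by (rule norm_entry_le)
    also have "\<dots> = 1/2 * norm (?X * gram n ?X)"
      by (simp add: polar_step_def)
    also have "\<dots> \<le> 1/2 * (C * (1/4 * (1/4) ^ k))"
      using norm_mult_ineq[of ?X "gram n ?X"] mult_mono[OF X g] by (simp add: C_def)
    also have "\<dots> \<le> C * (1/4) ^ k"
      by (simp add: C_def)
    finally show ?thesis .
  qed
  then have "summable (\<lambda>k. f (Suc k) - f k)"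
    by (rule summable_comparison_test'[rotated]) (intro summable_mult, simp add: summable_geometric)
  then have "convergent (\<lambda>n. \<Sum>k<n. f (Suc k) - f k)"
    by (rule summable_iff_convergent[THEN iffD1])
  then have "convergent (\<lambda>n. (f n - f 0) + f 0)"
    by (intro convergent_add convergent_const) (simp add: sum_lessThan_telescope)
  then have "convergent f"
    by simp
  then show "(\<lambda>k. entry (polar_iter n k A) i j) \<longlonglongrightarrow> entry (polar N n A) i j"
    using ij by (simp add: entry_polar f_def[abs_def] convergent_LIMSEQ_iff)
qed (simp_all add: dims_polar dims_polar_iter A(1))

lemma polar_orthonormal:
  assumes A: "dims N n A" "norm (gram n A) \<le> 1/4"
  shows "adj (polar N n A) * polar N n A = idm n"
proof -
  have "(\<lambda>k. gram n (polar_iter n k A)) \<longlonglongrightarrow> adj (polar N n A) * polar N n A - idm n"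
    unfolding gram_def by (intro tendsto_intros tendsto_adj polar_tendsto A)
  moreover have "(\<lambda>k. gram n (polar_iter n k A)) \<longlonglongrightarrow> 0"
  proof (rule Lim_null_comparison)
    show "\<forall>\<^sub>F k in sequentially. norm (gram n (polar_iter n k A)) \<le> 1/4 * (1/4) ^ k"
      using gram_polar_iter[OF A] by simp
    show "(\<lambda>k. 1/4 * (1/4 :: real) ^ k) \<longlonglongrightarrow> 0"
      by (intro tendsto_mult_right_zero LIMSEQ_realpow_zero) auto
  qed
  ultimately have "adj (polar N n A) * polar N n A - idm n = 0"
    by (rule LIMSEQ_unique)
  then show ?thesis
    by simp
qed

lemma polar_lipschitz:
  assumes A: "dims N n A" "norm (gram n A) \<le> \<delta>" and B: "dims N n B" "norm (gram n B) \<le> \<delta>"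
    and \<delta>: "\<delta> \<le> 1/4"
  shows "norm (polar N n A - polar N n B) \<le> exp \<delta> * norm (A - B)"
proof (rule LIMSEQ_le_const2)
  show "(\<lambda>k. norm (polar_iter n k A - polar_iter n k B)) \<longlonglongrightarrow> norm (polar N n A - polar N n B)"
    using assms by (intro tendsto_intros polar_tendsto) auto
  have \<delta>0: "0 \<le> \<delta>"
    using A(2) norm_ge_zero order_trans by blast
  have "norm (polar_iter n k A - polar_iter n k B) \<le> exp \<delta> * norm (A - B)" for k
  proof -
    have "\<delta> * (1 - (1/4) ^ k) \<le> \<delta> * 1"
      using \<delta>0 by (intro mult_left_mono) auto
    then have "exp (\<delta> * (1 - (1/4) ^ k)) * norm (A - B) \<le> exp \<delta> * norm (A - B)"
      by (intro mult_right_mono) auto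
    with polar_iter_lipschitz[OF A B \<delta>, of k] show ?thesis
      by (rule order_trans)
  qed
  then show "\<exists>K. \<forall>k\<ge>K. norm (polar_iter n k A - polar_iter n k B) \<le> exp \<delta> * norm (A - B)"
    by blast
qed

lemma polar_equivariant:
  assumes U: "dims N N U" "adj U * U = idm N" and A: "dims N n A" "norm (gram n A) \<le> 1/4"
  shows "polar N n (U * A) = U * polar N n A"
proof -
  have "polar_iter n k (U * A) = U * polar_iter n k A" for k
    by (induction k) (simp_all add: polar_step_equivariant[OF U dims_polar_iter[OF A(1)]])
  then have "(\<lambda>k. polar_iter n k (U * A)) \<longlonglongrightarrow> U * polar N n A"
    using polar_tendsto[OF A] by (simp add: tendsto_mult_left)
  moreover have "(\<lambda>k. polar_iter n k (U * A)) \<longlonglongrightarrow> polar N n (U * A)"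
    using A by (intro polar_tendsto dims_mult[OF U(1)]) (auto simp: polar_step_equivariant[OF U])
  ultimately show ?thesis
    using LIMSEQ_unique by blast
qed

section \<open>Matrices, finitely supported matrices and real coordinates\<close>

definition fm :: "'f :: zero mat \<Rightarrow> 'f fmat" where
  "fm Z = Abs_fmat (\<lambda>i j. if i < dim_row Z \<and> j < dim_col Z then Z $$ (i, j) else 0)"

definition of_fm :: "nat \<Rightarrow> nat \<Rightarrow> 'f :: zero fmat \<Rightarrow> 'f mat" where
  "of_fm N n A = mat N n (\<lambda>(i, j). entry A i j)"

lemma entry_fm: "entry (fm Z) i j = (if i < dim_row Z \<and> j < dim_col Z then Z $$ (i, j) else 0)"
  unfolding fm_def by (subst entry_Abs_fmat[of "dim_row Z" "dim_col Z"]) auto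

lemma dims_fm: "Z \<in> carrier_mat N n \<Longrightarrow> dims N n (fm Z)"
  by (auto simp: dims_def entry_fm)

lemma of_fm_carrier [simp]: "of_fm N n A \<in> carrier_mat N n"
  by (simp add: of_fm_def)

lemma fm_of_fm: "dims N n A \<Longrightarrow> fm (of_fm N n A) = A"
  by (rule fmat_eqI) (auto simp: entry_fm of_fm_def dims_def)

lemma of_fm_fm: "Z \<in> carrier_mat N n \<Longrightarrow> of_fm N n (fm Z) = Z"
  by (rule eq_matI) (auto simp: entry_fm of_fm_def)

lemma fm_inject: "Z \<in> carrier_mat N n \<Longrightarrow> W \<in> carrier_mat N n \<Longrightarrow> fm Z = fm W \<longleftrightarrow> Z = W"
  by (metis of_fm_fm)

lemma fm_mult:
  assumes "A \<in> carrier_mat N m" "B \<in> carrier_mat m n"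
  shows "fm (A * B) = fm A * (fm B :: 'f :: star_div_algebra fmat)"
proof (rule fmat_eqI)
  fix i j
  show "entry (fm (A * B)) i j = entry (fm A * fm B) i j"
  proof (cases "i < N \<and> j < n")
    case True
    with assms show ?thesis
      unfolding entry_mult[OF dims_fm[OF assms(1)]]
      by (auto simp: entry_fm scalar_prod_def atLeast0LessThan intro!: sum.cong)
  next
    case False
    with assms show ?thesis
      unfolding entry_mult[OF dims_fm[OF assms(1)]]
      by (auto simp: entry_fm intro!: sum.neutral[symmetric])
  qed
qed

lemma fm_conj_transpose: "fm (conj_transpose A) = adj (fm A)"
  by (rule fmat_eqI) (auto simp: entry_fm conj_transpose_def)

lemma fm_one: "fm (1\<^sub>m n) = idm n"
  by (rule fmat_eqI) (auto simp: entry_fm)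

lemma fm_minus:
  "A \<in> carrier_mat N n \<Longrightarrow> B \<in> carrier_mat N n \<Longrightarrow> fm (A - B) = fm A - (fm B :: 'f :: ab_group_add fmat)"
  by (rule fmat_eqI) (auto simp: entry_fm)

lemma frob_norm_fm: "A \<in> carrier_mat N n \<Longrightarrow> frob_norm A = norm (fm A)"
  by (rule power2_eq_imp_eq)
    (auto simp: frob_norm_eq norm_fmat_sum[OF dims_fm] entry_fm sum_nonneg intro!: sum.cong)

lemma conj_transpose_carrier: "A \<in> carrier_mat N n \<Longrightarrow> conj_transpose A \<in> carrier_mat n N"
  by (simp add: conj_transpose_def)

lemma stiefel_set_iff: "Z \<in> stiefel_set N n \<longleftrightarrow> Z \<in> carrier_mat N n \<and> adj (fm Z) * fm Z = idm n"
proof -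
  have "conj_transpose Z * Z = 1\<^sub>m n \<longleftrightarrow> adj (fm Z) * fm Z = idm n" if Z: "Z \<in> carrier_mat N n"
  proof -
    have "conj_transpose Z * Z = 1\<^sub>m n \<longleftrightarrow> fm (conj_transpose Z * Z) = fm (1\<^sub>m n)"
      using Z conj_transpose_carrier[OF Z] by (intro fm_inject[symmetric]) auto
    then show ?thesis
      by (simp add: fm_mult[OF conj_transpose_carrier[OF Z] Z] fm_conj_transpose fm_one)
  qed
  then show ?thesis
    by (auto simp: stiefel_set_def)
qed

lemma unitary_group_iff: "U \<in> unitary_group N \<longleftrightarrow>
  U \<in> carrier_mat N N \<and> adj (fm U) * fm U = idm N \<and> fm U * adj (fm U) = idm N"
proof -
  have "conj_transpose U * U = 1\<^sub>m N \<longleftrightarrow> adj (fm U) * fm U = idm N"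
    "U * conj_transpose U = 1\<^sub>m N \<longleftrightarrow> fm U * adj (fm U) = idm N" if U: "U \<in> carrier_mat N N"
  proof -
    note c = conj_transpose_carrier[OF U]
    have "conj_transpose U * U = 1\<^sub>m N \<longleftrightarrow> fm (conj_transpose U * U) = fm (1\<^sub>m N)"
      "U * conj_transpose U = 1\<^sub>m N \<longleftrightarrow> fm (U * conj_transpose U) = fm (1\<^sub>m N)"
      using U c by (intro fm_inject[symmetric]; auto)+
    then show "conj_transpose U * U = 1\<^sub>m N \<longleftrightarrow> adj (fm U) * fm U = idm N"
      "U * conj_transpose U = 1\<^sub>m N \<longleftrightarrow> fm U * adj (fm U) = idm N"
      by (simp_all add: fm_mult[OF c U] fm_mult[OF U c] fm_conj_transpose fm_one)
  qed
  then show ?thesis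
    by (auto simp: unitary_group_def)
qed

section \<open>Real coordinates of matrices over the scalars\<close>

definition basis_enum :: "nat \<Rightarrow> 'f :: euclidean_space" where
  "basis_enum = (SOME f. bij_betw f {..<DIM('f)} Basis)"

lemma basis_enum: "bij_betw (basis_enum :: nat \<Rightarrow> 'f) {..<DIM('f :: euclidean_space)} Basis"
proof -
  have "\<exists>f. bij_betw f {..<DIM('f)} (Basis :: 'f set)"
    using ex_bij_betw_nat_finite[OF finite_Basis] by (simp add: atLeast0LessThan)
  then show ?thesis
    unfolding basis_enum_def by (rule someI_ex)
qed

lemma inner_basis_enum:
  assumes "b < DIM('f)" "c < DIM('f)"
  shows "inner (basis_enum b) (basis_enum c :: 'f :: euclidean_space) = (if b = c then 1 else 0)"
proof -
  have "basis_enum b \<in> (Basis :: 'f set)" "basis_enum c \<in> (Basis :: 'f set)"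
    using basis_enum[where 'f = 'f] assms by (auto simp: bij_betw_def)
  moreover have "(basis_enum b = (basis_enum c :: 'f)) = (b = c)"
    using basis_enum[where 'f = 'f] assms by (auto simp: bij_betw_def inj_on_def)
  ultimately show ?thesis
    by (simp add: inner_Basis)
qed

lemma basis_enum_expansion: "(\<Sum>b<DIM('f). inner x (basis_enum b) *\<^sub>R basis_enum b) = (x :: 'f :: euclidean_space)"
proof -
  have "(\<Sum>b<DIM('f). inner x (basis_enum b) *\<^sub>R basis_enum b) = (\<Sum>u\<in>Basis. inner x u *\<^sub>R u)"
    by (rule sum.reindex_bij_betw[OF basis_enum])
  then show ?thesis
    by (simp add: euclidean_representation)
qed

lemma norm_sum_basis_enum: "(norm (\<Sum>b<DIM('f). t b *\<^sub>R (basis_enum b :: 'f :: euclidean_space)))\<^sup>2 = (\<Sum>b<DIM('f). (t b)\<^sup>2)"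
proof -
  let ?x = "\<Sum>b<DIM('f). t b *\<^sub>R (basis_enum b :: 'f)"
  have "inner ?x (basis_enum c) = t c" if "c < DIM('f)" for c
  proof -
    have "inner ?x (basis_enum c) = (\<Sum>b<DIM('f). if b = c then t b else 0)"
      unfolding inner_sum_left by (intro sum.cong) (use that in \<open>auto simp: inner_basis_enum\<close>)
    with that show ?thesis
      by simp
  qed
  moreover have "inner ?x ?x = (\<Sum>c<DIM('f). inner ?x (t c *\<^sub>R basis_enum c))"
    by (rule inner_sum_right)
  ultimately have "inner ?x ?x = (\<Sum>c<DIM('f). t c * t c)"
    by simp
  then show ?thesis
    by (simp add: dot_square_norm power2_eq_square)
qed

lemma sum_lessThan_mult: "(\<Sum>k<a * b. g k) = (\<Sum>i<a. \<Sum>j<b. g (i * b + j :: nat))"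
proof -
  have "(\<Sum>i<a. \<Sum>j<b. g (i * b + j)) = (\<Sum>i<a. sum g {i * b..<i * b + b})"
    by (rule sum.cong[OF refl], rule sum.reindex_bij_witness[where i = "\<lambda>k. k - i * b" and j = "\<lambda>j. i * b + j" for i])
      auto
  then show ?thesis
    by (simp add: sum.nat_group)
qed

text \<open>The real coordinate with index \<open>(i * n + j) * d + b\<close> is the coefficient of the basis
  element number \<open>b\<close> in the matrix entry \<open>(i, j)\<close>, where \<open>d\<close> is the real dimension of the
  scalars.\<close>

definition to_fm :: "nat \<Rightarrow> nat \<Rightarrow> (nat \<Rightarrow> real) \<Rightarrow> 'f :: euclidean_space fmat" where
  "to_fm N n x = Abs_fmat (\<lambda>i j. if i < N \<and> j < n
     then \<Sum>b<DIM('f). x ((i * n + j) * DIM('f) + b) *\<^sub>R basis_enum b else 0)"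

definition coords :: "nat \<Rightarrow> nat \<Rightarrow> 'f :: euclidean_space fmat \<Rightarrow> nat \<Rightarrow> real" where
  "coords N n A = (\<lambda>k\<in>{..<N * n * DIM('f)}.
     inner (entry A (k div DIM('f) div n) (k div DIM('f) mod n)) (basis_enum (k mod DIM('f))))"

lemma entry_to_fm: "entry (to_fm N n x :: 'f :: euclidean_space fmat) i j = (if i < N \<and> j < n
     then \<Sum>b<DIM('f). x ((i * n + j) * DIM('f) + b) *\<^sub>R basis_enum b else 0)"
  unfolding to_fm_def by (subst entry_Abs_fmat[of N n]) auto

lemma dims_to_fm: "dims N n (to_fm N n x)"
  by (auto simp: dims_def entry_to_fm)

lemma coords_in: "coords N n (A :: 'f :: euclidean_space fmat) \<in> coord_space (N * n * DIM('f))"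
  by (simp add: coords_def)

lemma to_fm_coords:
  assumes "dims N n A"
  shows "to_fm N n (coords N n A) = (A :: 'f :: euclidean_space fmat)"
proof (rule fmat_eqI)
  fix i j
  let ?d = "DIM('f)"
  show "entry (to_fm N n (coords N n A)) i j = entry A i j"
  proof (cases "i < N \<and> j < n")
    case True
    have "coords N n A ((i * n + j) * ?d + b) = inner (entry A i j) (basis_enum b)" if b: "b < ?d" for b
    proof -
      have "(i * n + j) * ?d + b < (i * n + j + 1) * ?d"
        using b by simp
      also have "\<dots> \<le> (i * n + n) * ?d"
        using True by (intro mult_right_mono) auto
      also have "\<dots> = (i + 1) * n * ?d"
        by (simp add: algebra_simps)
      also have "\<dots> \<le> N * n * ?d"
        using True by (intro mult_right_mono) auto
      finally have "(i * n + j) * ?d + b < N * n * ?d" .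
      moreover have "((i * n + j) * ?d + b) div ?d = i * n + j" "((i * n + j) * ?d + b) mod ?d = b"
        using b by simp_all
      moreover have "(i * n + j) div n = i" "(i * n + j) mod n = j"
        using True by simp_all
      ultimately show ?thesis
        by (simp add: coords_def)
    qed
    with True show ?thesis
      by (simp add: entry_to_fm basis_enum_expansion)
  next
    case False
    with assms show ?thesis
      by (auto simp: entry_to_fm dims_def)
  qed
qed

lemma to_fm_vplus:
  "to_fm N n (vplus (N * n * DIM('f)) x y) = to_fm N n x + (to_fm N n y :: 'f :: euclidean_space fmat)"
proof (rule fmat_eqI)
  fix i j
  let ?d = "DIM('f)"
  have "(i * n + j) * ?d + b < N * n * ?d" if "i < N" "j < n" "b < ?d" for b
  proof -
    have "(i * n + j) * ?d + b < (i * n + j + 1) * ?d"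
      using that by simp
    also have "\<dots> \<le> (i * n + n) * ?d"
      using that by (intro mult_right_mono) auto
    also have "\<dots> = (i + 1) * n * ?d"
      by (simp add: algebra_simps)
    also have "\<dots> \<le> N * n * ?d"
      using that by (intro mult_right_mono) auto
    finally show ?thesis .
  qed
  then show "entry (to_fm N n (vplus (N * n * ?d) x y)) i j = entry (to_fm N n x + (to_fm N n y :: 'f fmat)) i j"
    by (auto simp: entry_to_fm vplus_def scaleR_add_left sum.distrib[symmetric] intro!: sum.cong)
qed

lemma norm_to_fm_diff:
  "norm (to_fm N n x - (to_fm N n y :: 'f :: euclidean_space fmat)) = vdist (N * n * DIM('f)) x y"
proof (rule power2_eq_imp_eq)
  let ?d = "DIM('f)"
  have "(norm (to_fm N n x - (to_fm N n y :: 'f fmat)))\<^sup>2 =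
      (\<Sum>i<N. \<Sum>j<n. (norm (entry (to_fm N n x - (to_fm N n y :: 'f fmat)) i j))\<^sup>2)"
    by (intro norm_fmat_sum dims_closed dims_to_fm)
  also have "\<dots> = (\<Sum>i<N. \<Sum>j<n. \<Sum>b<?d. (x ((i * n + j) * ?d + b) - y ((i * n + j) * ?d + b))\<^sup>2)"
    by (intro sum.cong refl)
      (simp add: entry_to_fm norm_sum_basis_enum flip: sum_subtractf scaleR_diff_left)
  also have "\<dots> = (\<Sum>k<N * n * ?d. (x k - y k)\<^sup>2)"
    by (simp add: sum_lessThan_mult[where a = "N * n" and b = ?d] sum_lessThan_mult[where a = N and b = n])
  finally show "(norm (to_fm N n x - (to_fm N n y :: 'f fmat)))\<^sup>2 = (vdist (N * n * ?d) x y)\<^sup>2"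
    by (simp add: vdist_sqrt sum_nonneg)
qed (simp_all add: vdist_def)

lemma to_fm_zero: "to_fm N n (\<lambda>_. 0) = 0"
  by (rule fmat_eqI) (simp add: entry_to_fm)

lemma norm_to_fm:
  "(norm (to_fm N n x :: 'f :: euclidean_space fmat))\<^sup>2 = (\<Sum>k<N * n * DIM('f). (x k)\<^sup>2)"
  using norm_to_fm_diff[of N n x "\<lambda>_. 0", where 'f = 'f]
  by (simp add: to_fm_zero vdist_sqrt sum_nonneg)

lemma coords_to_fm:
  assumes "x \<in> coord_space (N * n * DIM('f))"
  shows "coords N n (to_fm N n x :: 'f :: euclidean_space fmat) = x"
proof -
  let ?y = "coords N n (to_fm N n x :: 'f fmat)"
  have "vdist (N * n * DIM('f)) ?y x = norm (to_fm N n ?y - (to_fm N n x :: 'f fmat))"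
    by (simp add: norm_to_fm_diff)
  also have "\<dots> = 0"
    by (simp add: to_fm_coords[OF dims_to_fm])
  finally show ?thesis
    using Metric_space.zero[OF Metric_space_vdist coords_in assms] by simp
qed

section \<open>Measurability of matrix-valued maps and the unitary action\<close>

definition measurable_fm :: "'w measure \<Rightarrow> ('w \<Rightarrow> 'f :: star_div_algebra fmat) \<Rightarrow> bool" where
  "measurable_fm M F \<longleftrightarrow> (\<forall>i j. (\<lambda>w. entry (F w) i j) \<in> borel_measurable M)"

lemma measurable_star: "(star :: 'f :: star_div_algebra \<Rightarrow> 'f) \<in> borel_measurable borel"
proof (rule borel_measurable_continuous_onI)
  show "continuous_on UNIV (star :: 'f \<Rightarrow> 'f)"
    unfolding continuous_on_iff dist_norm star_minus[symmetric] norm_star by blast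
qed

lemma measurable_fm_const: "measurable_fm M (\<lambda>_. A)"
  by (simp add: measurable_fm_def)

lemma measurable_fm_diff:
  "measurable_fm M F \<Longrightarrow> measurable_fm M G \<Longrightarrow> measurable_fm M (\<lambda>w. F w - G w)"
  by (auto simp: measurable_fm_def intro!: borel_measurable_diff)

lemma measurable_fm_scaleR:
  "measurable_fm M F \<Longrightarrow> r \<in> borel_measurable M \<Longrightarrow> measurable_fm M (\<lambda>w. r w *\<^sub>R F w)"
  by (auto simp: measurable_fm_def intro!: borel_measurable_scaleR)

lemma measurable_fm_adj: "measurable_fm M F \<Longrightarrow> measurable_fm M (\<lambda>w. adj (F w))"
  unfolding measurable_fm_def by (auto intro: measurable_compose[OF _ measurable_star])

lemma measurable_fm_mult:
  assumes "measurable_fm M F" "measurable_fm M G" "\<And>w. w \<in> space M \<Longrightarrow> dims N m (F w)"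
  shows "measurable_fm M (\<lambda>w. F w * (G w :: 'f :: star_div_algebra fmat))"
  unfolding measurable_fm_def
proof (intro allI)
  fix i j
  have [measurable]: "(\<lambda>w. entry (F w) i j) \<in> borel_measurable M" "(\<lambda>w. entry (G w) i j) \<in> borel_measurable M" for i j
    using assms by (auto simp: measurable_fm_def)
  have "(\<lambda>w. \<Sum>k<m. entry (F w) i k * entry (G w) k j) \<in> borel_measurable M"
    by (intro borel_measurable_sum borel_measurable_times) measurable
  then show "(\<lambda>w. entry (F w * G w) i j) \<in> borel_measurable M"
    by (rule measurable_cong[THEN iffD2, rotated]) (simp add: entry_mult[OF assms(3)])
qed

lemma measurable_fm_norm:
  assumes "measurable_fm M F" "\<And>w. w \<in> space M \<Longrightarrow> dims N m (F w)"
  shows "(\<lambda>w. norm (F w :: 'f :: star_div_algebra fmat)) \<in> borel_measurable M"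
proof -
  have [measurable]: "(\<lambda>w. entry (F w) i j) \<in> borel_measurable M" for i j
    using assms by (auto simp: measurable_fm_def)
  have "(\<lambda>w. sqrt (\<Sum>i<N. \<Sum>j<m. (norm (entry (F w) i j))\<^sup>2)) \<in> borel_measurable M"
    by measurable
  then show ?thesis
  proof (rule measurable_cong[THEN iffD2, rotated])
    fix w assume "w \<in> space M"
    from norm_fmat_sum[OF assms(2)[OF this]]
    show "norm (F w) = sqrt (\<Sum>i<N. \<Sum>j<m. (norm (entry (F w) i j))\<^sup>2)"
      by (simp flip: \<open>(norm (F w))\<^sup>2 = _\<close>)
  qed
qed

lemma measurable_fm_gram:
  assumes F: "measurable_fm M F" "\<And>w. w \<in> space M \<Longrightarrow> dims N n (F w)"
  shows "measurable_fm M (\<lambda>w. gram n (F w))"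
  unfolding gram_def
  by (intro measurable_fm_diff measurable_fm_mult[where N = n and m = N] measurable_fm_adj
      measurable_fm_const F dims_adj) auto

lemma measurable_fm_polar_step:
  assumes F: "measurable_fm M F" "\<And>w. w \<in> space M \<Longrightarrow> dims N n (F w)"
  shows "measurable_fm M (\<lambda>w. polar_step n (F w))"
  unfolding polar_step_def
  by (intro measurable_fm_diff measurable_fm_scaleR measurable_fm_mult[where N = N and m = n]
      measurable_fm_gram[where N = N] F) auto

lemma measurable_fm_polar:
  assumes F: "measurable_fm M F" "\<And>w. w \<in> space M \<Longrightarrow> dims N n (F w)"
  shows "measurable_fm M (\<lambda>w. polar N n (F w))"
proof -
  have iter: "measurable_fm M (\<lambda>w. polar_iter n k (F w))" for k
  proof (induction k)
    case (Suc k)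
    show ?case
      using measurable_fm_polar_step[OF Suc, of N] F(2) by (simp add: dims_polar_iter)
  qed (use F in simp)
  show ?thesis
    unfolding measurable_fm_def
  proof (intro allI)
    fix i j
    have [measurable]: "(\<lambda>w. entry (polar_iter n k (F w)) i j) \<in> borel_measurable M" for k
      using iter by (simp add: measurable_fm_def)
    show "(\<lambda>w. entry (polar N n (F w)) i j) \<in> borel_measurable M"
      by (cases "i < N \<and> j < n") (simp_all add: entry_polar)
  qed
qed

lemma measurable_fm_to_fm: "measurable_fm (gauss (N * n * DIM('f))) (to_fm N n :: _ \<Rightarrow> 'f :: star_div_algebra fmat)"
  unfolding measurable_fm_def
proof (intro allI)
  fix i j
  let ?d = "DIM('f)"
  show "(\<lambda>x. entry (to_fm N n x :: 'f fmat) i j) \<in> borel_measurable (gauss (N * n * ?d))"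
  proof (cases "i < N \<and> j < n")
    case True
    have "(i * n + j) * ?d + b < N * n * ?d" if "b < ?d" for b
    proof -
      have "(i * n + j) * ?d + b < (i * n + j + 1) * ?d"
        using that by simp
      also have "\<dots> \<le> (i * n + n) * ?d"
        using True by (intro mult_right_mono) auto
      also have "\<dots> = (i + 1) * n * ?d"
        by (simp add: algebra_simps)
      also have "\<dots> \<le> N * n * ?d"
        using True by (intro mult_right_mono) auto
      finally show ?thesis .
    qed
    then have "(\<lambda>x. \<Sum>b<?d. x ((i * n + j) * ?d + b) *\<^sub>R (basis_enum b :: 'f)) \<in> borel_measurable (gauss (N * n * ?d))"
      by (intro borel_measurable_sum borel_measurable_scaleR measurable_gauss_coord) auto
    with True show ?thesis
      by (simp add: entry_to_fm)
  next
    case False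
    then have "(\<lambda>x. entry (to_fm N n x :: 'f fmat) i j) = (\<lambda>_. 0)"
      by (auto simp: entry_to_fm)
    then show ?thesis
      by simp
  qed
qed

lemma measurable_coords:
  assumes "measurable_fm M (F :: _ \<Rightarrow> 'f :: star_div_algebra fmat)"
  shows "(\<lambda>w. coords N n (F w)) \<in> M \<rightarrow>\<^sub>M gauss (N * n * DIM('f))"
proof (rule measurable_into_gauss)
  have [measurable]: "(\<lambda>w. entry (F w) i j) \<in> borel_measurable M" for i j
    using assms by (simp add: measurable_fm_def)
  show "(\<lambda>w. coords N n (F w) k) \<in> borel_measurable M" if "k < N * n * DIM('f)" for k
    using that by (simp add: coords_def)
qed (simp add: coords_in)

definition unitary_action :: "nat \<Rightarrow> nat \<Rightarrow> 'f :: star_div_algebra fmat \<Rightarrow> (nat \<Rightarrow> real) \<Rightarrow> nat \<Rightarrow> real" where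
  "unitary_action N n u x = coords N n (u * to_fm N n x)"

lemma to_fm_unitary_action: "dims N N u \<Longrightarrow> to_fm N n (unitary_action N n u x) = u * to_fm N n x"
  unfolding unitary_action_def by (intro to_fm_coords dims_mult[OF _ dims_to_fm])

lemma norm_mult_unitary:
  assumes "adj u * u = idm N" "dims N n A"
  shows "norm (u * A) = norm A"
proof -
  have "adj u * (u * A) = A"
    using assms by (simp add: mult.assoc[symmetric] idm_mult)
  then show ?thesis
    by (simp add: norm_eq_sqrt_inner inner_mult_adj)
qed

text \<open>In real coordinates left multiplication by a unitary is additive, isometric and, through
  \<open>adj u\<close>, surjective, so \<open>gauss_isometry\<close> applies.\<close>

lemma gauss_unitary_action:
  fixes u :: "'f :: star_div_algebra fmat" and n :: nat
  assumes u: "dims N N u" "adj u * u = idm N" "u * adj u = idm N"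
  defines "m \<equiv> N * n * DIM('f)"
  shows "unitary_action N n u \<in> gauss m \<rightarrow>\<^sub>M gauss m"
    "distr (gauss m) (gauss m) (unitary_action N n u) = gauss m"
proof -
  let ?L = "unitary_action N n u"
  show meas: "?L \<in> gauss m \<rightarrow>\<^sub>M gauss m"
    unfolding unitary_action_def m_def
    by (rule measurable_coords, rule measurable_fm_mult[OF measurable_fm_const measurable_fm_to_fm u(1)])
  show "distr (gauss m) (gauss m) ?L = gauss m"
  proof (rule gauss_isometry[OF meas])
    fix x y assume "x \<in> coord_space m" "y \<in> coord_space m"
    have "to_fm N n (?L (vplus m x y)) = (to_fm N n (vplus m (?L x) (?L y)) :: 'f fmat)"
      unfolding to_fm_unitary_action[OF u(1)] m_def to_fm_vplus by (simp add: distrib_left)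
    then have "coords N n (to_fm N n (?L (vplus m x y)) :: 'f fmat) =
        coords N n (to_fm N n (vplus m (?L x) (?L y)) :: 'f fmat)"
      by simp
    then show "?L (vplus m x y) = vplus m (?L x) (?L y)"
      unfolding m_def by (subst (asm) (1 2) coords_to_fm) (simp_all add: unitary_action_def coords_in)
  next
    fix y assume y: "y \<in> coord_space m"
    define x where "x = unitary_action N n (adj u) y"
    have "?L x = coords N n (u * (adj u * (to_fm N n y :: 'f fmat)))"
      unfolding unitary_action_def[of N n u] x_def using u(1) by (subst to_fm_unitary_action) (auto intro: dims_adj)
    also have "\<dots> = y"
      using u y by (simp add: mult.assoc[symmetric] idm_mult[OF dims_to_fm] coords_to_fm m_def)
    finally show "\<exists>x\<in>coord_space m. ?L x = y"
      by (intro bexI[of _ x]) (simp_all add: x_def unitary_action_def coords_in m_def)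
  next
    fix x assume x: "x \<in> coord_space m"
    have "(\<Sum>i<m. (?L x i)\<^sup>2) = (norm (u * (to_fm N n x :: 'f fmat)))\<^sup>2"
      unfolding m_def norm_to_fm[symmetric, where 'f = 'f] to_fm_unitary_action[OF u(1)] ..
    also have "\<dots> = (\<Sum>i<m. (x i)\<^sup>2)"
      unfolding m_def norm_mult_unitary[OF u(2) dims_to_fm] by (rule norm_to_fm)
    finally show "(\<Sum>i<m. (?L x i)\<^sup>2) = (\<Sum>i<m. (x i)\<^sup>2)" .
  qed
qed

section \<open>Stiefel manifolds as homogeneous spaces\<close>

lemma stiefel_dist_fm:
  assumes "Z \<in> stiefel_set N n" "W \<in> stiefel_set N n"
  shows "stiefel_dist N n Z W = norm (fm Z - fm W)"
proof -
  have c: "Z \<in> carrier_mat N n" "W \<in> carrier_mat N n" "Z - W \<in> carrier_mat N n"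
    using assms by (auto simp: stiefel_set_iff)
  show ?thesis
    using assms by (simp add: stiefel_dist_def frob_norm_fm[OF c(3)] fm_minus[OF c(1,2)])
qed

lemma Metric_space_stiefel: "Metric_space (stiefel_set N n) (stiefel_dist N n)"
proof
  have nn: "frob_norm (Z - W) = norm (fm Z - fm W)" if "Z \<in> stiefel_set N n" "W \<in> stiefel_set N n" for Z W :: "'a mat"
    using that stiefel_dist_fm[OF that] by (simp add: stiefel_dist_def)
  show "0 \<le> stiefel_dist N n Z W" for Z W :: "'a mat"
    by (simp add: stiefel_dist_def nn)
  show "stiefel_dist N n Z W = stiefel_dist N n W Z" for Z W :: "'a mat"
    by (simp add: stiefel_dist_def nn norm_minus_commute)
  show "stiefel_dist N n Z W = 0 \<longleftrightarrow> Z = W" if "Z \<in> stiefel_set N n" "W \<in> stiefel_set N n" for Z W :: "'a mat"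
    using that by (simp add: stiefel_dist_fm fm_inject[of _ N n] stiefel_set_iff)
  show "stiefel_dist N n X Z \<le> stiefel_dist N n X Y + stiefel_dist N n Y Z"
    if "X \<in> stiefel_set N n" "Y \<in> stiefel_set N n" "Z \<in> stiefel_set N n" for X Y Z :: "'a mat"
    using that norm_triangle_ineq[of "fm X - fm Y" "fm Y - fm Z"] by (simp add: stiefel_dist_fm)
qed

lemma of_fm_stiefel: "dims N n A \<Longrightarrow> adj A * A = idm n \<Longrightarrow> of_fm N n A \<in> stiefel_set N n"
  by (simp add: stiefel_set_iff fm_of_fm)

lemma stiefel_set_not_empty:
  assumes "n \<le> N"
  shows "stiefel_set N n \<noteq> ({} :: 'f :: star_div_algebra mat set)"
proof -
  have "of_fm N n (idm n :: 'f fmat) \<in> stiefel_set N n"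
    using assms dims_mono[OF dims_idm] by (intro of_fm_stiefel) (auto simp: adj_idm idm_mult[OF dims_idm])
  then show ?thesis
    by blast
qed

lemma sep_metric_stiefel:
  assumes "n \<le> N"
  shows "\<exists>c. sep_metric (stiefel_set N n :: 'f :: star_div_algebra mat set) (stiefel_dist N n) c"
proof (rule sep_metric_coords[OF Metric_space_stiefel stiefel_set_not_empty[OF assms]])
  fix X Y :: "'f mat" assume XY: "X \<in> stiefel_set N n" "Y \<in> stiefel_set N n"
  have d: "dims N n (fm X)" "dims N n (fm Y)"
    using XY by (simp_all add: stiefel_set_iff dims_fm)
  have "stiefel_dist N n X Y = vdist (N * n * DIM('f)) (coords N n (fm X)) (coords N n (fm Y))"
    by (simp add: stiefel_dist_fm[OF XY] to_fm_coords d flip: norm_to_fm_diff[where 'f = 'f])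
  then show "stiefel_dist N n X Y \<le>
      (\<Sum>i<N * n * DIM('f). \<bar>coords N n (fm X) i - coords N n (fm Y) i\<bar>)"
    using vdist_le_sum[of "N * n * DIM('f)" "coords N n (fm X)" "coords N n (fm Y)"] by simp
qed

abbreviation stiefel_borel :: "nat \<Rightarrow> nat \<Rightarrow> 'f :: star_div_algebra mat measure" where
  "stiefel_borel N n \<equiv> borel_measure_of (Metric_space.mtopology (stiefel_set N n) (stiefel_dist N n))"

lemma space_stiefel_borel: "space (stiefel_borel N n) = stiefel_set N n"
proof -
  interpret Metric_space "stiefel_set N n" "stiefel_dist N n" by (rule Metric_space_stiefel)
  show ?thesis by simp
qed

lemma measurable_into_stiefel:
  assumes nN: "n \<le> N" and h: "h \<in> space M \<rightarrow> stiefel_set N n" and meas: "measurable_fm M (\<lambda>w. fm (h w))"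
  shows "h \<in> M \<rightarrow>\<^sub>M stiefel_borel N n"
proof -
  obtain c where "sep_metric (stiefel_set N n :: 'b mat set) (stiefel_dist N n) c"
    using sep_metric_stiefel[OF nN] by blast
  then interpret sep_metric "stiefel_set N n :: 'b mat set" "stiefel_dist N n" c .
  show ?thesis
  proof (rule measurable_into[OF h])
    fix i
    have d: "dims N n (fm (h w))" if "w \<in> space M" for w
      using h that by (auto simp: stiefel_set_iff intro!: dims_fm)
    have "(\<lambda>w. norm (fm (h w) - fm (c i))) \<in> borel_measurable M"
      using c_in[of i] by (intro measurable_fm_norm[where N = N and m = n] measurable_fm_diff meas
          measurable_fm_const dims_closed d dims_fm) (auto simp: stiefel_set_iff)
    then show "(\<lambda>w. stiefel_dist N n (h w) (c i)) \<in> borel_measurable M"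
      using h c_in[of i] by (subst measurable_cong[of M _ "\<lambda>w. norm (fm (h w) - fm (c i))"])
        (auto intro!: stiefel_dist_fm)
  qed
qed

lemma unitary_mult_stiefel:
  assumes U: "U \<in> unitary_group N" and Z: "Z \<in> stiefel_set N n"
  shows "U * Z \<in> stiefel_set N n" "fm (U * Z) = fm U * fm Z"
proof -
  have c: "U \<in> carrier_mat N N" "Z \<in> carrier_mat N n"
    using U Z by (simp_all add: stiefel_set_iff unitary_group_iff)
  show fm: "fm (U * Z) = fm U * fm Z"
    by (rule fm_mult[OF c])
  have "adj (fm U * fm Z) * (fm U * fm Z) = adj (fm Z) * ((adj (fm U) * fm U) * fm Z)"
    by (simp add: adj_mult mult.assoc)
  also have "\<dots> = idm n"
    using U Z by (simp add: unitary_group_iff stiefel_set_iff idm_mult[OF dims_fm[of Z N n]])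
  finally show "U * Z \<in> stiefel_set N n"
    using c by (simp add: stiefel_set_iff fm)
qed

lemma stiefel_dist_unitary:
  assumes U: "U \<in> unitary_group N" and Z: "Z \<in> stiefel_set N n" and W: "W \<in> stiefel_set N n"
  shows "stiefel_dist N n (U * Z) (U * W) = stiefel_dist N n Z W"
proof -
  have "norm (fm U * (fm Z - fm W)) = norm (fm Z - fm W)"
    using U Z W by (intro norm_mult_unitary[where N = N and n = n] dims_closed dims_fm)
      (simp_all add: unitary_group_iff stiefel_set_iff)
  then show ?thesis
    using unitary_mult_stiefel[OF U Z] unitary_mult_stiefel[OF U W] Z W
    by (simp add: stiefel_dist_fm algebra_simps)
qed

lemma measurable_unitary_mult:
  assumes "U \<in> unitary_group N"
  shows "(\<lambda>Z. U * Z) \<in> stiefel_borel N n \<rightarrow>\<^sub>M stiefel_borel N n"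
  by (rule lipschitz_measurable[OF Metric_space_stiefel Metric_space_stiefel, where K = 1])
    (use unitary_mult_stiefel[OF assms] stiefel_dist_unitary[OF assms] in auto)

section \<open>Transitivity of the unitary action\<close>

definition scal :: "'f :: star_div_algebra \<Rightarrow> 'f fmat" where
  "scal a = Abs_fmat (\<lambda>i j. if i = 0 \<and> j = 0 then a else 0)"

lemma entry_scal [simp]: "entry (scal a) i j = (if i = 0 \<and> j = 0 then a else 0)"
  unfolding scal_def by (subst entry_Abs_fmat[of 1 1]) auto

lemma dims_scal: "dims 1 1 (scal a)"
  by (auto simp: dims_def)

lemma dims_1_1_scal: "dims 1 1 A \<Longrightarrow> A = scal (entry A 0 0)"
  by (rule fmat_eqI) (auto simp: dims_def Suc_le_eq)

lemma scal_mult: "scal a * scal b = scal (a * b)"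
  by (rule fmat_eqI) (simp add: entry_mult[OF dims_scal])

lemma scal_one: "scal 1 = idm 1"
  by (rule fmat_eqI) auto

lemma adj_mult_self_eq_0: "adj A * A = 0 \<longleftrightarrow> A = (0 :: 'f :: star_div_algebra fmat)"
proof
  assume *: "adj A * A = 0"
  obtain m where "dims m m A"
    using dims_ex by blast
  then have "inner A A = inner (A * idm m) A"
    by (simp add: mult_idm)
  also have "\<dots> = 0"
    by (simp add: inner_mult_adj *)
  finally show "A = 0"
    by simp
qed simp

text \<open>Over a noncommutative field the reflection exchanging two unit vectors is replaced by
  \<open>1 - w \<alpha> w\<^sup>*\<close> with \<open>w = x - y\<close> and \<open>\<alpha> = (1 - y\<^sup>* x)\<^bsup>-1\<^esup>\<close>, which maps \<open>x\<close> to \<open>y\<close> and is unitary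
  because \<open>\<alpha>\<^bsup>-1\<^esup> + (\<alpha>\<^bsup>-1\<^esup>)\<^sup>* = w\<^sup>* w\<close>.\<close>

lemma quasi_reflection:
  fixes x y :: "'f :: star_div_algebra fmat"
  assumes x: "dims N 1 x" "adj x * x = idm 1" and y: "dims N 1 y" "adj y * y = idm 1"
  shows "\<exists>h. dims N N h \<and> adj h * h = idm N \<and> h * adj h = idm N \<and> h * x = y \<and>
    (\<forall>v. dims N 1 v \<and> adj (x - y) * v = 0 \<longrightarrow> h * v = v)"
proof (cases "x = y")
  case True
  with x show ?thesis
    by (intro exI[of _ "idm N"]) (auto simp: adj_idm dims_idm idm_mult[OF dims_idm] idm_mult[OF x(1)] idm_mult)
next
  case False
  define w where "w = x - y"
  define \<beta> where "\<beta> = idm 1 - adj y * x"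
  have w: "dims N 1 w" "dims 1 N (adj w)"
    using x y by (auto simp: w_def intro!: dims_adj)
  have \<beta>: "dims 1 1 \<beta>"
    unfolding \<beta>_def by (intro dims_closed dims_idm dims_mult[OF dims_adj[OF y(1)] x(1)])
  have ww: "adj w * w = \<beta> + adj \<beta>"
    by (simp add: w_def \<beta>_def adj_simps adj_mult adj_idm algebra_simps x(2) y(2))
  define b where "b = entry \<beta> 0 0"
  have \<beta>_scal: "\<beta> = scal b"
    unfolding b_def by (rule dims_1_1_scal[OF \<beta>])
  \<comment> \<open>If \<open>adj y * x\<close> were the identity, then
    \<open>adj w * w = \<beta> + adj \<beta>\<close> would vanish and \<open>x\<close> would equal
    \<open>y\<close>.\<close>
  have "b \<noteq> 0"
  proof
    assume "b = 0"
    have "\<beta> = 0"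
      unfolding \<beta>_scal \<open>b = 0\<close> by (rule fmat_eqI) simp
    then have "adj w * w = 0"
      using ww adj_simps(3)[of 0 0] by simp
    with False show False
      by (simp add: adj_mult_self_eq_0 w_def)
  qed
  define \<alpha> where "\<alpha> = scal (inverse b)"
  have \<alpha>: "dims 1 1 \<alpha>"
    unfolding \<alpha>_def by (rule dims_scal)
  have \<alpha>\<beta>: "\<alpha> * \<beta> = idm 1" "\<beta> * \<alpha> = idm 1"
    unfolding \<alpha>_def \<beta>_scal scal_mult scal_one[symmetric] using \<open>b \<noteq> 0\<close> by simp_all
  have \<alpha>\<beta>': "adj \<beta> * adj \<alpha> = idm 1" "adj \<alpha> * adj \<beta> = idm 1"
    using \<alpha>\<beta> by (metis adj_mult adj_idm)+
  define h where "h = idm N - w * (\<alpha> * adj w)"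
  have h: "dims N N h"
    unfolding h_def by (intro dims_closed dims_idm dims_mult[OF w(1) dims_mult[OF \<alpha> w(2)]])
  have adj_h: "adj h = idm N - w * (adj \<alpha> * adj w)"
    by (simp add: h_def adj_simps adj_mult adj_idm mult.assoc)
  have iw: "idm N * w = w" "adj w * idm N = adj w"
    by (simp_all add: idm_mult[OF w(1)] mult_idm[OF w(2)])
  have i\<alpha>: "idm 1 * \<alpha> = \<alpha>" "idm 1 * adj \<alpha> = adj \<alpha>"
    by (rule idm_mult[OF \<alpha>], rule idm_mult[OF dims_adj[OF \<alpha>]])
  \<comment> \<open>This and its mirror image \<open>2\<close> cancel the mixed terms in
    \<open>adj h * h\<close> and in \<open>h * adj h\<close>; they combine
    \<open>adj w * w = \<beta> + adj \<beta>\<close> with the invertibility of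
    \<open>\<beta>\<close>.\<close>
  have 1: "adj \<alpha> * ((adj w * w) * \<alpha>) = adj \<alpha> + \<alpha>"
  proof -
    have "adj \<alpha> * ((adj w * w) * \<alpha>) = adj \<alpha> * (\<beta> * \<alpha>) + (adj \<alpha> * adj \<beta>) * \<alpha>"
      unfolding ww by (simp add: algebra_simps)
    also have "\<dots> = adj \<alpha> + \<alpha>"
      unfolding \<alpha>\<beta> \<alpha>\<beta>' using i\<alpha> mult_idm[OF dims_adj[OF \<alpha>]] by simp
    finally show ?thesis .
  qed
  have 2: "\<alpha> * ((adj w * w) * adj \<alpha>) = adj \<alpha> + \<alpha>"
  proof -
    have "\<alpha> * ((adj w * w) * adj \<alpha>) = (\<alpha> * \<beta>) * adj \<alpha> + \<alpha> * (adj \<beta> * adj \<alpha>)"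
      unfolding ww by (simp add: algebra_simps)
    also have "\<dots> = adj \<alpha> + \<alpha>"
      unfolding \<alpha>\<beta> \<alpha>\<beta>' using i\<alpha> mult_idm[OF \<alpha>] by simp
    finally show ?thesis .
  qed
  have "adj h * h = idm N * idm N - (idm N * w) * (\<alpha> * adj w) - w * (adj \<alpha> * (adj w * idm N)) +
      w * ((adj \<alpha> * ((adj w * w) * \<alpha>)) * adj w)"
    unfolding adj_h unfolding h_def by (simp add: algebra_simps)
  then have hh: "adj h * h = idm N"
    unfolding iw 1 by (simp add: algebra_simps idm_mult[OF dims_idm])
  have "h * adj h = idm N * idm N - (idm N * w) * (adj \<alpha> * adj w) - w * (\<alpha> * (adj w * idm N)) +
      w * ((\<alpha> * ((adj w * w) * adj \<alpha>)) * adj w)"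
    unfolding adj_h unfolding h_def by (simp add: algebra_simps)
  then have hh': "h * adj h = idm N"
    unfolding iw 2 by (simp add: algebra_simps idm_mult[OF dims_idm])
  have "adj w * x = \<beta>"
    by (simp add: w_def \<beta>_def adj_simps algebra_simps x(2))
  then have "h * x = x - w * (\<alpha> * \<beta>)"
    by (simp add: h_def algebra_simps idm_mult[OF x(1)])
  also have "\<dots> = y"
    unfolding \<alpha>\<beta> mult_idm[OF w(1)] by (simp add: w_def)
  finally have hx: "h * x = y" .
  have "h * v = v" if "dims N 1 v" "adj w * v = 0" for v
    using that by (simp add: h_def algebra_simps idm_mult[OF that(1)])
  with h hh hh' hx show ?thesis
    by (auto simp: w_def)
qed

definition unit_col :: "nat \<Rightarrow> 'f :: star_div_algebra fmat" where
  "unit_col j = Abs_fmat (\<lambda>i l. if i = j \<and> l = 0 then 1 else 0)"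

lemma entry_unit_col [simp]: "entry (unit_col j) i l = (if i = j \<and> l = 0 then 1 else 0)"
  unfolding unit_col_def by (subst entry_Abs_fmat[of "Suc j" 1]) auto

lemma dims_unit_col: "j < n \<Longrightarrow> dims n 1 (unit_col j)"
  by (auto simp: dims_def)

lemma entry_mult_unit_col: "entry (A * unit_col j) i 0 = entry A i j"
proof -
  obtain m where m: "dims m m A"
    using dims_ex by blast
  have "entry (A * unit_col j) i 0 = (\<Sum>k<m. if k = j then entry A i k else 0)"
    unfolding entry_mult[OF m] by (intro sum.cong) auto
  with m show ?thesis
    by (auto simp: dims_def)
qed

lemma adj_unit_col_mult: "adj (unit_col k) * unit_col j = (if j = k then idm 1 else 0)"
proof (rule fmat_eqI)
  fix i l
  have "entry (adj (unit_col k) * unit_col j) i l =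
      (\<Sum>t<Suc k. if t = j then (if t = k \<and> i = 0 \<and> l = 0 then 1 else 0) else 0)"
    unfolding entry_mult[OF dims_adj[OF dims_unit_col[OF lessI]]] by (intro sum.cong) auto
  then show "entry (adj (unit_col k) * unit_col j) i l = entry (if j = k then idm 1 else 0) i l"
    by auto
qed

text \<open>Columns are aligned one after the other. Both frames being orthonormal, the columns
  already aligned are orthogonal to the difference of the next pair, so the quasi-reflection that
  matches this pair fixes them.\<close>

lemma unitary_transitive_fm:
  fixes z w :: "'f :: star_div_algebra fmat"
  assumes z: "dims N n z" "adj z * z = idm n" and w: "dims N n w" "adj w * w = idm n"
  shows "\<exists>u. dims N N u \<and> adj u * u = idm N \<and> u * adj u = idm N \<and> u * z = w"
proof -
  have ortho: "adj (a * unit_col k) * (a * unit_col j) = (if j = k then idm 1 else 0)"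
    if a: "dims N n a" "adj a * a = idm n" and jk: "j < n" "k < n" for a :: "'f fmat" and j k
  proof -
    have "adj (a * unit_col k) * (a * unit_col j) = adj (unit_col k) * ((adj a * a) * unit_col j)"
      by (simp add: adj_mult mult.assoc)
    then show ?thesis
      by (simp add: a idm_mult[OF dims_unit_col[OF jk(1)]] adj_unit_col_mult)
  qed
  have "\<exists>u. dims N N u \<and> adj u * u = idm N \<and> u * adj u = idm N \<and>
      (\<forall>j<k. u * (z * unit_col j) = w * unit_col j)" if "k \<le> n" for k
    using that
  proof (induction k)
    case 0
    show ?case
      by (intro exI[of _ "idm N"]) (auto simp: adj_idm dims_idm idm_mult[OF dims_idm])
  next
    case (Suc k)
    then obtain u where u: "dims N N u" "adj u * u = idm N" "u * adj u = idm N"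
      "\<And>j. j < k \<Longrightarrow> u * (z * unit_col j) = w * unit_col j"
      by auto
    have k: "k < n"
      using Suc by simp
    define x where "x = u * z * unit_col k"
    define y where "y = w * unit_col k"
    have uz: "dims N n (u * z)" "adj (u * z) * (u * z) = idm n"
    proof -
      show "dims N n (u * z)"
        by (rule dims_mult[OF u(1) z(1)])
      have "adj (u * z) * (u * z) = adj z * ((adj u * u) * z)"
        by (simp add: adj_mult mult.assoc)
      then show "adj (u * z) * (u * z) = idm n"
        by (simp add: u idm_mult[OF z(1)] z)
    qed
    have xy: "dims N 1 x" "dims N 1 y"
      unfolding x_def y_def by (intro dims_mult[OF uz(1) dims_unit_col[OF k]] dims_mult[OF w(1) dims_unit_col[OF k]])+
    obtain h where h: "dims N N h" "adj h * h = idm N" "h * adj h = idm N" "h * x = y"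
      "\<And>v. dims N 1 v \<Longrightarrow> adj (x - y) * v = 0 \<Longrightarrow> h * v = v"
      using quasi_reflection[OF xy(1) _ xy(2)] ortho[OF uz k k] ortho[OF w k k]
      unfolding x_def y_def by auto
    have "dims N N (h * u)"
      by (rule dims_mult[OF h(1) u(1)])
    moreover have "adj (h * u) * (h * u) = adj u * ((adj h * h) * u)"
      "(h * u) * adj (h * u) = h * ((u * adj u) * adj h)"
      by (simp_all add: adj_mult mult.assoc)
    then have "adj (h * u) * (h * u) = idm N" "(h * u) * adj (h * u) = idm N"
      by (simp_all add: h u idm_mult[OF u(1)] idm_mult[OF dims_adj[OF h(1)]])
    moreover have "h * u * (z * unit_col j) = w * unit_col j" if "j < Suc k" for j
    proof (cases "j = k")
      case True
      with h(4) show ?thesis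
        by (simp add: x_def y_def mult.assoc)
    next
      case False
      then have j: "j < k" "j < n"
        using that k by auto
      have "adj (x - y) * (w * unit_col j) = adj x * (u * z * unit_col j) - adj y * (w * unit_col j)"
        using u(4)[OF j(1)] by (simp add: adj_simps algebra_simps)
      also have "\<dots> = 0"
        using ortho[OF uz j(2) k] ortho[OF w j(2) k] False by (simp add: x_def y_def)
      finally have "h * (w * unit_col j) = w * unit_col j"
        by (rule h(5)[OF dims_mult[OF w(1) dims_unit_col[OF j(2)]]])
      then show ?thesis
        using u(4)[OF j(1)] by (simp add: mult.assoc)
    qed
    ultimately show ?case
      by blast
  qed
  from this[OF order_refl] obtain u where u: "dims N N u" "adj u * u = idm N" "u * adj u = idm N"
    "\<And>j. j < n \<Longrightarrow> u * (z * unit_col j) = w * unit_col j"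
    by blast
  have "u * z = w"
  proof (rule fmat_eqI)
    fix i j
    show "entry (u * z) i j = entry w i j"
    proof (cases "j < n")
      case True
      have "entry (u * z) i j = entry (u * (z * unit_col j)) i 0"
        by (simp add: entry_mult_unit_col flip: mult.assoc)
      with u(4)[OF True] show ?thesis
        by (simp add: entry_mult_unit_col)
    next
      case False
      with dims_mult[OF u(1) z(1)] w(1) show ?thesis
        by (auto simp: dims_def)
    qed
  qed
  with u show ?thesis
    by blast
qed

lemma unitary_transitive:
  assumes "Z \<in> stiefel_set N n" "W \<in> stiefel_set N n"
  shows "\<exists>U\<in>unitary_group N. U * Z = W"
proof -
  have c: "Z \<in> carrier_mat N n" "W \<in> carrier_mat N n"
    using assms by (simp_all add: stiefel_set_iff)
  obtain u where u: "dims N N u" "adj u * u = idm N" "u * adj u = idm N" "u * fm Z = fm W"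
    using unitary_transitive_fm[OF dims_fm[OF c(1)] _ dims_fm[OF c(2)]] assms by (auto simp: stiefel_set_iff)
  define U where "U = of_fm N N u"
  have U: "U \<in> unitary_group N" "U \<in> carrier_mat N N"
    using u by (simp_all add: U_def unitary_group_iff fm_of_fm)
  have "fm (U * Z) = fm W"
    using fm_mult[OF U(2) c(1)] u by (simp add: U_def fm_of_fm)
  then have "U * Z = W"
    using U(2) c by (subst (asm) fm_inject[of _ N n]) auto
  with U(1) show ?thesis
    by blast
qed

section \<open>Invariant measures on Stiefel manifolds\<close>

text \<open>Two probability measures for which all balls of the same radius have the same mass agree:
  by Fubini the masses of the balls coincide for the two measures, and then Fatou's lemma
  compares the measures of an open set.\<close>

lemma (in sep_metric) uniform_measure_ball_pos:
  assumes "prob_space \<mu>" "sets \<mu> = sets B"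
    and h: "\<And>x y r. x \<in> M \<Longrightarrow> y \<in> M \<Longrightarrow> emeasure \<mu> (mball x r) = emeasure \<mu> (mball y r)"
    and "x \<in> M" "r > 0"
  shows "emeasure \<mu> (mball x r) > 0"
proof -
  interpret \<mu>: prob_space \<mu> by fact
  have space: "space \<mu> = M"
    using sets_eq_imp_space_eq[OF assms(2)] by simp
  have ball: "mball x r \<in> sets \<mu>" for x r
    unfolding assms(2) by (rule openin_sets_borel_measure_of) simp
  have "emeasure \<mu> (mball x r) \<noteq> 0"
  proof
    assume "emeasure \<mu> (mball x r) = 0"
    then have "emeasure \<mu> (mball (c i) r) = 0" for i
      using h[OF c_in assms(4)] by simp
    then have "(\<Union>i. mball (c i) r) \<in> null_sets \<mu>"
      using ball by (intro null_sets_UN) (auto simp: null_sets_def)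
    moreover have "(\<Union>i. mball (c i) r) = M"
      using c_dense[OF _ assms(5)] c_in commute by fastforce
    ultimately show False
      using \<mu>.emeasure_space_1 by (simp add: space null_sets_def)
  qed
  then show ?thesis
    by (simp add: zero_less_iff_neq_zero)
qed

lemma (in sep_metric) uniform_measures_le:
  assumes \<mu>: "prob_space \<mu>" "sets \<mu> = sets B" and \<nu>: "prob_space \<nu>" "sets \<nu> = sets B"
    and h: "\<And>x y r. x \<in> M \<Longrightarrow> y \<in> M \<Longrightarrow> emeasure \<mu> (mball x r) = emeasure \<mu> (mball y r)"
    and g: "\<And>x y r. x \<in> M \<Longrightarrow> y \<in> M \<Longrightarrow> emeasure \<nu> (mball x r) = emeasure \<nu> (mball y r)"
    and U: "openin mtopology U"
  shows "emeasure \<mu> U \<le> emeasure \<nu> U"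
proof -
  interpret \<mu>: prob_space \<mu> by fact
  interpret \<nu>: prob_space \<nu> by fact
  interpret P: pair_prob_space \<mu> \<nu> ..
  have space: "space \<mu> = M" "space \<nu> = M"
    using sets_eq_imp_space_eq[OF \<mu>(2)] sets_eq_imp_space_eq[OF \<nu>(2)] by simp_all
  have sets_pair: "sets (\<mu> \<Otimes>\<^sub>M \<nu>) = sets (B \<Otimes>\<^sub>M B)"
    by (rule sets_pair_measure_cong[OF \<mu>(2) \<nu>(2)])
  have [measurable]: "(\<lambda>p. d (fst p) (snd p)) \<in> borel_measurable (\<mu> \<Otimes>\<^sub>M \<nu>)"
    using measurable_dist_pair unfolding measurable_cong_sets[OF sets_pair refl] .
  define h0 where "h0 r = emeasure \<mu> (mball (c 0) r)" for r
  define g0 where "g0 r = emeasure \<nu> (mball (c 0) r)" for r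
  have ball: "mball x r \<in> sets \<mu>" "mball x r \<in> sets \<nu>" for x r
    unfolding \<mu>(2) \<nu>(2) by (simp_all add: openin_sets_borel_measure_of)
  \<comment> \<open>Indicator of the pairs of points of \<open>V\<close> at distance less than
    \<open>r\<close>; integrating it in both orders gives \<open>main\<close>.\<close>
  define D where "D V r p = (indicator V (fst p) * indicator V (snd p) * indicator {p. d (fst p) (snd p) < r} p :: ennreal)"
    for V r and p :: "'a \<times> 'a"
  have main: "(\<integral>\<^sup>+ x. indicator V x * emeasure \<nu> (V \<inter> mball x r) \<partial>\<mu>) =
      (\<integral>\<^sup>+ y. indicator V y * emeasure \<mu> (V \<inter> mball y r) \<partial>\<nu>)" if V: "openin mtopology V" for V r
  proof -
    have [measurable]: "V \<in> sets \<mu>" "V \<in> sets \<nu>"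
      unfolding \<mu>(2) \<nu>(2) by (simp_all add: openin_sets_borel_measure_of V)
    have VM: "V \<subseteq> M"
      using openin_subset[OF V] by simp
    have "Measurable.pred (\<mu> \<Otimes>\<^sub>M \<nu>) (\<lambda>p. d (fst p) (snd p) < r)"
      by measurable
    then have [measurable]: "(\<lambda>p. indicator {p. d (fst p) (snd p) < r} p :: ennreal) \<in> borel_measurable (\<mu> \<Otimes>\<^sub>M \<nu>)"
      unfolding indicator_def by simp
    have D: "D V r \<in> borel_measurable (\<mu> \<Otimes>\<^sub>M \<nu>)"
      unfolding D_def by measurable
    have "(\<integral>\<^sup>+ x. indicator V x * emeasure \<nu> (V \<inter> mball x r) \<partial>\<mu>) = (\<integral>\<^sup>+ x. (\<integral>\<^sup>+ y. D V r (x, y) \<partial>\<nu>) \<partial>\<mu>)"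
    proof (rule nn_integral_cong)
      fix x assume "x \<in> space \<mu>"
      then have "x \<in> M" by (simp add: space)
      have "(\<integral>\<^sup>+ y. D V r (x, y) \<partial>\<nu>) = (\<integral>\<^sup>+ y. indicator V x * indicator (V \<inter> mball x r) y \<partial>\<nu>)"
        using \<open>x \<in> M\<close> by (intro nn_integral_cong) (auto simp: D_def space split: split_indicator)
      also have "\<dots> = indicator V x * emeasure \<nu> (V \<inter> mball x r)"
        using ball by (intro nn_integral_cmult_indicator) auto
      finally show "indicator V x * emeasure \<nu> (V \<inter> mball x r) = (\<integral>\<^sup>+ y. D V r (x, y) \<partial>\<nu>)" ..
    qed
    also have "\<dots> = (\<integral>\<^sup>+ y. (\<integral>\<^sup>+ x. D V r (x, y) \<partial>\<mu>) \<partial>\<nu>)"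
      by (rule P.Fubini[symmetric]) (rule D)
    also have "\<dots> = (\<integral>\<^sup>+ y. indicator V y * emeasure \<mu> (V \<inter> mball y r) \<partial>\<nu>)"
    proof (rule nn_integral_cong)
      fix y assume "y \<in> space \<nu>"
      then have "y \<in> M" by (simp add: space)
      have "(\<integral>\<^sup>+ x. D V r (x, y) \<partial>\<mu>) = (\<integral>\<^sup>+ x. indicator V y * indicator (V \<inter> mball y r) x \<partial>\<mu>)"
        using \<open>y \<in> M\<close> by (intro nn_integral_cong) (auto simp: D_def space commute split: split_indicator)
      also have "\<dots> = indicator V y * emeasure \<mu> (V \<inter> mball y r)"
        using ball by (intro nn_integral_cmult_indicator) auto
      finally show "(\<integral>\<^sup>+ x. D V r (x, y) \<partial>\<mu>) = indicator V y * emeasure \<mu> (V \<inter> mball y r)" .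
    qed
    finally show ?thesis .
  qed
  have M_ball: "M \<inter> mball x r = mball x r" for x r
    by auto
  \<comment> \<open>For \<open>V = M\<close> both sides of \<open>main\<close> are integrals of
    constants, so balls of equal radius have the same mass for the two measures.\<close>
  have hg: "h0 r = g0 r" for r
  proof -
    have "(\<integral>\<^sup>+ x. indicator M x * emeasure \<nu> (M \<inter> mball x r) \<partial>\<mu>) = (\<integral>\<^sup>+ x. g0 r \<partial>\<mu>)"
      using g[OF _ c_in] unfolding M_ball by (intro nn_integral_cong) (simp add: space g0_def)
    moreover have "(\<integral>\<^sup>+ y. indicator M y * emeasure \<mu> (M \<inter> mball y r) \<partial>\<nu>) = (\<integral>\<^sup>+ y. h0 r \<partial>\<nu>)"
      using h[OF _ c_in] unfolding M_ball by (intro nn_integral_cong) (simp add: space h0_def)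
    ultimately show ?thesis
      using main[of M r] by (simp add: \<mu>.emeasure_space_1 \<nu>.emeasure_space_1)
  qed
  have g_pos: "g0 r \<noteq> 0" "g0 r \<noteq> \<infinity>" if "r > 0" for r
    using uniform_measure_ball_pos[OF \<nu> g c_in[of 0] that] \<nu>.emeasure_finite by (auto simp: g0_def)
  define R where "R k = 1 / (1 + real k)" for k
  have R: "R k > 0" for k
    by (simp add: R_def add_pos_nonneg)
  \<comment> \<open>The share of the ball around \<open>x\<close> that \<open>U\<close> occupies
    with respect to \<open>\<nu>\<close>. On the open set \<open>U\<close> it is eventually 1, while
    \<open>main\<close> turns its integral over \<open>\<mu>\<close> into an integral over
    \<open>\<nu>\<close> that is at most \<open>emeasure \<nu> U\<close>.\<close>
  define F where "F k x = indicator U x * (emeasure \<nu> (U \<inter> mball x (R k)) / g0 (R k))" for k x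
  have UM: "U \<subseteq> M"
    using openin_subset[OF U] by simp
  have U_sets [measurable]: "U \<in> sets \<mu>" "U \<in> sets \<nu>"
    unfolding \<mu>(2) \<nu>(2) by (simp_all add: openin_sets_borel_measure_of U)
  have em [measurable]: "(\<lambda>x. emeasure \<nu> (U \<inter> mball x (R k))) \<in> borel_measurable \<mu>" for k
  proof -
    have "Measurable.pred (\<mu> \<Otimes>\<^sub>M \<nu>) (\<lambda>p. snd p \<in> U \<and> d (fst p) (snd p) < R k)"
      by measurable
    then have Q: "{p \<in> space (\<mu> \<Otimes>\<^sub>M \<nu>). snd p \<in> U \<and> d (fst p) (snd p) < R k} \<in> sets (\<mu> \<Otimes>\<^sub>M \<nu>)"
      by (simp add: pred_def)
    have "(\<lambda>x. emeasure \<nu> (Pair x -` {p \<in> space (\<mu> \<Otimes>\<^sub>M \<nu>). snd p \<in> U \<and> d (fst p) (snd p) < R k})) \<in> borel_measurable \<mu>"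
      by (rule \<nu>.measurable_emeasure_Pair[OF Q])
    moreover have "Pair x -` {p \<in> space (\<mu> \<Otimes>\<^sub>M \<nu>). snd p \<in> U \<and> d (fst p) (snd p) < R k} = U \<inter> mball x (R k)"
      if "x \<in> space \<mu>" for x
      using that UM by (auto simp: space_pair_measure space)
    ultimately show ?thesis
      by (simp cong: measurable_cong)
  qed
  have Fm: "F k \<in> borel_measurable \<mu>" for k
    unfolding F_def by measurable
  have "emeasure \<mu> U = (\<integral>\<^sup>+ x. indicator U x \<partial>\<mu>)"
    by simp
  also have "\<dots> \<le> (\<integral>\<^sup>+ x. liminf (\<lambda>k. F k x) \<partial>\<mu>)"
  proof (rule nn_integral_mono)
    fix x assume "x \<in> space \<mu>"
    show "indicator U x \<le> liminf (\<lambda>k. F k x)"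
    proof (cases "x \<in> U")
      case True
      then obtain r where r: "r > 0" "mball x r \<subseteq> U"
        using U unfolding openin_mtopology by blast
      obtain k0 where k0: "R k0 < r"
        using reals_Archimedean[OF r(1)] by (auto simp: R_def inverse_eq_divide)
      have "F k x = 1" if "k \<ge> k0" for k
      proof -
        have "R k \<le> R k0"
          using that by (simp add: R_def frac_le)
        then have "mball x (R k) \<subseteq> U"
          using r k0 mball_subset_concentric[of "R k" r x] by auto
        then have "U \<inter> mball x (R k) = mball x (R k)"
          by blast
        moreover have "emeasure \<nu> (mball x (R k)) = g0 (R k)"
          unfolding g0_def using True UM c_in by (intro g) auto
        ultimately show ?thesis
          using True g_pos[OF R] by (simp add: F_def ennreal_divide_self top.not_eq_extremum)
      qed
      then have "\<forall>\<^sub>F k in sequentially. 1 \<le> F k x"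
        unfolding eventually_sequentially by (intro exI[of _ k0]) auto
      then have "1 \<le> liminf (\<lambda>k. F k x)"
        by (rule Liminf_bounded)
      with True show ?thesis
        by simp
    qed simp
  qed
  also have "\<dots> \<le> liminf (\<lambda>k. \<integral>\<^sup>+ x. F k x \<partial>\<mu>)"
    by (rule nn_integral_liminf) (rule Fm)
  also have "\<dots> \<le> liminf (\<lambda>k. emeasure \<nu> U)"
  proof (rule Liminf_mono, rule always_eventually, rule allI)
    fix k
    have "(\<integral>\<^sup>+ x. F k x \<partial>\<mu>) = (\<integral>\<^sup>+ x. indicator U x * emeasure \<nu> (U \<inter> mball x (R k)) \<partial>\<mu>) / g0 (R k)"
      unfolding F_def ennreal_times_divide by (rule nn_integral_divide) measurable
    also have "\<dots> = (\<integral>\<^sup>+ y. indicator U y * emeasure \<mu> (U \<inter> mball y (R k)) \<partial>\<nu>) / g0 (R k)"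
      by (simp add: main[OF U])
    also have "\<dots> \<le> (\<integral>\<^sup>+ y. indicator U y * g0 (R k) \<partial>\<nu>) / g0 (R k)"
    proof (intro divide_right_mono_ennreal nn_integral_mono mult_left_mono)
      fix y assume "y \<in> space \<nu>"
      have "emeasure \<mu> (U \<inter> mball y (R k)) \<le> emeasure \<mu> (mball y (R k))"
        using ball by (intro emeasure_mono) auto
      also have "\<dots> = g0 (R k)"
        using \<open>y \<in> space \<nu>\<close> h[OF _ c_in] by (simp add: space hg[symmetric] h0_def)
      finally show "emeasure \<mu> (U \<inter> mball y (R k)) \<le> g0 (R k)" .
    qed simp
    also have "\<dots> = emeasure \<nu> U"
      using g_pos[OF R, of k] by (simp add: nn_integral_multc mult_divide_eq_ennreal top.not_eq_extremum)
    finally show "(\<integral>\<^sup>+ x. F k x \<partial>\<mu>) \<le> emeasure \<nu> U" .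
  qed
  also have "\<dots> = emeasure \<nu> U"
    by (rule Liminf_const) simp
  finally show ?thesis .
qed

lemma (in sep_metric) uniform_measures_eq:
  assumes \<mu>: "prob_space \<mu>" "sets \<mu> = sets B" and \<nu>: "prob_space \<nu>" "sets \<nu> = sets B"
    and h: "\<And>x y r. x \<in> M \<Longrightarrow> y \<in> M \<Longrightarrow> emeasure \<mu> (mball x r) = emeasure \<mu> (mball y r)"
    and g: "\<And>x y r. x \<in> M \<Longrightarrow> y \<in> M \<Longrightarrow> emeasure \<nu> (mball x r) = emeasure \<nu> (mball y r)"
  shows "\<mu> = \<nu>"
proof (rule measure_eqI_generator_eq[where A = "\<lambda>_. M" and E = "{U. openin mtopology U}" and \<Omega> = M])
  interpret \<mu>: prob_space \<mu> by fact
  have sB: "sets B = sigma_sets M {U. openin mtopology U}"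
    using openin_subset[of mtopology] by (auto simp: borel_measure_of_def sets_measure_of_conv)
  show "sets \<mu> = sigma_sets M {U. openin mtopology U}" "sets \<nu> = sigma_sets M {U. openin mtopology U}"
    by (simp_all add: \<mu>(2) \<nu>(2) sB)
  show "Int_stable {U. openin mtopology U}"
    by (auto simp: Int_stable_def)
  show "{U. openin mtopology U} \<subseteq> Pow M"
    using openin_subset[of mtopology] by auto
  show "emeasure \<mu> U = emeasure \<nu> U" if "U \<in> {U. openin mtopology U}" for U
    using that uniform_measures_le[OF \<mu> \<nu> h g] uniform_measures_le[OF \<nu> \<mu> g h] by (intro antisym) auto
  show "emeasure \<mu> M \<noteq> \<infinity>"
    using \<mu>.emeasure_finite by simp
qed auto

section \<open>Haar measure of the Stiefel manifold\<close>

definition stiefel_invariant :: "nat \<Rightarrow> nat \<Rightarrow> 'f :: star_div_algebra mat measure \<Rightarrow> bool" where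
  "stiefel_invariant N n \<mu> \<longleftrightarrow> sets \<mu> = sets (stiefel_borel N n) \<and> prob_space \<mu> \<and>
     (\<forall>U\<in>unitary_group N. distr \<mu> \<mu> (\<lambda>Z. U * Z) = \<mu>)"

text \<open>A unitary \<open>U\<close> with \<open>U * Z = W\<close> is an isometry that preserves
  the measure and carries one ball onto the other.\<close>

lemma stiefel_invariant_ball:
  assumes \<mu>: "stiefel_invariant N n \<mu>" and Z: "Z \<in> stiefel_set N n" and W: "W \<in> stiefel_set N n"
  shows "emeasure \<mu> (Metric_space.mball (stiefel_set N n) (stiefel_dist N n) Z r) =
    emeasure \<mu> (Metric_space.mball (stiefel_set N n) (stiefel_dist N n) W r)"
proof -
  interpret Metric_space "stiefel_set N n :: 'a mat set" "stiefel_dist N n"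
    by (rule Metric_space_stiefel)
  have sets: "sets \<mu> = sets (borel_measure_of mtopology)"
    using \<mu> by (simp add: stiefel_invariant_def)
  have space: "space \<mu> = stiefel_set N n"
    using sets_eq_imp_space_eq[OF sets] by simp
  obtain U where U: "U \<in> unitary_group N" "U * Z = W"
    using unitary_transitive[OF Z W] by blast
  have meas: "(\<lambda>Z. U * Z) \<in> \<mu> \<rightarrow>\<^sub>M \<mu>"
    using measurable_unitary_mult[OF U(1)] unfolding measurable_cong_sets[OF sets sets] .
  have "mball W r \<in> sets \<mu>"
    unfolding sets by (simp add: openin_sets_borel_measure_of)
  then have "emeasure \<mu> (mball W r) = emeasure \<mu> ((\<lambda>Z. U * Z) -` mball W r \<inter> space \<mu>)"
    using \<mu> U(1) meas emeasure_distr[OF meas] by (metis stiefel_invariant_def)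
  also have "(\<lambda>Z. U * Z) -` mball W r \<inter> space \<mu> = mball Z r"
    using Z W unitary_mult_stiefel(1)[OF U(1)] stiefel_dist_unitary[OF U(1) Z] U(2)
    by (auto simp: space)
  finally show ?thesis ..
qed

lemma stiefel_invariant_unique:
  fixes \<mu> :: "'f :: star_div_algebra mat measure"
  assumes "n \<le> N" "stiefel_invariant N n \<mu>" "stiefel_invariant N n \<nu>"
  shows "\<mu> = \<nu>"
proof -
  obtain c where "sep_metric (stiefel_set N n :: 'f mat set) (stiefel_dist N n) c"
    using sep_metric_stiefel[OF assms(1)] by blast
  then interpret sep_metric "stiefel_set N n :: 'f mat set" "stiefel_dist N n" c .
  show ?thesis
  proof (rule uniform_measures_eq)
    show "prob_space \<mu>" "prob_space \<nu>" "sets \<mu> = sets B" "sets \<nu> = sets B"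
      using assms(2,3) by (simp_all add: stiefel_invariant_def)
    show "emeasure \<mu> (mball x r) = emeasure \<mu> (mball y r)" "emeasure \<nu> (mball x r) = emeasure \<nu> (mball y r)"
      if "x \<in> stiefel_set N n" "y \<in> stiefel_set N n" for x y r
      by (rule stiefel_invariant_ball[OF assms(2) that], rule stiefel_invariant_ball[OF assms(3) that])
  qed
qed

text \<open>Turns the definite description into a usable measure. Uniqueness is settled at this
  point; existence comes from the Gaussian construction below.\<close>

lemma stiefel_haar_eq:
  assumes "n \<le> N" "stiefel_invariant N n \<mu>"
  shows "stiefel_haar N n = \<mu>"
proof -
  have "stiefel_haar N n = (THE \<mu>. stiefel_invariant N n \<mu>)"
    by (simp add: stiefel_haar_def stiefel_invariant_def)
  also have "\<dots> = \<mu>"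
    using assms stiefel_invariant_unique by (intro the_equality) blast+
  finally show ?thesis .
qed

lemma mtopology_scale:
  assumes "Metric_space M d" "t > 0"
  shows "Metric_space M (\<lambda>x y. t * d x y)"
    "Metric_space.mtopology M (\<lambda>x y. t * d x y) = Metric_space.mtopology M d"
proof -
  interpret Metric_space M d by fact
  show S: "Metric_space M (\<lambda>x y. t * d x y)"
  proof
    show "t * d x z \<le> t * d x y + t * d y z" if "x \<in> M" "y \<in> M" "z \<in> M" for x y z
      using triangle[OF that] assms(2) by (simp flip: distrib_left)
  qed (use assms(2) commute in auto)
  then interpret S: Metric_space M "\<lambda>x y. t * d x y" .
  have "openin S.mtopology U \<longleftrightarrow> openin mtopology U" for U
    using lipschitz_preimage_openin[OF S Metric_space_axioms, of "\<lambda>x. x" "1 / t" U]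
      lipschitz_preimage_openin[OF Metric_space_axioms S, of "\<lambda>x. x" t U]
      openin_subset[of S.mtopology U] openin_subset[of mtopology U] assms(2)
    by (auto simp: vimage_def Int_absorb2)
  then show "S.mtopology = mtopology"
    by (simp add: topology_eq)
qed

text \<open>By homogeneity a null ball would make all balls of that radius null, and countably many
  of them cover the manifold.\<close>

lemma full_support_scaled_stiefel:
  fixes \<mu> :: "'f :: star_div_algebra mat measure"
  assumes nN: "n \<le> N" and \<mu>: "stiefel_invariant N n \<mu>" and t: "t > 0"
  shows "full_support_space (mms_scale t (stiefel N n :: 'f mat mms))"
proof -
  obtain c where "sep_metric (stiefel_set N n :: 'f mat set) (stiefel_dist N n) c"
    using sep_metric_stiefel[OF nN] by blast
  then interpret sep_metric "stiefel_set N n :: 'f mat set" "stiefel_dist N n" c .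
  have haar: "stiefel_haar N n = \<mu>"
    by (rule stiefel_haar_eq[OF nN \<mu>])
  have sets: "sets \<mu> = sets B" and prob: "prob_space \<mu>"
    using \<mu> by (simp_all add: stiefel_invariant_def)
  have top: "mms_top (mms_scale t (stiefel N n)) = mtopology"
    using mtopology_scale[OF Metric_space_axioms t] by (simp add: mms_scale_def stiefel_def)
  have "emeasure \<mu> U > 0" if U: "openin mtopology U" "x \<in> U" for U x
  proof -
    obtain r where r: "r > 0" "mball x r \<subseteq> U" and x: "x \<in> stiefel_set N n"
      using U unfolding openin_mtopology by blast
    have "emeasure \<mu> (mball x r) > 0"
      by (rule uniform_measure_ball_pos[OF prob sets stiefel_invariant_ball[OF \<mu>] x r(1)])
    also have "emeasure \<mu> (mball x r) \<le> emeasure \<mu> U"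
      using r(2) openin_sets_borel_measure_of[OF U(1)] by (intro emeasure_mono) (simp_all add: sets)
    finally show ?thesis .
  qed
  then have "mms_supp (mms_scale t (stiefel N n :: 'f mat mms)) = stiefel_set N n"
    unfolding mms_supp_def top by (auto simp: mms_scale_def stiefel_def haar)
  then show ?thesis
    using mtopology_scale(1)[OF Metric_space_axioms t] sets prob top
    by (simp add: full_support_space_def mms_scale_def stiefel_def haar)
qed

section \<open>Haar measure from equivariant images of Gaussian matrices\<close>

lemma parametrizable_gauss_sets:
  assumes "prob_space M" "sets M = sets (gauss m)"
  shows "parametrizable M"
proof (rule parametrizable_embed)
  show "(\<lambda>x i. if i < m then x i else 0) \<in> borel_measurable M"
    unfolding measurable_cong_sets[OF assms(2) refl]
  proof (rule measurable_coordinatewise_then_product)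
    show "(\<lambda>x. if i < m then x i else 0) \<in> borel_measurable (gauss m)" for i
      by (cases "i < m") auto
  qed
  show "(\<lambda>a. restrict a {..<m}) \<in> borel \<rightarrow>\<^sub>M M"
    unfolding measurable_cong_sets[OF refl assms(2)]
    by (rule measurable_into_gauss) (auto intro: measurable_product_coordinates)
  show "restrict (\<lambda>i. if i < m then x i else 0) {..<m} = x" if "x \<in> space M" for x
    using that sets_eq_imp_space_eq[OF assms(2)] by (intro coord_space_eqI[of _ m]) (auto simp: space_gauss)
qed (rule assms(1))

text \<open>Orthonormalization of a Gaussian matrix is available only on an invariant event
  \<open>K\<close>: near orthonormality for frames, being nonzero for a single column. Outside
  \<open>K\<close> the map is merely measurable.\<close>

definition equivariant_on :: "nat \<Rightarrow> nat \<Rightarrow> (nat \<Rightarrow> real) set \<Rightarrow> ((nat \<Rightarrow> real) \<Rightarrow> 'f :: star_div_algebra mat) \<Rightarrow> bool" where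
  "equivariant_on N n K q \<longleftrightarrow> K \<in> sets (gauss (N * n * DIM('f))) \<and>
     q \<in> gauss (N * n * DIM('f)) \<rightarrow>\<^sub>M stiefel_borel N n \<and>
     (\<forall>U\<in>unitary_group N. \<forall>x\<in>coord_space (N * n * DIM('f)).
       (unitary_action N n (fm U) x \<in> K \<longleftrightarrow> x \<in> K) \<and>
       (x \<in> K \<longrightarrow> q (unitary_action N n (fm U) x) = U * q x))"

lemma gauss_unitary_group:
  fixes U :: "'f :: star_div_algebra mat"
  assumes "U \<in> unitary_group N"
  shows "unitary_action N n (fm U) \<in> gauss (N * n * DIM('f)) \<rightarrow>\<^sub>M gauss (N * n * DIM('f))"
    "distr (gauss (N * n * DIM('f))) (gauss (N * n * DIM('f))) (unitary_action N n (fm U)) = gauss (N * n * DIM('f))"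
  using assms by (auto simp: unitary_group_iff intro!: gauss_unitary_action dims_fm)

text \<open>Conditioning the Gaussian on the invariant event \<open>K\<close> keeps it invariant, so
  its image under \<open>q\<close> is invariant as well.\<close>

lemma stiefel_invariant_exists:
  fixes q :: "_ \<Rightarrow> 'f :: star_div_algebra mat"
  assumes q: "equivariant_on N n K q" and pos: "emeasure (gauss (N * n * DIM('f))) K \<noteq> 0"
  shows "\<exists>\<mu> :: 'f mat measure. stiefel_invariant N n \<mu> \<and> parametrizable \<mu>"
proof -
  define \<gamma> where "\<gamma> = gauss (N * n * DIM('f))"
  interpret \<gamma>: prob_space \<gamma>
    unfolding \<gamma>_def by (rule prob_space_gauss)
  have K: "K \<in> sets \<gamma>" and qm: "q \<in> \<gamma> \<rightarrow>\<^sub>M stiefel_borel N n"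
    using q by (simp_all add: equivariant_on_def \<gamma>_def)
  define \<kappa> where "\<kappa> = uniform_measure \<gamma> K"
  have \<kappa>: "prob_space \<kappa>" "sets \<kappa> = sets \<gamma>" "space \<kappa> = space \<gamma>"
    unfolding \<kappa>_def using pos \<gamma>.emeasure_finite by (auto intro!: prob_space_uniform_measure simp: \<gamma>_def)
  have pk: "parametrizable \<kappa>"
    by (rule parametrizable_gauss_sets) (use \<kappa> in \<open>auto simp: \<gamma>_def\<close>)
  have qk: "q \<in> \<kappa> \<rightarrow>\<^sub>M stiefel_borel N n"
    using qm unfolding measurable_cong_sets[OF \<kappa>(2) refl] .
  define \<mu> where "\<mu> = distr \<kappa> (stiefel_borel N n) q"
  have "distr \<mu> \<mu> (\<lambda>Z. U * Z) = \<mu>" if U: "U \<in> unitary_group N" for U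
  proof -
    define L where "L = unitary_action N n (fm U)"
    have L: "L \<in> \<gamma> \<rightarrow>\<^sub>M \<gamma>" "distr \<gamma> \<gamma> L = \<gamma>"
      unfolding L_def \<gamma>_def by (rule gauss_unitary_group[OF U])+
    have LK: "L x \<in> K \<longleftrightarrow> x \<in> K" "x \<in> K \<Longrightarrow> q (L x) = U * q x" if "x \<in> space \<gamma>" for x
      using q U that by (auto simp: equivariant_on_def L_def \<gamma>_def space_gauss)
    have Lk: "L \<in> \<kappa> \<rightarrow>\<^sub>M \<kappa>"
      using L(1) unfolding measurable_cong_sets[OF \<kappa>(2) \<kappa>(2)] .
    have k_inv: "distr \<kappa> \<kappa> L = \<kappa>"
    proof (rule measure_eqI)
      fix A assume "A \<in> sets (distr \<kappa> \<kappa> L)"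
      then have A: "A \<in> sets \<gamma>" by (simp add: \<kappa>)
      have "emeasure (distr \<kappa> \<kappa> L) A = emeasure \<kappa> (L -` A \<inter> space \<gamma>)"
        using Lk A by (simp add: emeasure_distr \<kappa>)
      also have "\<dots> = emeasure \<gamma> (K \<inter> (L -` A \<inter> space \<gamma>)) / emeasure \<gamma> K"
        unfolding \<kappa>_def by (rule emeasure_uniform_measure[OF K measurable_sets[OF L(1) A]])
      also have "K \<inter> (L -` A \<inter> space \<gamma>) = L -` (K \<inter> A) \<inter> space \<gamma>"
        using LK(1) sets.sets_into_space[OF K] by auto
      also have "emeasure \<gamma> (L -` (K \<inter> A) \<inter> space \<gamma>) = emeasure (distr \<gamma> \<gamma> L) (K \<inter> A)"
        using L(1) K A by (simp add: emeasure_distr)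
      also have "\<dots> = emeasure \<gamma> (K \<inter> A)"
        by (simp add: L(2))
      also have "emeasure \<gamma> (K \<inter> A) / emeasure \<gamma> K = emeasure \<kappa> A"
        unfolding \<kappa>_def by (rule emeasure_uniform_measure[OF K A, symmetric])
      finally show "emeasure (distr \<kappa> \<kappa> L) A = emeasure \<kappa> A" .
    qed simp
    have mU: "(\<lambda>Z. U * Z) \<in> stiefel_borel N n \<rightarrow>\<^sub>M stiefel_borel N n"
      by (rule measurable_unitary_mult[OF U])
    have "distr \<mu> \<mu> (\<lambda>Z. U * Z) = distr \<mu> (stiefel_borel N n) (\<lambda>Z. U * Z)"
      by (rule distr_cong) (simp_all add: \<mu>_def)
    also have "\<dots> = distr \<kappa> (stiefel_borel N n) ((\<lambda>Z. U * Z) \<circ> q)"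
      unfolding \<mu>_def by (rule distr_distr[OF mU qk])
    also have "\<dots> = distr \<kappa> (stiefel_borel N n) (q \<circ> L)"
    proof (rule distr_cong_AE)
      have "AE x in \<gamma>. x \<in> K \<longrightarrow> U * q x = q (L x)"
        using LK(2) by (intro AE_I2) auto
      then show "AE x in \<kappa>. ((\<lambda>Z. U * Z) \<circ> q) x = (q \<circ> L) x"
        unfolding \<kappa>_def by (intro AE_uniform_measureI[OF K]) simp
    qed (use mU qk Lk in auto)
    also have "\<dots> = distr (distr \<kappa> \<kappa> L) (stiefel_borel N n) q"
      by (rule distr_distr[OF qk Lk, symmetric])
    also have "\<dots> = \<mu>"
      by (simp add: k_inv \<mu>_def)
    finally show ?thesis .
  qed
  moreover have "prob_space \<mu>"
    unfolding \<mu>_def by (rule prob_space.prob_space_distr[OF \<kappa>(1) qk])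
  moreover have "parametrizable \<mu>"
    unfolding \<mu>_def by (rule parametrizable_distr[OF pk qk])
  ultimately show ?thesis
    by (intro exI[of _ \<mu>]) (simp add: stiefel_invariant_def \<mu>_def)
qed

text \<open>Conditioning would change the Gaussian marginal, which the couplings have to keep.
  Instead an independent invariant frame is used off \<open>K\<close>; the combined map commutes
  with the action of \<open>U\<close> on both factors, so its law is invariant and uniqueness
  identifies it.\<close>

lemma stiefel_invariant_law:
  fixes q :: "_ \<Rightarrow> 'f :: star_div_algebra mat" and n :: nat
  assumes nN: "n \<le> N" and q: "equivariant_on N n K q" and \<mu>: "stiefel_invariant N n \<mu>"
  defines "\<gamma> \<equiv> gauss (N * n * DIM('f))"
  shows "(\<lambda>p. if fst p \<in> K then q (fst p) else snd p) \<in> \<gamma> \<Otimes>\<^sub>M \<mu> \<rightarrow>\<^sub>M \<mu>"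
    "distr (\<gamma> \<Otimes>\<^sub>M \<mu>) \<mu> (\<lambda>p. if fst p \<in> K then q (fst p) else snd p) = \<mu>"
proof -
  let ?f = "\<lambda>p. if fst p \<in> K then q (fst p) else snd p"
  interpret \<gamma>: prob_space \<gamma>
    unfolding \<gamma>_def by (rule prob_space_gauss)
  interpret \<mu>: prob_space \<mu>
    using \<mu> by (simp add: stiefel_invariant_def)
  interpret P: pair_prob_space \<gamma> \<mu> ..
  have sets: "sets \<mu> = sets (stiefel_borel N n)"
    using \<mu> by (simp add: stiefel_invariant_def)
  have space: "space \<mu> = stiefel_set N n"
    using sets_eq_imp_space_eq[OF sets] by (simp only: space_stiefel_borel)
  have [measurable]: "K \<in> sets \<gamma>" "q \<in> \<gamma> \<rightarrow>\<^sub>M \<mu>"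
    using q unfolding measurable_cong_sets[OF refl sets] by (simp_all add: equivariant_on_def \<gamma>_def)
  show f: "?f \<in> \<gamma> \<Otimes>\<^sub>M \<mu> \<rightarrow>\<^sub>M \<mu>"
    by measurable
  have "stiefel_invariant N n (distr (\<gamma> \<Otimes>\<^sub>M \<mu>) \<mu> ?f)"
    unfolding stiefel_invariant_def
  proof (intro conjI ballI)
    show "prob_space (distr (\<gamma> \<Otimes>\<^sub>M \<mu>) \<mu> ?f)"
      by (rule P.prob_space_distr[OF f])
    fix U :: "'f mat" assume U: "U \<in> unitary_group N"
    define L where "L = unitary_action N n (fm U)"
    have L [measurable]: "L \<in> \<gamma> \<rightarrow>\<^sub>M \<gamma>" and L_eq: "distr \<gamma> \<gamma> L = \<gamma>"
      unfolding L_def \<gamma>_def by (rule gauss_unitary_group[OF U])+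
    have LK: "L x \<in> K \<longleftrightarrow> x \<in> K" "x \<in> K \<Longrightarrow> q (L x) = U * q x" if "x \<in> space \<gamma>" for x
      using q U that by (auto simp: equivariant_on_def L_def \<gamma>_def space_gauss)
    have mU: "(\<lambda>Z. U * Z) \<in> \<mu> \<rightarrow>\<^sub>M \<mu>"
      using measurable_unitary_mult[OF U] unfolding measurable_cong_sets[OF sets sets] .
    have \<mu>U: "distr \<mu> \<mu> (\<lambda>Z. U * Z) = \<mu>"
      using \<mu> U by (simp add: stiefel_invariant_def)
    define G where "G = (\<lambda>(x, Z). (L x, U * Z))"
    have Gm: "G \<in> \<gamma> \<Otimes>\<^sub>M \<mu> \<rightarrow>\<^sub>M \<gamma> \<Otimes>\<^sub>M \<mu>"
      unfolding G_def using mU L by measurable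
    have "distr \<gamma> \<gamma> L \<Otimes>\<^sub>M distr \<mu> \<mu> (\<lambda>Z. U * Z) = distr (\<gamma> \<Otimes>\<^sub>M \<mu>) (\<gamma> \<Otimes>\<^sub>M \<mu>) G"
      unfolding G_def by (rule pair_measure_distr[OF L mU]) (simp add: \<mu>U \<mu>.sigma_finite_measure_axioms)
    then have G: "distr (\<gamma> \<Otimes>\<^sub>M \<mu>) (\<gamma> \<Otimes>\<^sub>M \<mu>) G = \<gamma> \<Otimes>\<^sub>M \<mu>"
      by (simp add: L_eq \<mu>U)
    have "distr (distr (\<gamma> \<Otimes>\<^sub>M \<mu>) \<mu> ?f) (distr (\<gamma> \<Otimes>\<^sub>M \<mu>) \<mu> ?f) (\<lambda>Z. U * Z) =
        distr (distr (\<gamma> \<Otimes>\<^sub>M \<mu>) \<mu> ?f) \<mu> (\<lambda>Z. U * Z)"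
      by (rule distr_cong) simp_all
    also have "\<dots> = distr (\<gamma> \<Otimes>\<^sub>M \<mu>) \<mu> ((\<lambda>Z. U * Z) \<circ> ?f)"
      by (rule distr_distr[OF mU f])
    also have "\<dots> = distr (\<gamma> \<Otimes>\<^sub>M \<mu>) \<mu> (?f \<circ> G)"
      by (rule distr_cong) (auto simp: space_pair_measure G_def LK)
    also have "\<dots> = distr (distr (\<gamma> \<Otimes>\<^sub>M \<mu>) (\<gamma> \<Otimes>\<^sub>M \<mu>) G) \<mu> ?f"
      by (rule distr_distr[OF f Gm, symmetric])
    also have "\<dots> = distr (\<gamma> \<Otimes>\<^sub>M \<mu>) \<mu> ?f"
      by (simp add: G)
    finally show "distr (distr (\<gamma> \<Otimes>\<^sub>M \<mu>) \<mu> ?f) (distr (\<gamma> \<Otimes>\<^sub>M \<mu>) \<mu> ?f) (\<lambda>Z. U * Z) =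
        distr (\<gamma> \<Otimes>\<^sub>M \<mu>) \<mu> ?f" .
  qed (simp add: sets)
  then show "distr (\<gamma> \<Otimes>\<^sub>M \<mu>) \<mu> ?f = \<mu>"
    using stiefel_invariant_unique[OF nN _ \<mu>] by blast
qed

section \<open>Gaussian matrices are nearly orthonormal\<close>

definition coord_index :: "nat \<Rightarrow> nat \<Rightarrow> nat \<Rightarrow> nat \<Rightarrow> nat \<Rightarrow> nat" where
  "coord_index n d i j a = (i * n + j) * d + a"

lemma coord_index_less:
  assumes "i < N" "j < n" "a < d"
  shows "coord_index n d i j a < N * n * d"
proof -
  have "coord_index n d i j a < (i * n + j + 1) * d"
    using assms by (simp add: coord_index_def)
  also have "\<dots> \<le> (i * n + n) * d"
    using assms by (intro mult_right_mono) auto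
  also have "\<dots> = (i + 1) * n * d"
    by (simp add: algebra_simps)
  also have "\<dots> \<le> N * n * d"
    using assms by (intro mult_right_mono) auto
  finally show ?thesis .
qed

lemma coord_index_eq_iff:
  assumes "j < n" "a < d" "j' < n" "a' < d"
  shows "coord_index n d i j a = coord_index n d i' j' a' \<longleftrightarrow> i = i' \<and> j = j' \<and> a = a'"
proof
  assume eq: "coord_index n d i j a = coord_index n d i' j' a'"
  have "coord_index n d i j a div d = i * n + j" "coord_index n d i j a mod d = a"
    "coord_index n d i' j' a' div d = i' * n + j'" "coord_index n d i' j' a' mod d = a'"
    using assms by (simp_all add: coord_index_def)
  with eq have 1: "i * n + j = i' * n + j'" "a = a'"
    by metis+
  moreover have "(i * n + j) div n = i" "(i * n + j) mod n = j" "(i' * n + j') div n = i'" "(i' * n + j') mod n = j'"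
    using assms by simp_all
  ultimately show "i = i' \<and> j = j' \<and> a = a'"
    by metis
qed simp

lemma norm_eq_sum_basis_enum: "(norm y)\<^sup>2 = (\<Sum>u<DIM('f). (inner y (basis_enum u))\<^sup>2)"
  for y :: "'f :: euclidean_space"
  using norm_sum_basis_enum[of "\<lambda>u. inner y (basis_enum u)", where 'f = 'f]
  by (simp only: basis_enum_expansion)

lemma norm_basis_enum: "a < DIM('f) \<Longrightarrow> norm (basis_enum a :: 'f :: euclidean_space) = 1"
  using inner_basis_enum[of a a, where 'f = 'f] by (simp add: norm_eq_sqrt_inner)

definition scaled_fm :: "nat \<Rightarrow> nat \<Rightarrow> (nat \<Rightarrow> real) \<Rightarrow> 'f :: euclidean_space fmat" where
  "scaled_fm N n x = (1 / sqrt (real (N * DIM('f)))) *\<^sub>R to_fm N n x"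

lemma dims_scaled_fm: "dims N n (scaled_fm N n x)"
  unfolding scaled_fm_def by (intro dims_closed dims_to_fm)

text \<open>Brings the real components of the Gram defect into the form of the centred quadratic
  sums of \<open>gauss_quadratic_variance\<close>.\<close>

lemma inner_entry_gram_scaled_fm:
  fixes j k u N n :: nat
  assumes N: "N > 0" and jk: "j < n" "k < n" and u: "u < DIM('f :: star_div_algebra)"
  shows "inner (entry (gram n (scaled_fm N n x :: 'f fmat)) j k) (basis_enum u) =
    (\<Sum>(i, a, b)\<in>{..<N} \<times> {..<DIM('f)} \<times> {..<DIM('f)}.
      (1 / real (N * DIM('f)) * inner (star (basis_enum a) * basis_enum b) (basis_enum u :: 'f)) *
      (x (coord_index n DIM('f) i j a) * x (coord_index n DIM('f) i k b) -
       of_bool (coord_index n DIM('f) i j a = coord_index n DIM('f) i k b)))"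
proof -
  let ?d = "DIM('f)"
  let ?e = "basis_enum :: nat \<Rightarrow> 'f"
  let ?s = "1 / real (N * ?d)"
  define c where "c a b = inner (star (?e a) * ?e b) (?e u)" for a b
  let ?X = "\<lambda>i a b. x (coord_index n ?d i j a) * x (coord_index n ?d i k b)"
  have Nd: "real (N * ?d) > 0"
    using N DIM_positive[where 'a = 'f] by simp
  have entry: "entry (adj (to_fm N n x) * (to_fm N n x :: 'f fmat)) j k =
      (\<Sum>i<N. \<Sum>a<?d. \<Sum>b<?d. ?X i a b *\<^sub>R (star (?e a) * ?e b))"
    unfolding entry_mult[OF dims_adj[OF dims_to_fm]]
    using jk by (intro sum.cong refl)
      (simp add: entry_to_fm star_sum star_scaleR sum_product coord_index_def mult.commute)
  have 1: "inner (entry (adj (to_fm N n x) * (to_fm N n x :: 'f fmat)) j k) (?e u) =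
      (\<Sum>i<N. \<Sum>a<?d. \<Sum>b<?d. ?X i a b * c a b)"
    unfolding entry inner_sum_left by (simp add: c_def)
  \<comment> \<open>For \<open>j = k\<close> the terms with \<open>a = b\<close> contribute
    \<open>star e * e = 1\<close> each, and there are \<open>N * DIM('f)\<close> of them; the
    centring therefore subtracts exactly the identity matrix.\<close>
  have 2: "(\<Sum>i<N. \<Sum>a<?d. \<Sum>b<?d. of_bool (coord_index n ?d i j a = coord_index n ?d i k b) * c a b) =
      real (N * ?d) * inner (entry (idm n :: 'f fmat) j k) (?e u)"
  proof (cases "j = k")
    case True
    have "(\<Sum>i<N. \<Sum>a<?d. \<Sum>b<?d. of_bool (coord_index n ?d i j a = coord_index n ?d i k b) * c a b) =
        (\<Sum>i<N. \<Sum>a<?d. \<Sum>b<?d. if b = a then c a b else 0)"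
      using jk True by (intro sum.cong refl) (simp add: coord_index_eq_iff)
    also have "\<dots> = (\<Sum>i<N. \<Sum>a<?d. c a a)"
      by simp
    also have "\<dots> = (\<Sum>i<N. \<Sum>a<?d. inner (1 :: 'f) (?e u))"
      by (intro sum.cong refl) (simp add: c_def star_mult_self norm_basis_enum)
    finally show ?thesis
      using True jk by simp
  next
    case False
    then have "(\<Sum>i<N. \<Sum>a<?d. \<Sum>b<?d. of_bool (coord_index n ?d i j a = coord_index n ?d i k b) * c a b) = 0"
      using jk by (intro sum.neutral ballI) (simp add: coord_index_eq_iff)
    with False show ?thesis
      by simp
  qed
  have "adj (scaled_fm N n x) * (scaled_fm N n x :: 'f fmat) = ?s *\<^sub>R (adj (to_fm N n x) * to_fm N n x)"
    using Nd by (simp add: scaled_fm_def adj_simps)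
  then have "inner (entry (gram n (scaled_fm N n x :: 'f fmat)) j k) (?e u) =
      ?s * inner (entry (adj (to_fm N n x) * (to_fm N n x :: 'f fmat)) j k) (?e u) -
      inner (entry (idm n :: 'f fmat) j k) (?e u)"
    by (simp only: gram_def entry_minus entry_scaleR inner_diff_left inner_scaleR_left)
  also have "\<dots> = ?s * ((\<Sum>i<N. \<Sum>a<?d. \<Sum>b<?d. ?X i a b * c a b) -
      (\<Sum>i<N. \<Sum>a<?d. \<Sum>b<?d. of_bool (coord_index n ?d i j a = coord_index n ?d i k b) * c a b))"
  proof -
    have "?s * real (N * ?d) = 1"
      using Nd by (simp del: of_nat_mult)
    then have "?s * (a - real (N * ?d) * b) = ?s * a - b" for a b
      by (simp only: right_diff_distrib mult.assoc[symmetric] mult_1_left)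
    then show ?thesis
      unfolding 1 2 by (rule sym)
  qed
  also have "\<dots> = (\<Sum>i<N. \<Sum>a<?d. \<Sum>b<?d. (?s * c a b) *
      (?X i a b - of_bool (coord_index n ?d i j a = coord_index n ?d i k b)))"
    by (simp only: sum_subtractf[symmetric] sum_distrib_left) (simp add: algebra_simps)
  also have "\<dots> = (\<Sum>(i, a, b)\<in>{..<N} \<times> {..<?d} \<times> {..<?d}. (?s * c a b) *
      (?X i a b - of_bool (coord_index n ?d i j a = coord_index n ?d i k b)))"
    by (simp add: sum.cartesian_product case_prod_beta)
  finally show ?thesis
    by (simp add: c_def)
qed

text \<open>There are \<open>n * n\<close> entries. With \<open>d = DIM('f)\<close>, each product
  \<open>star (basis_enum a) * basis_enum b\<close> has norm 1, so the squared coefficients of one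
  entry, summed over its \<open>d\<close> real components, add up to
  \<open>N d^2 / (N d)^2 = 1 / N\<close>; the variance bound doubles this.\<close>

lemma gram_scaled_fm_moment:
  fixes N n :: nat
  assumes N: "N > 0"
  defines "m \<equiv> N * n * DIM('f :: star_div_algebra)"
  shows "integrable (gauss m) (\<lambda>x. (norm (gram n (scaled_fm N n x :: 'f fmat)))\<^sup>2)"
    "integral\<^sup>L (gauss m) (\<lambda>x. (norm (gram n (scaled_fm N n x :: 'f fmat)))\<^sup>2) \<le> 2 * (real n)\<^sup>2 / real N"
proof -
  let ?d = "DIM('f)"
  let ?e = "basis_enum :: nat \<Rightarrow> 'f"
  let ?T = "{..<N} \<times> {..<?d} \<times> {..<?d}"
  define c where "c u t = (case t of (i :: nat, a, b) \<Rightarrow> 1 / real (N * ?d) * inner (star (?e a) * ?e b) (?e u))" for u t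
  define p where "p j t = (case t of (i, a, b :: nat) \<Rightarrow> coord_index n ?d i j a)" for j t
  define q where "q k t = (case t of (i, a :: nat, b) \<Rightarrow> coord_index n ?d i k b)" for k t
  define f where "f j k u x = (\<Sum>t\<in>?T. c u t * (x (p j t) * x (q k t) - of_bool (p j t = q k t)))"
    for j k u and x :: "nat \<Rightarrow> real"
  have expand: "(norm (gram n (scaled_fm N n x :: 'f fmat)))\<^sup>2 = (\<Sum>j<n. \<Sum>k<n. \<Sum>u<?d. (f j k u x)\<^sup>2)" for x
    unfolding norm_fmat_sum[OF dims_gram[OF dims_scaled_fm]] norm_eq_sum_basis_enum
    by (intro sum.cong refl)
      (simp add: inner_entry_gram_scaled_fm[OF N] f_def c_def p_def q_def case_prod_beta)
  have pq: "p j t < m \<and> q k t < m" if "t \<in> ?T" "j < n" "k < n" for t j k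
    using that by (auto simp: p_def q_def m_def intro!: coord_index_less)
  have inj: "inj_on (\<lambda>t. (p j t, q k t)) ?T" if "j < n" "k < n" for j k
    using that by (auto simp: inj_on_def p_def q_def coord_index_eq_iff)
  have f: "integrable (gauss m) (\<lambda>x. (f j k u x)\<^sup>2)"
    "integral\<^sup>L (gauss m) (\<lambda>x. (f j k u x)\<^sup>2) \<le> 2 * (\<Sum>t\<in>?T. (c u t)\<^sup>2)" if "j < n" "k < n" for j k u
    unfolding f_def using gauss_quadratic_variance[OF _ pq[OF _ that] inj[OF that]] by auto
  show "integrable (gauss m) (\<lambda>x. (norm (gram n (scaled_fm N n x :: 'f fmat)))\<^sup>2)"
    unfolding expand by (intro Bochner_Integration.integrable_sum f(1)) auto
  have "integral\<^sup>L (gauss m) (\<lambda>x. (norm (gram n (scaled_fm N n x :: 'f fmat)))\<^sup>2) =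
      (\<Sum>j<n. \<Sum>k<n. \<Sum>u<?d. integral\<^sup>L (gauss m) (\<lambda>x. (f j k u x)\<^sup>2))"
  proof -
    have 1: "integrable (gauss m) (\<lambda>x. \<Sum>u<?d. (f j k u x)\<^sup>2)" if "j < n" "k < n" for j k
      by (intro Bochner_Integration.integrable_sum f(1) that)
    have 2: "integrable (gauss m) (\<lambda>x. \<Sum>k<n. \<Sum>u<?d. (f j k u x)\<^sup>2)" if "j < n" for j
      using that by (intro Bochner_Integration.integrable_sum[of "{..<n}"] 1) auto
    have "integral\<^sup>L (gauss m) (\<lambda>x. \<Sum>j<n. \<Sum>k<n. \<Sum>u<?d. (f j k u x)\<^sup>2) =
        (\<Sum>j<n. integral\<^sup>L (gauss m) (\<lambda>x. \<Sum>k<n. \<Sum>u<?d. (f j k u x)\<^sup>2))"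
      by (rule Bochner_Integration.integral_sum) (use 2 in auto)
    also have "\<dots> = (\<Sum>j<n. \<Sum>k<n. integral\<^sup>L (gauss m) (\<lambda>x. \<Sum>u<?d. (f j k u x)\<^sup>2))"
      by (rule sum.cong[OF refl], rule Bochner_Integration.integral_sum) (use 1 in auto)
    also have "\<dots> = (\<Sum>j<n. \<Sum>k<n. \<Sum>u<?d. integral\<^sup>L (gauss m) (\<lambda>x. (f j k u x)\<^sup>2))"
      by (rule sum.cong[OF refl], rule sum.cong[OF refl], rule Bochner_Integration.integral_sum) (use f(1) in auto)
    finally show ?thesis
      unfolding expand .
  qed
  also have "\<dots> \<le> (\<Sum>j<n. \<Sum>k<n. \<Sum>u<?d. 2 * (\<Sum>t\<in>?T. (c u t)\<^sup>2))"
    by (intro sum_mono f(2)) auto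
  also have "\<dots> = (real n)\<^sup>2 * (2 * (\<Sum>u<?d. \<Sum>t\<in>?T. (c u t)\<^sup>2))"
    by (simp add: sum_distrib_left power2_eq_square mult.assoc)
  also have "(\<Sum>u<?d. \<Sum>t\<in>?T. (c u t)\<^sup>2) = (\<Sum>t\<in>?T. \<Sum>u<?d. (c u t)\<^sup>2)"
    by (rule sum.swap)
  also have "\<dots> = (\<Sum>t\<in>?T. (1 / real (N * ?d))\<^sup>2)"
  proof (rule sum.cong[OF refl])
    fix t assume "t \<in> ?T"
    then obtain i a b where t: "t = (i, a, b)" "a < ?d" "b < ?d"
      by auto
    have "(\<Sum>u<?d. (c u t)\<^sup>2) = (1 / real (N * ?d))\<^sup>2 * (\<Sum>u<?d. (inner (star (?e a) * ?e b) (?e u))\<^sup>2)"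
      by (simp only: c_def t power_mult_distrib sum_distrib_left prod.case)
    also have "(\<Sum>u<?d. (inner (star (?e a) * ?e b) (?e u))\<^sup>2) = 1"
      using t by (simp add: norm_mult norm_basis_enum flip: norm_eq_sum_basis_enum)
    finally show "(\<Sum>u<?d. (c u t)\<^sup>2) = (1 / real (N * ?d))\<^sup>2"
      by simp
  qed
  also have "(real n)\<^sup>2 * (2 * (\<Sum>t\<in>?T. (1 / real (N * ?d))\<^sup>2)) = 2 * (real n)\<^sup>2 / real N"
    using N DIM_positive[where 'a = 'f] by (simp add: power2_eq_square field_simps)
  finally show "integral\<^sup>L (gauss m) (\<lambda>x. (norm (gram n (scaled_fm N n x :: 'f fmat)))\<^sup>2) \<le> 2 * (real n)\<^sup>2 / real N" .
qed

section \<open>Orthonormalization on the good event\<close>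

definition nearly_orthonormal :: "'f :: star_div_algebra itself \<Rightarrow> nat \<Rightarrow> nat \<Rightarrow> real \<Rightarrow> (nat \<Rightarrow> real) set" where
  "nearly_orthonormal _ N n \<delta> = {x \<in> coord_space (N * n * DIM('f)).
     norm (gram n (scaled_fm N n x :: 'f fmat)) \<le> \<delta>}"

lemma measurable_fm_scaled_fm:
  "measurable_fm (gauss (N * n * DIM('f))) (scaled_fm N n :: _ \<Rightarrow> 'f :: star_div_algebra fmat)"
  unfolding scaled_fm_def[abs_def] by (intro measurable_fm_scaleR measurable_fm_to_fm) simp

lemma nearly_orthonormal_sets:
  "nearly_orthonormal TYPE('f :: star_div_algebra) N n \<delta> \<in> sets (gauss (N * n * DIM('f)))"
proof -
  have [measurable]: "(\<lambda>x. norm (gram n (scaled_fm N n x :: 'f fmat))) \<in> borel_measurable (gauss (N * n * DIM('f)))"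
    by (intro measurable_fm_norm[where N = n and m = n] measurable_fm_gram[where N = N]
        measurable_fm_scaled_fm dims_gram[OF dims_scaled_fm] dims_scaled_fm)
  have "{x \<in> space (gauss (N * n * DIM('f))). norm (gram n (scaled_fm N n x :: 'f fmat)) \<le> \<delta>} \<in> sets (gauss (N * n * DIM('f)))"
    by measurable
  then show ?thesis
    by (simp add: nearly_orthonormal_def space_gauss)
qed

lemma nearly_orthonormal_prob:
  assumes N: "N > 0" and \<delta>: "\<delta> > 0"
  shows "measure (gauss (N * n * DIM('f))) (nearly_orthonormal TYPE('f :: star_div_algebra) N n \<delta>) \<ge>
    1 - 2 * (real n)\<^sup>2 / (real N * \<delta>\<^sup>2)"
proof -
  let ?m = "N * n * DIM('f)"
  let ?g = "\<lambda>x. (norm (gram n (scaled_fm N n x :: 'f fmat)))\<^sup>2"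
  let ?K = "nearly_orthonormal TYPE('f) N n \<delta>"
  interpret prob_space "gauss ?m"
    by (rule prob_space_gauss)
  have [measurable]: "?g \<in> borel_measurable (gauss ?m)"
    using gram_scaled_fm_moment(1)[OF N] by blast
  have bad: "{x \<in> space (gauss ?m). ?g x \<ge> \<delta>\<^sup>2} \<in> sets (gauss ?m)"
    by measurable
  have "prob {x \<in> space (gauss ?m). ?g x \<ge> \<delta>\<^sup>2} \<le> integral\<^sup>L (gauss ?m) ?g / \<delta>\<^sup>2"
    using \<delta> gram_scaled_fm_moment(1)[OF N, of n, where 'f = 'f]
    by (intro integral_Markov_inequality_measure[where A = "{}"]) auto
  also have "\<dots> \<le> (2 * (real n)\<^sup>2 / real N) / \<delta>\<^sup>2"
    by (intro divide_right_mono gram_scaled_fm_moment(2)[OF N]) simp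
  finally have le: "prob {x \<in> space (gauss ?m). ?g x \<ge> \<delta>\<^sup>2} \<le> 2 * (real n)\<^sup>2 / (real N * \<delta>\<^sup>2)"
    by simp
  have "space (gauss ?m) - {x \<in> space (gauss ?m). ?g x \<ge> \<delta>\<^sup>2} \<subseteq> ?K"
  proof
    fix x assume "x \<in> space (gauss ?m) - {x \<in> space (gauss ?m). ?g x \<ge> \<delta>\<^sup>2}"
    then have x: "x \<in> coord_space ?m" "?g x < \<delta>\<^sup>2"
      unfolding space_gauss Diff_iff mem_Collect_eq de_Morgan_conj not_le by blast+
    from x(2) have "norm (gram n (scaled_fm N n x :: 'f fmat)) < \<delta>"
      by (rule power_less_imp_less_base) (use \<delta> in simp)
    with x(1) show "x \<in> ?K"
      by (simp only: nearly_orthonormal_def mem_Collect_eq less_imp_le simp_thms)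
  qed
  then have "prob (space (gauss ?m) - {x \<in> space (gauss ?m). ?g x \<ge> \<delta>\<^sup>2}) \<le> prob ?K"
    by (intro finite_measure_mono nearly_orthonormal_sets)
  with le show ?thesis
    by (simp add: prob_compl[OF bad])
qed

lemma scaled_fm_unitary_action:
  "dims N N u \<Longrightarrow> scaled_fm N n (unitary_action N n u x) = u * scaled_fm N n x"
  by (simp add: scaled_fm_def to_fm_unitary_action)

text \<open>Off the good event the value is a fixed frame, which keeps the map measurable and inside
  the Stiefel manifold.\<close>

definition polar_map :: "nat \<Rightarrow> nat \<Rightarrow> real \<Rightarrow> (nat \<Rightarrow> real) \<Rightarrow> 'f :: star_div_algebra mat" where
  "polar_map N n \<delta> x = (if x \<in> nearly_orthonormal TYPE('f) N n \<delta>
     then of_fm N n (polar N n (scaled_fm N n x)) else of_fm N n (idm n))"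

lemma fm_polar_map:
  assumes "x \<in> nearly_orthonormal TYPE('f :: star_div_algebra) N n \<delta>"
  shows "fm (polar_map N n \<delta> x :: 'f mat) = polar N n (scaled_fm N n x)"
  using assms by (simp add: polar_map_def fm_of_fm dims_polar)

lemma polar_map_in:
  assumes "n \<le> N" "\<delta> \<le> 1/4"
  shows "(polar_map N n \<delta> x :: 'f :: star_div_algebra mat) \<in> stiefel_set N n"
proof (cases "x \<in> nearly_orthonormal TYPE('f) N n \<delta>")
  case True
  then have "norm (gram n (scaled_fm N n x :: 'f fmat)) \<le> 1/4"
    using assms by (auto simp: nearly_orthonormal_def)
  with True show ?thesis
    unfolding polar_map_def by (simp add: of_fm_stiefel dims_polar polar_orthonormal[OF dims_scaled_fm])
next
  case False
  with assms dims_mono[OF dims_idm] show ?thesis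
    by (auto simp: polar_map_def adj_idm idm_mult[OF dims_idm] intro!: of_fm_stiefel)
qed

lemma equivariant_on_polar_map:
  assumes nN: "n \<le> N" and \<delta>: "\<delta> \<le> 1/4"
  shows "equivariant_on N n (nearly_orthonormal TYPE('f) N n \<delta>) (polar_map N n \<delta> :: _ \<Rightarrow> 'f :: star_div_algebra mat)"
  unfolding equivariant_on_def
proof (intro conjI ballI impI)
  let ?K = "nearly_orthonormal TYPE('f) N n \<delta>" and ?m = "N * n * DIM('f)"
  show "?K \<in> sets (gauss ?m)"
    by (rule nearly_orthonormal_sets)
  then have K: "Measurable.pred (gauss ?m) (\<lambda>x. x \<in> ?K)"
    by simp
  show "(polar_map N n \<delta> :: _ \<Rightarrow> 'f mat) \<in> gauss ?m \<rightarrow>\<^sub>M stiefel_borel N n"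
  proof (rule measurable_into_stiefel[OF nN])
    have pm: "measurable_fm (gauss ?m) (\<lambda>x. polar N n (scaled_fm N n x) :: 'f fmat)"
      by (intro measurable_fm_polar measurable_fm_scaled_fm dims_scaled_fm)
    have "fm (polar_map N n \<delta> x :: 'f mat) =
        (if x \<in> ?K then polar N n (scaled_fm N n x) else idm n)" for x
    proof -
      have "dims N n (idm n :: 'f fmat)"
        by (rule dims_mono[OF dims_idm nN order_refl])
      then show ?thesis
        by (simp add: polar_map_def fm_of_fm dims_polar)
    qed
    note eq = this
    show "measurable_fm (gauss ?m) (\<lambda>x. fm (polar_map N n \<delta> x :: 'f mat))"
      unfolding eq measurable_fm_def if_distrib[of "\<lambda>A. entry A _ _"]
      using pm unfolding measurable_fm_def
      by (intro allI measurable_If borel_measurable_const K[unfolded pred_def]) blast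
  qed (use polar_map_in[OF assms] in auto)
  fix U :: "'f mat" and x assume U: "U \<in> unitary_group N" and x: "x \<in> coord_space ?m"
  have u: "dims N N (fm U)" "adj (fm U) * fm U = idm N"
    using U by (simp_all add: unitary_group_iff dims_fm)
  show K_iff: "unitary_action N n (fm U) x \<in> ?K \<longleftrightarrow> x \<in> ?K"
    using x coords_in[of N n "fm U * to_fm N n x"]
    by (simp add: nearly_orthonormal_def scaled_fm_unitary_action[OF u(1)]
        polar_step_equivariant(1)[OF u dims_scaled_fm]) (simp add: unitary_action_def)
  assume xK: "x \<in> ?K"
  then have "norm (gram n (scaled_fm N n x :: 'f fmat)) \<le> 1/4"
    using \<delta> by (auto simp: nearly_orthonormal_def)
  from polar_equivariant[OF u dims_scaled_fm this]
  have "polar N n (scaled_fm N n (unitary_action N n (fm U) x)) = fm U * polar N n (scaled_fm N n x)"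
    by (simp add: scaled_fm_unitary_action[OF u(1)])
  then have "fm (polar_map N n \<delta> (unitary_action N n (fm U) x) :: 'f mat) = fm (U * polar_map N n \<delta> x)"
    using xK K_iff unitary_mult_stiefel(2)[OF U polar_map_in[OF assms]] by (simp add: fm_polar_map)
  then show "polar_map N n \<delta> (unitary_action N n (fm U) x) = U * polar_map N n \<delta> x"
    using polar_map_in[OF assms, where 'f = 'f] unitary_mult_stiefel(1)[OF U polar_map_in[OF assms]]
    by (subst (asm) fm_inject[of _ N n]) (auto simp: stiefel_set_iff)
qed

text \<open>\<open>scaled_fm\<close> divides by \<open>sqrt (N * d)\<close> and the manifold is
  multiplied by the smaller \<open>sqrt (N * d - 1)\<close>, where \<open>d\<close> is the real
  dimension of the scalars; the scalings cancel up to a factor at most 1, and the constant of the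
  polar factor remains.\<close>

lemma polar_map_lipschitz:
  fixes x y :: "nat \<Rightarrow> real"
  assumes nN: "n \<le> N" and N: "N > 0" and \<delta>: "\<delta> \<le> 1/4"
    and x: "x \<in> nearly_orthonormal TYPE('f :: star_div_algebra) N n \<delta>" and y: "y \<in> nearly_orthonormal TYPE('f) N n \<delta>"
  shows "sqrt (real (N * DIM('f)) - 1) * stiefel_dist N n (polar_map N n \<delta> x :: 'f mat) (polar_map N n \<delta> y)
    \<le> exp \<delta> * vdist (N * n * DIM('f)) x y"
proof -
  let ?D = "real (N * DIM('f))"
  have D: "?D \<ge> 1"
    using N DIM_positive[where 'a = 'f] by (metis One_nat_def Suc_leI mult_pos_pos of_nat_1 of_nat_le_iff)
  have "stiefel_dist N n (polar_map N n \<delta> x :: 'f mat) (polar_map N n \<delta> y) =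
      norm (polar N n (scaled_fm N n x) - polar N n (scaled_fm N n y) :: 'f fmat)"
    using polar_map_in[OF nN \<delta>, where 'f = 'f] by (simp add: stiefel_dist_fm fm_polar_map x y)
  also have "\<dots> \<le> exp \<delta> * norm (scaled_fm N n x - scaled_fm N n y :: 'f fmat)"
    using x y \<delta> by (intro polar_lipschitz dims_scaled_fm) (auto simp: nearly_orthonormal_def)
  also have "norm (scaled_fm N n x - scaled_fm N n y :: 'f fmat) = vdist (N * n * DIM('f)) x y / sqrt ?D"
    by (simp add: scaled_fm_def flip: scaleR_diff_right norm_to_fm_diff[where 'f = 'f])
  finally have "sqrt (?D - 1) * stiefel_dist N n (polar_map N n \<delta> x :: 'f mat) (polar_map N n \<delta> y) \<le>
      sqrt ?D * (exp \<delta> * (vdist (N * n * DIM('f)) x y / sqrt ?D))"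
    using D by (intro mult_mono) (auto simp: Metric_space.nonneg[OF Metric_space_stiefel])
  also have "\<dots> = exp \<delta> * vdist (N * n * DIM('f)) x y"
  proof -
    have "s * (e * (v / s)) = e * v" if "s \<noteq> 0" for s e v :: real
      using that by simp
    moreover have "sqrt ?D > 0"
      by (rule real_sqrt_gt_zero) (use D in linarith)
    then have "sqrt ?D \<noteq> 0"
      by linarith
    ultimately show ?thesis
      by blast
  qed
  finally show ?thesis .
qed

section \<open>The first column of a random orthonormal frame\<close>

lemma adj_mult_column:
  fixes A :: "'f :: star_div_algebra fmat"
  assumes "dims N 1 A"
  shows "adj A * A = (norm A)\<^sup>2 *\<^sub>R idm 1"
proof (rule fmat_eqI)
  fix i j
  have "entry (adj A * A) i j = (\<Sum>k<N. star (entry A k i) * entry A k j)"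
    by (simp add: entry_mult[OF dims_adj[OF assms]])
  also have "\<dots> = entry ((norm A)\<^sup>2 *\<^sub>R idm 1) i j"
  proof (cases "i = 0 \<and> j = 0")
    case True
    then show ?thesis
      by (simp add: star_mult_self) (simp add: norm_fmat_sum[OF assms] scaleR_sum_left)
  next
    case False
    with assms show ?thesis
      by (auto simp: dims_def intro!: sum.neutral)
  qed
  finally show "entry (adj A * A) i j = entry ((norm A)\<^sup>2 *\<^sub>R idm 1) i j" .
qed

definition nonzero_coords :: "nat \<Rightarrow> (nat \<Rightarrow> real) set" where
  "nonzero_coords m = {x \<in> coord_space m. (\<Sum>k<m. (x k)\<^sup>2) \<noteq> 0}"

text \<open>For one column the polar factor is explicit, the normalized vector, and makes sense
  wherever the vector is nonzero. The explicit form allows its coordinates to be compared with those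
  of the Gaussian vector.\<close>

definition sphere_map :: "nat \<Rightarrow> (nat \<Rightarrow> real) \<Rightarrow> 'f :: star_div_algebra mat" where
  "sphere_map N x = of_fm N 1 (if x \<in> nonzero_coords (N * 1 * DIM('f))
     then (1 / norm (to_fm N 1 x :: 'f fmat)) *\<^sub>R to_fm N 1 x else idm 1)"

lemma nonzero_coords_iff:
  "x \<in> nonzero_coords (N * 1 * DIM('f)) \<longleftrightarrow>
    x \<in> coord_space (N * 1 * DIM('f)) \<and> to_fm N 1 x \<noteq> (0 :: 'f :: euclidean_space fmat)"
proof -
  have "(\<Sum>k<N * 1 * DIM('f). (x k)\<^sup>2) \<noteq> 0 \<longleftrightarrow> to_fm N 1 x \<noteq> (0 :: 'f fmat)"
    unfolding norm_to_fm[of N 1 x, where 'f = 'f, symmetric] by simp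
  then show ?thesis
    by (simp only: nonzero_coords_def mem_Collect_eq)
qed

lemma dims_sphere:
  assumes "N \<ge> 1"
  shows "dims N 1 (if x \<in> nonzero_coords (N * 1 * DIM('f))
     then (1 / norm (to_fm N 1 x :: 'f :: star_div_algebra fmat)) *\<^sub>R to_fm N 1 x else idm 1 :: 'f fmat)"
proof (cases "x \<in> nonzero_coords (N * 1 * DIM('f))")
  case True
  then show ?thesis
    by (simp only: if_True) (intro dims_closed dims_to_fm)
next
  case False
  then show ?thesis
    by (simp only: if_False) (rule dims_mono[OF dims_idm assms order_refl])
qed

lemma fm_sphere_map:
  assumes "N \<ge> 1" "x \<in> nonzero_coords (N * 1 * DIM('f))"
  shows "fm (sphere_map N x :: 'f :: star_div_algebra mat) = (1 / norm (to_fm N 1 x :: 'f fmat)) *\<^sub>R to_fm N 1 x"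
  unfolding sphere_map_def fm_of_fm[OF dims_sphere[OF assms(1)]] using assms(2) by (simp only: if_True)

lemma sphere_map_in:
  assumes "N \<ge> 1"
  shows "(sphere_map N x :: 'f :: star_div_algebra mat) \<in> stiefel_set N 1"
  unfolding sphere_map_def
proof (rule of_fm_stiefel[OF dims_sphere[OF assms]])
  show "adj (if x \<in> nonzero_coords (N * 1 * DIM('f)) then (1 / norm (to_fm N 1 x :: 'f fmat)) *\<^sub>R to_fm N 1 x else idm 1)
    * (if x \<in> nonzero_coords (N * 1 * DIM('f)) then (1 / norm (to_fm N 1 x :: 'f fmat)) *\<^sub>R to_fm N 1 x else idm 1) =
    (idm 1 :: 'f fmat)"
  proof (cases "x \<in> nonzero_coords (N * 1 * DIM('f))")
    case True
    then have "norm (to_fm N 1 x :: 'f fmat) \<noteq> 0"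
      by (simp only: nonzero_coords_iff norm_eq_zero not_False_eq_True simp_thms)
    then show ?thesis
      by (simp only: True if_True adj_simps mult_scaleR_left mult_scaleR_right adj_mult_column[OF dims_to_fm])
        (simp add: power2_eq_square)
  qed (simp only: if_False adj_idm idm_mult[OF dims_idm])
qed

lemma equivariant_on_sphere_map:
  assumes N: "N \<ge> 1"
  shows "equivariant_on N 1 (nonzero_coords (N * 1 * DIM('f))) (sphere_map N :: _ \<Rightarrow> 'f :: star_div_algebra mat)"
  unfolding equivariant_on_def
proof (intro conjI ballI impI)
  let ?K = "nonzero_coords (N * 1 * DIM('f))" and ?m = "N * 1 * DIM('f)"
  have [measurable]: "(\<lambda>x. \<Sum>k<?m. (x k)\<^sup>2) \<in> borel_measurable (gauss ?m)"
    by (intro borel_measurable_sum borel_measurable_power measurable_gauss_coord) simp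
  have "{x \<in> space (gauss ?m). (\<Sum>k<?m. (x k)\<^sup>2) \<noteq> 0} \<in> sets (gauss ?m)"
    by measurable
  then show Ks: "?K \<in> sets (gauss ?m)"
    by (simp only: nonzero_coords_def space_gauss)
  then have K: "Measurable.pred (gauss ?m) (\<lambda>x. x \<in> ?K)"
    by simp
  show "(sphere_map N :: _ \<Rightarrow> 'f mat) \<in> gauss ?m \<rightarrow>\<^sub>M stiefel_borel N 1"
  proof (rule measurable_into_stiefel[OF N])
    have "(\<lambda>x. norm (to_fm N 1 x :: 'f fmat)) \<in> borel_measurable (gauss ?m)"
      by (intro measurable_fm_norm[where N = N and m = 1] measurable_fm_to_fm dims_to_fm)
    then have pm: "measurable_fm (gauss ?m) (\<lambda>x. (1 / norm (to_fm N 1 x :: 'f fmat)) *\<^sub>R to_fm N 1 x :: 'f fmat)"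
      by (intro measurable_fm_scaleR measurable_fm_to_fm) auto
    show "measurable_fm (gauss ?m) (\<lambda>x. fm (sphere_map N x :: 'f mat))"
      unfolding sphere_map_def fm_of_fm[OF dims_sphere[OF N]] measurable_fm_def if_distrib[of "\<lambda>A. entry A _ _"]
      using pm unfolding measurable_fm_def
      by (intro allI measurable_If borel_measurable_const K[unfolded pred_def]) blast
  qed (use sphere_map_in[OF N] in auto)
  fix U :: "'f mat" and x assume U: "U \<in> unitary_group N" and x: "x \<in> coord_space ?m"
  have u: "dims N N (fm U)" "adj (fm U) * fm U = idm N"
    using U by (simp_all add: unitary_group_iff dims_fm)
  have norm_u: "norm (fm U * (to_fm N 1 x :: 'f fmat)) = norm (to_fm N 1 x :: 'f fmat)"
    by (rule norm_mult_unitary[OF u(2) dims_to_fm])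
  have zero_iff: "(fm U * (to_fm N 1 x :: 'f fmat) = 0) = (to_fm N 1 x = (0 :: 'f fmat))"
    using norm_u by (metis norm_eq_zero)
  show K_iff: "unitary_action N 1 (fm U) x \<in> ?K \<longleftrightarrow> x \<in> ?K"
    unfolding nonzero_coords_iff to_fm_unitary_action[OF u(1)] zero_iff
    using x coords_in[of N 1 "fm U * to_fm N 1 x"] by (simp only: unitary_action_def simp_thms)
  assume xK: "x \<in> ?K"
  have "fm (sphere_map N (unitary_action N 1 (fm U) x) :: 'f mat) = fm U * fm (sphere_map N x :: 'f mat)"
    unfolding fm_sphere_map[OF N xK] fm_sphere_map[OF N K_iff[THEN iffD2, OF xK]]
      to_fm_unitary_action[OF u(1)] norm_u by simp
  also have "\<dots> = fm (U * sphere_map N x)"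
    by (rule unitary_mult_stiefel(2)[OF U sphere_map_in[OF N], symmetric])
  finally show "sphere_map N (unitary_action N 1 (fm U) x) = U * sphere_map N x"
    using sphere_map_in[OF N, where 'f = 'f] unitary_mult_stiefel(1)[OF U sphere_map_in[OF N]]
    by (subst (asm) fm_inject[of _ N 1]) (auto simp only: stiefel_set_iff)
qed

section \<open>Projection to the first column\<close>

definition first_column :: "nat \<Rightarrow> 'f :: star_div_algebra mat \<Rightarrow> 'f mat" where
  "first_column N Z = of_fm N 1 (fm Z * idm 1)"

lemma first_column:
  assumes n: "n \<ge> 1" and Z: "Z \<in> stiefel_set N n"
  shows "fm (first_column N Z) = fm Z * idm 1" "first_column N Z \<in> stiefel_set N 1"
proof -
  have z: "dims N n (fm Z)" "adj (fm Z) * fm Z = idm n"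
    using Z by (simp_all add: stiefel_set_iff dims_fm)
  have d: "dims N 1 (fm Z * idm 1)"
    by (rule dims_mult[OF z(1) dims_idm])
  then show "fm (first_column N Z) = fm Z * idm 1"
    unfolding first_column_def by (rule fm_of_fm)
  have "adj (fm Z * idm 1) * (fm Z * idm 1) = idm 1 * ((adj (fm Z) * fm Z) * idm 1)"
    by (simp only: adj_mult adj_idm mult.assoc)
  also have "\<dots> = idm 1"
    using n unfolding z(2) by (simp only: idm_mult[OF dims_mono[OF dims_idm n order_refl]] idm_mult[OF dims_idm])
  finally show "first_column N Z \<in> stiefel_set N 1"
    unfolding first_column_def by (rule of_fm_stiefel[OF d])
qed

lemma norm_mult_idm_le:
  fixes A :: "'f :: star_div_algebra fmat"
  assumes A: "dims N n A" and n: "n \<ge> 1"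
  shows "norm (A * idm 1) \<le> norm A"
proof -
  have d: "dims N 1 (A * idm 1)"
    by (rule dims_mult[OF A dims_idm])
  have e: "entry (A * idm 1) i 0 = entry A i 0" for i
  proof -
    have "entry (A * idm 1) i 0 = (\<Sum>k<n. if k = 0 then entry A i k else 0)"
      unfolding entry_mult[OF A] by (intro sum.cong) auto
    with n show ?thesis
      by simp
  qed
  have "(norm (A * idm 1))\<^sup>2 = (\<Sum>i<N. (norm (entry A i 0))\<^sup>2)"
    unfolding norm_fmat_sum[OF d] by (simp add: e[simplified])
  also have "\<dots> \<le> (\<Sum>i<N. \<Sum>j<n. (norm (entry A i j))\<^sup>2)"
    using n by (intro sum_mono member_le_sum[of 0 "{..<n}" "\<lambda>j. (norm (entry A _ j))\<^sup>2"]) auto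
  also have "\<dots> = (norm A)\<^sup>2"
    by (rule norm_fmat_sum[OF A, symmetric])
  finally show ?thesis
    by (rule power2_le_imp_le) simp
qed

lemma first_column_dist:
  assumes n: "n \<ge> 1" and Z: "Z \<in> stiefel_set N n" and W: "W \<in> stiefel_set N n"
  shows "stiefel_dist N 1 (first_column N Z) (first_column N W) \<le> stiefel_dist N n Z W"
proof -
  have "dims N n (fm Z - fm W)"
    using Z W by (intro dims_closed dims_fm) (simp_all only: stiefel_set_iff)
  from norm_mult_idm_le[OF this n] show ?thesis
    unfolding stiefel_dist_fm[OF Z W] stiefel_dist_fm[OF first_column(2)[OF n Z] first_column(2)[OF n W]]
      first_column(1)[OF n Z] first_column(1)[OF n W] by (simp only: left_diff_distrib)
qed

text \<open>Taking the first column is a multiplication on the right and so commutes with the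
  unitary action on the left.\<close>

lemma first_column_invariant:
  fixes \<mu> :: "'f :: star_div_algebra mat measure"
  assumes n: "n \<ge> 1" and \<mu>: "stiefel_invariant N n \<mu>"
  shows "first_column N \<in> \<mu> \<rightarrow>\<^sub>M stiefel_borel N 1"
    "stiefel_invariant N 1 (distr \<mu> (stiefel_borel N 1) (first_column N))"
proof -
  have sets: "sets \<mu> = sets (stiefel_borel N n)" and prob: "prob_space \<mu>"
    using \<mu> by (simp_all only: stiefel_invariant_def)
  have space: "space \<mu> = stiefel_set N n"
    using sets_eq_imp_space_eq[OF sets] by (simp only: space_stiefel_borel)
  show p: "first_column N \<in> \<mu> \<rightarrow>\<^sub>M stiefel_borel N 1"
    unfolding measurable_cong_sets[OF sets refl]
    by (rule lipschitz_measurable[OF Metric_space_stiefel Metric_space_stiefel, where K = 1])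
      (use first_column[OF n] first_column_dist[OF n] in \<open>auto simp del: One_nat_def\<close>)
  let ?\<nu> = "distr \<mu> (stiefel_borel N 1) (first_column N)"
  have "distr ?\<nu> ?\<nu> (\<lambda>Z. U * Z) = ?\<nu>" if U: "U \<in> unitary_group N" for U
  proof -
    have mU: "(\<lambda>Z. U * Z) \<in> \<mu> \<rightarrow>\<^sub>M \<mu>"
      using measurable_unitary_mult[OF U] unfolding measurable_cong_sets[OF sets sets] .
    have mU1: "(\<lambda>Z. U * Z) \<in> stiefel_borel N 1 \<rightarrow>\<^sub>M stiefel_borel N 1"
      by (rule measurable_unitary_mult[OF U])
    have comm: "U * first_column N Z = first_column N (U * Z)" if Z: "Z \<in> stiefel_set N n" for Z
    proof -
      have "fm (U * first_column N Z) = fm (first_column N (U * Z))"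
        unfolding unitary_mult_stiefel(2)[OF U first_column(2)[OF n Z]] first_column(1)[OF n Z]
          first_column(1)[OF n unitary_mult_stiefel(1)[OF U Z]] unitary_mult_stiefel(2)[OF U Z]
        by (simp only: mult.assoc)
      then show ?thesis
        using unitary_mult_stiefel(1)[OF U first_column(2)[OF n Z]]
          first_column(2)[OF n unitary_mult_stiefel(1)[OF U Z]]
        by (subst (asm) fm_inject[of _ N 1]) (auto simp only: stiefel_set_iff)
    qed
    have "distr ?\<nu> ?\<nu> (\<lambda>Z. U * Z) = distr ?\<nu> (stiefel_borel N 1) (\<lambda>Z. U * Z)"
      by (rule distr_cong) simp_all
    also have "\<dots> = distr \<mu> (stiefel_borel N 1) ((\<lambda>Z. U * Z) \<circ> first_column N)"
      by (rule distr_distr[OF mU1 p])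
    also have "\<dots> = distr \<mu> (stiefel_borel N 1) (first_column N \<circ> (\<lambda>Z. U * Z))"
      by (rule distr_cong) (auto simp: space comm)
    also have "\<dots> = distr (distr \<mu> \<mu> (\<lambda>Z. U * Z)) (stiefel_borel N 1) (first_column N)"
      by (rule distr_distr[OF p mU, symmetric])
    also have "\<dots> = ?\<nu>"
      using \<mu> U by (simp add: stiefel_invariant_def)
    finally show ?thesis .
  qed
  moreover have "prob_space ?\<nu>"
    by (rule prob_space.prob_space_distr[OF prob p])
  ultimately show "stiefel_invariant N 1 ?\<nu>"
    unfolding stiefel_invariant_def by (intro conjI ballI sets_distr)
qed

section \<open>Approximating spaces dominated by Gaussian spaces\<close>

abbreviation (input) scaled_stiefel :: "nat \<Rightarrow> nat \<Rightarrow> 'f :: star_div_algebra mat mms" where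
  "scaled_stiefel N n \<equiv> mms_scale (sqrt (real (N * DIM('f)) - 1)) (stiefel N n)"

lemma scaled_stiefel_sel:
  "pts (scaled_stiefel N n :: 'f :: star_div_algebra mat mms) = stiefel_set N n"
  "dst (scaled_stiefel N n :: 'f mat mms) = (\<lambda>Z W. sqrt (real (N * DIM('f)) - 1) * stiefel_dist N n Z W)"
  "msr (scaled_stiefel N n :: 'f mat mms) = stiefel_haar N n"
  by (simp_all add: mms_scale_def stiefel_def)

lemma DIM_ge_1: "1 \<le> DIM('f :: euclidean_space)"
  using DIM_positive[where 'a = 'f] by linarith

lemma scaled_stiefel_factor_pos:
  assumes "N \<ge> 2"
  shows "sqrt (real (N * DIM('f :: euclidean_space)) - 1) > 0"
proof -
  have "2 * 1 \<le> N * DIM('f)"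
    by (intro mult_le_mono assms DIM_ge_1)
  then have "real 2 \<le> real (N * DIM('f))"
    by (subst of_nat_le_iff) simp
  then show ?thesis
    by simp
qed

text \<open>Gives \<open>stiefel_haar\<close> its meaning: near orthonormality has positive
  probability, so an invariant measure exists, and it is unique.\<close>

lemma stiefel_haar_invariant:
  assumes nN: "n \<le> N" and N: "N > 0" and \<delta>: "0 < \<delta>" "\<delta> \<le> 1/4" and small: "2 * (real n)\<^sup>2 / (real N * \<delta>\<^sup>2) < 1"
  shows "stiefel_invariant N n (stiefel_haar N n :: 'f :: star_div_algebra mat measure)"
    "parametrizable (stiefel_haar N n :: 'f mat measure)"
proof -
  let ?K = "nearly_orthonormal TYPE('f) N n \<delta>" and ?\<gamma> = "gauss (N * n * DIM('f))"
  have "measure ?\<gamma> ?K > 0"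
    using nearly_orthonormal_prob[OF N \<delta>(1), of n, where 'f = 'f] small by linarith
  then have "emeasure ?\<gamma> ?K \<noteq> 0"
    by (auto simp: measure_def)
  then obtain \<mu> :: "'f mat measure" where \<mu>: "stiefel_invariant N n \<mu>" "parametrizable \<mu>"
    using stiefel_invariant_exists[OF equivariant_on_polar_map[OF nN \<delta>(2)]] by blast
  then show "stiefel_invariant N n (stiefel_haar N n :: 'f mat measure)"
    "parametrizable (stiefel_haar N n :: 'f mat measure)"
    by (simp_all only: stiefel_haar_eq[OF nN \<mu>(1)])
qed

lemma gauss_coord_tail:
  assumes "k < m" "R > 0"
  shows "measure (gauss m) {x \<in> space (gauss m). \<bar>x k\<bar> > R} \<le> 1 / R\<^sup>2"
proof -
  interpret prob_space "gauss m"
    by (rule prob_space_gauss)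
  note m2 = gauss_moment2[OF assms(1) assms(1)]
  have [measurable]: "(\<lambda>x. x k) \<in> borel_measurable (gauss m)"
    by (rule measurable_gauss_coord[OF assms(1)])
  have "measure (gauss m) {x \<in> space (gauss m). \<bar>x k\<bar> > R} \<le>
      measure (gauss m) {x \<in> space (gauss m). x k * x k \<ge> R\<^sup>2}"
  proof (rule finite_measure_mono)
    show "{x \<in> space (gauss m). \<bar>x k\<bar> > R} \<subseteq> {x \<in> space (gauss m). x k * x k \<ge> R\<^sup>2}"
    proof
      fix x assume x: "x \<in> {x \<in> space (gauss m). \<bar>x k\<bar> > R}"
      then have "R\<^sup>2 \<le> \<bar>x k\<bar>\<^sup>2"
        using assms(2) by (intro power_mono) auto
      also have "\<bar>x k\<bar>\<^sup>2 = x k * x k"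
        by (simp only: power2_abs power2_eq_square)
      finally show "x \<in> {x \<in> space (gauss m). x k * x k \<ge> R\<^sup>2}"
        using x by simp
    qed
    show "{x \<in> space (gauss m). x k * x k \<ge> R\<^sup>2} \<in> events"
      by measurable
  qed
  also have "\<dots> \<le> integral\<^sup>L (gauss m) (\<lambda>x. x k * x k) / R\<^sup>2"
    using assms(2) m2(1) by (intro integral_Markov_inequality_measure[where A = "{}"]) auto
  finally show ?thesis
    by (simp add: m2(2))
qed

lemma coords_scaleR:
  assumes "k < N * n * DIM('f)"
  shows "coords N n (r *\<^sub>R (A :: 'f :: star_div_algebra fmat)) k = r * coords N n A k"
  using assms by (simp add: coords_def)

lemma vdist_coords:
  assumes "dims N n A" "dims N n B"
  shows "vdist (N * n * DIM('f)) (coords N n A) (coords N n B) = norm (A - B :: 'f :: star_div_algebra fmat)"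
  using norm_to_fm_diff[of N n "coords N n A" "coords N n B", where 'f = 'f]
  by (simp add: to_fm_coords assms)

lemma vdist_mono: "m \<le> m' \<Longrightarrow> vdist m x y \<le> vdist m' x y"
  unfolding vdist_sqrt by (intro real_sqrt_le_mono sum_mono2) auto

lemma vdist_cong: "(\<And>k. k < m \<Longrightarrow> x k = x' k) \<Longrightarrow> (\<And>k. k < m \<Longrightarrow> y k = y' k) \<Longrightarrow> vdist m x y = vdist m x' y'"
  by (simp add: vdist_sqrt)

lemma vdist_scale: "t \<ge> 0 \<Longrightarrow> vdist m (\<lambda>k. t * x k) (\<lambda>k. t * y k) = t * vdist m x y"
  by (simp add: vdist_sqrt real_sqrt_mult power_mult_distrib
      flip: right_diff_distrib sum_distrib_left)

text \<open>For one column the Gram defect is a scalar, squared norm minus 1, so near orthonormality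
  becomes concentration of the squared length of the Gaussian vector.\<close>

lemma nearly_orthonormal_column:
  fixes N :: nat
  assumes N: "N \<ge> 1" and x: "x \<in> nearly_orthonormal TYPE('f :: star_div_algebra) N 1 \<delta>"
  shows "\<bar>(\<Sum>k<N * 1 * DIM('f). (x k)\<^sup>2) / real (N * DIM('f)) - 1\<bar> \<le> \<delta>"
proof -
  let ?A = "scaled_fm N 1 x :: 'f fmat"
  have "norm (idm 1 :: 'f fmat) = 1"
  proof -
    have "(norm (idm 1 :: 'f fmat))\<^sup>2 = 1\<^sup>2"
      unfolding norm_fmat_sum[OF dims_idm] by simp
    then show ?thesis
      by (rule power2_eq_imp_eq[OF _ norm_ge_zero zero_le_one])
  qed
  moreover have "gram 1 ?A = ((norm ?A)\<^sup>2 - 1) *\<^sub>R idm 1"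
    unfolding gram_def adj_mult_column[OF dims_scaled_fm] by (simp only: scaleR_diff_left scaleR_one)
  ultimately have "norm (gram 1 ?A) = \<bar>(norm ?A)\<^sup>2 - 1\<bar>"
    by (simp only: norm_scaleR mult_1_right real_norm_def)
  moreover have "(norm ?A)\<^sup>2 = (\<Sum>k<N * 1 * DIM('f). (x k)\<^sup>2) / real (N * DIM('f))"
    unfolding scaled_fm_def norm_scaleR power_mult_distrib norm_to_fm by (simp add: power_divide)
  moreover have "norm (gram 1 ?A) \<le> \<delta>"
    using x by (simp only: nearly_orthonormal_def mem_Collect_eq)
  ultimately show ?thesis
    by (simp only:)
qed

text \<open>\<open>s\<close> stands for the length of the Gaussian vector and
  \<open>r = sqrt (D - 1) / s\<close> for the factor by which normalization and scaling change it.
  For \<open>r \<ge> 0\<close> one has \<open>|1 - r| \<le> |1 - r^2|\<close>, and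
  \<open>1 - r^2 = (v - 1 + 1 / D) / v\<close> with \<open>v = s^2 / D \<ge> 1/2\<close>, which
  gives the factor 2.\<close>

lemma normalization_estimate:
  fixes s D \<delta> :: real
  assumes s: "\<bar>s\<^sup>2 / D - 1\<bar> \<le> \<delta>" "s \<ge> 0" and D: "D \<ge> 1" and \<delta>: "\<delta> \<le> 1/2"
  shows "s > 0" "\<bar>1 - sqrt (D - 1) / s\<bar> \<le> 2 * (\<delta> + 1 / D)"
proof -
  define v where "v = s\<^sup>2 / D"
  have v2: "\<bar>v - 1\<bar> \<le> \<delta>"
    using s(1) by (simp only: v_def)
  then have v: "1/2 \<le> v" "\<bar>v - 1\<bar> \<le> \<delta>"
    using \<delta> by linarith+
  then have "s \<noteq> 0"
    by (auto simp: v_def)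
  then show "s > 0"
    using s(2) by simp
  define r where "r = sqrt (D - 1) / s"
  have r: "r \<ge> 0"
    using s(2) D by (simp add: r_def)
  have "r\<^sup>2 = (D - 1) / s\<^sup>2"
    using D by (simp add: r_def power_divide)
  also have "\<dots> = (1 - 1 / D) / v"
    using D \<open>s > 0\<close> by (simp add: v_def field_simps)
  finally have "1 - r\<^sup>2 = (v - 1 + 1 / D) / v"
    using v(1) by (simp add: field_simps)
  then have "\<bar>1 - r\<^sup>2\<bar> = \<bar>v - 1 + 1 / D\<bar> / v"
    using v(1) by simp
  also have "\<dots> \<le> (\<delta> + 1 / D) / (1/2)"
  proof (rule frac_le)
    have "0 \<le> 1 / D"
      using D by simp
    then show "\<bar>v - 1 + 1 / D\<bar> \<le> \<delta> + 1 / D" "0 \<le> \<delta> + 1 / D"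
      using v by linarith+
  qed (use v in auto)
  finally have "\<bar>1 - r\<^sup>2\<bar> \<le> 2 * (\<delta> + 1 / D)"
    by simp
  moreover have "\<bar>1 - r\<bar> \<le> \<bar>1 - r\<^sup>2\<bar>"
  proof -
    have "1 - r\<^sup>2 = (1 - r) * (1 + r)"
      by (simp add: power2_eq_square algebra_simps)
    then have "\<bar>1 - r\<^sup>2\<bar> = \<bar>1 - r\<bar> * (1 + r)"
      using r by (simp add: abs_mult)
    moreover have "\<bar>1 - r\<bar> * 1 \<le> \<bar>1 - r\<bar> * (1 + r)"
      using r by (intro mult_left_mono) auto
    ultimately show ?thesis
      by simp
  qed
  ultimately show "\<bar>1 - sqrt (D - 1) / s\<bar> \<le> 2 * (\<delta> + 1 / D)"
    unfolding r_def by linarith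
qed

lemma distr_pair_fst:
  assumes "prob_space M" "prob_space N"
  shows "distr (M \<Otimes>\<^sub>M N) M fst = M"
proof -
  interpret M: prob_space M by fact
  interpret N: prob_space N by fact
  show ?thesis
  proof (rule measure_eqI)
    fix A assume "A \<in> sets (distr (M \<Otimes>\<^sub>M N) M fst)"
    then have A: "A \<in> sets M" by simp
    have "fst -` A \<inter> space (M \<Otimes>\<^sub>M N) = A \<times> space N"
      using sets.sets_into_space[OF A] by (auto simp: space_pair_measure)
    then show "emeasure (distr (M \<Otimes>\<^sub>M N) M fst) A = emeasure M A"
      using A by (simp add: emeasure_distr N.emeasure_pair_measure_Times N.emeasure_space_1)
  qed simp
qed

text \<open>Precomposing the map \<open>f\<close> onto \<open>X\<close> with the first
  \<open>m\<close> coordinates of the scaled first column gives a 1-Lipschitz map on the Stiefel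
  manifold. When the column is the normalized Gaussian vector, the two arguments of \<open>f\<close>
  differ only by the factor \<open>t / s\<close>, which is close to 1.\<close>

lemma dominated_by_stiefel:
  fixes X :: mms_rep and N n m :: nat and R \<delta> \<epsilon> :: real
  assumes X: "mm_space X" and le: "lip_le X (gaussian_space m)"
    and N: "N \<ge> 2" and n: "1 \<le> n" "n \<le> N" and haar: "32 * (real n)\<^sup>2 < real N"
    and m: "m \<le> N" and R: "R > 0" and \<delta>: "0 < \<delta>" "\<delta> \<le> 1/2" and \<epsilon>: "\<epsilon> \<ge> 0"
    and dist: "4 * real m * R * (\<delta> + 1 / real N) \<le> \<epsilon>"
    and prob: "real m / R\<^sup>2 + 2 / (real N * \<delta>\<^sup>2) \<le> \<epsilon>"
  shows "\<exists>Y\<in>pyramid_of (scaled_stiefel N n :: 'f :: star_div_algebra mat mms). box_dist X Y \<le> \<epsilon>"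
proof -
  let ?M = "N * 1 * DIM('f)"
  define \<gamma> where "\<gamma> = gauss ?M"
  define D where "D = real (N * DIM('f))"
  define t where "t = sqrt (D - 1)"
  have N1: "N \<ge> 1" and N0: "N > 0"
    using N by auto
  have t: "t > 0"
    unfolding t_def D_def by (rule scaled_stiefel_factor_pos[OF N])
  have "N * 1 \<le> N * DIM('f)"
    by (intro mult_le_mono order_refl DIM_ge_1)
  then have ND: "real N \<le> D" and mM: "m \<le> ?M"
    using m by (simp_all only: D_def of_nat_le_iff mult_1_right)
  then have D1: "D \<ge> 1"
    using N by linarith
  obtain f where f0: "f ` coord_space m \<subseteq> pts X \<and>
    (\<forall>x\<in>coord_space m. \<forall>y\<in>coord_space m. dst X (f x) (f y) \<le> vdist m x y) \<and>
    f \<in> gauss m \<rightarrow>\<^sub>M msr X \<and> distr (gauss m) (msr X) f = msr X"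
    using le unfolding lip_le_def gaussian_space_sel by (elim exE)
  then have f: "f ` coord_space m \<subseteq> pts X"
    "\<And>x y. x \<in> coord_space m \<Longrightarrow> y \<in> coord_space m \<Longrightarrow> dst X (f x) (f y) \<le> vdist m x y"
    "f \<in> gauss m \<rightarrow>\<^sub>M msr X" "distr (gauss m) (msr X) f = msr X"
    by blast+
  \<comment> \<open>Existence of Haar measure is obtained with the threshold 1/4 of the polar map;
    hence \<open>32 = 2 * 4^2\<close> in the hypothesis.\<close>
  have small: "2 * (real n)\<^sup>2 / (real N * (1/4)\<^sup>2) < 1"
    using haar N by (simp add: field_simps power2_eq_square)
  define \<mu> where "\<mu> = (stiefel_haar N n :: 'f mat measure)"
  have \<mu>: "stiefel_invariant N n \<mu>" "parametrizable \<mu>"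
    unfolding \<mu>_def using stiefel_haar_invariant[OF n(2) N0 _ _ small] by simp_all
  define \<nu> where "\<nu> = distr \<mu> (stiefel_borel N 1) (first_column N)"
  have fc: "first_column N \<in> \<mu> \<rightarrow>\<^sub>M stiefel_borel N 1"
    by (rule first_column_invariant(1)[OF n(1) \<mu>(1)])
  have \<nu>: "stiefel_invariant N 1 \<nu>" "parametrizable \<nu>"
    unfolding \<nu>_def by (rule first_column_invariant(2)[OF n(1) \<mu>(1)], rule parametrizable_distr[OF \<mu>(2) fc])
  have haar1: "stiefel_haar N 1 = \<nu>"
    by (rule stiefel_haar_eq[OF N1 \<nu>(1)])
  have space_\<mu>: "space \<mu> = stiefel_set N n" and space_\<nu>: "space \<nu> = stiefel_set N 1"
    using sets_eq_imp_space_eq[of \<mu> "stiefel_borel N n"] sets_eq_imp_space_eq[of \<nu> "stiefel_borel N 1"] \<mu>(1) \<nu>(1)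
    by (simp_all only: space_stiefel_borel stiefel_invariant_def)
  \<comment> \<open>The image is taken of the sphere, whose law couples explicitly with a Gaussian
    vector; \<open>first_column\<close> then passes the domination on to the manifold of
    \<open>n\<close>-frames.\<close>
  define X1 where "X1 = (scaled_stiefel N 1 :: 'f mat mms)"
  have X1: "full_support_space X1"
    unfolding X1_def by (rule full_support_scaled_stiefel[OF N1 \<nu>(1) scaled_stiefel_factor_pos[OF N]])
  have X1_sel: "pts X1 = stiefel_set N 1" "dst X1 = (\<lambda>Z W. t * stiefel_dist N 1 Z W)" "msr X1 = \<nu>"
    unfolding X1_def scaled_stiefel_sel haar1 t_def D_def by simp_all
  define \<pi> where "\<pi> Z = (\<lambda>k\<in>{..<m}. t * coords N 1 (fm Z) k)" for Z :: "'f mat"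
  have \<pi>_in: "\<pi> Z \<in> coord_space m" for Z
    by (simp add: \<pi>_def)
  define g where "g Z = f (\<pi> Z)" for Z
  have g_in: "g \<in> pts X1 \<rightarrow> pts X"
    using f(1) \<pi>_in by (auto simp: g_def)
  have g_lip: "dst X (g Z) (g W) \<le> dst X1 Z W" if ZW: "Z \<in> pts X1" "W \<in> pts X1" for Z W
  proof -
    have ZW': "Z \<in> stiefel_set N 1" "W \<in> stiefel_set N 1"
      using ZW by (simp_all only: X1_sel)
    then have d: "dims N 1 (fm Z)" "dims N 1 (fm W)"
      by (auto simp only: stiefel_set_iff intro: dims_fm)
    have "dst X (g Z) (g W) \<le> vdist m (\<pi> Z) (\<pi> W)"
      unfolding g_def by (rule f(2)[OF \<pi>_in \<pi>_in])
    also have "\<dots> = vdist m (\<lambda>k. t * coords N 1 (fm Z) k) (\<lambda>k. t * coords N 1 (fm W) k)"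
      by (rule vdist_cong) (simp_all add: \<pi>_def)
    also have "\<dots> = t * vdist m (coords N 1 (fm Z)) (coords N 1 (fm W))"
      by (rule vdist_scale) (use t in simp)
    also have "\<dots> \<le> t * vdist ?M (coords N 1 (fm Z)) (coords N 1 (fm W))"
      using t by (intro mult_left_mono vdist_mono[OF mM]) auto
    also have "\<dots> = dst X1 Z W"
      by (simp only: vdist_coords[OF d] X1_sel stiefel_dist_fm[OF ZW'])
    finally show ?thesis .
  qed
  obtain c where sep: "sep_metric (pts X) (dst X) c"
    using mm_space_sep_metric[OF X] by blast
  interpret X: sep_metric "pts X" "dst X" c by (rule sep)
  have compl: "X.mcomplete"
    using X by (simp add: mm_space_def)
  define Y where "Y = image_mms X1 (pts X) (dst X) g"
  note Y0 = image_mms[OF X1 sep compl g_in]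
  note Y = Y0[OF g_lip, folded Y_def, unfolded X1_sel]
  have Y_pyr: "Y \<in> pyramid_of (scaled_stiefel N n :: 'f mat mms)"
  proof -
    have gf: "g \<circ> first_column N \<in> \<mu> \<rightarrow>\<^sub>M msr Y"
      using measurable_comp[OF fc, of g "msr Y"] Y(5) unfolding \<nu>_def by simp
    have "distr \<mu> (msr Y) (g \<circ> first_column N) = distr \<nu> (msr Y) g"
      unfolding \<nu>_def using Y(5) by (intro distr_distr[OF _ fc, symmetric]) (simp add: \<nu>_def)
    then have law: "distr \<mu> (msr Y) (g \<circ> first_column N) = msr Y"
      by (simp only: Y(6))
    have "lip_le Y (scaled_stiefel N n :: 'f mat mms)"
      unfolding lip_le_def scaled_stiefel_sel
    proof (intro exI[of _ "g \<circ> first_column N"] conjI ballI)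
      show "(g \<circ> first_column N) ` stiefel_set N n \<subseteq> pts Y"
        using Y(4) first_column(2)[OF n(1)] by auto
      show "g \<circ> first_column N \<in> stiefel_haar N n \<rightarrow>\<^sub>M msr Y"
        "distr (stiefel_haar N n) (msr Y) (g \<circ> first_column N) = msr Y"
        using gf law by (simp_all only: \<mu>_def)
      fix Z W :: "'f mat" assume ZW: "Z \<in> stiefel_set N n" "W \<in> stiefel_set N n"
      have "dst Y ((g \<circ> first_column N) Z) ((g \<circ> first_column N) W) \<le>
          t * stiefel_dist N 1 (first_column N Z) (first_column N W)"
        using g_lip[unfolded X1_sel, OF first_column(2)[OF n(1) ZW(1)] first_column(2)[OF n(1) ZW(2)]]
        by (simp only: Y(7) comp_apply)
      also have "\<dots> \<le> t * stiefel_dist N n Z W"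
        using t by (intro mult_left_mono first_column_dist[OF n(1) ZW]) auto
      finally show "dst Y ((g \<circ> first_column N) Z) ((g \<circ> first_column N) W) \<le>
          sqrt (real (N * DIM('f)) - 1) * stiefel_dist N n Z W"
        by (simp only: t_def D_def)
    qed
    with Y(1) show ?thesis
      by (simp add: pyramid_of_def all_mms_def)
  qed
  define P where "P = \<gamma> \<Otimes>\<^sub>M \<nu>"
  interpret \<gamma>: prob_space \<gamma>
    unfolding \<gamma>_def by (rule prob_space_gauss)
  interpret \<nu>: prob_space \<nu>
    using \<nu>(1) by (simp add: stiefel_invariant_def)
  have pP: "parametrizable P"
    unfolding P_def \<gamma>_def by (rule parametrizable_pair[OF parametrizable_gauss \<nu>(2)])
  let ?F = "\<lambda>p. if fst p \<in> nonzero_coords ?M then sphere_map N (fst p) else snd p :: 'f mat"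
  have F: "?F \<in> P \<rightarrow>\<^sub>M \<nu>" "distr P \<nu> ?F = \<nu>"
    unfolding P_def \<gamma>_def
    by (rule stiefel_invariant_law[OF N1 equivariant_on_sphere_map[OF N1] \<nu>(1)])+
  have fst_P: "fst \<in> P \<rightarrow>\<^sub>M \<gamma>" "distr P \<gamma> fst = \<gamma>"
    unfolding P_def by (simp, rule distr_pair_fst[OF \<gamma>.prob_space_axioms \<nu>.prob_space_axioms])
  define \<phi> :: "(nat \<Rightarrow> real) \<times> 'f mat \<Rightarrow> nat \<Rightarrow> real" where "\<phi> = f \<circ> ((\<lambda>x. restrict x {..<m}) \<circ> fst)"
  have rP: "(\<lambda>x. restrict x {..<m}) \<circ> fst \<in> P \<rightarrow>\<^sub>M gauss m"
    using measurable_comp[OF fst_P(1)] gauss_restrict(1)[OF mM] by (simp only: \<gamma>_def)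
  have "distr P (gauss m) ((\<lambda>x. restrict x {..<m}) \<circ> fst) = gauss m"
    using distr_distr[OF gauss_restrict(1)[OF mM, folded \<gamma>_def] fst_P(1)] gauss_restrict(2)[OF mM] fst_P(2)
    by (simp only: \<gamma>_def)
  then have \<phi>: "\<phi> \<in> P \<rightarrow>\<^sub>M msr X" "distr P (msr X) \<phi> = msr X"
    using measurable_comp[OF rP f(3)] distr_distr[OF f(3) rP] f(4) by (simp_all only: \<phi>_def)
  define \<psi> where "\<psi> = g \<circ> ?F"
  have \<psi>: "\<psi> \<in> P \<rightarrow>\<^sub>M msr Y" "distr P (msr Y) \<psi> = msr Y"
    using measurable_comp[OF F(1) Y(5)] distr_distr[OF Y(5) F(1)] F(2) Y(6) by (simp_all only: \<psi>_def)
  \<comment> \<open>Bounded first coordinates turn the relative error of the normalization into an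
    absolute one; the Gram condition controls the length of the vector.\<close>
  define Good where "Good = {x \<in> space \<gamma>. \<forall>k<m. \<bar>x k\<bar> \<le> R} \<inter> nearly_orthonormal TYPE('f) N 1 \<delta>"
  have tail: "{x \<in> space \<gamma>. \<forall>k<m. \<bar>x k\<bar> \<le> R} \<in> sets \<gamma>"
    "\<gamma>.prob {x \<in> space \<gamma>. \<forall>k<m. \<bar>x k\<bar> \<le> R} \<ge> 1 - real m / R\<^sup>2"
  proof -
    have [measurable]: "(\<lambda>x. x k) \<in> borel_measurable \<gamma>" if "k < m" for k
      unfolding \<gamma>_def using mM that by (intro measurable_gauss_coord) linarith
    have bad: "{x \<in> space \<gamma>. \<bar>x k\<bar> > R} \<in> sets \<gamma>" if "k < m" for k
      using that by measurable
    have eq: "{x \<in> space \<gamma>. \<forall>k<m. \<bar>x k\<bar> \<le> R} = space \<gamma> - (\<Union>k<m. {x \<in> space \<gamma>. \<bar>x k\<bar> > R})"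
      by (auto simp: not_le)
    have U: "(\<Union>k<m. {x \<in> space \<gamma>. \<bar>x k\<bar> > R}) \<in> sets \<gamma>"
      using bad by (intro sets.finite_UN) auto
    then show "{x \<in> space \<gamma>. \<forall>k<m. \<bar>x k\<bar> \<le> R} \<in> sets \<gamma>"
      unfolding eq by auto
    have "\<gamma>.prob (\<Union>k<m. {x \<in> space \<gamma>. \<bar>x k\<bar> > R}) \<le> (\<Sum>k<m. \<gamma>.prob {x \<in> space \<gamma>. \<bar>x k\<bar> > R})"
      using bad by (intro measure_UNION_le) auto
    also have "\<dots> \<le> (\<Sum>k<m. 1 / R\<^sup>2)"
      unfolding \<gamma>_def using mM by (intro sum_mono gauss_coord_tail R) auto
    finally show "\<gamma>.prob {x \<in> space \<gamma>. \<forall>k<m. \<bar>x k\<bar> \<le> R} \<ge> 1 - real m / R\<^sup>2"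
      unfolding eq \<gamma>.prob_compl[OF U] by simp
  qed
  have no: "nearly_orthonormal TYPE('f) N 1 \<delta> \<in> sets \<gamma>" "\<gamma>.prob (nearly_orthonormal TYPE('f) N 1 \<delta>) \<ge> 1 - 2 / (real N * \<delta>\<^sup>2)"
    unfolding \<gamma>_def using nearly_orthonormal_sets[of N 1 \<delta>, where 'f = 'f]
      nearly_orthonormal_prob[OF N0 \<delta>(1), of 1, where 'f = 'f] by simp_all
  have Good: "Good \<in> sets \<gamma>" "\<gamma>.prob Good \<ge> 1 - \<epsilon>"
    unfolding Good_def
    by (rule sets.Int[OF tail(1) no(1)], use \<gamma>.prob_Int_ge[OF tail(1) no(1)] tail(2) no(2) prob in linarith)
  define A where "A = fst -` Good \<inter> space P"
  have A: "A \<in> sets P"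
    unfolding A_def by (rule measurable_sets[OF fst_P(1) Good(1)])
  have "measure P A = measure (distr P \<gamma> fst) Good"
    unfolding A_def by (rule measure_distr[OF fst_P(1) Good(1), symmetric])
  then have mA: "measure P A \<ge> 1 - \<epsilon>"
    using Good(2) by (simp only: fst_P(2))
  \<comment> \<open>Half of \<open>\<epsilon>\<close> for each point, since distances between two
    points are compared.\<close>
  have near: "dst X (\<phi> p) (\<psi> p) \<le> \<epsilon> / 2" and in_X: "\<phi> p \<in> pts X" "\<psi> p \<in> pts X" if p: "p \<in> A" for p
  proof -
    define x where "x = fst p"
    have pP: "p \<in> space P" and xG: "x \<in> Good"
      using p by (auto simp: A_def x_def)
    then have x: "x \<in> coord_space ?M" "\<And>k. k < m \<Longrightarrow> \<bar>x k\<bar> \<le> R" "x \<in> nearly_orthonormal TYPE('f) N 1 \<delta>"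
      unfolding Good_def \<gamma>_def space_gauss by auto
    define s where "s = norm (to_fm N 1 x :: 'f fmat)"
    have "\<bar>s\<^sup>2 / D - 1\<bar> \<le> \<delta>"
      using nearly_orthonormal_column[OF N1 x(3)] unfolding s_def norm_to_fm D_def .
    from normalization_estimate[OF this _ D1 \<delta>(2)]
    have s: "s > 0" "\<bar>1 - t / s\<bar> \<le> 2 * (\<delta> + 1 / D)"
      by (simp_all add: s_def t_def)
    have x0: "x \<in> nonzero_coords ?M"
      unfolding nonzero_coords_iff using s(1) x(1) by (auto simp: s_def)
    have Fp: "?F p = sphere_map N x"
      using x0 by (simp only: x_def if_True)
    have \<phi>p: "\<phi> p = f (restrict x {..<m})"
      by (simp add: \<phi>_def x_def)
    have \<psi>p: "\<psi> p = f (\<pi> (sphere_map N x))"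
      unfolding \<psi>_def comp_apply Fp g_def ..
    show "\<phi> p \<in> pts X" "\<psi> p \<in> pts X"
      unfolding \<phi>p \<psi>p using f(1) \<pi>_in by auto
    have coord: "\<bar>restrict x {..<m} k - \<pi> (sphere_map N x) k\<bar> \<le> R * (2 * (\<delta> + 1 / D))" if k: "k < m" for k
    proof -
      have "\<pi> (sphere_map N x) k = t * coords N 1 ((1 / s) *\<^sub>R to_fm N 1 x :: 'f fmat) k"
        using k by (simp only: \<pi>_def fm_sphere_map[OF N1 x0] s_def restrict_apply' lessThan_iff)
      also have "\<dots> = t / s * x k"
        using k mM by (subst coords_scaleR) (simp_all only: coords_to_fm[OF x(1)] less_le_trans times_divide_eq_left mult_1_left times_divide_eq_right)
      finally have "restrict x {..<m} k - \<pi> (sphere_map N x) k = x k * (1 - t / s)"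
        using k by (simp add: algebra_simps)
      then show ?thesis
        using mult_mono[OF x(2)[OF k] s(2)] R by (simp add: abs_mult)
    qed
    have "dst X (\<phi> p) (\<psi> p) \<le> vdist m (restrict x {..<m}) (\<pi> (sphere_map N x))"
      unfolding \<phi>p \<psi>p by (rule f(2)) (simp_all add: \<pi>_in)
    also have "\<dots> \<le> (\<Sum>k<m. \<bar>restrict x {..<m} k - \<pi> (sphere_map N x) k\<bar>)"
      by (rule vdist_le_sum)
    also have "\<dots> \<le> (\<Sum>k<m. R * (2 * (\<delta> + 1 / D)))"
      using coord by (intro sum_mono) auto
    also have "\<dots> = 2 * real m * R * (\<delta> + 1 / D)"
      by simp
    also have "\<dots> \<le> 2 * real m * R * (\<delta> + 1 / real N)"
      using ND N R by (intro mult_left_mono add_left_mono divide_left_mono) auto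
    also have "\<dots> \<le> \<epsilon> / 2"
      using dist by simp
    finally show "dst X (\<phi> p) (\<psi> p) \<le> \<epsilon> / 2" .
  qed
  have "box_dist X Y \<le> \<epsilon>"
  proof (rule box_dist_le[OF pP \<phi> \<psi> A mA \<epsilon>])
    fix p q assume pq: "p \<in> A" "q \<in> A"
    have "\<bar>dst X (\<phi> p) (\<phi> q) - dst X (\<psi> p) (\<psi> q)\<bar> \<le> \<epsilon>"
      using X.triangle[OF in_X(1)[OF pq(1)] in_X(2)[OF pq(1)] in_X(1)[OF pq(2)]]
        X.triangle[OF in_X(2)[OF pq(1)] in_X(2)[OF pq(2)] in_X(1)[OF pq(2)]]
        X.triangle[OF in_X(2)[OF pq(1)] in_X(1)[OF pq(1)] in_X(2)[OF pq(2)]]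
        X.triangle[OF in_X(1)[OF pq(1)] in_X(1)[OF pq(2)] in_X(2)[OF pq(2)]]
        near[OF pq(1)] near[OF pq(2)] X.commute[of "\<phi> p" "\<psi> p"] X.commute[of "\<phi> q" "\<psi> q"]
      by linarith
    then show "\<bar>dst X (\<phi> p) (\<phi> q) - dst Y (\<psi> p) (\<psi> q)\<bar> \<le> \<epsilon>"
      by (simp only: Y(7))
  qed
  with Y_pyr show ?thesis
    by blast
qed

section \<open>Spaces dominated by Stiefel manifolds are nearly dominated by Gaussian spaces\<close>

text \<open>McShane's formula, the infimum of the cones \<open>g z + d x z\<close>. It is finite
  because any fixed \<open>z0\<close> in \<open>K\<close> gives the lower bound
  \<open>g z0 - d z0 x\<close>.\<close>

lemma McShane_extension:
  assumes "Metric_space M d" and K: "K \<subseteq> M" "K \<noteq> {}"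
    and g: "\<And>x y. x \<in> K \<Longrightarrow> y \<in> K \<Longrightarrow> \<bar>g x - g y\<bar> \<le> d x y"
  shows "\<exists>h :: 'a \<Rightarrow> real. (\<forall>x\<in>K. h x = g x) \<and> (\<forall>x\<in>M. \<forall>y\<in>M. \<bar>h x - h y\<bar> \<le> d x y)"
proof -
  interpret Metric_space M d by fact
  define h where "h x = (INF z\<in>K. g z + d x z)" for x
  obtain z0 where z0: "z0 \<in> K"
    using K(2) by blast
  have bdd: "bdd_below ((\<lambda>z. g z + d x z) ` K)" if x: "x \<in> M" for x
  proof (rule bdd_belowI2)
    fix z assume z: "z \<in> K"
    have "g z0 - g z \<le> d z0 z"
      using g[OF z0 z] by linarith
    also have "d z0 z \<le> d z0 x + d x z"
      using K(1) z z0 x by (intro triangle) auto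
    finally show "g z0 - d z0 x \<le> g z + d x z"
      by linarith
  qed
  have one: "h x \<le> h y + d x y" if xy: "x \<in> M" "y \<in> M" for x y
  proof -
    have "h x - d x y \<le> h y"
      unfolding h_def[of y]
    proof (rule cINF_greatest[OF K(2)])
      fix z assume z: "z \<in> K"
      have "h x \<le> g z + d x z"
        unfolding h_def by (rule cINF_lower[OF bdd[OF xy(1)] z])
      moreover have "d x z \<le> d x y + d y z"
        using xy z K(1) by (intro triangle) auto
      ultimately show "h x - d x y \<le> g z + d y z"
        by linarith
    qed
    then show ?thesis
      by linarith
  qed
  have "\<bar>h x - h y\<bar> \<le> d x y" if "x \<in> M" "y \<in> M" for x y
    using one[OF that] one[OF that(2,1)] commute[of x y] by linarith
  moreover have "h x = g x" if x: "x \<in> K" for x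
  proof (rule antisym)
    have "h x \<le> g x + d x x"
      unfolding h_def using x K(1) by (intro cINF_lower bdd) auto
    then show "h x \<le> g x"
      using x K(1) by auto
    show "g x \<le> h x"
      unfolding h_def
    proof (rule cINF_greatest[OF K(2)])
      fix z assume "z \<in> K"
      then show "g x \<le> g z + d x z"
        using g[OF x] by force
    qed
  qed
  ultimately show ?thesis
    by blast
qed

lemma mm_space_full_support: "mm_space X \<Longrightarrow> full_support_space X"
  by (simp add: mm_space_def full_support_space_def)

section \<open>Exhaustion by balls and finite-dimensional images\<close>

lemma exhausting_balls:
  assumes X: "mm_space X" and sep: "sep_metric (pts X) (dst X) c" and \<eta>: "\<eta> > 0"
  shows "\<exists>k. measure (msr X) (\<Union>i<k. Metric_space.mball (pts X) (dst X) (c i) \<eta>) \<ge> 1 - \<eta>"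
proof -
  interpret sep_metric "pts X" "dst X" c by fact
  interpret prob_space "msr X"
    using X by (simp add: mm_space_def)
  let ?B = "\<lambda>k. \<Union>i<k. mball (c i) \<eta>"
  have ball: "mball (c i) \<eta> \<in> events" for i
    unfolding mm_space_sets[OF X] by (simp add: openin_sets_borel_measure_of)
  have "(\<lambda>k. prob (?B k)) \<longlonglongrightarrow> prob (\<Union>k. ?B k)"
  proof (rule finite_Lim_measure_incseq)
    show "incseq ?B"
      by (auto simp: incseq_def intro: less_le_trans)
  qed (use ball in auto)
  moreover have "(\<Union>k. ?B k) = space (msr X)"
    unfolding mm_space_space[OF X]
  proof (intro equalityI subsetI)
    fix x assume x: "x \<in> pts X"
    then obtain i where "dst X x (c i) < \<eta>"
      using c_dense \<eta> by blast
    then have "x \<in> mball (c i) \<eta>"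
      using x c_in commute[of x "c i"] by simp
    then have "x \<in> ?B (Suc i)"
      by (rule UN_I[OF lessThan_iff[THEN iffD2, OF lessI]])
    then show "x \<in> (\<Union>k. ?B k)"
      by (rule UN_I[OF UNIV_I])
  qed auto
  ultimately have "(\<lambda>k. prob (?B k)) \<longlonglongrightarrow> 1"
    by (simp add: prob_space)
  then have "\<forall>\<^sub>F k in sequentially. 1 - \<eta> < prob (?B k)"
    using \<eta> by (intro order_tendstoD(1)) auto
  then show ?thesis
    by (auto simp: eventually_sequentially intro: less_imp_le)
qed

lemma mm_space_mcball_sets:
  assumes X: "mm_space X"
  shows "Metric_space.mcball (pts X) (dst X) x r \<in> sets (msr X)"
proof -
  interpret Metric_space "pts X" "dst X"
    using X by (simp add: mm_space_def)
  have "openin mtopology (pts X - mcball x r)"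
    using closedin_mcball[of x r] by (simp add: closedin_def)
  then have "pts X - mcball x r \<in> sets (msr X)"
    unfolding mm_space_sets[OF X] by (rule openin_sets_borel_measure_of)
  then have "space (msr X) - (pts X - mcball x r) \<in> sets (msr X)"
    by (rule sets.compl_sets)
  moreover have "space (msr X) - (pts X - mcball x r) = mcball x r"
    using mcball_subset_mspace[of x r] by (auto simp: mm_space_space[OF X])
  ultimately show ?thesis
    by simp
qed

lemma exhausting_ball:
  assumes X: "mm_space X" and \<eta>: "\<eta> > 0"
  shows "\<exists>x\<in>pts X. \<exists>R>0. measure (msr X) (Metric_space.mcball (pts X) (dst X) x R) \<ge> 1 - \<eta>"
proof -
  obtain c where "sep_metric (pts X) (dst X) c"
    using mm_space_sep_metric[OF X] by blast
  then interpret sep_metric "pts X" "dst X" c .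
  interpret prob_space "msr X"
    using X by (simp add: mm_space_def)
  let ?B = "\<lambda>k :: nat. mcball (c 0) (real k)"
  have ball: "mcball (c 0) r \<in> events" for r
    by (rule mm_space_mcball_sets[OF X])
  have "(\<lambda>k. prob (?B k)) \<longlonglongrightarrow> prob (\<Union>k. ?B k)"
  proof (rule finite_Lim_measure_incseq)
    show "incseq ?B"
      by (auto simp: incseq_def)
  qed (use ball in auto)
  moreover have "(\<Union>k. ?B k) = space (msr X)"
    unfolding mm_space_space[OF X] using c_in by (auto intro: real_arch_simple)
  ultimately have "(\<lambda>k. prob (?B k)) \<longlonglongrightarrow> 1"
    by (simp add: prob_space)
  then have "\<forall>\<^sub>F k in sequentially. 1 - \<eta> < prob (?B k)"
    using \<eta> by (intro order_tendstoD(1)) auto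
  then obtain k0 where "\<And>k. k \<ge> k0 \<Longrightarrow> 1 - \<eta> < prob (?B k)"
    unfolding eventually_sequentially by blast
  \<comment> \<open>\<open>Suc k0\<close> in place of \<open>k0\<close> makes the radius
    positive.\<close>
  from this[of "Suc k0"] have "1 - \<eta> \<le> prob (?B (Suc k0))"
    by simp
  then show ?thesis
    using c_in[of 0] by (intro bexI[of _ "c 0"] exI[of _ "real (Suc k0)"]) auto
qed

lemma mm_space_lipschitz_ball_sets:
  assumes Y: "mm_space Y" and F: "\<And>y. y \<in> pts Y \<Longrightarrow> F y \<in> coord_space k" and w: "w \<in> coord_space k"
    and lip: "\<And>y y'. y \<in> pts Y \<Longrightarrow> y' \<in> pts Y \<Longrightarrow> mdist k (F y) (F y') \<le> dst Y y y'"
  shows "{y \<in> space (msr Y). mdist k w (F y) \<le> r} \<in> sets (msr Y)"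
proof -
  interpret Y: Metric_space "pts Y" "dst Y"
    using Y by (simp add: mm_space_def)
  interpret Mk: Metric_space "coord_space k" "mdist k"
    by (rule Metric_space_mdist)
  have "(\<lambda>y. mdist k w (F y)) \<in> borel_measurable (msr Y)"
    unfolding measurable_cong_sets[OF mm_space_sets[OF Y] refl]
  proof (rule lipschitz_measurable_real[where K = 1])
    fix y y' assume y: "y \<in> pts Y" "y' \<in> pts Y"
    show "\<bar>mdist k w (F y) - mdist k w (F y')\<bar> \<le> 1 * dst Y y y'"
      using Mk.triangle[OF w F[OF y(1)] F[OF y(2)]] Mk.triangle[OF w F[OF y(2)] F[OF y(1)]]
        lip[OF y] Mk.commute[of "F y" "F y'"] by linarith
  qed (rule Y.Metric_space_axioms)
  then show ?thesis
    by measurable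
qed

text \<open>A space close to \<open>X\<close> is replaced by its image under finitely many distance functions, so
  that Lipschitz maps into it can be extended coordinatewise.\<close>

lemma finite_dimensional_image:
  fixes X Y :: mms_rep
  assumes X: "mm_space X" and Y: "mm_space Y" and box: "box_dist X Y < \<eta>" and \<eta>: "0 < \<eta>" "3 * \<eta> < 1"
    and x0: "x0 \<in> pts X" "measure (msr X) (Metric_space.mcball (pts X) (dst X) x0 R) \<ge> 1 - \<eta>"
  shows "\<exists>k F w. (\<forall>y\<in>pts Y. F y \<in> coord_space k) \<and>
    (\<forall>y\<in>pts Y. \<forall>y'\<in>pts Y. mdist k (F y) (F y') \<le> dst Y y y') \<and>
    box_dist X (image_mms Y (coord_space k) (mdist k) F) \<le> 7 * \<eta> \<and> w \<in> coord_space k \<and>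
    measure (msr Y) {y \<in> space (msr Y). mdist k w (F y) \<le> 2 * R + 7 * \<eta>} \<ge> 1 - 3 * \<eta>"
proof -
  obtain c where sepX: "sep_metric (pts X) (dst X) c"
    using mm_space_sep_metric[OF X] by blast
  interpret X: sep_metric "pts X" "dst X" c by (rule sepX)
  interpret Y: Metric_space "pts Y" "dst Y"
    using Y by (simp add: mm_space_def)
  interpret U: prob_space unit_interval
    by (rule prob_space_unit_interval)
  note sX = mm_space_sets[OF X] and sY = mm_space_sets[OF Y]
  obtain \<phi> \<psi> A where \<phi>: "\<phi> \<in> unit_interval \<rightarrow>\<^sub>M msr X" "distr unit_interval (msr X) \<phi> = msr X"
    and \<psi>: "\<psi> \<in> unit_interval \<rightarrow>\<^sub>M msr Y" "distr unit_interval (msr Y) \<psi> = msr Y"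
    and A: "A \<in> sets unit_interval" "measure unit_interval A \<ge> 1 - \<eta>"
    and close: "\<And>s t. s \<in> A \<Longrightarrow> t \<in> A \<Longrightarrow> \<bar>dst X (\<phi> s) (\<phi> t) - dst Y (\<psi> s) (\<psi> t)\<bar> \<le> \<eta>"
    using box_dist_lessE[OF box mm_space_parametrizable[OF X] mm_space_parametrizable[OF Y]] by metis
  have \<phi>_in: "\<phi> s \<in> pts X" and \<psi>_in: "\<psi> s \<in> pts Y" if "s \<in> space unit_interval" for s
    using measurable_space[OF \<phi>(1) that] measurable_space[OF \<psi>(1) that]
    by (simp_all add: mm_space_space[OF X] mm_space_space[OF Y])
  obtain k where k: "measure (msr X) (\<Union>i<k. X.mball (c i) \<eta>) \<ge> 1 - \<eta>"
    using exhausting_balls[OF X sepX \<eta>(1)] by blast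
  have net: "(\<Union>i<k. X.mball (c i) \<eta>) \<in> sets (msr X)"
    unfolding sX by (intro sets.finite_UN) (auto intro: openin_sets_borel_measure_of)
  have cball: "X.mcball x0 R \<in> sets (msr X)"
    by (rule mm_space_mcball_sets[OF X])
  define A1 where "A1 = \<phi> -` (\<Union>i<k. X.mball (c i) \<eta>) \<inter> space unit_interval"
  define A2 where "A2 = \<phi> -` X.mcball x0 R \<inter> space unit_interval"
  have A1: "A1 \<in> sets unit_interval" "U.prob A1 \<ge> 1 - \<eta>"
    using measurable_sets[OF \<phi>(1) net] measure_distr[OF \<phi>(1) net] k unfolding \<phi>(2) by (simp_all add: A1_def)
  have A2: "A2 \<in> sets unit_interval" "U.prob A2 \<ge> 1 - \<eta>"
    using measurable_sets[OF \<phi>(1) cball] measure_distr[OF \<phi>(1) cball] x0(2) unfolding \<phi>(2) by (simp_all add: A2_def)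
  \<comment> \<open>Parameters at which the distances of \<open>X\<close> and \<open>Y\<close> agree
    up to \<open>\<eta>\<close> and the point of \<open>X\<close> lies near the net and in the large
    ball; each of the three conditions costs at most \<open>\<eta>\<close>.\<close>
  define I where "I = A \<inter> A1 \<inter> A2"
  have I: "I \<in> sets unit_interval"
    unfolding I_def using A(1) A1(1) A2(1) by blast
  have "U.prob I \<ge> 1 - 3 * \<eta>"
    using U.prob_Int_ge[OF A(1) A1(1)] U.prob_Int_ge[OF sets.Int[OF A(1) A1(1)] A2(1)] A(2) A1(2) A2(2)
    unfolding I_def by linarith
  note I = I this
  have "I \<noteq> {}"
    using I(2) \<eta> by auto
  then obtain s0 where s0: "s0 \<in> I"
    by blast
  have I_in: "s \<in> A" "s \<in> space unit_interval" "\<phi> s \<in> X.mcball x0 R" "\<exists>i<k. \<phi> s \<in> X.mball (c i) \<eta>"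
    if "s \<in> I" for s
    using that by (auto simp: I_def A1_def A2_def)
  \<comment> \<open>The centres \<open>c i\<close> themselves may be missed by the good parameters,
    and only good parameters can be transported to \<open>Y\<close>. A good parameter close to each
    centre is chosen, with \<open>s0\<close> as default where there is none.\<close>
  define net_pt where "net_pt i = (if \<exists>s\<in>I. \<phi> s \<in> X.mball (c i) \<eta>
     then SOME s. s \<in> I \<and> \<phi> s \<in> X.mball (c i) \<eta> else s0)" for i
  have sel: "net_pt i \<in> I \<and> \<phi> (net_pt i) \<in> X.mball (c i) \<eta>" if "\<exists>s\<in>I. \<phi> s \<in> X.mball (c i) \<eta>" for i
  proof -
    have "\<exists>s. s \<in> I \<and> \<phi> s \<in> X.mball (c i) \<eta>"
      using that by blast
    then show ?thesis
      unfolding net_pt_def if_P[OF that] by (rule someI_ex)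
  qed
  have net_pt: "net_pt i \<in> I" for i
  proof (cases "\<exists>s\<in>I. \<phi> s \<in> X.mball (c i) \<eta>")
    case True
    then show ?thesis
      by (rule sel[THEN conjunct1])
  next
    case False
    show ?thesis
      unfolding net_pt_def if_not_P[OF False] by (rule s0)
  qed
  have net_pt_ball: "\<phi> (net_pt i) \<in> X.mball (c i) \<eta>" if "s \<in> I" "\<phi> s \<in> X.mball (c i) \<eta>" for i s
    by (rule sel[THEN conjunct2]) (use that in blast)
  define a where "a i = \<psi> (net_pt i)" for i
  have a_in: "a i \<in> pts Y" for i
    unfolding a_def by (rule \<psi>_in[OF I_in(2)[OF net_pt]])
  \<comment> \<open>Frechet coordinates: the distances to the finitely many transported net
    points.\<close>
  define F where "F y = (\<lambda>i\<in>{..<k}. dst Y y (a i))" for y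
  have F_in: "F y \<in> coord_space k" for y
    by (simp add: F_def)
  have F_lip: "mdist k (F y) (F y') \<le> dst Y y y'" if "y \<in> pts Y" "y' \<in> pts Y" for y y'
    unfolding mdist_le_iff
  proof (intro conjI allI impI)
    fix i assume "i < k"
    then show "\<bar>F y i - F y' i\<bar> \<le> dst Y y y'"
      using Y.triangle[OF that a_in[of i]] Y.triangle[OF that(2,1) a_in[of i]] Y.commute[of y y']
      by (simp add: F_def abs_le_iff)
  qed simp
  have F_close: "\<bar>dst X (\<phi> s) (\<phi> t) - mdist k (F (\<psi> s)) (F (\<psi> t))\<bar> \<le> 7 * \<eta>" if st: "s \<in> I" "t \<in> I" for s t
  proof -
    note Ys = \<psi>_in[OF I_in(2)[OF st(1)]] and Yt = \<psi>_in[OF I_in(2)[OF st(2)]]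
    have "mdist k (F (\<psi> s)) (F (\<psi> t)) \<le> dst X (\<phi> s) (\<phi> t) + \<eta>"
      using F_lip[OF Ys Yt] close[OF I_in(1)[OF st(1)] I_in(1)[OF st(2)]] by linarith
    \<comment> \<open>For \<open>a i\<close> near \<open>\<psi> s\<close>, coordinate
      \<open>i\<close> almost realizes the distance: \<open>dst Y (\<psi> s) (\<psi> t)\<close>
      exceeds it by at most twice \<open>dst Y (\<psi> s) (a i) \<le> 3 * \<eta>\<close>. One more
      \<open>\<eta>\<close> leads back to \<open>X\<close>, which makes 7.\<close>
    moreover have "dst X (\<phi> s) (\<phi> t) \<le> mdist k (F (\<psi> s)) (F (\<psi> t)) + 7 * \<eta>"
    proof -
      obtain i where i: "i < k" "\<phi> s \<in> X.mball (c i) \<eta>"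
        using I_in(4)[OF st(1)] by blast
      have "dst X (\<phi> s) (\<phi> (net_pt i)) < 2 * \<eta>"
        using i(2) net_pt_ball[OF st(1) i(2)] X.triangle[of "\<phi> s" "c i" "\<phi> (net_pt i)"] X.commute[of "\<phi> s" "c i"]
        by auto
      then have 1: "dst Y (\<psi> s) (a i) \<le> 3 * \<eta>"
        using close[OF I_in(1)[OF st(1)] I_in(1)[OF net_pt[of i]]] unfolding a_def by linarith
      have 2: "dst Y (\<psi> s) (\<psi> t) \<le> dst Y (\<psi> s) (a i) + dst Y (\<psi> t) (a i)"
        using Y.triangle[OF Ys a_in Yt, of i] Y.commute[of "a i" "\<psi> t"] by simp
      have 3: "\<bar>dst Y (\<psi> s) (a i) - dst Y (\<psi> t) (a i)\<bar> \<le> mdist k (F (\<psi> s)) (F (\<psi> t))"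
        using abs_coord_le_mdist[OF i(1), of "F (\<psi> s)" "F (\<psi> t)"] i(1) by (simp add: F_def)
      from 1 2 3 close[OF I_in(1)[OF st(1)] I_in(1)[OF st(2)]] show ?thesis
        by linarith
    qed
    ultimately show ?thesis
      using \<eta>(1) by linarith
  qed
  obtain c' where sepk: "sep_metric (coord_space k) (mdist k) c'"
    using sep_metric_mdist by blast
  define W where "W = image_mms Y (coord_space k) (mdist k) F"
  note W = image_mms[OF mm_space_full_support[OF Y] sepk mcomplete_mdist, of F, folded W_def]
  have F_Pi: "F \<in> pts Y \<rightarrow> coord_space k"
    using F_in by auto
  note W = W[OF F_Pi F_lip]
  have "box_dist X W \<le> 7 * \<eta>"
  proof (rule box_dist_le)
    have "unit_interval = distr unit_interval unit_interval (\<lambda>x. x)"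
      by (simp add: distr_id)
    then show "parametrizable unit_interval"
      unfolding parametrizable_def by (intro bexI[of _ "\<lambda>x. x"]) auto
    show "F \<circ> \<psi> \<in> unit_interval \<rightarrow>\<^sub>M msr W" "distr unit_interval (msr W) (F \<circ> \<psi>) = msr W"
      using measurable_comp[OF \<psi>(1) W(5)] distr_distr[OF W(5) \<psi>(1)] \<psi>(2) W(6) by simp_all
    show "1 - 7 * \<eta> \<le> U.prob I"
      using I(2) \<eta>(1) by linarith
    show "\<bar>dst X (\<phi> s) (\<phi> t) - dst W ((F \<circ> \<psi>) s) ((F \<circ> \<psi>) t)\<bar> \<le> 7 * \<eta>" if "s \<in> I" "t \<in> I" for s t
      using F_close[OF that] by (simp add: W(7))
  qed (use \<phi> I \<eta> in auto)
  \<comment> \<open>Two points of the ball of radius \<open>R\<close> are at most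
    \<open>2 * R\<close> apart, and \<open>s0\<close> supplies the centre of the image.\<close>
  moreover have "measure (msr Y) {y \<in> space (msr Y). mdist k (F (\<psi> s0)) (F y) \<le> 2 * R + 7 * \<eta>} \<ge> 1 - 3 * \<eta>"
  proof -
    let ?S = "{y \<in> space (msr Y). mdist k (F (\<psi> s0)) (F y) \<le> 2 * R + 7 * \<eta>}"
    have S: "?S \<in> sets (msr Y)"
      by (rule mm_space_lipschitz_ball_sets[OF Y]) (use F_in F_lip in auto)
    have "I \<subseteq> \<psi> -` ?S \<inter> space unit_interval"
    proof
      fix s assume s: "s \<in> I"
      have "dst X (\<phi> s0) (\<phi> s) \<le> 2 * R"
        using I_in(3)[OF s0] I_in(3)[OF s] X.triangle[of "\<phi> s0" x0 "\<phi> s"] X.commute[of "\<phi> s0" x0] by auto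
      then show "s \<in> \<psi> -` ?S \<inter> space unit_interval"
        using F_close[OF s0 s] I_in(2)[OF s] \<psi>_in[OF I_in(2)[OF s]] by (auto simp: mm_space_space[OF Y])
    qed
    then have "U.prob I \<le> U.prob (\<psi> -` ?S \<inter> space unit_interval)"
      by (rule U.finite_measure_mono) (rule measurable_sets[OF \<psi>(1) S])
    also have "\<dots> = measure (msr Y) ?S"
      using measure_distr[OF \<psi>(1) S] by (simp add: \<psi>(2))
    finally show ?thesis
      using I(2) by linarith
  qed
  ultimately show ?thesis
    using F_in F_lip unfolding W_def
    by (intro exI[of _ k] exI[of _ F] exI[of _ "F (\<psi> s0)"] conjI ballI) auto
qed

text \<open>On \<open>K\<close> the map \<open>F \<circ> h \<circ> q\<close> is
  \<open>exp \<delta>\<close>-Lipschitz for the maximum metric; multiplied by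
  \<open>exp (- \<delta>)\<close>, its coordinates extend to 1-Lipschitz functions on the whole
  Gaussian space. The error is \<open>7 * \<eta>\<close> for the finite-dimensional replacement and
  \<open>4 * \<eta>\<close> for the contraction and the exceptional sets.\<close>

lemma nearly_dominated_by_gaussian:
  fixes X Y :: mms_rep and N n :: nat and R \<delta> \<eta> :: real
  assumes X: "mm_space X" and Y: "Y \<in> pyramid_of (scaled_stiefel N n :: 'f :: star_div_algebra mat mms)"
    and box: "box_dist X Y < \<eta>" and \<eta>: "0 < \<eta>" "3 * \<eta> < 1"
    and x0: "x0 \<in> pts X" "measure (msr X) (Metric_space.mcball (pts X) (dst X) x0 R) \<ge> 1 - \<eta>"
    and n: "n \<le> N" and N: "N \<ge> 1" and \<delta>: "0 < \<delta>" "\<delta> \<le> 1/4" "\<delta> * (4 * R + 14 * \<eta>) \<le> \<eta>"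
    and small: "2 * (real n)\<^sup>2 / (real N * \<delta>\<^sup>2) \<le> \<eta>"
  shows "\<exists>Z\<in>pyramid_of (gaussian_space (N * n * DIM('f))). box_dist X Z \<le> 11 * \<eta>"
proof -
  let ?M = "N * n * DIM('f)"
  define \<gamma> where "\<gamma> = gauss ?M"
  define K where "K = nearly_orthonormal TYPE('f) N n \<delta>"
  define t where "t = sqrt (real (N * DIM('f)) - 1)"
  have N0: "N > 0"
    using N by simp
  have Ymm: "mm_space Y" and le: "lip_le Y (scaled_stiefel N n :: 'f mat mms)"
    using Y by (simp_all add: pyramid_of_def all_mms_def)
  interpret Y: Metric_space "pts Y" "dst Y"
    using Ymm by (simp add: mm_space_def)
  obtain k F w where F0: "(\<forall>y\<in>pts Y. F y \<in> coord_space k) \<and>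
    (\<forall>y\<in>pts Y. \<forall>y'\<in>pts Y. mdist k (F y) (F y') \<le> dst Y y y') \<and>
    box_dist X (image_mms Y (coord_space k) (mdist k) F) \<le> 7 * \<eta> \<and> w \<in> coord_space k \<and>
    measure (msr Y) {y \<in> space (msr Y). mdist k w (F y) \<le> 2 * R + 7 * \<eta>} \<ge> 1 - 3 * \<eta>"
    using finite_dimensional_image[OF X Ymm box \<eta> x0] by (elim exE)
  then have F: "\<And>y. y \<in> pts Y \<Longrightarrow> F y \<in> coord_space k"
    "\<And>y y'. y \<in> pts Y \<Longrightarrow> y' \<in> pts Y \<Longrightarrow> mdist k (F y) (F y') \<le> dst Y y y'"
    "box_dist X (image_mms Y (coord_space k) (mdist k) F) \<le> 7 * \<eta>"
    "w \<in> coord_space k" "measure (msr Y) {y \<in> space (msr Y). mdist k w (F y) \<le> 2 * R + 7 * \<eta>} \<ge> 1 - 3 * \<eta>"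
    by blast+
  obtain c' where sepk: "sep_metric (coord_space k) (mdist k) c'"
    using sep_metric_mdist by blast
  interpret Mk: Metric_space "coord_space k" "mdist k"
    by (rule Metric_space_mdist)
  have F_Pi: "F \<in> pts Y \<rightarrow> coord_space k"
    using F(1) by auto
  define W where "W = image_mms Y (coord_space k) (mdist k) F"
  note W0 = image_mms[OF mm_space_full_support[OF Ymm] sepk mcomplete_mdist F_Pi]
  note W = W0[OF F(2), folded W_def]
  have "2 * (real n)\<^sup>2 / (real N * \<delta>\<^sup>2) < 1"
    using small \<eta> by linarith
  note haar = stiefel_haar_invariant[OF n N0 \<delta>(1,2) this, where 'f = 'f]
  define \<mu> where "\<mu> = (stiefel_haar N n :: 'f mat measure)"
  have space_\<mu>: "space \<mu> = stiefel_set N n"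
    using sets_eq_imp_space_eq[of \<mu> "stiefel_borel N n"] haar(1)
    by (simp_all only: space_stiefel_borel stiefel_invariant_def \<mu>_def)
  obtain h where h0: "h ` stiefel_set N n \<subseteq> pts Y \<and>
    (\<forall>Z\<in>stiefel_set N n. \<forall>Z'\<in>stiefel_set N n. dst Y (h Z) (h Z') \<le> t * stiefel_dist N n Z Z') \<and>
    h \<in> \<mu> \<rightarrow>\<^sub>M msr Y \<and> distr \<mu> (msr Y) h = msr Y"
    using le unfolding lip_le_def scaled_stiefel_sel \<mu>_def t_def by (elim exE)
  then have h: "h ` stiefel_set N n \<subseteq> pts Y"
    "\<And>Z Z'. Z \<in> stiefel_set N n \<Longrightarrow> Z' \<in> stiefel_set N n \<Longrightarrow> dst Y (h Z) (h Z') \<le> t * stiefel_dist N n Z Z'"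
    "h \<in> \<mu> \<rightarrow>\<^sub>M msr Y" "distr \<mu> (msr Y) h = msr Y"
    by blast+
  interpret \<gamma>: prob_space \<gamma>
    unfolding \<gamma>_def by (rule prob_space_gauss)
  interpret \<mu>: prob_space \<mu>
    using haar(1) by (simp add: stiefel_invariant_def \<mu>_def)
  have K: "K \<in> sets \<gamma>" "\<gamma>.prob K \<ge> 1 - \<eta>"
    using nearly_orthonormal_sets[of N n \<delta>, where 'f = 'f] nearly_orthonormal_prob[OF N0 \<delta>(1), of n, where 'f = 'f] small
    unfolding K_def \<gamma>_def by auto
  have "K \<noteq> {}"
    using K(2) \<eta> by auto
  have K_sub: "K \<subseteq> coord_space ?M"
    unfolding K_def nearly_orthonormal_def by auto
  define q where "q = (polar_map N n \<delta> :: _ \<Rightarrow> 'f mat)"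
  have q_in: "q x \<in> stiefel_set N n" for x
    unfolding q_def by (rule polar_map_in[OF n \<delta>(2)])
  have hq_in: "h (q x) \<in> pts Y" for x
    using h(1) q_in by auto
  have Fhq: "mdist k (F (h (q x))) (F (h (q y))) \<le> exp \<delta> * vdist ?M x y" if "x \<in> K" "y \<in> K" for x y
  proof -
    have "mdist k (F (h (q x))) (F (h (q y))) \<le> dst Y (h (q x)) (h (q y))"
      by (rule F(2)[OF hq_in hq_in])
    also have "\<dots> \<le> t * stiefel_dist N n (q x) (q y)"
      by (rule h(2)[OF q_in q_in])
    also have "\<dots> \<le> exp \<delta> * vdist ?M x y"
      unfolding t_def q_def using that unfolding K_def by (rule polar_map_lipschitz[OF n N0 \<delta>(2)])
    finally show ?thesis .
  qed
  have "\<forall>i\<in>{..<k}. \<exists>E. (\<forall>x\<in>K. E x = exp (- \<delta>) * F (h (q x)) i) \<and>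
      (\<forall>x\<in>coord_space ?M. \<forall>y\<in>coord_space ?M. \<bar>E x - E y\<bar> \<le> vdist ?M x y)"
  proof (rule ballI, rule McShane_extension[OF Metric_space_vdist K_sub \<open>K \<noteq> {}\<close>])
    fix i x y assume "i \<in> {..<k}"
    then have i: "i < k"
      by simp
    assume xy: "x \<in> K" "y \<in> K"
    have "\<bar>exp (- \<delta>) * F (h (q x)) i - exp (- \<delta>) * F (h (q y)) i\<bar> =
        exp (- \<delta>) * \<bar>F (h (q x)) i - F (h (q y)) i\<bar>"
      by (simp add: abs_mult flip: right_diff_distrib)
    also have "\<dots> \<le> exp (- \<delta>) * (exp \<delta> * vdist ?M x y)"
      using Fhq[OF xy] abs_coord_le_mdist[OF i, of "F (h (q x))" "F (h (q y))"] by (intro mult_left_mono) auto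
    also have "\<dots> = vdist ?M x y"
      by (simp add: exp_minus)
    finally show "\<bar>exp (- \<delta>) * F (h (q x)) i - exp (- \<delta>) * F (h (q y)) i\<bar> \<le> vdist ?M x y" .
  qed
  then obtain E0 where "\<forall>i\<in>{..<k}. (\<forall>x\<in>K. E0 i x = exp (- \<delta>) * F (h (q x)) i) \<and>
      (\<forall>x\<in>coord_space ?M. \<forall>y\<in>coord_space ?M. \<bar>E0 i x - E0 i y\<bar> \<le> vdist ?M x y)"
    by (elim bchoice[THEN exE])
  then have E0: "\<And>i x. i < k \<Longrightarrow> x \<in> K \<Longrightarrow> E0 i x = exp (- \<delta>) * F (h (q x)) i"
    "\<And>i x y. i < k \<Longrightarrow> x \<in> coord_space ?M \<Longrightarrow> y \<in> coord_space ?M \<Longrightarrow> \<bar>E0 i x - E0 i y\<bar> \<le> vdist ?M x y"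
    by blast+
  define E where "E x = (\<lambda>i\<in>{..<k}. E0 i x)" for x
  have E_Pi: "E \<in> pts (gaussian_space ?M) \<rightarrow> coord_space k"
    by (simp add: E_def)
  have E_lip: "mdist k (E x) (E y) \<le> dst (gaussian_space ?M) x y"
    if "x \<in> pts (gaussian_space ?M)" "y \<in> pts (gaussian_space ?M)" for x y
    using that E0(2) unfolding mdist_le_iff gaussian_space_sel
    by (auto simp: E_def vdist_def)
  define Z where "Z = image_mms (gaussian_space ?M) (coord_space k) (mdist k) E"
  note Z0 = image_mms[OF full_support_gaussian_space sepk mcomplete_mdist E_Pi]
  note Z = Z0[OF E_lip, folded Z_def,
      unfolded gaussian_space_sel, folded \<gamma>_def]
  have dst_Z: "dst Z = mdist k"
    by (rule Z(7))
  define P where "P = \<gamma> \<Otimes>\<^sub>M \<mu>"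
  interpret PP: pair_prob_space \<gamma> \<mu> ..
  interpret P: prob_space P
    unfolding P_def by (rule PP.prob_space_axioms)
  have pP: "parametrizable P"
    unfolding P_def \<gamma>_def by (rule parametrizable_pair[OF parametrizable_gauss haar(2)[folded \<mu>_def]])
  let ?q = "\<lambda>p. if fst p \<in> K then q (fst p) else snd p :: 'f mat"
  have q: "?q \<in> P \<rightarrow>\<^sub>M \<mu>" "distr P \<mu> ?q = \<mu>"
    unfolding P_def \<gamma>_def K_def q_def
    by (rule stiefel_invariant_law[OF n equivariant_on_polar_map[OF n \<delta>(2)] haar(1)[folded \<mu>_def]])+
  have fst_P: "fst \<in> P \<rightarrow>\<^sub>M \<gamma>" "distr P \<gamma> fst = \<gamma>"
    unfolding P_def by (simp, rule distr_pair_fst[OF \<gamma>.prob_space_axioms \<mu>.prob_space_axioms])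
  have hq: "h \<circ> ?q \<in> P \<rightarrow>\<^sub>M msr Y" "distr P (msr Y) (h \<circ> ?q) = msr Y"
    using measurable_comp[OF q(1) h(3)] distr_distr[OF h(3) q(1)] q(2) h(4) by simp_all
  define \<phi> where "\<phi> = F \<circ> (h \<circ> ?q)"
  have \<phi>: "\<phi> \<in> P \<rightarrow>\<^sub>M msr W" "distr P (msr W) \<phi> = msr W"
    using measurable_comp[OF hq(1) W(5)] distr_distr[OF W(5) hq(1)] hq(2) W(6) by (simp_all only: \<phi>_def)
  define \<psi> :: "(nat \<Rightarrow> real) \<times> 'f mat \<Rightarrow> nat \<Rightarrow> real" where "\<psi> = E \<circ> fst"
  have \<psi>: "\<psi> \<in> P \<rightarrow>\<^sub>M msr Z" "distr P (msr Z) \<psi> = msr Z"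
    using measurable_comp[OF fst_P(1) Z(5)] distr_distr[OF Z(5) fst_P(1)] fst_P(2) Z(6) by (simp_all only: \<psi>_def)
  let ?S = "{y \<in> space (msr Y). mdist k w (F y) \<le> 2 * R + 7 * \<eta>}"
  have S: "?S \<in> sets (msr Y)"
    by (rule mm_space_lipschitz_ball_sets[OF Ymm F(1) F(4) F(2)])
  \<comment> \<open>Besides \<open>K\<close>, which costs \<open>\<eta>\<close>, the image is
    confined to a ball at a cost of \<open>3 * \<eta>\<close>: a contraction by
    \<open>exp (- \<delta>)\<close> changes distances little only when they are bounded.\<close>
  define A where "A = (fst -` K \<inter> space P) \<inter> ((h \<circ> ?q) -` ?S \<inter> space P)"
  have A1: "fst -` K \<inter> space P \<in> sets P" "P.prob (fst -` K \<inter> space P) \<ge> 1 - \<eta>"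
    using measurable_sets[OF fst_P(1) K(1)] measure_distr[OF fst_P(1) K(1)] K(2) unfolding fst_P(2) by simp_all
  have A2: "(h \<circ> ?q) -` ?S \<inter> space P \<in> sets P" "P.prob ((h \<circ> ?q) -` ?S \<inter> space P) \<ge> 1 - 3 * \<eta>"
    using measurable_sets[OF hq(1) S] measure_distr[OF hq(1) S] F(5) unfolding hq(2) by simp_all
  have A: "A \<in> sets P" "P.prob A \<ge> 1 - 4 * \<eta>"
    unfolding A_def using A1 A2 P.prob_Int_ge[OF A1(1) A2(1)] by (auto simp del: vimage_comp)
  have "box_dist W Z \<le> 4 * \<eta>"
  proof (rule box_dist_le[OF pP \<phi> \<psi> A])
    fix p p' assume pp: "p \<in> A" "p' \<in> A"
    have on_A: "fst p \<in> K" "\<phi> p = F (h (q (fst p)))" "mdist k w (\<phi> p) \<le> 2 * R + 7 * \<eta>"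
      "\<phi> p \<in> coord_space k" if "p \<in> A" for p
    proof -
      show pK: "fst p \<in> K"
        using that by (simp add: A_def)
      show \<phi>p: "\<phi> p = F (h (q (fst p)))"
        unfolding \<phi>_def comp_apply by (simp only: pK if_True)
      have "(h \<circ> ?q) p \<in> ?S"
        using that unfolding A_def by blast
      then show "mdist k w (\<phi> p) \<le> 2 * R + 7 * \<eta>"
        by (simp add: \<phi>_def)
      show "\<phi> p \<in> coord_space k"
        unfolding \<phi>p by (rule F(1)[OF hq_in])
    qed
    define D where "D = mdist k (\<phi> p) (\<phi> p')"
    have D: "0 \<le> D" "D \<le> 4 * R + 14 * \<eta>"
      using Mk.triangle[OF on_A(4)[OF pp(1)] F(4) on_A(4)[OF pp(2)]] on_A(3)[OF pp(1)] on_A(3)[OF pp(2)]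
        Mk.commute[of "\<phi> p" w] by (auto simp: D_def mdist_nonneg)
    \<comment> \<open>On \<open>K\<close> the extension is the contracted map itself, so distances
      are multiplied by exactly \<open>exp (- \<delta>)\<close>.\<close>
    have "mdist k (\<psi> p) (\<psi> p') = exp (- \<delta>) * D"
    proof -
      have \<psi>i: "\<psi> p i - \<psi> p' i = exp (- \<delta>) * (\<phi> p i - \<phi> p' i)" if "i < k" for i
        using that E0(1)[OF that on_A(1)[OF pp(1)]] E0(1)[OF that on_A(1)[OF pp(2)]]
        unfolding \<psi>_def on_A(2)[OF pp(1)] on_A(2)[OF pp(2)] by (simp add: E_def right_diff_distrib)
      show ?thesis
      proof (rule antisym)
        show "mdist k (\<psi> p) (\<psi> p') \<le> exp (- \<delta>) * D"
          unfolding mdist_le_iff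
        proof (intro conjI allI impI)
          fix i assume i: "i < k"
          show "\<bar>\<psi> p i - \<psi> p' i\<bar> \<le> exp (- \<delta>) * D"
            unfolding \<psi>i[OF i] D_def abs_mult using abs_coord_le_mdist[OF i, of "\<phi> p" "\<phi> p'"]
            by (intro mult_mono) auto
        qed (use D in simp)
        have "D \<le> exp \<delta> * mdist k (\<psi> p) (\<psi> p')"
          unfolding D_def mdist_le_iff[of k "\<phi> p"]
        proof (intro conjI allI impI)
          fix i assume i: "i < k"
          have "\<bar>\<phi> p i - \<phi> p' i\<bar> = exp \<delta> * \<bar>\<psi> p i - \<psi> p' i\<bar>"
            unfolding \<psi>i[OF i] by (simp add: abs_mult exp_minus)
          also have "\<dots> \<le> exp \<delta> * mdist k (\<psi> p) (\<psi> p')"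
            using abs_coord_le_mdist[OF i] by (intro mult_left_mono) auto
          finally show "\<bar>\<phi> p i - \<phi> p' i\<bar> \<le> exp \<delta> * mdist k (\<psi> p) (\<psi> p')" .
        qed (simp add: mdist_nonneg)
        then have "exp (- \<delta>) * D \<le> exp (- \<delta>) * (exp \<delta> * mdist k (\<psi> p) (\<psi> p'))"
          by (intro mult_left_mono) auto
        then show "exp (- \<delta>) * D \<le> mdist k (\<psi> p) (\<psi> p')"
          unfolding mult.assoc[symmetric] exp_add[symmetric] by simp
      qed
    qed
    then have "\<bar>dst W (\<phi> p) (\<phi> p') - dst Z (\<psi> p) (\<psi> p')\<bar> = \<bar>(1 - exp (- \<delta>)) * D\<bar>"
      by (simp add: W(7) dst_Z D_def algebra_simps)
    also have "\<dots> = (1 - exp (- \<delta>)) * D"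
      using D(1) \<delta>(1) by (simp add: abs_mult)
    also have "\<dots> \<le> \<delta> * (4 * R + 14 * \<eta>)"
    proof (intro mult_mono)
      show "1 - exp (- \<delta>) \<le> \<delta>"
        using exp_ge_add_one_self[of "- \<delta>"] by linarith
    qed (use D \<delta> in auto)
    also have "\<dots> \<le> 4 * \<eta>"
      using \<delta>(3) \<eta>(1) by linarith
    finally show "\<bar>dst W (\<phi> p) (\<phi> p') - dst Z (\<psi> p) (\<psi> p')\<bar> \<le> 4 * \<eta>" .
  qed (use \<eta> in simp)
  moreover have "box_dist X Z \<le> box_dist X W + box_dist W Z"
    by (rule box_dist_triangle[OF X W(1) Z(1)])
  ultimately have "box_dist X Z \<le> 11 * \<eta>"
    using F(3) unfolding W_def by linarith
  moreover have "Z \<in> pyramid_of (gaussian_space ?M)"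
    using Z(1,2) by (simp add: pyramid_of_def all_mms_def)
  ultimately show ?thesis
    by blast
qed

section \<open>Weak convergence\<close>

text \<open>An upper bound \<open>B\<close> of the supremum leaves two cases. While
  \<open>n N\<close> stays below a constant, \<open>n^2 / N\<close> is small for large
  \<open>N\<close>; once \<open>2 * ln n > B + c / 4\<close>, the bound forces
  \<open>N > n^3\<close> and hence \<open>n^2 / N < 1 / n\<close>.\<close>

lemma quotient_tendsto_0:
  fixes n :: "nat \<Rightarrow> nat"
  assumes n: "\<And>N. N \<ge> 1 \<Longrightarrow> 1 \<le> n N \<and> n N \<le> N" and c: "c > 0"
    and bd: "(SUP N\<in>{1..}. ereal (2 * ln (real (n N)) - c / 4 * sqrt (real N / (real (n N))^3))) < \<infinity>"
  shows "(\<lambda>N. (real (n N))\<^sup>2 / real N) \<longlonglongrightarrow> 0"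
proof -
  obtain B where B: "(SUP N\<in>{1..}. ereal (2 * ln (real (n N)) - c / 4 * sqrt (real N / (real (n N))^3))) < ereal B"
    using bd less_PInf_Ex_of_nat by auto
  have B: "2 * ln (real (n N)) - c / 4 * sqrt (real N / (real (n N))^3) \<le> B" if "N \<ge> 1" for N
    using less_imp_le[OF B] that unfolding SUP_le_iff by auto
  show ?thesis
  proof (rule LIMSEQ_I)
    fix e :: real assume e: "e > 0"
    \<comment> \<open>The first term makes \<open>1 / n < e\<close> beyond \<open>m\<close>, the
      second makes \<open>2 * ln n\<close> exceed \<open>B + c / 4\<close>.\<close>
    define m where "m = nat \<lceil>max (1 / e) (exp ((B + c / 4) / 2))\<rceil> + 1"
    have m: "1 / e < real m" "exp ((B + c / 4) / 2) < real m"
      unfolding m_def by linarith+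
    have "\<bar>(real (n N))\<^sup>2 / real N\<bar> < e" if N: "N \<ge> nat \<lceil>(real m)\<^sup>2 / e\<rceil> + 1" for N
    proof -
      have N1: "N \<ge> 1" and Nm: "(real m)\<^sup>2 / e < real N"
        using N by linarith+
      have nN: "real (n N) \<ge> 1"
        using n[OF N1] by simp
      have "(real (n N))\<^sup>2 / real N < e"
      proof (cases "n N \<le> m")
        case True
        then have "(real (n N))\<^sup>2 \<le> (real m)\<^sup>2"
          by (intro power_mono) auto
        also have "\<dots> < e * real N"
          using Nm e by (simp add: field_simps)
        finally show ?thesis
          using N1 by (simp add: field_simps)
      next
        case False
        then have mn: "real m < real (n N)"
          by simp
        have "(B + c / 4) / 2 < ln (real (n N))"
          using m(2) mn nN by (subst exp_less_cancel_iff[symmetric], subst exp_ln) auto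
        then have "c / 4 < 2 * ln (real (n N)) - B"
          by (simp add: field_simps)
        also have "\<dots> \<le> c / 4 * sqrt (real N / (real (n N))^3)"
          using B[OF N1] by simp
        finally have "c / 4 * 1 < c / 4 * sqrt (real N / (real (n N))^3)"
          by simp
        then have "1 < sqrt (real N / (real (n N))^3)"
          using c by (subst (asm) mult_less_cancel_left_pos) auto
        then have "(real (n N))^3 < real N"
          using nN by (simp add: field_simps)
        then have "(real (n N))\<^sup>2 * real (n N) < real N"
          by (simp add: power3_eq_cube power2_eq_square)
        moreover have "1 / e * (real (n N))\<^sup>2 \<le> real (n N) * (real (n N))\<^sup>2"
          using m(1) mn by (intro mult_right_mono) auto
        ultimately have "1 / e * (real (n N))\<^sup>2 < real N"
          by (simp add: mult.commute)
        then show ?thesis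
          using N1 e by (simp add: field_simps)
      qed
      then show ?thesis
        by (simp add: abs_of_nonneg)
    qed
    then show "\<exists>no. \<forall>N\<ge>no. norm ((real (n N))\<^sup>2 / real N - 0) < e"
      by auto
  qed
qed

lemma gaussian_pyramid_eq:
  "gaussian_pyramid = {X \<in> all_mms. \<forall>\<epsilon>>0. \<exists>m\<ge>1. \<exists>Y\<in>pyramid_of (gaussian_space m). box_dist X Y < \<epsilon>}"
  unfolding gaussian_pyramid_def box_closure_def bex_UN by (simp add: Bex_def)

lemma bdd_below_box_dist:
  assumes "mm_space X" "P \<subseteq> all_mms"
  shows "bdd_below (box_dist X ` P)"
proof (rule bdd_belowI2)
  fix Y assume "Y \<in> P"
  then have "mm_space Y"
    using assms(2) by (auto simp: all_mms_def)
  then show "0 \<le> box_dist X Y"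
    by (rule box_dist_nonneg[OF mm_space_parametrizable[OF assms(1)] mm_space_parametrizable])
qed

lemma pyramid_of_subset: "pyramid_of X \<subseteq> all_mms"
  by (auto simp: pyramid_of_def)

text \<open>The second half of weak convergence is shown by contraposition: a space that, for every
  \<open>\<eta>\<close>, is within \<open>\<eta>\<close> of the pyramids for infinitely many
  \<open>N\<close> lies in the Gaussian pyramid. As the latter is a box closure, approximate
  domination suffices.\<close>

theorem stiefel_weakly_converges:
  fixes n :: "nat \<Rightarrow> nat"
  assumes n: "\<And>N. N \<ge> 1 \<Longrightarrow> 1 \<le> n N \<and> n N \<le> N"
    and lim: "(\<lambda>N. (real (n N))\<^sup>2 / real N) \<longlonglongrightarrow> 0"
  shows "weakly_converges (\<lambda>N. pyramid_of (scaled_stiefel N (n N) :: 'f :: star_div_algebra mat mms)) gaussian_pyramid"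
proof -
  let ?P = "\<lambda>N. pyramid_of (scaled_stiefel N (n N) :: 'f mat mms)"
  have small: "\<forall>\<^sub>F N in sequentially. K * ((real (n N))\<^sup>2 / real N) < e" if "e > 0" for K e :: real
    by (rule order_tendstoD(2)[OF _ that]) (use tendsto_mult_left[OF lim, of K] in simp)
  have big: "\<forall>\<^sub>F N in sequentially. K < real N" for K
    by (rule filterlim_at_top_dense[THEN iffD1, OF filterlim_real_sequentially, rule_format])
  have near: "\<forall>\<^sub>F N in sequentially. \<exists>Y\<in>?P N. box_dist X Y \<le> \<epsilon>"
    if X: "mm_space X" "lip_le X (gaussian_space m)" and \<epsilon>: "\<epsilon> > 0" for X :: mms_rep and m and \<epsilon> :: real
  proof -
    \<comment> \<open>Chebyshev: some of the \<open>m\<close> coordinates exceeds \<open>R\<close>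
      with probability at most \<open>m / R^2 \<le> \<epsilon> / 2\<close>. The summand 1 keeps
      \<open>R\<close> positive for \<open>m = 0\<close>.\<close>
    define R where "R = sqrt (2 * real m / \<epsilon>) + 1"
    \<comment> \<open>For \<open>N\<close> with \<open>1 / N \<le> \<delta>\<close> this yields
      \<open>4 * m * R * (\<delta> + 1 / N) \<le> 8 * (m + 1) * R * \<delta> \<le>
      \<epsilon>\<close>; \<open>m + 1\<close> avoids a zero denominator.\<close>
    define \<delta> where "\<delta> = min (1 / 2) (\<epsilon> / (8 * (real m + 1) * R))"
    have R: "R > 0" "real m / R\<^sup>2 \<le> \<epsilon> / 2"
    proof -
      have R1: "R \<ge> 1" "sqrt (2 * real m / \<epsilon>) \<le> R"
        using \<epsilon> by (auto simp: R_def)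
      then show "R > 0"
        by simp
      have "2 * real m / \<epsilon> \<le> R\<^sup>2"
        using R1 by (intro sqrt_le_D) 
      then show "real m / R\<^sup>2 \<le> \<epsilon> / 2"
        using R1 \<epsilon> by (simp add: field_simps)
    qed
    have \<delta>: "0 < \<delta>" "\<delta> \<le> 1 / 2"
      using R(1) \<epsilon> unfolding \<delta>_def by (simp, intro min.cobounded1)
    have "8 * (real m + 1) * R * \<delta> \<le> 8 * (real m + 1) * R * (\<epsilon> / (8 * (real m + 1) * R))"
      using R(1) by (intro mult_left_mono) (auto simp: \<delta>_def)
    also have "\<dots> = \<epsilon>"
      by (rule nonzero_mult_div_cancel_left[of "8 * (real m + 1) * R" \<epsilon>, folded times_divide_eq_right])
        (use R(1) in simp)
    finally have \<delta>_R: "8 * (real m + 1) * R * \<delta> \<le> \<epsilon>" .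
    show ?thesis
      using eventually_ge_at_top[of 2] eventually_ge_at_top[of m] big[of "1 / \<delta>"] big[of "4 / (\<delta>\<^sup>2 * \<epsilon>)"]
        small[of 1 32, simplified]
    proof eventually_elim
      case (elim N)
      note N = elim
      have N1: "N \<ge> 1" and N0: "real N > 0"
        using N(1) by auto
      have "1 / real N \<le> \<delta>"
        using N(3) N0 \<delta>(1) by (simp add: field_simps)
      then have "4 * real m * R * (\<delta> + 1 / real N) \<le> 4 * (real m + 1) * R * (\<delta> + \<delta>)"
        using R(1) \<delta>(1) N0 by (intro mult_mono) auto
      also have "\<dots> \<le> \<epsilon>"
        using \<delta>_R by (simp add: algebra_simps)
      finally have 1: "4 * real m * R * (\<delta> + 1 / real N) \<le> \<epsilon>" .
      have "2 / (real N * \<delta>\<^sup>2) \<le> \<epsilon> / 2"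
        using N(4) N0 \<delta>(1) \<epsilon> by (simp add: field_simps)
      then have 2: "real m / R\<^sup>2 + 2 / (real N * \<delta>\<^sup>2) \<le> \<epsilon>"
        using R(2) by linarith
      have 3: "32 * (real (n N))\<^sup>2 < real N"
        using N(5) N0 by (simp add: field_simps)
      show ?case
        using dominated_by_stiefel[OF X N(1) _ _ 3 N(2) R(1) \<delta> less_imp_le[OF \<epsilon>] 1 2] n[OF N1] by blast
    qed
  qed
  have dom: "(\<lambda>N. box_to_set X (?P N)) \<longlonglongrightarrow> 0" if X: "X \<in> gaussian_pyramid" for X
  proof (rule LIMSEQ_I)
    fix e :: real assume e: "e > 0"
    have mmX: "mm_space X"
      using X by (simp add: gaussian_pyramid_eq all_mms_def)
    obtain m X' where X': "X' \<in> pyramid_of (gaussian_space m)" "box_dist X X' < e / 3"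
      using X e unfolding gaussian_pyramid_eq by (auto dest!: spec[of _ "e / 3"])
    then have mmX': "mm_space X'" "lip_le X' (gaussian_space m)"
      by (simp_all add: pyramid_of_def all_mms_def)
    have "\<forall>\<^sub>F N in sequentially. \<exists>Y\<in>?P N. box_dist X' Y \<le> e / 3"
      by (rule near[OF mmX']) (use e in simp)
    then have "\<forall>\<^sub>F N in sequentially. norm (box_to_set X (?P N) - 0) < e"
    proof eventually_elim
      case (elim N)
      then obtain Y where Y: "Y \<in> ?P N" "box_dist X' Y \<le> e / 3"
        by blast
      have mmY: "mm_space Y"
        using Y(1) by (simp add: pyramid_of_def all_mms_def)
      have "box_to_set X (?P N) \<le> box_dist X Y"
        unfolding box_to_set_def by (rule cINF_lower[OF bdd_below_box_dist[OF mmX pyramid_of_subset] Y(1)])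
      also have "\<dots> \<le> box_dist X X' + box_dist X' Y"
        by (rule box_dist_triangle[OF mmX mmX'(1) mmY])
      also have "\<dots> < e"
        using Y(2) X'(2) e by linarith
      finally have "box_to_set X (?P N) < e" .
      moreover have "0 \<le> box_to_set X (?P N)"
        unfolding box_to_set_def
      proof (rule cINF_greatest)
        show "?P N \<noteq> {}"
          using Y(1) by blast
        fix Z assume "Z \<in> ?P N"
        then have "mm_space Z"
          by (simp add: pyramid_of_def all_mms_def)
        then show "0 \<le> box_dist X Z"
          by (rule box_dist_nonneg[OF mm_space_parametrizable[OF mmX] mm_space_parametrizable])
      qed
      ultimately show ?case
        by simp
    qed
    then show "\<exists>no. \<forall>N\<ge>no. norm (box_to_set X (?P N) - 0) < e"
      unfolding eventually_sequentially .
  qed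
  \<comment> \<open>An infimum over the empty set is unspecified. The one-point Gaussian space of
    dimension 0 is approximated by members of the pyramids, which are therefore eventually
    nonempty.\<close>
  have nonempty: "\<forall>\<^sub>F N in sequentially. ?P N \<noteq> {}"
  proof -
    obtain c where sep: "sep_metric (coord_space 0) (mdist 0) c"
      using sep_metric_mdist by blast
    define X where "X = image_mms (gaussian_space 0) (coord_space 0) (mdist 0) (\<lambda>x. x)"
    have X: "mm_space X" "lip_le X (gaussian_space 0)"
      unfolding X_def by (rule image_mms[OF full_support_gaussian_space sep mcomplete_mdist],
        simp, simp add: vdist_def mdist_le_iff)+
    show ?thesis
    proof (rule eventually_mono[OF near[OF X, of 1]])
      fix N assume "\<exists>Y\<in>?P N. box_dist X Y \<le> 1"
      then show "?P N \<noteq> {}"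
        by (elim bexE) (rule notI, simp only: empty_iff)
    qed simp
  qed
  have closed: "X \<in> gaussian_pyramid" if X: "X \<in> all_mms" and freq: "\<And>\<eta>. \<eta> > 0 \<Longrightarrow> \<exists>\<^sub>F N in sequentially. box_to_set X (?P N) < \<eta>" for X
  proof -
    have mmX: "mm_space X"
      using X by (simp add: all_mms_def)
    have "\<exists>m\<ge>1. \<exists>Z\<in>pyramid_of (gaussian_space m). box_dist X Z < \<epsilon>" if \<epsilon>: "\<epsilon> > 0" for \<epsilon> :: real
    proof -
      \<comment> \<open>\<open>11 * \<eta>\<close> must stay below \<open>\<epsilon>\<close>, and
        \<open>3 * \<eta> < 1\<close> keeps the good event of positive measure.\<close>
      define \<eta> where "\<eta> = min (1 / 4) (\<epsilon> / 12)"
      have \<eta>: "0 < \<eta>" "3 * \<eta> < 1" "11 * \<eta> < \<epsilon>"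
        using \<epsilon> by (auto simp: \<eta>_def min_def)
      obtain x0 R where x0: "x0 \<in> pts X" "measure (msr X) (Metric_space.mcball (pts X) (dst X) x0 R) \<ge> 1 - \<eta>" and R: "R > 0"
        using exhausting_ball[OF mmX \<eta>(1)] by blast
      \<comment> \<open>The radius \<open>R\<close> depends on \<open>X\<close> and
        \<open>\<eta>\<close> only, so \<open>\<delta>\<close> is fixed before a large
        \<open>N\<close> is chosen.\<close>
      define \<delta> where "\<delta> = min (1 / 4) (\<eta> / (4 * R + 14 * \<eta>))"
      have \<delta>: "0 < \<delta>" "\<delta> \<le> 1 / 4"
        using R \<eta>(1) by (auto simp: \<delta>_def)
      have "\<delta> * (4 * R + 14 * \<eta>) \<le> \<eta> / (4 * R + 14 * \<eta>) * (4 * R + 14 * \<eta>)"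
        using R \<eta>(1) by (intro mult_right_mono) (auto simp: \<delta>_def)
      then have \<delta>3: "\<delta> * (4 * R + 14 * \<eta>) \<le> \<eta>"
        using R \<eta>(1) by simp
      have "\<exists>\<^sub>F N in sequentially. (?P N \<noteq> {} \<and> N \<ge> 1 \<and> 2 / \<delta>\<^sup>2 * ((real (n N))\<^sup>2 / real N) < \<eta>) \<and> box_to_set X (?P N) < \<eta>"
        by (intro frequently_eventually_conj[OF freq[OF \<eta>(1)]] eventually_conj nonempty eventually_ge_at_top small \<eta>(1))
      then obtain N where N: "box_to_set X (?P N) < \<eta>" "?P N \<noteq> {}" "N \<ge> 1" "2 / \<delta>\<^sup>2 * ((real (n N))\<^sup>2 / real N) < \<eta>"
        using frequently_ex by blast
      obtain Y where Y: "Y \<in> ?P N" "box_dist X Y < \<eta>"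
        using N(1) unfolding box_to_set_def cINF_less_iff[OF N(2) bdd_below_box_dist[OF mmX pyramid_of_subset]] by blast
      have "2 * (real (n N))\<^sup>2 / (real N * \<delta>\<^sup>2) \<le> \<eta>"
        using N(4) by (simp add: mult.commute)
      from nearly_dominated_by_gaussian[OF mmX Y \<eta>(1,2) x0 _ N(3) \<delta> \<delta>3 this] n[OF N(3)]
      obtain Z where Z: "Z \<in> pyramid_of (gaussian_space (N * n N * DIM('f)))" "box_dist X Z \<le> 11 * \<eta>"
        by blast
      have "1 \<le> N * n N * DIM('f)"
        using N(3) n[OF N(3)] DIM_positive[where 'a = 'f] by (simp add: Suc_le_eq)
      moreover have "box_dist X Z < \<epsilon>"
        using Z(2) \<eta>(3) by linarith
      ultimately show ?thesis
        using Z(1) by blast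
    qed
    then show ?thesis
      using X unfolding gaussian_pyramid_eq by blast
  qed
  have "liminf (\<lambda>N. ereal (box_to_set X (?P N))) > 0" if X: "X \<in> all_mms - gaussian_pyramid" for X
  proof -
    obtain \<eta> where \<eta>: "\<eta> > 0" "\<not> (\<exists>\<^sub>F N in sequentially. box_to_set X (?P N) < \<eta>)"
      using X closed[of X] by blast
    have "\<forall>\<^sub>F N in sequentially. ereal \<eta> \<le> ereal (box_to_set X (?P N))"
      using \<eta>(2) by (simp add: not_frequently not_less)
    then have "ereal \<eta> \<le> liminf (\<lambda>N. ereal (box_to_set X (?P N)))"
      by (rule Liminf_bounded)
    then show ?thesis
      by (rule less_le_trans[rotated]) (use \<eta>(1) in simp)
  qed
  with dom show ?thesis
    unfolding weakly_converges_def by blast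
qed

theorem theorem1p1:
  fixes n :: "nat \<Rightarrow> nat" and c :: real
  assumes "\<And>N. N \<ge> 1 \<Longrightarrow> 1 \<le> n N \<and> n N \<le> N"
    and "0 < c" "c < 1"
    and "(SUP N\<in>{1..}. ereal (2 * ln (real (n N)) - c / 4 * sqrt (real N / real (n N) ^ 3))) < \<infinity>"
  shows "weakly_converges
           (\<lambda>N. pyramid_of (mms_scale (sqrt (real (N * DIM(real)) - 1))
                  (stiefel N (n N) :: real mat mms)))
           gaussian_pyramid \<and>
         weakly_converges
           (\<lambda>N. pyramid_of (mms_scale (sqrt (real (N * DIM(complex)) - 1))
                  (stiefel N (n N) :: complex mat mms)))
           gaussian_pyramid \<and>
         weakly_converges
           (\<lambda>N. pyramid_of (mms_scale (sqrt (real (N * DIM(quat)) - 1))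
                  (stiefel N (n N) :: quat mat mms)))
           gaussian_pyramid"
proof -
  have lim: "(\<lambda>N. (real (n N))\<^sup>2 / real N) \<longlonglongrightarrow> 0"
    by (rule quotient_tendsto_0[OF assms(1,2,4)])
  show ?thesis
    by (intro conjI stiefel_weakly_converges[OF assms(1) lim])
qed

end
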